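(* Let $(P,A,\mathcal T)$ be an extendable poset with extended admissible system $\underline{\mathcal R}=\{\mathcal R_{x,y}\}$ on $\underline P^m=P\cup\{0,m\}$, and suppose that $\mathcal R_x$ is a field for all $x\in\underline P^m$ and that $\mathcal R_{0,x}$ is one-dimensional as a right $\mathcal R_x$-vector space for all $x\in P^m$. Two objects $M,N\in\mathrm{mod}\,\mathcal D^e$ with local bases $\mathscr B(M)$ and $\mathscr B(N)$, respectively, are isomorphic if and only if they have the same dimension vector $(d_x)$ and there are non-singular square matrices $T_0\in\mathscr M_{d_0}(\mathcal R_0)$, $T_x\in\mathscr M_{d_x}(\mathcal R_x)$ for all $x\in P^m$, and for each $y<x$ in $P^m$ a matrix $T_{y,x}\in\mathscr M_{d_y\times d_x}(\mathcal R_{y,x})$, such that for all $x\in P^m$ $$\mathscr M(M)_x=\rho_x(T_0)\,\mathscr M(N)_x\,T_x+\sum_{y<x}\rho_x(T_0)\,\chi_{y,x}\bigl(\mathscr M(N)_y\,T_{y,x}\bigr),$$ where the sum is over $y\in P^m$ with $y<x$ and $\rho_x,\chi_{y,x}$ are applied entrywise.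
   Context: Posets. $K$ is a field, $A$ a finite-dimensional $K$-algebra, $P$ a finite poset. A $P$-multiplicative system over $A$ is a family $\{\mathcal R_{i,j}\subseteq A\mid i\le j\}$ of $K$-subspaces with $\mathcal R_{i,j}\mathcal R_{j,l}\subseteq\mathcal R_{i,l}$ for $i\le j\le l$, and each $\mathcal R_i=\mathcal R_{i,i}$ a $K$-algebra with unit $1_i$ such that $1_ir=r=r1_j$ for $r\in\mathcal R_{i,j}$. $\Lambda(\mathcal R)=\bigoplus_{i\le j}e_{i,j}\mathcal R_{i,j}$ ($e_{i,j}$ matrix units, matrix operations), $e_i=e_{i,i}1_i$. For a poset with greatest element $m$ the system is admissible if each $\mathcal R_i$ is a division ring and, whenever $j<m$ and $0\ne x\in\mathcal R_{i,j}$, there is $y\in\mathcal R_{j,l}$, $l\neq j$, with $xy\ne0$. $P^m$ is $P$ with a greatest element $m$ added; $\mathcal T^m$ consists of $\mathcal T_{i,j}$ for $i\le j$ in $P$ and $\mathcal T_{i,m}=A$ for $i\in P^m$. $(P,A,\mathcal T)$ is extendable if $A$ is semisimple with exactly one simple module $\varepsilon_mA$ up to isomorphism, each $\mathcal T_i$ is a unital subalgebra of $A$, and there are idempotents $\varepsilon_i\in\mathcal T_i$ ($i\in P^m$) such that $\{\varepsilon_i\mathcal T_{i,j}\varepsilon_j\}_{i\le j\in P^m}$ is admissible with incidence algebra Morita equivalent to $\Lambda(\mathcal T^m)$. $\underline P^m=P^m\cup\{0\}$ with $0$ least, $\mathcal T_{0,i}=A$, $\varepsilon_0=\varepsilon_m$,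 $\underline{\mathcal R}=\{\mathcal R_{i,j}=\varepsilon_i\mathcal T_{i,j}\varepsilon_j\mid i\le j\in\underline P^m\}$; $\Lambda=\Lambda(\underline{\mathcal R})$. The ditalgebra $\mathcal D^e$. $\Lambda=S\oplus J$, $S=\bigoplus_ie_{i,i}\mathcal R_i$, $J=\bigoplus_{i<j}e_{i,j}\mathcal R_{i,j}$, $\hat e=1-e_0$. ${}^*J=\mathrm{Hom}_S({}_SJ,S)$ is an $S$-bimodule by $(s\gamma)(u)=\gamma(us)$, $(\gamma s)(u)=\gamma(u)s$ (so $e_x{}^*Je_y$ is dual to $e_yJe_x$). Choose left $\mathcal R_y$-bases of the $e_yJe_x$ ($y<x$); their union $\{p_i\}$ with dual elements $\gamma_i\in{}^*J$ is a dual basis of ${}_SJ$. Put $R^e=w_1\hat eS\oplus w_2e_0S$ ($w_1,w_2$ orthogonal idempotents), $W_0=w_{1,2}\hat e\,{}^*Je_0$ (left action through $w_1$, right action through $w_2$), $W_1=w_1\hat e\,{}^*J\hat e$ (both actions through $w_1$), and $T=T_{R^e}(W_0\oplus W_1)$, graded with $R^e,W_0$ in degree 0 and $W_1$ in degree 1. The differential $d_e$ (degree 1, $d_e(R^e)=0$, graded Leibniz rule $d_e(ab)=d_e(a)b+(-1)^{\deg a}a\,d_e(b)$) is given by $d_e(w_{1,2}\gamma)=-\sum_{i,j}w_1\gamma_i\otimes w_{1,2}\gamma_j\,\gamma(p_jp_i)$ for $\gamma\in\hat e\,{}^*Je_0$ and $d_e(w_1\gamma)=-\sum_{i,j}w_1\gamma_i\otimes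 w_1\gamma_j\,\gamma(p_jp_i)$ for $\gamma\in\hat e\,{}^*J\hat e$ (only non-zero terms are written). $\mathcal D^e=(T,d_e)$. $\mathrm{mod}\,\mathcal D^e$: objects are right $T_0$-modules $M$ ($T_0=R^e\oplus W_0$) finite-dimensional over $K$; write $M_0=Mw_2e_0$, $M_1=Mw_1\hat e$ and $M_x=Mw_1e_x$ for $x\in P^m$. A morphism $f:M\to N$ is a pair $(f^0,f^1)$ with $f^0$ right $R^e$-linear and $f^1:T_1\to\mathrm{Hom}_K(M,N)$ a $T_0$-bimodule morphism (where $(ah)(m)=h(ma)$, $(ha)(m)=h(m)a$) such that $f^0(m)a=f^0(ma)+f^1(d_e(a))(m)$ for $a\in T_0,m\in M$. Composition: $(gf)^0=g^0f^0$, $(gf)^1(v)=g^1(v)f^0+g^0f^1(v)-\sum g^1(v'')f^1(v')$ where $d_e(v)=\sum v'\otimes v''$; identities are $(\mathrm{id},0)$. Matrices. A local basis of $M$ is $\mathscr B(M)=\bigcup_{x\in\underline P^m}\mathscr B_x(M)$ with $\mathscr B_x(M)=\{m^x_i:1\le i\le d_x\}$ an $\mathcal R_x$-basis of $M_x$; the dimension vector is $(d_x=\dim_{\mathcal R_x}M_x)_x$. For $x\in P^m$ fix $v_{0,x}$ with $\mathcal R_{0,x}=v_{0,x}\mathcal R_x$. $\rho_x:\mathcal R_0\to\mathcal R_x$ is the field morphism with $av_{0,x}=v_{0,x}\rho_x(a)$; $\chi_{y,x}:\mathcal R_{y,x}\to\mathcal R_x$ is the $\mathcal R_x$-linear map with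 $v_{0,y}r=v_{0,x}\chi_{y,x}(r)$. Let $\tilde h_M:M_1\to M_0\otimes_{\mathcal R_0}e_0J\hat e$, $\tilde h_M(m)=\sum_k mw_{1,2}\gamma_k\otimes p_k$, the sum over those $k$ with $p_k\in e_0J\hat e$. The stripe $\mathscr M(M)_x=(M^x_{j,i})$ is the $d_0\times d_x$ matrix over $\mathcal R_x$ with $\tilde h_M(m^x_i)=\sum_{j=1}^{d_0}m^0_j\otimes e_{0,x}v_{0,x}M^x_{j,i}$. *)

theory Defs
  imports
    Complex_Main
    "HOL-Algebra.Module"
    "HOL-Library.FuncSet"
    "HOL-Library.Function_Algebras"
    "HOL-Library.Product_Plus"
    "HOL-Library.Poly_Mapping"
begin

section \<open>Algebras and right modules\<close>

text \<open>
  An algebra over the field type \<open>'k\<close> is given as a record of type \<open>('k, 'r) module\<close> (a ring with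
  a scalar multiplication). Right modules are subsets of a type of class \<^class>\<open>ab_group_add\<close>, whose
  addition they inherit. The scalars act on a module over an algebra \<open>L\<close> through \<open>c \<odot>\<^bsub>L\<^esub> \<one>\<^bsub>L\<^esub>\<close>.
\<close>

record ('r, 'm) rmod =
  mcar :: "'m set"
  mact :: "'m \<Rightarrow> 'r \<Rightarrow> 'm"

definition right_module :: "('k, 'r) module \<Rightarrow> ('r, 'm::ab_group_add) rmod \<Rightarrow> bool" where
  "right_module L M \<longleftrightarrow>
     0 \<in> mcar M \<and> (\<forall>m\<in>mcar M. \<forall>m'\<in>mcar M. m - m' \<in> mcar M) \<and>
     (\<forall>m\<in>mcar M. \<forall>r\<in>carrier L. mact M m r \<in> mcar M) \<and>
     (\<forall>m\<in>mcar M. \<forall>m'\<in>mcar M. \<forall>r\<in>carrier L. mact M (m + m') r = mact M m r + mact M m' r) \<and>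
     (\<forall>m\<in>mcar M. \<forall>r\<in>carrier L. \<forall>s\<in>carrier L.
        mact M m (r \<oplus>\<^bsub>L\<^esub> s) = mact M m r + mact M m s \<and>
        mact M m (r \<otimes>\<^bsub>L\<^esub> s) = mact M (mact M m r) s) \<and>
     (\<forall>m\<in>mcar M. mact M m \<one>\<^bsub>L\<^esub> = m)"

definition mod_scale :: "('k, 'r) module \<Rightarrow> ('r, 'm) rmod \<Rightarrow> 'k \<Rightarrow> 'm \<Rightarrow> 'm" where
  "mod_scale L M c m = mact M m (c \<odot>\<^bsub>L\<^esub> \<one>\<^bsub>L\<^esub>)"

definition fd_module :: "('k, 'r) module \<Rightarrow> ('r, 'm::ab_group_add) rmod \<Rightarrow> bool" where
  "fd_module L M \<longleftrightarrow> right_module L M \<and>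
     (\<exists>B. finite B \<and> B \<subseteq> mcar M \<and> (\<forall>m\<in>mcar M. \<exists>c. m = (\<Sum>b\<in>B. mod_scale L M (c b) b)))"

definition mod_hom ::
    "('k, 'r) module \<Rightarrow> ('r, 'm::ab_group_add) rmod \<Rightarrow> ('r, 'n::ab_group_add) rmod \<Rightarrow> ('m \<Rightarrow> 'n) set" where
  "mod_hom L M N = {h \<in> mcar M \<rightarrow>\<^sub>E mcar N.
     (\<forall>m\<in>mcar M. \<forall>m'\<in>mcar M. h (m + m') = h m + h m') \<and>
     (\<forall>m\<in>mcar M. \<forall>r\<in>carrier L. h (mact M m r) = mact N (h m) r)}"

definition mod_iso ::
    "('k, 'r) module \<Rightarrow> ('r, 'm::ab_group_add) rmod \<Rightarrow> ('r, 'n::ab_group_add) rmod \<Rightarrow> bool" where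
  "mod_iso L M N \<longleftrightarrow> (\<exists>h\<in>mod_hom L M N. bij_betw h (mcar M) (mcar N))"

definition simple_module :: "('k, 'r) module \<Rightarrow> ('r, 'm::ab_group_add) rmod \<Rightarrow> bool" where
  "simple_module L M \<longleftrightarrow> right_module L M \<and> mcar M \<noteq> {0} \<and>
     (\<forall>V. V \<subseteq> mcar M \<and> right_module L (M\<lparr>mcar := V\<rparr>) \<longrightarrow> V = {0} \<or> V = mcar M)"

text \<open>
  Morita equivalence: the categories of finite-dimensional right modules are equivalent. Every
  finite-dimensional module over a \<open>'k\<close>-algebra is isomorphic to one carried by a subgroup of
  \<open>nat \<Rightarrow> 'k\<close>, so the modules of that type form a category equivalent to that of all
  finite-dimensional right modules.
\<close>

type_synonym ('k, 'r) cmod = "('r, nat \<Rightarrow> 'k) rmod"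
type_synonym ('k, 'r, 's) ofun = "('k, 'r) cmod \<Rightarrow> ('k, 's) cmod"
type_synonym 'k chom = "(nat \<Rightarrow> 'k) \<Rightarrow> (nat \<Rightarrow> 'k)"
type_synonym ('k, 'r) mfun = "('k, 'r) cmod \<Rightarrow> ('k, 'r) cmod \<Rightarrow> 'k chom \<Rightarrow> 'k chom"

definition mod_functor ::
    "('k::field, 'r) module \<Rightarrow> ('k, 's) module \<Rightarrow> ('k, 'r, 's) ofun \<Rightarrow> ('k, 'r) mfun \<Rightarrow> bool" where
  "mod_functor L L' Fo Fm \<longleftrightarrow>
     (\<forall>M. fd_module L M \<longrightarrow> fd_module L' (Fo M) \<and>
        Fm M M (restrict id (mcar M)) = restrict id (mcar (Fo M))) \<and>
     (\<forall>M N h. fd_module L M \<and> fd_module L N \<and> h \<in> mod_hom L M N \<longrightarrow>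
        Fm M N h \<in> mod_hom L' (Fo M) (Fo N)) \<and>
     (\<forall>M N Q h g. fd_module L M \<and> fd_module L N \<and> fd_module L Q \<and>
        h \<in> mod_hom L M N \<and> g \<in> mod_hom L N Q \<longrightarrow>
        Fm M Q (compose (mcar M) g h) = compose (mcar (Fo M)) (Fm N Q g) (Fm M N h))"

definition nat_iso_from_id ::
    "('k::field, 'r) module \<Rightarrow> ('k, 'r, 'r) ofun \<Rightarrow> ('k, 'r) mfun \<Rightarrow> (('k, 'r) cmod \<Rightarrow> 'k chom) \<Rightarrow> bool" where
  "nat_iso_from_id L Fo Fm \<eta> \<longleftrightarrow>
     (\<forall>M. fd_module L M \<longrightarrow> \<eta> M \<in> mod_hom L M (Fo M) \<and> bij_betw (\<eta> M) (mcar M) (mcar (Fo M))) \<and>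
     (\<forall>M N h. fd_module L M \<and> fd_module L N \<and> h \<in> mod_hom L M N \<longrightarrow>
        compose (mcar M) (\<eta> N) h = compose (mcar M) (Fm M N h) (\<eta> M))"

definition morita_equivalent :: "('k::field, 'r) module \<Rightarrow> ('k, 's) module \<Rightarrow> bool" where
  "morita_equivalent L L' \<longleftrightarrow> (\<exists>Fo Fm Go Gm \<eta> \<theta>.
     mod_functor L L' Fo Fm \<and> mod_functor L' L Go Gm \<and>
     nat_iso_from_id L (Go \<circ> Fo) (\<lambda>M N h. Gm (Fo M) (Fo N) (Fm M N h)) \<eta> \<and>
     nat_iso_from_id L' (Fo \<circ> Go) (\<lambda>M N h. Fm (Go M) (Go N) (Gm M N h)) \<theta>)"

definition fd_algebra :: "('k::field \<Rightarrow> 'a::ring_1 \<Rightarrow> 'a) \<Rightarrow> bool" where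
  "fd_algebra sc \<longleftrightarrow> vector_space sc \<and>
     (\<forall>c a b. sc c (a * b) = sc c a * b \<and> sc c (a * b) = a * sc c b) \<and>
     (\<exists>B. finite B \<and> module.span sc B = UNIV)"

definition alg_of :: "('k \<Rightarrow> 'a::ring_1 \<Rightarrow> 'a) \<Rightarrow> ('k, 'a) module" where
  "alg_of sc = \<lparr>carrier = UNIV, mult = (*), one = 1, zero = 0, add = (+), smult = sc\<rparr>"

abbreviation right_ideal_mod :: "'a::ring_1 set \<Rightarrow> ('a, 'a) rmod" where
  "right_ideal_mod V \<equiv> \<lparr>mcar = V, mact = (*)\<rparr>"

text \<open>The regular module is a direct sum of simple modules.\<close>
definition semisimple_algebra :: "('k \<Rightarrow> 'a::ring_1 \<Rightarrow> 'a) \<Rightarrow> bool" where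
  "semisimple_algebra sc \<longleftrightarrow> (\<exists>(n::nat) V.
     (\<forall>i<n. simple_module (alg_of sc) (right_ideal_mod (V i))) \<and>
     (\<forall>a. \<exists>!v. v \<in> PiE {..<n} V \<and> a = (\<Sum>i<n. v i)))"

text \<open>\<open>X\<close> is, up to isomorphism, the only simple module.\<close>
definition only_simple_module :: "('k::field \<Rightarrow> 'a::ring_1 \<Rightarrow> 'a) \<Rightarrow> ('a, 'a) rmod \<Rightarrow> bool" where
  "only_simple_module sc X \<longleftrightarrow> simple_module (alg_of sc) X \<and>
     (\<forall>Y :: ('k, 'a) cmod. fd_module (alg_of sc) Y \<and> simple_module (alg_of sc) Y \<longrightarrow>
        mod_iso (alg_of sc) Y X)"

section \<open>Multiplicative systems and incidence algebras\<close>

definition sub_ring :: "'a::ring_1 set \<Rightarrow> 'a \<Rightarrow> 'a ring" where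
  "sub_ring F u = \<lparr>carrier = F, mult = (*), one = u, zero = 0, add = (+)\<rparr>"

definition is_division_ring :: "('a, 'b) ring_scheme \<Rightarrow> bool" where
  "is_division_ring F \<longleftrightarrow> ring F \<and> Units F = carrier F - {\<zero>\<^bsub>F\<^esub>}"

text \<open>The function \<open>u\<close> lists the units of the algebras \<open>R i i\<close>.\<close>
definition mult_system ::
    "('k::field \<Rightarrow> 'a::ring_1 \<Rightarrow> 'a) \<Rightarrow> 'i::order set \<Rightarrow> ('i \<Rightarrow> 'i \<Rightarrow> 'a set) \<Rightarrow> ('i \<Rightarrow> 'a) \<Rightarrow> bool" where
  "mult_system sc I R u \<longleftrightarrow>
     (\<forall>i\<in>I. \<forall>j\<in>I. i \<le> j \<longrightarrow> module.subspace sc (R i j)) \<and>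
     (\<forall>i\<in>I. \<forall>j\<in>I. \<forall>l\<in>I. i \<le> j \<and> j \<le> l \<longrightarrow> (\<forall>a\<in>R i j. \<forall>b\<in>R j l. a * b \<in> R i l)) \<and>
     (\<forall>i\<in>I. u i \<in> R i i) \<and>
     (\<forall>i\<in>I. \<forall>j\<in>I. i \<le> j \<longrightarrow> (\<forall>r\<in>R i j. u i * r = r \<and> r * u j = r))"

definition admissible ::
    "('k::field \<Rightarrow> 'a::ring_1 \<Rightarrow> 'a) \<Rightarrow> 'i::order set \<Rightarrow> 'i \<Rightarrow> ('i \<Rightarrow> 'i \<Rightarrow> 'a set) \<Rightarrow> ('i \<Rightarrow> 'a) \<Rightarrow> bool" where
  "admissible sc I m R u \<longleftrightarrow>
     m \<in> I \<and> (\<forall>i\<in>I. i \<le> m) \<and> mult_system sc I R u \<and>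
     (\<forall>i\<in>I. is_division_ring (sub_ring (R i i) (u i))) \<and>
     (\<forall>i\<in>I. \<forall>j\<in>I. i \<le> j \<and> j < m \<longrightarrow> (\<forall>x\<in>R i j. x \<noteq> 0 \<longrightarrow>
        (\<exists>l\<in>I. j \<le> l \<and> l \<noteq> j \<and> (\<exists>y\<in>R j l. x * y \<noteq> 0))))"

text \<open>Elements of an incidence algebra are matrices indexed by the whole type, zero outside \<open>i \<le> j\<close> in \<open>I\<close>.\<close>

definition mmul :: "'i set \<Rightarrow> ('i \<Rightarrow> 'i \<Rightarrow> 'a::ring_1) \<Rightarrow> ('i \<Rightarrow> 'i \<Rightarrow> 'a) \<Rightarrow> ('i \<Rightarrow> 'i \<Rightarrow> 'a)" where
  "mmul I X Y = (\<lambda>i j. \<Sum>l\<in>I. X i l * Y l j)"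

definition mscale :: "('k \<Rightarrow> 'a \<Rightarrow> 'a) \<Rightarrow> 'k \<Rightarrow> ('i \<Rightarrow> 'i \<Rightarrow> 'a) \<Rightarrow> ('i \<Rightarrow> 'i \<Rightarrow> 'a)" where
  "mscale sc c X = (\<lambda>i j. sc c (X i j))"

definition mone :: "'i set \<Rightarrow> ('i \<Rightarrow> 'a::ring_1) \<Rightarrow> ('i \<Rightarrow> 'i \<Rightarrow> 'a)" where
  "mone I u = (\<lambda>i j. if i \<in> I \<and> i = j then u i else 0)"

definition munit :: "'i \<Rightarrow> 'i \<Rightarrow> 'a::ring_1 \<Rightarrow> ('i \<Rightarrow> 'i \<Rightarrow> 'a)" where
  "munit i j a = (\<lambda>k l. if k = i \<and> l = j then a else 0)"

definition inc_carrier :: "'i::order set \<Rightarrow> ('i \<Rightarrow> 'i \<Rightarrow> 'a::ring_1 set) \<Rightarrow> ('i \<Rightarrow> 'i \<Rightarrow> 'a) set" where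
  "inc_carrier I R =
     {X. \<forall>i j. if i \<in> I \<and> j \<in> I \<and> i \<le> j then X i j \<in> R i j else X i j = 0}"

definition incidence_algebra ::
    "('k \<Rightarrow> 'a::ring_1 \<Rightarrow> 'a) \<Rightarrow> 'i::order set \<Rightarrow> ('i \<Rightarrow> 'i \<Rightarrow> 'a set) \<Rightarrow> ('i \<Rightarrow> 'a) \<Rightarrow>
     ('k, 'i \<Rightarrow> 'i \<Rightarrow> 'a) module" where
  "incidence_algebra sc I R u =
     \<lparr>carrier = inc_carrier I R, mult = mmul I, one = mone I u, zero = 0, add = (+), smult = mscale sc\<rparr>"

section \<open>Extendable posets\<close>

text \<open>\<open>Bot\<close> and \<open>Top\<close> are the added elements \<open>0\<close> and \<open>m\<close>.\<close>

datatype 'p xp = Bot | Pt 'p | Top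

instantiation xp :: (order) order
begin

definition less_eq_xp :: "'a xp \<Rightarrow> 'a xp \<Rightarrow> bool" where
  "x \<le> y \<longleftrightarrow> x = Bot \<or> y = Top \<or> (\<exists>p q. x = Pt p \<and> y = Pt q \<and> p \<le> q)"

definition less_xp :: "'a xp \<Rightarrow> 'a xp \<Rightarrow> bool" where
  "(x :: 'a xp) < y \<longleftrightarrow> x \<le> y \<and> x \<noteq> y"

instance
proof
  fix x y z :: "'a xp"
  show "x < y \<longleftrightarrow> x \<le> y \<and> \<not> y \<le> x"
    by (cases x; cases y) (auto simp: less_eq_xp_def less_xp_def)
  show "x \<le> x"
    by (cases x) (auto simp: less_eq_xp_def)
  show "x \<le> y \<Longrightarrow> y \<le> z \<Longrightarrow> x \<le> z"
    by (cases x; cases y; cases z) (auto simp: less_eq_xp_def)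
  show "x \<le> y \<Longrightarrow> y \<le> x \<Longrightarrow> x = y"
    by (cases x; cases y) (auto simp: less_eq_xp_def)
qed

end

text \<open>
  The data \<open>(P, A, T)\<close> with a choice of the idempotents; \<open>A\<close> is the type \<open>'a\<close>. The value of \<open>idm\<close>
  at \<open>Bot\<close> is irrelevant.
\<close>

record ('k, 'a, 'p) eposet =
  scal :: "'k \<Rightarrow> 'a \<Rightarrow> 'a"
  pts :: "'p set"
  sys :: "'p \<Rightarrow> 'p \<Rightarrow> 'a set"
  idm :: "'p xp \<Rightarrow> 'a"

definition Pm :: "('k, 'a, 'p) eposet \<Rightarrow> 'p xp set" where
  "Pm D = insert Top (Pt ` pts D)"

definition uPm :: "('k, 'a, 'p) eposet \<Rightarrow> 'p xp set" where
  "uPm D = insert Bot (Pm D)"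

definition ext_sys :: "('k, 'a, 'p) eposet \<Rightarrow> 'p xp \<Rightarrow> 'p xp \<Rightarrow> 'a set" where
  "ext_sys D x y = (case (x, y) of (Pt i, Pt j) \<Rightarrow> sys D i j | _ \<Rightarrow> UNIV)"

definition eps :: "('k, 'a, 'p) eposet \<Rightarrow> 'p xp \<Rightarrow> 'a" where
  "eps D x = (if x = Bot then idm D Top else idm D x)"

definition RR :: "('k, 'a::ring_1, 'p) eposet \<Rightarrow> 'p xp \<Rightarrow> 'p xp \<Rightarrow> 'a set" where
  "RR D x y = {eps D x * t * eps D y | t. t \<in> ext_sys D x y}"

definition extendable :: "('k::field, 'a::ring_1, 'p::order) eposet \<Rightarrow> bool" where
  "extendable D \<longleftrightarrow>
     finite (pts D) \<and> fd_algebra (scal D) \<and>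
     mult_system (scal D) (pts D) (sys D) (\<lambda>i. 1) \<and>
     semisimple_algebra (scal D) \<and>
     (\<forall>x\<in>Pm D. eps D x \<in> ext_sys D x x \<and> eps D x * eps D x = eps D x) \<and>
     only_simple_module (scal D) (right_ideal_mod {eps D Top * a | a. True}) \<and>
     admissible (scal D) (Pm D) Top (RR D) (eps D) \<and>
     morita_equivalent
       (incidence_algebra (scal D) (Pm D) (RR D) (eps D))
       (incidence_algebra (scal D) (Pm D) (ext_sys D) (\<lambda>x. 1))"

section \<open>Additive quotients and tensor constructions\<close>

inductive_set add_hull :: "'g::ab_group_add set \<Rightarrow> 'g set" for X where
  zero: "0 \<in> add_hull X"
| base: "x \<in> X \<Longrightarrow> x \<in> add_hull X"
| diff: "x \<in> add_hull X \<Longrightarrow> y \<in> add_hull X \<Longrightarrow> x - y \<in> add_hull X"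

definition add_coset :: "'g::ab_group_add set \<Rightarrow> 'g \<Rightarrow> 'g set" where
  "add_coset N x = {y. y - x \<in> N}"

text \<open>
  Relations defining the tensor product of a right module \<open>V\<close> and a left module \<open>U\<close> over \<open>F\<close>:
  an element of the tensor product is a coset, in the free abelian group on the pairs, of the
  subgroup \<open>add_hull (tensor_rels F V ra U la)\<close>.
\<close>
definition tensor_rels ::
    "'f set \<Rightarrow> 'v::ab_group_add set \<Rightarrow> ('v \<Rightarrow> 'f \<Rightarrow> 'v) \<Rightarrow> 'u::ab_group_add set \<Rightarrow> ('f \<Rightarrow> 'u \<Rightarrow> 'u) \<Rightarrow>
     ('v \<times> 'u \<Rightarrow>\<^sub>0 int) set" where
  "tensor_rels F V ra U la =
     {frag_of (v + v', u) - frag_of (v, u) - frag_of (v', u) | v v' u. v \<in> V \<and> v' \<in> V \<and> u \<in> U} \<union>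
     {frag_of (v, u + u') - frag_of (v, u) - frag_of (v, u') | v u u'. v \<in> V \<and> u \<in> U \<and> u' \<in> U} \<union>
     {frag_of (ra v a, u) - frag_of (v, la a u) | v a u. v \<in> V \<and> a \<in> F \<and> u \<in> U}"

text \<open>
  The tensor algebra of a bimodule \<open>W\<close> over an algebra \<open>R\<close> is the direct sum of \<open>R\<close> and the tensor
  powers of \<open>W\<close> over \<open>R\<close>. The word \<open>Sc r\<close> stands for the element \<open>r\<close> of \<open>R\<close>, and
  \<open>Tw [w1, \<dots>, wn]\<close> (\<open>n \<ge> 1\<close>) for the pure tensor of the \<open>wi\<close>.
\<close>

record ('r, 'w) bimodule =
  bcarrier :: "'w set"
  lact :: "'r \<Rightarrow> 'w \<Rightarrow> 'w"
  ract :: "'w \<Rightarrow> 'r \<Rightarrow> 'w"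

datatype ('r, 'w) tword = Sc 'r | Tw "'w list"

definition twords :: "('k, 'r) module \<Rightarrow> ('r, 'w) bimodule \<Rightarrow> ('r, 'w) tword set" where
  "twords R W = Sc ` carrier R \<union> Tw ` {ws. ws \<noteq> [] \<and> set ws \<subseteq> bcarrier W}"

fun tword_mult ::
    "('k, 'r) module \<Rightarrow> ('r, 'w) bimodule \<Rightarrow> ('r, 'w) tword \<Rightarrow> ('r, 'w) tword \<Rightarrow> ('r, 'w) tword" where
  "tword_mult R W (Sc r) (Sc s) = Sc (r \<otimes>\<^bsub>R\<^esub> s)"
| "tword_mult R W (Sc r) (Tw ws) = Tw (lact W r (hd ws) # tl ws)"
| "tword_mult R W (Tw ws) (Sc s) = Tw (butlast ws @ [ract W (last ws) s])"
| "tword_mult R W (Tw ws) (Tw vs) = Tw (ws @ vs)"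

definition talg_rels ::
    "('k, 'r) module \<Rightarrow> ('r, 'w::ab_group_add) bimodule \<Rightarrow> (('r, 'w) tword \<Rightarrow>\<^sub>0 int) set" where
  "talg_rels R W =
     {frag_of (Sc (r \<oplus>\<^bsub>R\<^esub> s)) - frag_of (Sc r) - frag_of (Sc s) | r s. r \<in> carrier R \<and> s \<in> carrier R} \<union>
     {frag_of (Tw (us @ (w + w') # vs)) - frag_of (Tw (us @ w # vs)) - frag_of (Tw (us @ w' # vs)) |
        us w w' vs. set us \<subseteq> bcarrier W \<and> w \<in> bcarrier W \<and> w' \<in> bcarrier W \<and> set vs \<subseteq> bcarrier W} \<union>
     {frag_of (Tw (us @ ract W w r # w' # vs)) - frag_of (Tw (us @ w # lact W r w' # vs)) |
        us w r w' vs. set us \<subseteq> bcarrier W \<and> w \<in> bcarrier W \<and> r \<in> carrier R \<and> w' \<in> bcarrier W \<and>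
          set vs \<subseteq> bcarrier W}"

definition tcl ::
    "('k, 'r) module \<Rightarrow> ('r, 'w::ab_group_add) bimodule \<Rightarrow>
     (('r, 'w) tword \<Rightarrow>\<^sub>0 int) \<Rightarrow> (('r, 'w) tword \<Rightarrow>\<^sub>0 int) set" where
  "tcl R W x = add_coset (add_hull (talg_rels R W)) x"

definition tmult ::
    "('k, 'r) module \<Rightarrow> ('r, 'w) bimodule \<Rightarrow>
     (('r, 'w) tword \<Rightarrow>\<^sub>0 int) \<Rightarrow> (('r, 'w) tword \<Rightarrow>\<^sub>0 int) \<Rightarrow> (('r, 'w) tword \<Rightarrow>\<^sub>0 int)" where
  "tmult R W x y = frag_extend (\<lambda>a. frag_extend (\<lambda>b. frag_of (tword_mult R W a b)) y) x"

definition tensor_algebra ::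
    "('k, 'r) module \<Rightarrow> ('r, 'w::ab_group_add) bimodule \<Rightarrow> ('k, (('r, 'w) tword \<Rightarrow>\<^sub>0 int) set) module" where
  "tensor_algebra R W =
     \<lparr>carrier = {tcl R W x | x. Poly_Mapping.keys x \<subseteq> twords R W},
      mult = (\<lambda>X Y. \<Union>x\<in>X. \<Union>y\<in>Y. tcl R W (tmult R W x y)),
      one = tcl R W (frag_of (Sc \<one>\<^bsub>R\<^esub>)),
      zero = tcl R W 0,
      add = (\<lambda>X Y. \<Union>x\<in>X. \<Union>y\<in>Y. tcl R W (x + y)),
      smult = (\<lambda>c X. \<Union>x\<in>X. tcl R W (tmult R W (frag_of (Sc (c \<odot>\<^bsub>R\<^esub> \<one>\<^bsub>R\<^esub>))) x))\<rparr>"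

section \<open>The ditalgebra\<close>

type_synonym ('a, 'p) imat = "'p xp \<Rightarrow> 'p xp \<Rightarrow> 'a"
type_synonym ('a, 'p) dual = "('a, 'p) imat \<Rightarrow> ('a, 'p) imat"
type_synonym ('a, 'p) re_el = "('a, 'p) imat \<times> ('a, 'p) imat"
type_synonym ('a, 'p) w_el = "('a, 'p) dual \<times> ('a, 'p) dual"
type_synonym ('a, 'p) t_el = "((('a, 'p) re_el, ('a, 'p) w_el) tword \<Rightarrow>\<^sub>0 int) set"

abbreviation mm :: "('k, 'a::ring_1, 'p) eposet \<Rightarrow> ('a, 'p) imat \<Rightarrow> ('a, 'p) imat \<Rightarrow> ('a, 'p) imat" where
  "mm D \<equiv> mmul (uPm D)"

definition Lam :: "('k, 'a::ring_1, 'p::order) eposet \<Rightarrow> ('a, 'p) imat set" where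
  "Lam D = inc_carrier (uPm D) (RR D)"

definition SS :: "('k, 'a::ring_1, 'p::order) eposet \<Rightarrow> ('a, 'p) imat set" where
  "SS D = {X \<in> Lam D. \<forall>i j. i \<noteq> j \<longrightarrow> X i j = 0}"

definition JJ :: "('k, 'a::ring_1, 'p::order) eposet \<Rightarrow> ('a, 'p) imat set" where
  "JJ D = {X \<in> Lam D. \<forall>i. X i i = 0}"

definition ee :: "('k, 'a::ring_1, 'p) eposet \<Rightarrow> 'p xp \<Rightarrow> ('a, 'p) imat" where
  "ee D x = munit x x (eps D x)"

definition ehat :: "('k, 'a::ring_1, 'p) eposet \<Rightarrow> ('a, 'p) imat" where
  "ehat D = mone (uPm D) (eps D) - ee D Bot"

text \<open>\<open>e J f\<close> for idempotents \<open>e\<close> and \<open>f\<close> of \<open>S\<close>.\<close>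
definition peirceJ ::
    "('k, 'a::ring_1, 'p::order) eposet \<Rightarrow> ('a, 'p) imat \<Rightarrow> ('a, 'p) imat \<Rightarrow> ('a, 'p) imat set" where
  "peirceJ D e f = {mm D e (mm D u f) | u. u \<in> JJ D}"

text \<open>The \<open>S\<close>-bimodule \<open>Hom\<^sub>S(\<^sub>SJ, S)\<close>; its elements are extended by zero outside \<open>J\<close>.\<close>
definition dualJ :: "('k, 'a::ring_1, 'p::order) eposet \<Rightarrow> ('a, 'p) dual set" where
  "dualJ D = {\<gamma>. (\<forall>u\<in>JJ D. \<gamma> u \<in> SS D) \<and> (\<forall>u. u \<notin> JJ D \<longrightarrow> \<gamma> u = 0) \<and>
     (\<forall>u\<in>JJ D. \<forall>v\<in>JJ D. \<gamma> (u + v) = \<gamma> u + \<gamma> v) \<and>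
     (\<forall>s\<in>SS D. \<forall>u\<in>JJ D. \<gamma> (mm D s u) = mm D s (\<gamma> u))}"

definition dual_l :: "('k, 'a::ring_1, 'p::order) eposet \<Rightarrow> ('a, 'p) imat \<Rightarrow> ('a, 'p) dual \<Rightarrow> ('a, 'p) dual" where
  "dual_l D s \<gamma> = (\<lambda>u. if u \<in> JJ D then \<gamma> (mm D u s) else 0)"

definition dual_r :: "('k, 'a::ring_1, 'p::order) eposet \<Rightarrow> ('a, 'p) dual \<Rightarrow> ('a, 'p) imat \<Rightarrow> ('a, 'p) dual" where
  "dual_r D \<gamma> s = (\<lambda>u. mm D (\<gamma> u) s)"

definition peirceD ::
    "('k, 'a::ring_1, 'p::order) eposet \<Rightarrow> ('a, 'p) imat \<Rightarrow> ('a, 'p) imat \<Rightarrow> ('a, 'p) dual set" where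
  "peirceD D e f = {dual_l D e (dual_r D \<gamma> f) | \<gamma>. \<gamma> \<in> dualJ D}"

definition left_basis ::
    "'f::zero set \<Rightarrow> ('f \<Rightarrow> 'v::ab_group_add \<Rightarrow> 'v) \<Rightarrow> 'v set \<Rightarrow> 'v set \<Rightarrow> bool" where
  "left_basis F act V B \<longleftrightarrow> finite B \<and> B \<subseteq> V \<and>
     (\<forall>v\<in>V. \<exists>c\<in>B \<rightarrow> F. v = (\<Sum>b\<in>B. act (c b) b)) \<and>
     (\<forall>c\<in>B \<rightarrow> F. (\<Sum>b\<in>B. act (c b) b) = 0 \<longrightarrow> (\<forall>b\<in>B. c b = 0))"

text \<open>\<open>B\<close> is a union of left \<open>R\<^sub>y\<close>-bases of the spaces \<open>e\<^sub>y J e\<^sub>x\<close>, \<open>y < x\<close>.\<close>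
definition basis_choice :: "('k, 'a::ring_1, 'p::order) eposet \<Rightarrow> ('a, 'p) imat set \<Rightarrow> bool" where
  "basis_choice D B \<longleftrightarrow>
     B \<subseteq> (\<Union>y\<in>uPm D. \<Union>x\<in>{x\<in>uPm D. y < x}. peirceJ D (ee D y) (ee D x)) \<and>
     (\<forall>y\<in>uPm D. \<forall>x\<in>uPm D. y < x \<longrightarrow>
        left_basis (RR D y y) (\<lambda>r u. mm D (munit y y r) u)
          (peirceJ D (ee D y) (ee D x)) (B \<inter> peirceJ D (ee D y) (ee D x)))"

text \<open>The element of the dual basis belonging to \<open>p \<in> B\<close>, with \<open>\<gamma>\<^sub>p(p) = e\<^sub>y\<close> for \<open>p \<in> e\<^sub>y J e\<^sub>x\<close>.\<close>
definition dual_elt ::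
    "('k, 'a::ring_1, 'p::order) eposet \<Rightarrow> ('a, 'p) imat set \<Rightarrow> ('a, 'p) imat \<Rightarrow> ('a, 'p) dual" where
  "dual_elt D B p = (THE \<gamma>. \<gamma> \<in> dualJ D \<and>
     (\<forall>q\<in>B. q \<noteq> p \<longrightarrow> \<gamma> q = 0) \<and>
     (\<forall>y\<in>uPm D. \<forall>x\<in>uPm D. y < x \<and> p \<in> peirceJ D (ee D y) (ee D x) \<longrightarrow> \<gamma> p = ee D y))"

text \<open>The pair \<open>(a, b)\<close> is the element \<open>w\<^sub>1 a + w\<^sub>2 b\<close> of \<open>R\<^sup>e\<close>.\<close>
definition Re :: "('k, 'a::ring_1, 'p::order) eposet \<Rightarrow> ('k, ('a, 'p) re_el) module" where
  "Re D = \<lparr>carrier = {(mm D (ehat D) s, mm D (ee D Bot) s') | s s'. s \<in> SS D \<and> s' \<in> SS D},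
     mult = (\<lambda>(a, b) (a', b'). (mm D a a', mm D b b')),
     one = (ehat D, ee D Bot), zero = 0, add = (+),
     smult = (\<lambda>c (a, b). (mscale (scal D) c a, mscale (scal D) c b))\<rparr>"

text \<open>
  The pair \<open>(\<gamma>, \<delta>)\<close> is the element \<open>w\<^sub>1\<^sub>,\<^sub>2 \<gamma> + w\<^sub>1 \<delta>\<close> of \<open>W\<^sub>0 \<oplus> W\<^sub>1\<close>. On the right, \<open>R\<^sup>e\<close> acts on
  \<open>W\<^sub>0\<close> through \<open>w\<^sub>2\<close> and on \<open>W\<^sub>1\<close> through \<open>w\<^sub>1\<close>.
\<close>
definition WW :: "('k, 'a::ring_1, 'p::order) eposet \<Rightarrow> (('a, 'p) re_el, ('a, 'p) w_el) bimodule" where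
  "WW D = \<lparr>bcarrier = peirceD D (ehat D) (ee D Bot) \<times> peirceD D (ehat D) (ehat D),
     lact = (\<lambda>(a, b) (\<gamma>, \<delta>). (dual_l D a \<gamma>, dual_l D a \<delta>)),
     ract = (\<lambda>(\<gamma>, \<delta>) (a, b). (dual_r D \<gamma> b, dual_r D \<delta> a))\<rparr>"

definition TT :: "('k, 'a::ring_1, 'p::order) eposet \<Rightarrow> ('k, ('a, 'p) t_el) module" where
  "TT D = tensor_algebra (Re D) (WW D)"

abbreviation Tcl ::
    "('k, 'a::ring_1, 'p::order) eposet \<Rightarrow> ((('a, 'p) re_el, ('a, 'p) w_el) tword \<Rightarrow>\<^sub>0 int) \<Rightarrow> ('a, 'p) t_el" where
  "Tcl D \<equiv> tcl (Re D) (WW D)"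

definition letters :: "('k, 'a::ring_1, 'p::order) eposet \<Rightarrow> nat \<Rightarrow> ('a, 'p) w_el set" where
  "letters D k = (if k = 0 then {(\<gamma>, 0) | \<gamma>. \<gamma> \<in> peirceD D (ehat D) (ee D Bot)}
     else if k = 1 then {(0, \<delta>) | \<delta>. \<delta> \<in> peirceD D (ehat D) (ehat D)} else {})"

definition hom_words ::
    "('k, 'a::ring_1, 'p::order) eposet \<Rightarrow> nat \<Rightarrow> (('a, 'p) re_el, ('a, 'p) w_el) tword set" where
  "hom_words D n = {Sc r | r. r \<in> carrier (Re D) \<and> n = 0} \<union>
     {Tw ws | ws ks. ws \<noteq> [] \<and> list_all2 (\<lambda>w k. w \<in> letters D k) ws ks \<and> sum_list ks = n}"

definition Tdeg :: "('k, 'a::ring_1, 'p::order) eposet \<Rightarrow> nat \<Rightarrow> ('a, 'p) t_el set" where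
  "Tdeg D n = {Tcl D x | x. Poly_Mapping.keys x \<subseteq> hom_words D n}"

definition T0alg :: "('k, 'a::ring_1, 'p::order) eposet \<Rightarrow> ('k, ('a, 'p) t_el) module" where
  "T0alg D = (TT D)\<lparr>carrier := Tdeg D 0\<rparr>"

definition in_Re :: "('k, 'a::ring_1, 'p::order) eposet \<Rightarrow> ('a, 'p) re_el \<Rightarrow> ('a, 'p) t_el" where
  "in_Re D r = Tcl D (frag_of (Sc r))"

definition in_W0 :: "('k, 'a::ring_1, 'p::order) eposet \<Rightarrow> ('a, 'p) dual \<Rightarrow> ('a, 'p) t_el" where
  "in_W0 D \<gamma> = Tcl D (frag_of (Tw [(\<gamma>, 0)]))"

definition in_W1 :: "('k, 'a::ring_1, 'p::order) eposet \<Rightarrow> ('a, 'p) dual \<Rightarrow> ('a, 'p) t_el" where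
  "in_W1 D \<delta> = Tcl D (frag_of (Tw [(0, \<delta>)]))"

text \<open>
  The two formulas list exactly the pairs \<open>(p\<^sub>i, p\<^sub>j)\<close> which can contribute: \<open>\<gamma>(p\<^sub>j p\<^sub>i)\<close> vanishes unless
  \<open>p\<^sub>i \<in> ehat J ehat\<close> and, respectively, \<open>p\<^sub>j \<in> e\<^sub>0 J ehat\<close> or \<open>p\<^sub>j \<in> ehat J ehat\<close>.
  These conditions determine \<open>d\<close> on the carrier of \<open>T\<close>.
\<close>
definition is_differential ::
    "('k::field, 'a::ring_1, 'p::order) eposet \<Rightarrow> ('a, 'p) imat set \<Rightarrow> (('a, 'p) t_el \<Rightarrow> ('a, 'p) t_el) \<Rightarrow> bool" where
  "is_differential D B d \<longleftrightarrow>
     (\<forall>n. \<forall>t\<in>Tdeg D n. d t \<in> Tdeg D (Suc n)) \<and>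
     (\<forall>s\<in>carrier (TT D). \<forall>t\<in>carrier (TT D). d (s \<oplus>\<^bsub>TT D\<^esub> t) = d s \<oplus>\<^bsub>TT D\<^esub> d t) \<and>
     (\<forall>r\<in>carrier (Re D). d (in_Re D r) = \<zero>\<^bsub>TT D\<^esub>) \<and>
     (\<forall>n. \<forall>a\<in>Tdeg D n. \<forall>b\<in>carrier (TT D).
        d (a \<otimes>\<^bsub>TT D\<^esub> b) = d a \<otimes>\<^bsub>TT D\<^esub> b \<oplus>\<^bsub>TT D\<^esub> ((-1) ^ n) \<odot>\<^bsub>TT D\<^esub> (a \<otimes>\<^bsub>TT D\<^esub> d b)) \<and>
     (\<forall>\<gamma>\<in>peirceD D (ehat D) (ee D Bot).
        d (in_W0 D \<gamma>) = Tcl D (- (\<Sum>pi \<in> B \<inter> peirceJ D (ehat D) (ehat D).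
          \<Sum>pj \<in> B \<inter> peirceJ D (ee D Bot) (ehat D).
            frag_of (Tw [(0, dual_elt D B pi), (dual_r D (dual_elt D B pj) (\<gamma> (mm D pj pi)), 0)])))) \<and>
     (\<forall>\<gamma>\<in>peirceD D (ehat D) (ehat D).
        d (in_W1 D \<gamma>) = Tcl D (- (\<Sum>pi \<in> B \<inter> peirceJ D (ehat D) (ehat D).
          \<Sum>pj \<in> B \<inter> peirceJ D (ehat D) (ehat D).
            frag_of (Tw [(0, dual_elt D B pi), (0, dual_r D (dual_elt D B pj) (\<gamma> (mm D pj pi)))]))))"

section \<open>The category of modules over the ditalgebra\<close>

type_synonym ('a, 'p, 'm) dmod = "(('a, 'p) t_el, 'm) rmod"
type_synonym ('a, 'p, 'm, 'n) dmor = "('m \<Rightarrow> 'n) \<times> (('a, 'p) t_el \<Rightarrow> 'm \<Rightarrow> 'n)"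

definition mod_De :: "('k::field, 'a::ring_1, 'p::order) eposet \<Rightarrow> ('a, 'p, 'm::ab_group_add) dmod \<Rightarrow> bool" where
  "mod_De D M \<longleftrightarrow> fd_module (T0alg D) M"

definition hom_K ::
    "('k::field, 'a::ring_1, 'p::order) eposet \<Rightarrow> ('a, 'p, 'm::ab_group_add) dmod \<Rightarrow> ('a, 'p, 'n::ab_group_add) dmod \<Rightarrow>
     ('m \<Rightarrow> 'n) \<Rightarrow> bool" where
  "hom_K D M N h \<longleftrightarrow> h \<in> mcar M \<rightarrow> mcar N \<and>
     (\<forall>m\<in>mcar M. \<forall>m'\<in>mcar M. h (m + m') = h m + h m') \<and>
     (\<forall>c. \<forall>m\<in>mcar M. h (mod_scale (T0alg D) M c m) = mod_scale (T0alg D) N c (h m))"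

definition De_morphism ::
    "('k::field, 'a::ring_1, 'p::order) eposet \<Rightarrow> (('a, 'p) t_el \<Rightarrow> ('a, 'p) t_el) \<Rightarrow>
     ('a, 'p, 'm::ab_group_add) dmod \<Rightarrow> ('a, 'p, 'n::ab_group_add) dmod \<Rightarrow> ('a, 'p, 'm, 'n) dmor \<Rightarrow> bool" where
  "De_morphism D d M N f \<longleftrightarrow> (case f of (f0, f1) \<Rightarrow>
     f0 \<in> mcar M \<rightarrow> mcar N \<and>
     (\<forall>m\<in>mcar M. \<forall>m'\<in>mcar M. f0 (m + m') = f0 m + f0 m') \<and>
     (\<forall>r\<in>carrier (Re D). \<forall>m\<in>mcar M. f0 (mact M m (in_Re D r)) = mact N (f0 m) (in_Re D r)) \<and>
     (\<forall>v\<in>Tdeg D 1. hom_K D M N (f1 v)) \<and>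
     (\<forall>v\<in>Tdeg D 1. \<forall>v'\<in>Tdeg D 1. \<forall>m\<in>mcar M. f1 (v \<oplus>\<^bsub>TT D\<^esub> v') m = f1 v m + f1 v' m) \<and>
     (\<forall>a\<in>Tdeg D 0. \<forall>v\<in>Tdeg D 1. \<forall>m\<in>mcar M.
        f1 (a \<otimes>\<^bsub>TT D\<^esub> v) m = f1 v (mact M m a) \<and>
        f1 (v \<otimes>\<^bsub>TT D\<^esub> a) m = mact N (f1 v m) a) \<and>
     (\<forall>a\<in>Tdeg D 0. \<forall>m\<in>mcar M. mact N (f0 m) a = f0 (mact M m a) + f1 (d a) m))"

text \<open>A list of pairs \<open>(v', v'')\<close> in \<open>T\<^sub>1\<close> with \<open>d(v) = \<Sum> v' \<otimes> v''\<close>.\<close>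
definition splitting ::
    "('k::field, 'a::ring_1, 'p::order) eposet \<Rightarrow> (('a, 'p) t_el \<Rightarrow> ('a, 'p) t_el) \<Rightarrow> ('a, 'p) t_el \<Rightarrow>
     (('a, 'p) t_el \<times> ('a, 'p) t_el) list" where
  "splitting D d v = (SOME ps. set ps \<subseteq> Tdeg D 1 \<times> Tdeg D 1 \<and>
     d v = foldr (\<lambda>(v', v'') t. (v' \<otimes>\<^bsub>TT D\<^esub> v'') \<oplus>\<^bsub>TT D\<^esub> t) ps \<zero>\<^bsub>TT D\<^esub>)"

definition De_comp ::
    "('k::field, 'a::ring_1, 'p::order) eposet \<Rightarrow> (('a, 'p) t_el \<Rightarrow> ('a, 'p) t_el) \<Rightarrow>
     ('a, 'p, 'n, 'q::ab_group_add) dmor \<Rightarrow> ('a, 'p, 'm, 'n) dmor \<Rightarrow> ('a, 'p, 'm, 'q) dmor" where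
  "De_comp D d g f = (\<lambda>m. fst g (fst f m),
     \<lambda>v m. snd g v (fst f m) + fst g (snd f v m)
       - (\<Sum>(v', v'')\<leftarrow>splitting D d v. snd g v'' (snd f v' m)))"

definition De_id :: "('a, 'p, 'm::ab_group_add, 'm) dmor" where
  "De_id = (\<lambda>m. m, \<lambda>v m. 0)"

definition De_mor_eq ::
    "('k::field, 'a::ring_1, 'p::order) eposet \<Rightarrow> ('a, 'p, 'm) dmod \<Rightarrow>
     ('a, 'p, 'm, 'n) dmor \<Rightarrow> ('a, 'p, 'm, 'n) dmor \<Rightarrow> bool" where
  "De_mor_eq D M f g \<longleftrightarrow> (\<forall>m\<in>mcar M. fst f m = fst g m) \<and>
     (\<forall>v\<in>Tdeg D 1. \<forall>m\<in>mcar M. snd f v m = snd g v m)"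

definition De_isomorphic ::
    "('k::field, 'a::ring_1, 'p::order) eposet \<Rightarrow> (('a, 'p) t_el \<Rightarrow> ('a, 'p) t_el) \<Rightarrow>
     ('a, 'p, 'm::ab_group_add) dmod \<Rightarrow> ('a, 'p, 'n::ab_group_add) dmod \<Rightarrow> bool" where
  "De_isomorphic D d M N \<longleftrightarrow> (\<exists>f g. De_morphism D d M N f \<and> De_morphism D d N M g \<and>
     De_mor_eq D M (De_comp D d g f) De_id \<and> De_mor_eq D N (De_comp D d f g) De_id)"

section \<open>Local bases and matrices\<close>

definition right_basis ::
    "'f::zero set \<Rightarrow> ('v::ab_group_add \<Rightarrow> 'f \<Rightarrow> 'v) \<Rightarrow> 'v set \<Rightarrow> nat \<Rightarrow> (nat \<Rightarrow> 'v) \<Rightarrow> bool" where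
  "right_basis F act V n b \<longleftrightarrow> b \<in> {1..n} \<rightarrow> V \<and>
     (\<forall>v\<in>V. \<exists>c\<in>{1..n} \<rightarrow> F. v = (\<Sum>i=1..n. act (b i) (c i))) \<and>
     (\<forall>c\<in>{1..n} \<rightarrow> F. (\<Sum>i=1..n. act (b i) (c i)) = 0 \<longrightarrow> (\<forall>i\<in>{1..n}. c i = 0))"

text \<open>The element \<open>w\<^sub>1 e\<^sub>x\<^sub>,\<^sub>x r\<close>, or \<open>w\<^sub>2 e\<^sub>0\<^sub>,\<^sub>0 r\<close> for \<open>x = 0\<close>.\<close>
definition diag_elt :: "('k, 'a::ring_1, 'p::order) eposet \<Rightarrow> 'p xp \<Rightarrow> 'a \<Rightarrow> ('a, 'p) t_el" where
  "diag_elt D x r = in_Re D (if x = Bot then (0, munit x x r) else (munit x x r, 0))"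

definition comp_at ::
    "('k, 'a::ring_1, 'p::order) eposet \<Rightarrow> ('a, 'p, 'm) dmod \<Rightarrow> 'p xp \<Rightarrow> 'm set" where
  "comp_at D M x = {mact M m (diag_elt D x (eps D x)) | m. m \<in> mcar M}"

definition act_at ::
    "('k, 'a::ring_1, 'p::order) eposet \<Rightarrow> ('a, 'p, 'm) dmod \<Rightarrow> 'p xp \<Rightarrow> 'm \<Rightarrow> 'a \<Rightarrow> 'm" where
  "act_at D M x m r = mact M m (diag_elt D x r)"

definition dimvec ::
    "('k, 'a::ring_1, 'p::order) eposet \<Rightarrow> ('a, 'p, 'm::ab_group_add) dmod \<Rightarrow> 'p xp \<Rightarrow> nat" where
  "dimvec D M x = (THE n. \<exists>b. right_basis (RR D x x) (act_at D M x) (comp_at D M x) n b)"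

definition local_basis ::
    "('k, 'a::ring_1, 'p::order) eposet \<Rightarrow> ('a, 'p, 'm::ab_group_add) dmod \<Rightarrow> ('p xp \<Rightarrow> nat \<Rightarrow> 'm) \<Rightarrow> bool" where
  "local_basis D M b \<longleftrightarrow> (\<forall>x\<in>uPm D.
     right_basis (RR D x x) (act_at D M x) (comp_at D M x) (dimvec D M x) (b x))"

definition rho :: "('k, 'a::ring_1, 'p) eposet \<Rightarrow> ('p xp \<Rightarrow> 'a) \<Rightarrow> 'p xp \<Rightarrow> 'a \<Rightarrow> 'a" where
  "rho D v x a = (THE r. r \<in> RR D x x \<and> a * v x = v x * r)"

definition chi :: "('k, 'a::ring_1, 'p) eposet \<Rightarrow> ('p xp \<Rightarrow> 'a) \<Rightarrow> 'p xp \<Rightarrow> 'p xp \<Rightarrow> 'a \<Rightarrow> 'a" where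
  "chi D v y x r = (THE s. s \<in> RR D x x \<and> v y * r = v x * s)"

text \<open>Cosets in \<open>M\<^sub>0 \<otimes> e\<^sub>0 J ehat\<close>, the tensor product over \<open>R\<^sub>0\<close>.\<close>
definition M0J_cl ::
    "('k, 'a::ring_1, 'p::order) eposet \<Rightarrow> ('a, 'p, 'm::ab_group_add) dmod \<Rightarrow>
     ('m \<times> ('a, 'p) imat \<Rightarrow>\<^sub>0 int) \<Rightarrow> ('m \<times> ('a, 'p) imat \<Rightarrow>\<^sub>0 int) set" where
  "M0J_cl D M = add_coset (add_hull (tensor_rels (RR D Bot Bot) (comp_at D M Bot) (act_at D M Bot)
     (peirceJ D (ee D Bot) (ehat D)) (\<lambda>r u. mm D (munit Bot Bot r) u)))"

definition htilde ::
    "('k, 'a::ring_1, 'p::order) eposet \<Rightarrow> ('a, 'p) imat set \<Rightarrow> ('a, 'p, 'm::ab_group_add) dmod \<Rightarrow> 'm \<Rightarrow>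
     ('m \<times> ('a, 'p) imat \<Rightarrow>\<^sub>0 int) set" where
  "htilde D B M m = M0J_cl D M
     (\<Sum>p \<in> B \<inter> peirceJ D (ee D Bot) (ehat D). frag_of (mact M m (in_W0 D (dual_elt D B p)), p))"

text \<open>The stripe at \<open>x\<close>; only the entries with row in \<open>{1..d\<^sub>0}\<close> and column in \<open>{1..d\<^sub>x}\<close> matter.\<close>
definition stripe ::
    "('k, 'a::ring_1, 'p::order) eposet \<Rightarrow> ('a, 'p) imat set \<Rightarrow> ('p xp \<Rightarrow> 'a) \<Rightarrow>
     ('a, 'p, 'm::ab_group_add) dmod \<Rightarrow> ('p xp \<Rightarrow> nat \<Rightarrow> 'm) \<Rightarrow> 'p xp \<Rightarrow> nat \<Rightarrow> nat \<Rightarrow> 'a" where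
  "stripe D B v M b x = (SOME X. \<forall>i\<in>{1..dimvec D M x}.
     (\<forall>j\<in>{1..dimvec D M Bot}. X j i \<in> RR D x x) \<and>
     htilde D B M (b x i) =
       M0J_cl D M (\<Sum>j=1..dimvec D M Bot. frag_of (b Bot j, munit Bot x (v x * X j i))))"

definition mat_mult ::
    "nat \<Rightarrow> (nat \<Rightarrow> nat \<Rightarrow> 'a::ring_1) \<Rightarrow> (nat \<Rightarrow> nat \<Rightarrow> 'a) \<Rightarrow> (nat \<Rightarrow> nat \<Rightarrow> 'a)" where
  "mat_mult n X Y = (\<lambda>j i. \<Sum>k=1..n. X j k * Y k i)"

definition mat_map :: "('a \<Rightarrow> 'b) \<Rightarrow> (nat \<Rightarrow> nat \<Rightarrow> 'a) \<Rightarrow> (nat \<Rightarrow> nat \<Rightarrow> 'b)" where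
  "mat_map h X = (\<lambda>j i. h (X j i))"

definition mat_over :: "nat \<Rightarrow> nat \<Rightarrow> 'a set \<Rightarrow> (nat \<Rightarrow> nat \<Rightarrow> 'a) set" where
  "mat_over r c F = {X. \<forall>j\<in>{1..r}. \<forall>i\<in>{1..c}. X j i \<in> F}"

definition nonsingular :: "nat \<Rightarrow> 'a::ring_1 set \<Rightarrow> 'a \<Rightarrow> (nat \<Rightarrow> nat \<Rightarrow> 'a) \<Rightarrow> bool" where
  "nonsingular n F u X \<longleftrightarrow> X \<in> mat_over n n F \<and> (\<exists>Y\<in>mat_over n n F. \<forall>j\<in>{1..n}. \<forall>i\<in>{1..n}.
     mat_mult n X Y j i = (if j = i then u else 0) \<and>
     mat_mult n Y X j i = (if j = i then u else 0))"

end

theory Submission imports Defs begin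

text \<open>
  In coordinates, a morphism \<open>f : M \<rightarrow> N\<close> is a block matrix \<open>F\<close> over \<open>\<Lambda>\<close> without blocks \<open>F\<^sub>0\<^sub>,\<^sub>x\<close> for
  \<open>x \<noteq> 0\<close>: the diagonal blocks describe \<open>f\<^sup>0\<close>, and the blocks \<open>F\<^sub>y\<^sub>,\<^sub>x\<close> with \<open>y < x\<close> describe the
  restriction of \<open>f\<^sup>1\<close> to \<open>W\<^sub>1\<close>, since right \<open>S\<close>-linear maps out of the dual \<open>\<^sup>*J\<close> are given by
  elements of \<open>J\<close>. As the differential is dual to the multiplication of \<open>J\<close>, composition of morphisms
  becomes multiplication of matrices, and the compatibility of \<open>(f\<^sup>0, f\<^sup>1)\<close> with the action of \<open>W\<^sub>0\<close>
  becomes \<open>F H\<^sub>M = H\<^sub>N F\<close>, where \<open>H\<^sub>M\<close> has the entries of \<open>v\<^sub>x \<M>(M)\<^sub>x\<close> in the row of blocks at \<open>0\<close>.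
  A triangular matrix is invertible if its diagonal blocks are, so \<open>M \<cong> N\<close> means that
  \<open>H\<^sub>M = F\<^sub>0\<^sub>,\<^sub>0\<^sup>-\<^sup>1 H\<^sub>N F\<close> for some \<open>F\<close> with invertible diagonal blocks. This is the asserted equation
  multiplied by \<open>v\<^sub>x\<close>, with \<open>T\<^sub>0 = F\<^sub>0\<^sub>,\<^sub>0\<^sup>-\<^sup>1\<close>, \<open>T\<^sub>x = F\<^sub>x\<^sub>,\<^sub>x\<close> and \<open>T\<^sub>y\<^sub>,\<^sub>x = F\<^sub>y\<^sub>,\<^sub>x\<close>.
\<close>

section \<open>Cosets and tensor algebras\<close>

text \<open>Elements of \<open>T\<close> are cosets of integer combinations of words, and
  \<open>f\<^sup>1\<close>, the differential and the chosen splitting of \<open>d v\<close> in a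
  composition all live on them, while matrices see letters only. The bridge is the universal
  property of the tensor algebra: an action of \<open>R\<^sup>e\<close> and of the letters on an
  abelian group, with the evident compatibilities, extends to \<open>T\<close>. Three actions are
  used. On \<open>M\<close> the letters of \<open>W\<^sub>1\<close> act by zero; on
  \<open>M \<oplus> N\<close> they map \<open>M\<close> to \<open>N\<close>, and elements of degree
  one act as \<open>f\<^sup>1\<close>; on \<open>M \<oplus> N \<oplus> Q\<close> elements of degree
  two act as the sum over a splitting, whichever splitting was chosen. By the Leibniz rule,
  identities involving \<open>d\<close> then need checking on letters only. The stripes are
  specified by cosets in a tensor product as well; linear forms on it, one for each
  \<open>\<gamma>\<close> in \<open>W\<^sub>0\<close>, recover the action on \<open>M\<close>.
  Finally, the field and dimension hypotheses make multiplication by \<open>v\<^sub>x\<close>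
  injective on \<open>R\<^sub>x\<close>, which gives \<open>\<rho>\<^sub>x\<close> and
  \<open>\<chi>\<^sub>y\<^sub>,\<^sub>x\<close> their meaning and allows the matrix equation to be
  multiplied by \<open>v\<^sub>x\<close> without loss.\<close>

lemma add_hull_uminus: "x \<in> add_hull X \<Longrightarrow> - x \<in> add_hull X"
  using add_hull.diff[OF add_hull.zero] by fastforce

lemma add_hull_add: "x \<in> add_hull X \<Longrightarrow> y \<in> add_hull X \<Longrightarrow> x + y \<in> add_hull X"
  using add_hull.diff[OF _ add_hull_uminus] by fastforce

lemma add_hull_sum: "(\<And>i. i \<in> I \<Longrightarrow> f i \<in> add_hull X) \<Longrightarrow> sum f I \<in> add_hull X"
  by (induction I rule: infinite_finite_induct) (auto intro: add_hull.zero add_hull_add)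

lemma mem_add_coset: "x \<in> add_coset (add_hull X) x"
  by (simp add: add_coset_def add_hull.zero)

lemma add_coset_eq_iff:
  "add_coset (add_hull X) x = add_coset (add_hull X) y \<longleftrightarrow> x - y \<in> add_hull X"
proof
  show "x - y \<in> add_hull X" if "add_coset (add_hull X) x = add_coset (add_hull X) y"
    using that mem_add_coset[of x X] by (simp add: add_coset_def)
  have *: "z - y \<in> add_hull X \<longleftrightarrow> z - x \<in> add_hull X" if "x - y \<in> add_hull X" for z
    using add_hull_add[OF that, of "z - x"] add_hull.diff[OF _ that, of "z - y"] by auto
  then show "add_coset (add_hull X) x = add_coset (add_hull X) y" if "x - y \<in> add_hull X"
    using that by (auto simp: add_coset_def)
qed

section \<open>Additive maps out of a free abelian group\<close>

definition zmul :: "int \<Rightarrow> 'v::ab_group_add \<Rightarrow> 'v" where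
  "zmul k v = (\<Sum>i<nat k. v) - (\<Sum>i<nat (- k). v)"

lemma zmul_0 [simp]: "zmul 0 v = 0" and zmul_1 [simp]: "zmul 1 v = v"
  by (simp_all add: zmul_def)

lemma zmul_step: "zmul (k + 1) v = zmul k v + v"
proof (cases "k \<ge> 0")
  case True
  then have "nat (k + 1) = Suc (nat k)" "nat (- (k + 1)) = 0" "nat (- k) = 0" by auto
  then show ?thesis by (simp add: zmul_def add.commute)
next
  case False
  then have "nat (- k) = Suc (nat (- (k + 1)))" "nat (k + 1) = 0" "nat k = 0" by auto
  then show ?thesis by (simp add: zmul_def)
qed

lemma zmul_add: "zmul (k + l) v = zmul k v + zmul l v"
proof (induction l rule: int_induct[where k = 0])
  case (step1 i)
  then show ?case using zmul_step[of "k + i" v] zmul_step[of i v] by (simp add: add.assoc)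
next
  case (step2 i)
  then show ?case using zmul_step[of "k + i - 1" v] zmul_step[of "i - 1" v]
    by (simp add: algebra_simps)
qed simp

text \<open>The additive extension of \<open>f\<close> from the basis to the free abelian group,
  with values in an arbitrary abelian group. The actions of tensor algebras and the linear forms on
  \<open>M\<^sub>0 \<otimes> e\<^sub>0 J ehat\<close> are instances.\<close>

definition fext :: "('b \<Rightarrow> 'v::ab_group_add) \<Rightarrow> ('b \<Rightarrow>\<^sub>0 int) \<Rightarrow> 'v" where
  "fext f x = (\<Sum>w\<in>Poly_Mapping.keys x. zmul (Poly_Mapping.lookup x w) (f w))"

lemma fext_superset:
  assumes "finite S" "Poly_Mapping.keys x \<subseteq> S"
  shows "fext f x = (\<Sum>w\<in>S. zmul (Poly_Mapping.lookup x w) (f w))"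
  unfolding fext_def by (rule sum.mono_neutral_left) (use assms in \<open>auto simp: in_keys_iff\<close>)

lemma fext_of [simp]: "fext f (frag_of w) = f w"
  by (simp add: fext_def keys_frag_of)

lemma fext_0 [simp]: "fext f 0 = 0"
  by (simp add: fext_def)

lemma fext_add: "fext f (x + y) = fext f x + fext f y"
proof -
  let ?S = "Poly_Mapping.keys x \<union> Poly_Mapping.keys y"
  have "fext f (x + y) = (\<Sum>w\<in>?S. zmul (Poly_Mapping.lookup (x + y) w) (f w))"
    by (rule fext_superset) (use Poly_Mapping.keys_add[of x y] in auto)
  also have "\<dots> = fext f x + fext f y"
    by (simp add: fext_superset[of ?S] Poly_Mapping.lookup_add zmul_add sum.distrib)
  finally show ?thesis .
qed

lemma fext_diff: "fext f (x - y) = fext f x - fext f y"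
  using fext_add[of f "x - y" y] by simp

lemma fext_uminus: "fext f (- x) = - fext f x"
  using fext_diff[of f 0 x] by simp

lemma fext_sum: "fext f (sum g I) = (\<Sum>i\<in>I. fext f (g i))"
  by (induction I rule: infinite_finite_induct) (auto simp: fext_add)

lemma fext_closed:
  assumes "Poly_Mapping.keys x \<subseteq> S" "\<And>w. w \<in> S \<Longrightarrow> f w \<in> C" "0 \<in> C"
    "\<And>u v. u \<in> C \<Longrightarrow> v \<in> C \<Longrightarrow> u - v \<in> C"
  shows "fext f x \<in> C"
  using assms(1) by (induction x rule: frag_induction) (auto simp: fext_diff assms)

lemma tmult_diff_left: "tmult R W (x - y) z = tmult R W x z - tmult R W y z"
  by (simp add: tmult_def frag_extend_diff)

lemma tmult_0_left [simp]: "tmult R W 0 z = 0"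
  by (simp add: tmult_def)

lemma tmult_of_left: "tmult R W (frag_of a) z = frag_extend (\<lambda>b. frag_of (tword_mult R W a b)) z"
  by (simp add: tmult_def)

lemma tmult_of: "tmult R W (frag_of a) (frag_of b) = frag_of (tword_mult R W a b)"
  by (simp add: tmult_def)

lemma tmult_diff_right: "tmult R W x (y - z) = tmult R W x y - tmult R W x z"
proof -
  have "Poly_Mapping.keys x \<subseteq> UNIV" by simp
  then show ?thesis
  proof (induction x rule: frag_induction)
    case (one a)
    then show ?case by (simp add: tmult_of_left frag_extend_diff)
  qed (simp_all add: tmult_diff_left)
qed

lemma tmult_0_right [simp]: "tmult R W x 0 = 0"
  using tmult_diff_right[of R W x 0 0] by simp

lemma keys_diff_subset:
  "Poly_Mapping.keys x \<subseteq> S \<Longrightarrow> Poly_Mapping.keys y \<subseteq> S \<Longrightarrow>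
    Poly_Mapping.keys (x - y) \<subseteq> S" for x y :: "'b \<Rightarrow>\<^sub>0 int"
  using keys_diff[of x y] by auto

section \<open>Tensor algebras: the operations are independent of representatives\<close>

locale ring_bimodule =
  fixes R :: "('k, 'r) module" and W :: "('r, 'w::ab_group_add) bimodule"
  assumes add_closed: "\<And>r s. r \<in> carrier R \<Longrightarrow> s \<in> carrier R \<Longrightarrow> r \<oplus>\<^bsub>R\<^esub> s \<in> carrier R"
    and mult_closed: "\<And>r s. r \<in> carrier R \<Longrightarrow> s \<in> carrier R \<Longrightarrow> r \<otimes>\<^bsub>R\<^esub> s \<in> carrier R"
    and one_closed: "\<one>\<^bsub>R\<^esub> \<in> carrier R"
    and scalar_closed: "\<And>c. c \<odot>\<^bsub>R\<^esub> \<one>\<^bsub>R\<^esub> \<in> carrier R"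
    and r_one: "\<And>r. r \<in> carrier R \<Longrightarrow> r \<otimes>\<^bsub>R\<^esub> \<one>\<^bsub>R\<^esub> = r"
    and l_distr: "\<And>r s t. r \<in> carrier R \<Longrightarrow> s \<in> carrier R \<Longrightarrow> t \<in> carrier R \<Longrightarrow>
      (r \<oplus>\<^bsub>R\<^esub> s) \<otimes>\<^bsub>R\<^esub> t = r \<otimes>\<^bsub>R\<^esub> t \<oplus>\<^bsub>R\<^esub> s \<otimes>\<^bsub>R\<^esub> t"
    and r_distr: "\<And>r s t. r \<in> carrier R \<Longrightarrow> s \<in> carrier R \<Longrightarrow> t \<in> carrier R \<Longrightarrow>
      t \<otimes>\<^bsub>R\<^esub> (r \<oplus>\<^bsub>R\<^esub> s) = t \<otimes>\<^bsub>R\<^esub> r \<oplus>\<^bsub>R\<^esub> t \<otimes>\<^bsub>R\<^esub> s"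
    and w_add: "\<And>w w'. w \<in> bcarrier W \<Longrightarrow> w' \<in> bcarrier W \<Longrightarrow> w + w' \<in> bcarrier W"
    and lact_closed: "\<And>r w. r \<in> carrier R \<Longrightarrow> w \<in> bcarrier W \<Longrightarrow> lact W r w \<in> bcarrier W"
    and ract_closed: "\<And>r w. r \<in> carrier R \<Longrightarrow> w \<in> bcarrier W \<Longrightarrow> ract W w r \<in> bcarrier W"
    and lact_add: "\<And>r w w'. r \<in> carrier R \<Longrightarrow> w \<in> bcarrier W \<Longrightarrow> w' \<in> bcarrier W \<Longrightarrow>
      lact W r (w + w') = lact W r w + lact W r w'"
    and ract_add: "\<And>r w w'. r \<in> carrier R \<Longrightarrow> w \<in> bcarrier W \<Longrightarrow> w' \<in> bcarrier W \<Longrightarrow>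
      ract W (w + w') r = ract W w r + ract W w' r"
    and lact_add_left: "\<And>r s w. r \<in> carrier R \<Longrightarrow> s \<in> carrier R \<Longrightarrow> w \<in> bcarrier W \<Longrightarrow>
      lact W (r \<oplus>\<^bsub>R\<^esub> s) w = lact W r w + lact W s w"
    and ract_add_right: "\<And>r s w. r \<in> carrier R \<Longrightarrow> s \<in> carrier R \<Longrightarrow> w \<in> bcarrier W \<Longrightarrow>
      ract W w (r \<oplus>\<^bsub>R\<^esub> s) = ract W w r + ract W w s"
    and lact_ract: "\<And>r s w. r \<in> carrier R \<Longrightarrow> s \<in> carrier R \<Longrightarrow> w \<in> bcarrier W \<Longrightarrow>
      lact W r (ract W w s) = ract W (lact W r w) s"
begin

abbreviation "rel_hull \<equiv> add_hull (talg_rels R W)"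

lemma rel_Sc:
  "r \<in> carrier R \<Longrightarrow> s \<in> carrier R \<Longrightarrow>
    frag_of (Sc (r \<oplus>\<^bsub>R\<^esub> s)) - frag_of (Sc r) - frag_of (Sc s) \<in> talg_rels R W"
  by (auto simp: talg_rels_def)

lemma rel_add:
  "set us \<subseteq> bcarrier W \<Longrightarrow> w \<in> bcarrier W \<Longrightarrow> w' \<in> bcarrier W \<Longrightarrow> set vs \<subseteq> bcarrier W \<Longrightarrow>
    frag_of (Tw (us @ (w + w') # vs)) - frag_of (Tw (us @ w # vs)) - frag_of (Tw (us @ w' # vs))
      \<in> talg_rels R W"
  by (auto simp: talg_rels_def)

lemma rel_bal:
  "set us \<subseteq> bcarrier W \<Longrightarrow> w \<in> bcarrier W \<Longrightarrow> r \<in> carrier R \<Longrightarrow> w' \<in> bcarrier W \<Longrightarrow>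
    set vs \<subseteq> bcarrier W \<Longrightarrow>
    frag_of (Tw (us @ ract W w r # w' # vs)) - frag_of (Tw (us @ w # lact W r w' # vs))
      \<in> talg_rels R W"
  unfolding talg_rels_def by blast

lemma talg_rels_cases [consumes 1, case_names Sc add bal]:
  assumes "g \<in> talg_rels R W"
  obtains r s where "g = frag_of (Sc (r \<oplus>\<^bsub>R\<^esub> s)) - frag_of (Sc r) - frag_of (Sc s)"
      "r \<in> carrier R" "s \<in> carrier R"
  | us w w' vs where
      "g = frag_of (Tw (us @ (w + w') # vs)) - frag_of (Tw (us @ w # vs)) - frag_of (Tw (us @ w' # vs))"
      "set us \<subseteq> bcarrier W" "w \<in> bcarrier W" "w' \<in> bcarrier W" "set vs \<subseteq> bcarrier W"
  | us w r w' vs where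
      "g = frag_of (Tw (us @ ract W w r # w' # vs)) - frag_of (Tw (us @ w # lact W r w' # vs))"
      "set us \<subseteq> bcarrier W" "w \<in> bcarrier W" "r \<in> carrier R" "w' \<in> bcarrier W" "set vs \<subseteq> bcarrier W"
  using assms unfolding talg_rels_def by blast

lemma keys_talg_rels: "g \<in> talg_rels R W \<Longrightarrow> Poly_Mapping.keys g \<subseteq> twords R W"
  by (erule talg_rels_cases; hypsubst; intro keys_diff_subset;
      auto simp: keys_frag_of twords_def add_closed w_add ract_closed lact_closed)

lemma keys_hull: "h \<in> rel_hull \<Longrightarrow> Poly_Mapping.keys h \<subseteq> twords R W"
proof (induction h rule: add_hull.induct)
  case (diff x y)
  then show ?case using keys_diff[of x y] by auto
qed (use keys_talg_rels in auto)

lemma tword_mult_closed: "a \<in> twords R W \<Longrightarrow> b \<in> twords R W \<Longrightarrow> tword_mult R W a b \<in> twords R W"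
proof (cases a; cases b)
  fix r ws assume *: "a = Sc r" "b = Tw ws" "a \<in> twords R W" "b \<in> twords R W"
  then show ?thesis by (cases ws) (auto simp: twords_def lact_closed)
next
  fix r ws assume *: "b = Sc r" "a = Tw ws" "a \<in> twords R W" "b \<in> twords R W"
  then show ?thesis by (cases ws rule: rev_cases) (auto simp: twords_def ract_closed)
qed (auto simp: twords_def mult_closed)

text \<open>A relation sits at some place of a word, and a word multiplied from the right leaves
  that place alone unless it touches it. The remaining cases are absorbed by the bimodule laws: a
  scalar enters the last letter, and a relation between scalars becomes additivity in the first
  letter of the following word.\<close>

lemma rel_mult_left:
  assumes "g \<in> talg_rels R W" "b \<in> twords R W"
  shows "tmult R W g (frag_of b) \<in> rel_hull"
proof (cases b)
  case b: (Sc t)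
  then have t: "t \<in> carrier R" using assms by (auto simp: twords_def)
  from assms(1) show ?thesis
  proof (cases g rule: talg_rels_cases)
    case (Sc r s)
    then show ?thesis using t rel_Sc[of "r \<otimes>\<^bsub>R\<^esub> t" "s \<otimes>\<^bsub>R\<^esub> t"]
      by (simp add: b tmult_diff_left tmult_of l_distr mult_closed add_hull.base)
  next
    case (add us w w' vs)
    show ?thesis
    proof (cases vs rule: rev_cases)
      case Nil
      then show ?thesis using t add rel_add[of us "ract W w t" "ract W w' t" "[]"]
        by (simp add: b tmult_diff_left tmult_of butlast_append ract_add ract_closed add_hull.base)
    next
      case (snoc vs' z)
      then show ?thesis using t add rel_add[of us w w' "vs' @ [ract W z t]"]
        by (simp add: b tmult_diff_left tmult_of butlast_append ract_closed add_hull.base)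
    qed
  next
    case (bal us w r w' vs)
    show ?thesis
    proof (cases vs rule: rev_cases)
      case Nil
      then show ?thesis using t bal rel_bal[of us w r "ract W w' t" "[]"]
        by (simp add: b tmult_diff_left tmult_of butlast_append lact_ract ract_closed add_hull.base)
    next
      case (snoc vs' z)
      then show ?thesis using t bal rel_bal[of us w r w' "vs' @ [ract W z t]"]
        by (simp add: b tmult_diff_left tmult_of butlast_append ract_closed add_hull.base)
    qed
  qed
next
  case b: (Tw xs)
  then have xs: "xs \<noteq> []" "set xs \<subseteq> bcarrier W" using assms by (auto simp: twords_def)
  then obtain z zs where z: "xs = z # zs" by (cases xs) auto
  from assms(1) show ?thesis
  proof (cases g rule: talg_rels_cases)
    case (Sc r s)
    then show ?thesis using xs z rel_add[of "[]" "lact W r z" "lact W s z" zs]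
      by (simp add: b tmult_diff_left tmult_of lact_add_left lact_closed add_hull.base)
  next
    case (add us w w' vs)
    then show ?thesis using xs rel_add[of us w w' "vs @ xs"]
      by (simp add: b tmult_diff_left tmult_of add_hull.base)
  next
    case (bal us w r w' vs)
    then show ?thesis using xs rel_bal[of us w r w' "vs @ xs"]
      by (simp add: b tmult_diff_left tmult_of add_hull.base)
  qed
qed

lemma rel_mult_right:
  assumes "g \<in> talg_rels R W" "b \<in> twords R W"
  shows "tmult R W (frag_of b) g \<in> rel_hull"
proof (cases b)
  case b: (Sc t)
  then have t: "t \<in> carrier R" using assms by (auto simp: twords_def)
  from assms(1) show ?thesis
  proof (cases g rule: talg_rels_cases)
    case (Sc r s)
    then show ?thesis using t rel_Sc[of "t \<otimes>\<^bsub>R\<^esub> r" "t \<otimes>\<^bsub>R\<^esub> s"]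
      by (simp add: b tmult_diff_right tmult_of r_distr mult_closed add_hull.base)
  next
    case (add us w w' vs)
    show ?thesis
    proof (cases us)
      case Nil
      then show ?thesis using t add rel_add[of "[]" "lact W t w" "lact W t w'" vs]
        by (simp add: b tmult_diff_right tmult_of lact_add lact_closed add_hull.base)
    next
      case (Cons z us')
      then show ?thesis using t add rel_add[of "lact W t z # us'" w w' vs]
        by (simp add: b tmult_diff_right tmult_of lact_closed add_hull.base)
    qed
  next
    case (bal us w r w' vs)
    show ?thesis
    proof (cases us)
      case Nil
      then show ?thesis using t bal rel_bal[of "[]" "lact W t w" r w' vs]
        by (simp add: b tmult_diff_right tmult_of lact_ract lact_closed add_hull.base)
    next
      case (Cons z us')
      then show ?thesis using t bal rel_bal[of "lact W t z # us'" w r w' vs]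
        by (simp add: b tmult_diff_right tmult_of lact_closed add_hull.base)
    qed
  qed
next
  case b: (Tw xs)
  then have xs: "xs \<noteq> []" "set xs \<subseteq> bcarrier W" using assms by (auto simp: twords_def)
  then obtain z zs where z: "xs = zs @ [z]" by (cases xs rule: rev_cases) auto
  from assms(1) show ?thesis
  proof (cases g rule: talg_rels_cases)
    case (Sc r s)
    then show ?thesis using xs z rel_add[of zs "ract W z r" "ract W z s" "[]"]
      by (simp add: b tmult_diff_right tmult_of ract_add_right ract_closed add_hull.base)
  next
    case (add us w w' vs)
    then show ?thesis using xs rel_add[of "xs @ us" w w' vs]
      by (simp add: b tmult_diff_right tmult_of add_hull.base)
  next
    case (bal us w r w' vs)
    then show ?thesis using xs rel_bal[of "xs @ us" w r w' vs]
      by (simp add: b tmult_diff_right tmult_of add_hull.base)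
  qed
qed

text \<open>Together with \<open>hull_mult_right\<close> this makes the subgroup of relations a
  two-sided ideal, so products of cosets may be computed on any representatives.\<close>

lemma hull_mult_left:
  assumes "h \<in> rel_hull" "Poly_Mapping.keys x \<subseteq> twords R W"
  shows "tmult R W h x \<in> rel_hull"
  using assms(1)
proof (induction h rule: add_hull.induct)
  case (base g)
  from assms(2) show ?case
    by (induction x rule: frag_induction)
      (auto simp: tmult_diff_right rel_mult_left[OF base] intro: add_hull.intros)
qed (auto simp: tmult_diff_left intro: add_hull.intros)

lemma hull_mult_right:
  assumes "h \<in> rel_hull" "Poly_Mapping.keys x \<subseteq> twords R W"
  shows "tmult R W x h \<in> rel_hull"
  using assms(1)
proof (induction h rule: add_hull.induct)
  case (base g)
  from assms(2) show ?case
    by (induction x rule: frag_induction)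
      (auto simp: tmult_diff_left rel_mult_right[OF base] intro: add_hull.intros)
qed (auto simp: tmult_diff_right intro: add_hull.intros)

lemma tcl_eq_iff: "tcl R W x = tcl R W y \<longleftrightarrow> x - y \<in> rel_hull"
  by (simp add: tcl_def add_coset_eq_iff)

lemma mem_tcl: "y \<in> tcl R W x \<longleftrightarrow> y - x \<in> rel_hull"
  by (simp add: tcl_def add_coset_def)

text \<open>The operations of \<open>tensor_algebra\<close> are unions over all pairs of
  representatives. Such a union is a single coset once its members coincide, since every coset is
  inhabited.\<close>

lemma UN_const_tcl:
  assumes "\<And>x' y'. x' \<in> tcl R W x \<Longrightarrow> y' \<in> tcl R W y \<Longrightarrow> f x' y' = c"
  shows "(\<Union>x'\<in>tcl R W x. \<Union>y'\<in>tcl R W y. f x' y') = c"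
proof -
  have "x \<in> tcl R W x" "y \<in> tcl R W y" by (auto simp: mem_tcl add_hull.zero)
  then show ?thesis using assms by blast
qed

lemma tcl_add: "tcl R W x \<oplus>\<^bsub>tensor_algebra R W\<^esub> tcl R W y = tcl R W (x + y)"
proof -
  have "tcl R W (x' + y') = tcl R W (x + y)" if "x' \<in> tcl R W x" "y' \<in> tcl R W y" for x' y'
    using that add_hull_add[of "x' - x" _ "y' - y"] by (auto simp: mem_tcl tcl_eq_iff algebra_simps)
  then have "(\<Union>x'\<in>tcl R W x. \<Union>y'\<in>tcl R W y. tcl R W (x' + y')) = tcl R W (x + y)"
    by (rule UN_const_tcl)
  then show ?thesis by (simp only: tensor_algebra_def ring.simps)
qed

lemma tcl_mult:
  assumes x: "Poly_Mapping.keys x \<subseteq> twords R W" and y: "Poly_Mapping.keys y \<subseteq> twords R W"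
  shows "tcl R W x \<otimes>\<^bsub>tensor_algebra R W\<^esub> tcl R W y = tcl R W (tmult R W x y)"
proof -
  have "tcl R W (tmult R W x' y') = tcl R W (tmult R W x y)"
    if "x' \<in> tcl R W x" "y' \<in> tcl R W y" for x' y'
  proof -
    have h: "x' - x \<in> rel_hull" "y' - y \<in> rel_hull" using that by (auto simp: mem_tcl)
    have "Poly_Mapping.keys y' \<subseteq> twords R W"
      using keys_hull[OF h(2)] y Poly_Mapping.keys_add[of "y' - y" y] by auto
    then have "tmult R W (x' - x) y' + tmult R W x (y' - y) \<in> rel_hull"
      by (intro add_hull_add hull_mult_left hull_mult_right h x)
    then show ?thesis by (simp add: tcl_eq_iff tmult_diff_left tmult_diff_right)
  qed
  then have "(\<Union>x'\<in>tcl R W x. \<Union>y'\<in>tcl R W y. tcl R W (tmult R W x' y')) = tcl R W (tmult R W x y)"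
    by (rule UN_const_tcl)
  then show ?thesis by (simp only: tensor_algebra_def monoid.simps)
qed

lemma tcl_smult:
  "c \<odot>\<^bsub>tensor_algebra R W\<^esub> tcl R W x = tcl R W (tmult R W (frag_of (Sc (c \<odot>\<^bsub>R\<^esub> \<one>\<^bsub>R\<^esub>))) x)"
proof -
  have "tcl R W (tmult R W (frag_of (Sc (c \<odot>\<^bsub>R\<^esub> \<one>\<^bsub>R\<^esub>))) x') =
      tcl R W (tmult R W (frag_of (Sc (c \<odot>\<^bsub>R\<^esub> \<one>\<^bsub>R\<^esub>))) x)" if "x' \<in> tcl R W x" for x'
    using that hull_mult_right[of "x' - x" "frag_of (Sc (c \<odot>\<^bsub>R\<^esub> \<one>\<^bsub>R\<^esub>))"] scalar_closed[of c]
    by (auto simp: mem_tcl tcl_eq_iff tmult_diff_right keys_frag_of twords_def)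
  then have "(\<Union>x'\<in>tcl R W x. tcl R W (tmult R W (frag_of (Sc (c \<odot>\<^bsub>R\<^esub> \<one>\<^bsub>R\<^esub>))) x')) =
      tcl R W (tmult R W (frag_of (Sc (c \<odot>\<^bsub>R\<^esub> \<one>\<^bsub>R\<^esub>))) x)"
    by (metis (no_types, lifting) SUP_eq_const add_hull.zero diff_self empty_iff mem_tcl)
  then show ?thesis by (simp only: tensor_algebra_def module.simps)
qed

lemma tcl_zero: "\<zero>\<^bsub>tensor_algebra R W\<^esub> = tcl R W 0"
  and tcl_one: "\<one>\<^bsub>tensor_algebra R W\<^esub> = tcl R W (frag_of (Sc \<one>\<^bsub>R\<^esub>))"
  and tcl_carrier: "Poly_Mapping.keys x \<subseteq> twords R W \<Longrightarrow> tcl R W x \<in> carrier (tensor_algebra R W)"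
  by (auto simp: tensor_algebra_def)

lemma tcl_Sc_add:
  "r \<in> carrier R \<Longrightarrow> s \<in> carrier R \<Longrightarrow>
    tcl R W (frag_of (Sc (r \<oplus>\<^bsub>R\<^esub> s))) = tcl R W (frag_of (Sc r) + frag_of (Sc s))"
  using add_hull.base[OF rel_Sc, of r s] by (simp add: tcl_eq_iff algebra_simps)

lemma tcl_Tw_add:
  "w \<in> bcarrier W \<Longrightarrow> w' \<in> bcarrier W \<Longrightarrow>
    tcl R W (frag_of (Tw [w + w'])) = tcl R W (frag_of (Tw [w]) + frag_of (Tw [w']))"
  using add_hull.base[OF rel_add, of "[]" w w' "[]"] by (simp add: tcl_eq_iff algebra_simps)

lemma scalar_eq: "c \<odot>\<^bsub>tensor_algebra R W\<^esub> \<one>\<^bsub>tensor_algebra R W\<^esub> = tcl R W (frag_of (Sc (c \<odot>\<^bsub>R\<^esub> \<one>\<^bsub>R\<^esub>)))"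
  by (simp add: tcl_one tcl_smult tmult_of r_one scalar_closed)

end

subsection \<open>Representations of tensor algebras\<close>

text \<open>The data of a right module over the tensor algebra, given on generators. Words act
  letter by letter from left to right, which is why \<open>\<alpha>\<close> and
  \<open>\<beta>\<close> reverse the order of products.\<close>

locale talg_rep = ring_bimodule R W
  for R :: "('k, 'r) module" and W :: "('r, 'w::ab_group_add) bimodule" +
  fixes C :: "'v::ab_group_add set" and \<alpha> :: "'r \<Rightarrow> 'v \<Rightarrow> 'v" and \<beta> :: "'w \<Rightarrow> 'v \<Rightarrow> 'v"
  assumes C_0: "0 \<in> C" and C_diff: "\<And>u v. u \<in> C \<Longrightarrow> v \<in> C \<Longrightarrow> u - v \<in> C"
    and \<alpha>_closed: "\<And>r v. r \<in> carrier R \<Longrightarrow> v \<in> C \<Longrightarrow> \<alpha> r v \<in> C"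
    and \<alpha>_diff: "\<And>r u v. r \<in> carrier R \<Longrightarrow> u \<in> C \<Longrightarrow> v \<in> C \<Longrightarrow> \<alpha> r (u - v) = \<alpha> r u - \<alpha> r v"
    and \<alpha>_add: "\<And>r s v. r \<in> carrier R \<Longrightarrow> s \<in> carrier R \<Longrightarrow> v \<in> C \<Longrightarrow> \<alpha> (r \<oplus>\<^bsub>R\<^esub> s) v = \<alpha> r v + \<alpha> s v"
    and \<alpha>_mult: "\<And>r s v. r \<in> carrier R \<Longrightarrow> s \<in> carrier R \<Longrightarrow> v \<in> C \<Longrightarrow> \<alpha> (r \<otimes>\<^bsub>R\<^esub> s) v = \<alpha> s (\<alpha> r v)"
    and \<beta>_closed: "\<And>w v. w \<in> bcarrier W \<Longrightarrow> v \<in> C \<Longrightarrow> \<beta> w v \<in> C"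
    and \<beta>_diff: "\<And>w u v. w \<in> bcarrier W \<Longrightarrow> u \<in> C \<Longrightarrow> v \<in> C \<Longrightarrow> \<beta> w (u - v) = \<beta> w u - \<beta> w v"
    and \<beta>_add: "\<And>w w' v. w \<in> bcarrier W \<Longrightarrow> w' \<in> bcarrier W \<Longrightarrow> v \<in> C \<Longrightarrow> \<beta> (w + w') v = \<beta> w v + \<beta> w' v"
    and \<beta>_lact: "\<And>r w v. r \<in> carrier R \<Longrightarrow> w \<in> bcarrier W \<Longrightarrow> v \<in> C \<Longrightarrow> \<beta> (lact W r w) v = \<beta> w (\<alpha> r v)"
    and \<beta>_ract: "\<And>r w v. r \<in> carrier R \<Longrightarrow> w \<in> bcarrier W \<Longrightarrow> v \<in> C \<Longrightarrow> \<beta> (ract W w r) v = \<alpha> r (\<beta> w v)"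
begin

fun wact :: "('r, 'w) tword \<Rightarrow> 'v \<Rightarrow> 'v" where
  "wact (Sc r) v = \<alpha> r v"
| "wact (Tw ws) v = foldl (\<lambda>u w. \<beta> w u) v ws"

definition act :: "(('r, 'w) tword \<Rightarrow>\<^sub>0 int) \<Rightarrow> 'v \<Rightarrow> 'v" where
  "act x v = fext (\<lambda>w. wact w v) x"

text \<open>The representative is arbitrary: relations act by zero (\<open>act_hull\<close>), so
  \<open>tact_tcl\<close> may replace it by any other.\<close>

definition tact :: "(('r, 'w) tword \<Rightarrow>\<^sub>0 int) set \<Rightarrow> 'v \<Rightarrow> 'v" where
  "tact X v = act (SOME x. x \<in> X) v"

lemma C_add: "u \<in> C \<Longrightarrow> v \<in> C \<Longrightarrow> u + v \<in> C"
  using C_diff[of u "0 - v"] C_diff[OF C_0] by auto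

lemma foldl_closed: "set ws \<subseteq> bcarrier W \<Longrightarrow> v \<in> C \<Longrightarrow> foldl (\<lambda>u w. \<beta> w u) v ws \<in> C"
  by (induction ws arbitrary: v) (auto simp: \<beta>_closed)

lemma foldl_diff:
  "set ws \<subseteq> bcarrier W \<Longrightarrow> u \<in> C \<Longrightarrow> v \<in> C \<Longrightarrow>
    foldl (\<lambda>u w. \<beta> w u) (u - v) ws = foldl (\<lambda>u w. \<beta> w u) u ws - foldl (\<lambda>u w. \<beta> w u) v ws"
  by (induction ws arbitrary: u v) (auto simp: \<beta>_closed \<beta>_diff)

lemma foldl_add:
  assumes "set ws \<subseteq> bcarrier W" "u \<in> C" "v \<in> C"
  shows "foldl (\<lambda>u w. \<beta> w u) (u + v) ws = foldl (\<lambda>u w. \<beta> w u) u ws + foldl (\<lambda>u w. \<beta> w u) v ws"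
  using foldl_diff[of ws "u + v" v] assms by (simp add: C_add)

lemma wact_closed: "w \<in> twords R W \<Longrightarrow> v \<in> C \<Longrightarrow> wact w v \<in> C"
  by (auto simp: twords_def \<alpha>_closed foldl_closed)

lemma wact_diff: "w \<in> twords R W \<Longrightarrow> u \<in> C \<Longrightarrow> v \<in> C \<Longrightarrow> wact w (u - v) = wact w u - wact w v"
  by (auto simp: twords_def \<alpha>_diff foldl_diff)

lemma wact_mult:
  assumes "a \<in> twords R W" "b \<in> twords R W" "v \<in> C"
  shows "wact (tword_mult R W a b) v = wact b (wact a v)"
proof (cases a; cases b)
  fix r ws assume *: "a = Sc r" "b = Tw ws"
  then show ?thesis using assms by (cases ws) (auto simp: twords_def \<beta>_lact)
next
  fix r ws assume *: "b = Sc r" "a = Tw ws"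
  then show ?thesis using assms by (cases ws rule: rev_cases) (auto simp: twords_def \<beta>_ract foldl_closed)
qed (use assms in \<open>auto simp: twords_def \<alpha>_mult\<close>)

lemma act_closed: "Poly_Mapping.keys x \<subseteq> twords R W \<Longrightarrow> v \<in> C \<Longrightarrow> act x v \<in> C"
  unfolding act_def by (rule fext_closed) (auto intro: wact_closed C_0 C_diff)

lemma act_diff_left: "act (x - y) v = act x v - act y v"
  and act_add_left: "act (x + y) v = act x v + act y v"
  and act_uminus_left: "act (- x) v = - act x v"
  and act_sum_left: "act (sum g I) v = (\<Sum>i\<in>I. act (g i) v)"
  and act_of: "act (frag_of w) v = wact w v"
  and act_0_left: "act 0 v = 0"
  by (simp_all add: act_def fext_diff fext_add fext_uminus fext_sum)

lemma act_diff:
  assumes "Poly_Mapping.keys x \<subseteq> twords R W" "u \<in> C" "v \<in> C"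
  shows "act x (u - v) = act x u - act x v"
  using assms(1)
  by (induction x rule: frag_induction) (auto simp: act_diff_left act_of act_0_left wact_diff assms(2,3))

lemma act_mult:
  assumes x: "Poly_Mapping.keys x \<subseteq> twords R W" and y: "Poly_Mapping.keys y \<subseteq> twords R W" and v: "v \<in> C"
  shows "act (tmult R W x y) v = act y (act x v)"
proof -
  from x have "Poly_Mapping.keys x \<subseteq> twords R W \<and> act (tmult R W x y) v = act y (act x v)"
  proof (induction x rule: frag_induction)
    case zero
    show ?case using act_diff[OF y v v] by (simp add: act_0_left)
  next
    case (one a)
    from y one have "act (tmult R W (frag_of a) y) v = act y (act (frag_of a) v)"
      by (induction y rule: frag_induction)
        (auto simp: tmult_of tmult_diff_right act_of act_diff_left act_0_left wact_mult v)
    then show ?case using one by (auto simp: keys_frag_of)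
  next
    case (diff a b)
    then show ?case using keys_diff[of a b]
      by (auto simp: tmult_diff_left act_diff_left act_diff[OF y] act_closed v)
  qed
  then show ?thesis by simp
qed

lemma act_rel:
  assumes "g \<in> talg_rels R W" "v \<in> C"
  shows "act g v = 0"
  using assms
proof (cases g rule: talg_rels_cases)
  case (Sc r s)
  then show ?thesis using assms(2) by (simp add: act_diff_left act_of \<alpha>_add)
next
  case (add us w w' vs)
  then show ?thesis using assms(2)
    by (simp add: act_diff_left act_of \<beta>_add foldl_add foldl_closed \<beta>_closed)
next
  case (bal us w r w' vs)
  then show ?thesis using assms(2)
    by (simp add: act_diff_left act_of \<beta>_lact \<beta>_ract foldl_closed \<beta>_closed)
qed

lemma act_hull: "h \<in> rel_hull \<Longrightarrow> v \<in> C \<Longrightarrow> act h v = 0"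
  by (induction h rule: add_hull.induct) (auto simp: act_0_left act_diff_left act_rel)

lemma tact_tcl: "v \<in> C \<Longrightarrow> tact (tcl R W x) v = act x v"
proof -
  assume v: "v \<in> C"
  have "x \<in> tcl R W x" by (simp add: mem_tcl add_hull.zero)
  then have "(SOME y. y \<in> tcl R W x) \<in> tcl R W x" by (rule someI)
  then show ?thesis using act_hull[OF _ v] by (fastforce simp: tact_def mem_tcl act_diff_left)
qed

end

section \<open>Homomorphisms and extensions of representations\<close>

lemma act_hom:
  assumes E: "talg_rep R W C \<alpha> \<beta>" and E': "talg_rep R W C' \<alpha>' \<beta>'"
    and h: "\<And>u. u \<in> C \<Longrightarrow> h u \<in> C'"
    and h\<alpha>: "\<And>r u. r \<in> carrier R \<Longrightarrow> u \<in> C \<Longrightarrow> h (\<alpha> r u) = \<alpha>' r (h u)"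
    and h\<beta>: "\<And>w u. w \<in> bcarrier W \<Longrightarrow> u \<in> C \<Longrightarrow> h (\<beta> w u) = \<beta>' w (h u)"
    and hd: "\<And>u v. u \<in> C \<Longrightarrow> v \<in> C \<Longrightarrow> h (u - v) = h u - h v"
    and x: "Poly_Mapping.keys x \<subseteq> twords R W" and v: "v \<in> C"
  shows "h (talg_rep.act \<alpha> \<beta> x v) = talg_rep.act \<alpha>' \<beta>' x (h v)"
proof -
  interpret E: talg_rep R W C \<alpha> \<beta> by fact
  interpret E': talg_rep R W C' \<alpha>' \<beta>' by fact
  have fold: "h (foldl (\<lambda>u w. \<beta> w u) u ws) = foldl (\<lambda>u w. \<beta>' w u) (h u) ws"
    if "set ws \<subseteq> bcarrier W" "u \<in> C" for ws u
    using that by (induction ws arbitrary: u) (auto simp: h\<beta> E.\<beta>_closed)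
  have h0: "h 0 = 0" using hd[OF E.C_0 E.C_0] by simp
  from x have "Poly_Mapping.keys x \<subseteq> twords R W \<and> h (E.act x v) = E'.act x (h v)"
  proof (induction x rule: frag_induction)
    case (one a)
    then show ?case using v fold h\<alpha> by (auto simp: E.act_of E'.act_of twords_def keys_frag_of)
  next
    case (diff a b)
    then show ?case using keys_diff[of a b]
      by (auto simp: E.act_diff_left E'.act_diff_left hd E.act_closed v)
  qed (simp add: h0 E.act_0_left E'.act_0_left)
  then show ?thesis by simp
qed

text \<open>A letter acts on the direct sum by a triangular matrix with off-diagonal entry
  \<open>\<eta> w\<close>: the second summand is a submodule and the first one is the
  quotient.\<close>

definition ext_act ::
    "('w \<Rightarrow> 'v \<Rightarrow> 'v) \<Rightarrow> ('w \<Rightarrow> 'q \<Rightarrow> 'q::ab_group_add) \<Rightarrow> ('w \<Rightarrow> 'v \<Rightarrow> 'q) \<Rightarrow> 'w \<Rightarrow> 'v \<times> 'q \<Rightarrow> 'v \<times> 'q" where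
  "ext_act \<beta> \<beta>' \<eta> w = (\<lambda>(v, q). (\<beta> w v, \<beta>' w q + \<eta> w v))"

definition sum_act :: "('r \<Rightarrow> 'v \<Rightarrow> 'v) \<Rightarrow> ('r \<Rightarrow> 'q \<Rightarrow> 'q) \<Rightarrow> 'r \<Rightarrow> 'v \<times> 'q \<Rightarrow> 'v \<times> 'q" where
  "sum_act \<alpha> \<alpha>' r = (\<lambda>(v, q). (\<alpha> r v, \<alpha>' r q))"

text \<open>Words are free apart from additivity and balancing over \<open>R\<close>. Hence any
  family \<open>\<eta>\<close> that is additive in both arguments and respects the two actions of
  \<open>R\<close> may serve as off-diagonal entry; products of letters impose nothing
  further.\<close>

lemma ext_talg_rep:
  fixes C :: "'v::ab_group_add set" and C' :: "'q::ab_group_add set"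
  assumes E: "talg_rep R W C \<alpha> \<beta>" and E': "talg_rep R W C' \<alpha>' \<beta>'"
    and cl: "\<And>w v. w \<in> bcarrier W \<Longrightarrow> v \<in> C \<Longrightarrow> \<eta> w v \<in> C'"
    and df: "\<And>w u v. w \<in> bcarrier W \<Longrightarrow> u \<in> C \<Longrightarrow> v \<in> C \<Longrightarrow> \<eta> w (u - v) = \<eta> w u - \<eta> w v"
    and ad: "\<And>w w' v. w \<in> bcarrier W \<Longrightarrow> w' \<in> bcarrier W \<Longrightarrow> v \<in> C \<Longrightarrow> \<eta> (w + w') v = \<eta> w v + \<eta> w' v"
    and la: "\<And>r w v. r \<in> carrier R \<Longrightarrow> w \<in> bcarrier W \<Longrightarrow> v \<in> C \<Longrightarrow> \<eta> (lact W r w) v = \<eta> w (\<alpha> r v)"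
    and ra: "\<And>r w v. r \<in> carrier R \<Longrightarrow> w \<in> bcarrier W \<Longrightarrow> v \<in> C \<Longrightarrow> \<eta> (ract W w r) v = \<alpha>' r (\<eta> w v)"
  shows "talg_rep R W (C \<times> C') (sum_act \<alpha> \<alpha>') (ext_act \<beta> \<beta>' \<eta>)"
proof -
  interpret E: talg_rep R W C \<alpha> \<beta> by fact
  interpret E': talg_rep R W C' \<alpha>' \<beta>' by fact
  have \<alpha>'_plus: "\<alpha>' r (u + v) = \<alpha>' r u + \<alpha>' r v" if "r \<in> carrier R" "u \<in> C'" "v \<in> C'" for r u v
    using E'.\<alpha>_diff[of r "u + v" v] that by (simp add: E'.C_add)
  show ?thesis
  proof unfold_locales
    fix w and u v :: "'v \<times> 'q" assume "w \<in> bcarrier W" "u \<in> C \<times> C'" "v \<in> C \<times> C'"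
    then show "ext_act \<beta> \<beta>' \<eta> w (u - v) = ext_act \<beta> \<beta>' \<eta> w u - ext_act \<beta> \<beta>' \<eta> w v"
      by (auto simp: ext_act_def E.\<beta>_diff E'.\<beta>_diff df)
  next
    fix r and u v :: "'v \<times> 'q" assume "r \<in> carrier R" "u \<in> C \<times> C'" "v \<in> C \<times> C'"
    then show "sum_act \<alpha> \<alpha>' r (u - v) = sum_act \<alpha> \<alpha>' r u - sum_act \<alpha> \<alpha>' r v"
      by (auto simp: sum_act_def E.\<alpha>_diff E'.\<alpha>_diff)
  qed (auto simp: ext_act_def sum_act_def E.C_0 E'.C_0 zero_prod_def E.C_diff E'.C_diff
      E.\<alpha>_closed E'.\<alpha>_closed E.\<alpha>_add E'.\<alpha>_add E.\<alpha>_mult E'.\<alpha>_mult E.\<beta>_closed E'.\<beta>_closed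
      E.\<beta>_add E'.\<beta>_add E.\<beta>_lact E'.\<beta>_lact E.\<beta>_ract E'.\<beta>_ract cl ad la ra \<alpha>'_plus
      intro!: E'.C_add E.C_add)
qed

section \<open>The incidence algebra and its dual bimodule\<close>

lemma sum_apply: "(\<Sum>i\<in>I. f i) x = (\<Sum>i\<in>I. f i x)"
  by (induction I rule: infinite_finite_induct) auto

lemma mmul_assoc:
  "finite I \<Longrightarrow> mmul I X (mmul I Y Z) = mmul I (mmul I X Y) Z"
  by (intro ext) (simp add: mmul_def sum_distrib_left sum_distrib_right mult.assoc, rule sum.swap)

lemma mmul_add_left: "mmul I (X + Y) Z = mmul I X Z + mmul I Y Z"
  and mmul_add_right: "mmul I X (Y + Z) = mmul I X Y + mmul I X Z"
  and mmul_diff_left: "mmul I (X - Y) Z = mmul I X Z - mmul I Y Z"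
  and mmul_0_left [simp]: "mmul I 0 Z = 0"
  and mmul_0_right [simp]: "mmul I X 0 = 0"
  by (auto simp: mmul_def fun_eq_iff distrib_left distrib_right left_diff_distrib
      sum.distrib sum_subtractf)

lemma mmul_sum_left: "mmul I (\<Sum>a\<in>A. f a) Z = (\<Sum>a\<in>A. mmul I (f a) Z)"
  by (induction A rule: infinite_finite_induct) (auto simp: mmul_add_left simp del: plus_fun_apply zero_fun_apply)

lemma mmul_sum_right: "mmul I Z (\<Sum>a\<in>A. f a) = (\<Sum>a\<in>A. mmul I Z (f a))"
  by (induction A rule: infinite_finite_induct) (auto simp: mmul_add_right simp del: plus_fun_apply zero_fun_apply)

lemma munit_apply: "munit i j a k l = (if k = i \<and> l = j then a else 0)"
  by (simp add: munit_def)

lemma munit_0 [simp]: "munit i j 0 = 0"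
  and munit_add: "munit i j (a + b) = munit i j a + munit i j b"
  and munit_diff: "munit i j (a - b) = munit i j a - munit i j b"
  by (auto simp: munit_def fun_eq_iff)

lemma munit_sum: "munit i j (\<Sum>a\<in>A. f a) = (\<Sum>a\<in>A. munit i j (f a))"
  by (induction A rule: infinite_finite_induct) (auto simp: munit_add)

lemma mmul_munit_left:
  assumes "finite I" "y \<in> I"
  shows "mmul I (munit x y a) Y i j = (if i = x then a * Y y j else 0)"
proof -
  have "mmul I (munit x y a) Y i j = (\<Sum>l\<in>I. if l = y then (if i = x then a * Y y j else 0) else 0)"
    unfolding mmul_def by (intro sum.cong) (auto simp: munit_def)
  then show ?thesis using assms by simp
qed

lemma mmul_munit_munit:
  "finite I \<Longrightarrow> y \<in> I \<Longrightarrow> mmul I (munit x y a) (munit y z b) = munit x z (a * b)"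
  by (intro ext) (auto simp: mmul_munit_left, simp_all add: munit_def)

lemma Bot_in_uPm [simp]: "Bot \<in> uPm D"
  by (simp add: uPm_def)

lemma Pm_iff: "x \<in> Pm D \<longleftrightarrow> x \<in> uPm D \<and> x \<noteq> Bot"
  by (auto simp: uPm_def Pm_def)

lemma Bot_less: "Bot < x \<longleftrightarrow> x \<noteq> Bot"
  by (auto simp: less_xp_def less_eq_xp_def)

lemma not_less_Bot [simp]: "\<not> x < Bot" "x \<le> Bot \<longleftrightarrow> x = Bot"
  by (auto simp: less_xp_def less_eq_xp_def)

text \<open>What extendability and the fields provide for calculations with the spaces
  \<open>RR D x y\<close>, stated uniformly so that \<open>Bot\<close> is a point like any
  other.\<close>

locale ext_poset =
  fixes D :: "('k::field, 'a::ring_1, 'p::order) eposet"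
  assumes finite_pts: "finite (pts D)"
    and RR_0: "\<And>x y. x \<in> uPm D \<Longrightarrow> y \<in> uPm D \<Longrightarrow> x \<le> y \<Longrightarrow> 0 \<in> RR D x y"
    and RR_diff: "\<And>x y r s. x \<in> uPm D \<Longrightarrow> y \<in> uPm D \<Longrightarrow> x \<le> y \<Longrightarrow> r \<in> RR D x y \<Longrightarrow> s \<in> RR D x y \<Longrightarrow>
      r - s \<in> RR D x y"
    and RR_mult: "\<And>x y z r s. x \<in> uPm D \<Longrightarrow> y \<in> uPm D \<Longrightarrow> z \<in> uPm D \<Longrightarrow> x \<le> y \<Longrightarrow> y \<le> z \<Longrightarrow>
      r \<in> RR D x y \<Longrightarrow> s \<in> RR D y z \<Longrightarrow> r * s \<in> RR D x z"
    and eps_in: "\<And>x. x \<in> uPm D \<Longrightarrow> eps D x \<in> RR D x x"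
    and eps_l: "\<And>x y r. r \<in> RR D x y \<Longrightarrow> x \<in> uPm D \<Longrightarrow> y \<in> uPm D \<Longrightarrow> x \<le> y \<Longrightarrow> eps D x * r = r"
    and eps_r: "\<And>x y r. r \<in> RR D x y \<Longrightarrow> x \<in> uPm D \<Longrightarrow> y \<in> uPm D \<Longrightarrow> x \<le> y \<Longrightarrow> r * eps D y = r"
    and eps_nz: "\<And>x. x \<in> uPm D \<Longrightarrow> eps D x \<noteq> 0"
    and scal_eps: "\<And>c x. x \<in> uPm D \<Longrightarrow> scal D c (eps D x) \<in> RR D x x"
    and scal_0: "\<And>c. scal D c 0 = 0"
    and scal_1: "\<And>a. scal D 1 a = a"
    and scal_minus: "\<And>a. scal D (- 1) a = - a"
    and scal_l: "\<And>c a b. scal D c a * b = scal D c (a * b)"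
    and scal_r: "\<And>c a b. a * scal D c b = scal D c (a * b)"
begin

lemma finite_uPm [simp]: "finite (uPm D)"
  by (simp add: uPm_def Pm_def finite_pts)

lemma finite_Pm [simp]: "finite (Pm D)"
  by (simp add: Pm_def finite_pts)

lemma RR_uminus: "x \<in> uPm D \<Longrightarrow> y \<in> uPm D \<Longrightarrow> x \<le> y \<Longrightarrow> r \<in> RR D x y \<Longrightarrow> - r \<in> RR D x y"
  using RR_diff[of x y 0 r] RR_0 by auto

lemma RR_add:
  "x \<in> uPm D \<Longrightarrow> y \<in> uPm D \<Longrightarrow> x \<le> y \<Longrightarrow> r \<in> RR D x y \<Longrightarrow> s \<in> RR D x y \<Longrightarrow> r + s \<in> RR D x y"
  using RR_diff[of x y r "- s"] RR_uminus by auto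

lemma RR_sum:
  "x \<in> uPm D \<Longrightarrow> y \<in> uPm D \<Longrightarrow> x \<le> y \<Longrightarrow> (\<And>a. a \<in> A \<Longrightarrow> f a \<in> RR D x y) \<Longrightarrow> (\<Sum>a\<in>A. f a) \<in> RR D x y"
  by (induction A rule: infinite_finite_induct) (auto simp: RR_0 RR_add)

lemma JJ_iff:
  "u \<in> JJ D \<longleftrightarrow> (\<forall>i j. if i \<in> uPm D \<and> j \<in> uPm D \<and> i < j then u i j \<in> RR D i j else u i j = 0)"
proof
  assume u: "u \<in> JJ D"
  have "if i \<in> uPm D \<and> j \<in> uPm D \<and> i < j then u i j \<in> RR D i j else u i j = 0" for i j
  proof (cases "i = j")
    case True
    then show ?thesis using u by (auto simp: JJ_def)
  next
    case False
    have "if i \<in> uPm D \<and> j \<in> uPm D \<and> i \<le> j then u i j \<in> RR D i j else u i j = 0"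
      using u unfolding JJ_def Lam_def inc_carrier_def by blast
    then show ?thesis using False by (auto simp: less_le split: if_splits)
  qed
  then show "\<forall>i j. if i \<in> uPm D \<and> j \<in> uPm D \<and> i < j then u i j \<in> RR D i j else u i j = 0" by blast
next
  assume u: "\<forall>i j. if i \<in> uPm D \<and> j \<in> uPm D \<and> i < j then u i j \<in> RR D i j else u i j = 0"
  have 0: "u i i = 0" for i using u by (metis less_irrefl)
  have "if i \<in> uPm D \<and> j \<in> uPm D \<and> i \<le> j then u i j \<in> RR D i j else u i j = 0" for i j
    using u[rule_format, of i j] 0[of i] RR_0[of i j] by (cases "i = j") (auto simp: less_le split: if_splits)
  then show "u \<in> JJ D" using 0 unfolding JJ_def Lam_def inc_carrier_def by blast
qed

lemma JJ_in: "u \<in> JJ D \<Longrightarrow> i \<in> uPm D \<Longrightarrow> j \<in> uPm D \<Longrightarrow> i < j \<Longrightarrow> u i j \<in> RR D i j"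
  and JJ_zero: "u \<in> JJ D \<Longrightarrow> \<not> (i \<in> uPm D \<and> j \<in> uPm D \<and> i < j) \<Longrightarrow> u i j = 0"
  by (metis JJ_iff)+

lemma JJ_I:
  "(\<And>i j. i \<in> uPm D \<Longrightarrow> j \<in> uPm D \<Longrightarrow> i < j \<Longrightarrow> u i j \<in> RR D i j) \<Longrightarrow>
   (\<And>i j. \<not> (i \<in> uPm D \<and> j \<in> uPm D \<and> i < j) \<Longrightarrow> u i j = 0) \<Longrightarrow> u \<in> JJ D"
  by (auto simp: JJ_iff)

lemma SS_iff: "s \<in> SS D \<longleftrightarrow> (\<forall>i j. if i = j \<and> i \<in> uPm D then s i i \<in> RR D i i else s i j = 0)"
proof
  assume "s \<in> SS D"
  then show "\<forall>i j. if i = j \<and> i \<in> uPm D then s i i \<in> RR D i i else s i j = 0"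
    unfolding SS_def Lam_def inc_carrier_def by (auto split: if_splits)
next
  assume s: "\<forall>i j. if i = j \<and> i \<in> uPm D then s i i \<in> RR D i i else s i j = 0"
  have "if i \<in> uPm D \<and> j \<in> uPm D \<and> i \<le> j then s i j \<in> RR D i j else s i j = 0" for i j
    using s[rule_format, of i j] RR_0[of i j] by (cases "i = j") auto
  then show "s \<in> SS D" using s unfolding SS_def Lam_def inc_carrier_def by auto
qed

lemma SS_in: "s \<in> SS D \<Longrightarrow> i \<in> uPm D \<Longrightarrow> s i i \<in> RR D i i"
  and SS_zero: "s \<in> SS D \<Longrightarrow> i \<noteq> j \<or> i \<notin> uPm D \<Longrightarrow> s i j = 0"
  by (metis SS_iff)+

lemma SS_I:
  "(\<And>i. i \<in> uPm D \<Longrightarrow> s i i \<in> RR D i i) \<Longrightarrow> (\<And>i j. i \<noteq> j \<or> i \<notin> uPm D \<Longrightarrow> s i j = 0) \<Longrightarrow> s \<in> SS D"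
  by (auto simp: SS_iff)

lemma SS_eqI: "s \<in> SS D \<Longrightarrow> t \<in> SS D \<Longrightarrow> (\<And>i. i \<in> uPm D \<Longrightarrow> s i i = t i i) \<Longrightarrow> s = t"
  by (intro ext) (metis SS_zero)

lemma JJ_eqI:
  "u \<in> JJ D \<Longrightarrow> v \<in> JJ D \<Longrightarrow> (\<And>i j. i \<in> uPm D \<Longrightarrow> j \<in> uPm D \<Longrightarrow> i < j \<Longrightarrow> u i j = v i j) \<Longrightarrow> u = v"
  by (intro ext) (metis JJ_zero)

lemma mm_SS_left: 
  assumes "s \<in> SS D"
  shows "mm D s X i j = s i i * X i j"
proof -
  have "mm D s X i j = (\<Sum>l\<in>uPm D. if l = i then s i i * X i j else 0)"
    unfolding mmul_def by (intro sum.cong) (auto simp: SS_zero[OF assms])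
  then show ?thesis by (auto simp: SS_zero[OF assms])
qed

lemma mm_SS_right: 
  assumes "s \<in> SS D"
  shows "mm D X s i j = X i j * s j j"
proof -
  have "mm D X s i j = (\<Sum>l\<in>uPm D. if l = j then X i j * s j j else 0)"
    unfolding mmul_def by (intro sum.cong) (auto simp: SS_zero[OF assms])
  then show ?thesis by (auto simp: SS_zero[OF assms])
qed

lemma JJ_0: "0 \<in> JJ D" and SS_0: "0 \<in> SS D"
  by (auto simp: JJ_iff SS_iff RR_0)

lemma JJ_diff: "u \<in> JJ D \<Longrightarrow> v \<in> JJ D \<Longrightarrow> u - v \<in> JJ D"
  by (rule JJ_I) (auto simp: JJ_in RR_diff JJ_zero)

lemma JJ_add: "u \<in> JJ D \<Longrightarrow> v \<in> JJ D \<Longrightarrow> u + v \<in> JJ D"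
  by (rule JJ_I) (auto simp: JJ_in RR_add JJ_zero)

lemma JJ_sum: "(\<And>a. a \<in> A \<Longrightarrow> f a \<in> JJ D) \<Longrightarrow> (\<Sum>a\<in>A. f a) \<in> JJ D"
  by (induction A rule: infinite_finite_induct) (auto simp: JJ_0 JJ_add)

lemma SS_add: "u \<in> SS D \<Longrightarrow> v \<in> SS D \<Longrightarrow> u + v \<in> SS D"
  by (rule SS_I) (auto simp: SS_in RR_add SS_zero)

lemma SS_mm: "s \<in> SS D \<Longrightarrow> t \<in> SS D \<Longrightarrow> mm D s t \<in> SS D"
  by (rule SS_I) (auto simp: SS_in RR_mult SS_zero mm_SS_left)

lemma JJ_mm_SS: "s \<in> SS D \<Longrightarrow> u \<in> JJ D \<Longrightarrow> mm D s u \<in> JJ D"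
  by (rule JJ_I) (auto simp: JJ_zero mm_SS_left intro: RR_mult[OF _ _ _ _ _ SS_in JJ_in])

lemma JJ_SS_mm: "s \<in> SS D \<Longrightarrow> u \<in> JJ D \<Longrightarrow> mm D u s \<in> JJ D"
  by (rule JJ_I) (auto simp: JJ_zero mm_SS_right intro: RR_mult[OF _ _ _ _ _ JJ_in SS_in])

lemma JJ_mm:
  assumes "u \<in> JJ D" "v \<in> JJ D"
  shows "mm D u v \<in> JJ D"
proof (rule JJ_I)
  show "mm D u v i j \<in> RR D i j" if ij: "i \<in> uPm D" "j \<in> uPm D" "i < j" for i j
  proof -
    have "u i l * v l j \<in> RR D i j" if l: "l \<in> uPm D" for l
    proof (cases "i < l \<and> l < j")
      case True
      then show ?thesis using ij l assms by (intro RR_mult[of i l j] JJ_in) auto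
    next
      case False
      then show ?thesis using ij l assms by (auto simp: JJ_zero RR_0)
    qed
    then show ?thesis unfolding mmul_def using ij by (intro RR_sum) auto
  qed
  show "mm D u v i j = 0" if "\<not> (i \<in> uPm D \<and> j \<in> uPm D \<and> i < j)" for i j
  proof -
    have "u i l * v l j = 0" for l
      using that JJ_zero[OF assms(1), of i l] JJ_zero[OF assms(2), of l j]
      by (metis less_trans mult_zero_left mult_zero_right)
    then show ?thesis by (simp add: mmul_def)
  qed
qed

lemma munit_JJ: "x \<in> uPm D \<Longrightarrow> y \<in> uPm D \<Longrightarrow> x < y \<Longrightarrow> a \<in> RR D x y \<Longrightarrow> munit x y a \<in> JJ D"
  by (rule JJ_I) (auto simp: munit_def RR_0)

lemma munit_SS: "x \<in> uPm D \<Longrightarrow> a \<in> RR D x x \<Longrightarrow> munit x x a \<in> SS D"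
  by (rule SS_I) (auto simp: munit_def RR_0)

lemma ee_SS: "x \<in> uPm D \<Longrightarrow> ee D x \<in> SS D"
  by (simp add: ee_def munit_SS eps_in)

lemma ehat_apply: "ehat D i j = (if i = j \<and> i \<in> Pm D then eps D i else 0)"
  by (auto simp: ehat_def mone_def ee_def munit_def Pm_iff)

lemma ehat_SS: "ehat D \<in> SS D"
  by (rule SS_I) (auto simp: ehat_apply Pm_iff eps_in RR_0)

lemma ee_apply: "ee D x i j = (if i = x \<and> j = x then eps D x else 0)"
  by (simp add: ee_def munit_def)

text \<open>No point lies below \<open>0\<close>, so the column of \<open>u\<close> at
  \<open>0\<close> vanishes. In the dual, \<open>ehat\<close> therefore acts as the identity from
  the left, and membership in \<open>W\<^sub>0\<close> or \<open>W\<^sub>1\<close> becomes a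
  condition on the right action alone (\<open>peirceD_ehat\<close>).\<close>

lemma JJ_ehat: "u \<in> JJ D \<Longrightarrow> mm D u (ehat D) = u"
  by (rule JJ_eqI) (auto simp: JJ_SS_mm ehat_SS mm_SS_right ehat_apply Pm_iff intro: eps_r[OF JJ_in])

subsection \<open>The dual bimodule\<close>

lemma dualJ_SS: "\<gamma> \<in> dualJ D \<Longrightarrow> u \<in> JJ D \<Longrightarrow> \<gamma> u \<in> SS D"
  and dualJ_out: "\<gamma> \<in> dualJ D \<Longrightarrow> u \<notin> JJ D \<Longrightarrow> \<gamma> u = 0"
  and dualJ_add: "\<gamma> \<in> dualJ D \<Longrightarrow> u \<in> JJ D \<Longrightarrow> v \<in> JJ D \<Longrightarrow> \<gamma> (u + v) = \<gamma> u + \<gamma> v"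
  and dualJ_lin: "\<gamma> \<in> dualJ D \<Longrightarrow> s \<in> SS D \<Longrightarrow> u \<in> JJ D \<Longrightarrow> \<gamma> (mm D s u) = mm D s (\<gamma> u)"
  by (auto simp: dualJ_def)

lemma dualJ_0: "\<gamma> \<in> dualJ D \<Longrightarrow> \<gamma> 0 = 0"
  using dualJ_add[of \<gamma> 0 0] by (simp add: JJ_0)

lemma dualJ_diff: "\<gamma> \<in> dualJ D \<Longrightarrow> u \<in> JJ D \<Longrightarrow> v \<in> JJ D \<Longrightarrow> \<gamma> (u - v) = \<gamma> u - \<gamma> v"
  using dualJ_add[of \<gamma> "u - v" v] by (simp add: JJ_diff)

lemma dualJ_sum: "\<gamma> \<in> dualJ D \<Longrightarrow> (\<And>a. a \<in> A \<Longrightarrow> f a \<in> JJ D) \<Longrightarrow> \<gamma> (\<Sum>a\<in>A. f a) = (\<Sum>a\<in>A. \<gamma> (f a))"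
  by (induction A rule: infinite_finite_induct) (auto simp: dualJ_0 dualJ_add JJ_sum simp del: plus_fun_apply zero_fun_apply)

lemma dualJ_I:
  assumes "\<And>u. u \<in> JJ D \<Longrightarrow> \<gamma> u \<in> SS D" "\<And>u. u \<notin> JJ D \<Longrightarrow> \<gamma> u = 0"
    "\<And>u v. u \<in> JJ D \<Longrightarrow> v \<in> JJ D \<Longrightarrow> \<gamma> (u + v) = \<gamma> u + \<gamma> v"
    "\<And>s u. s \<in> SS D \<Longrightarrow> u \<in> JJ D \<Longrightarrow> \<gamma> (mm D s u) = mm D s (\<gamma> u)"
  shows "\<gamma> \<in> dualJ D"
  using assms by (auto simp: dualJ_def)

lemma zero_dualJ: "0 \<in> dualJ D"
  by (rule dualJ_I) (auto simp: SS_0)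

lemma add_dualJ: "\<gamma> \<in> dualJ D \<Longrightarrow> \<delta> \<in> dualJ D \<Longrightarrow> \<gamma> + \<delta> \<in> dualJ D"
  by (rule dualJ_I) (auto simp: fun_eq_iff SS_add dualJ_SS dualJ_out dualJ_add dualJ_lin mmul_add_right)

text \<open>Right multiplication by an element of \<open>J\<close> also preserves \<open>J\<close>
  and is left \<open>S\<close>-linear. The case \<open>s \<in> JJ D\<close> is included because sums
  arising from the differential evaluate to \<open>dual_l D p \<gamma>\<close> with a basis element
  \<open>p\<close> of \<open>J\<close>.\<close>

lemma dual_l_dualJ:
  assumes "s \<in> SS D \<or> s \<in> JJ D" "\<gamma> \<in> dualJ D"
  shows "dual_l D s \<gamma> \<in> dualJ D"
proof -
  have "mm D u s \<in> JJ D" if "u \<in> JJ D" for u using assms that by (auto simp: JJ_SS_mm JJ_mm)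
  note JJ_s = this
  show ?thesis
  proof (rule dualJ_I)
    show "dual_l D s \<gamma> u \<in> SS D" if "u \<in> JJ D" for u
      using that by (simp add: dual_l_def dualJ_SS[OF assms(2) JJ_s])
    show "dual_l D s \<gamma> (u + v) = dual_l D s \<gamma> u + dual_l D s \<gamma> v" if "u \<in> JJ D" "v \<in> JJ D" for u v
      using that by (simp add: dual_l_def JJ_add mmul_add_left dualJ_add[OF assms(2) JJ_s JJ_s])
    show "dual_l D s \<gamma> (mm D t u) = mm D t (dual_l D s \<gamma> u)" if t: "t \<in> SS D" and u: "u \<in> JJ D" for t u
    proof -
      have "\<gamma> (mm D (mm D t u) s) = mm D t (\<gamma> (mm D u s))"
        using dualJ_lin[OF assms(2) t JJ_s[OF u]] by (simp add: mmul_assoc)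
      then show ?thesis using t u by (simp add: dual_l_def JJ_mm_SS)
    qed
  qed (simp add: dual_l_def)
qed

lemma dual_r_dualJ: "s \<in> SS D \<Longrightarrow> \<gamma> \<in> dualJ D \<Longrightarrow> dual_r D \<gamma> s \<in> dualJ D"
  by (rule dualJ_I)
    (simp_all add: dual_r_def dualJ_SS dualJ_out SS_mm dualJ_add mmul_add_left dualJ_lin mmul_assoc
      del: plus_fun_apply zero_fun_apply)

lemma dual_l_l: "s \<in> SS D \<Longrightarrow> dual_l D s (dual_l D t \<gamma>) = dual_l D (mm D s t) \<gamma>"
  by (auto simp: dual_l_def fun_eq_iff JJ_SS_mm mmul_assoc)

lemma dual_r_r: "dual_r D (dual_r D \<gamma> s) t = dual_r D \<gamma> (mm D s t)"
  by (auto simp: dual_r_def fun_eq_iff mmul_assoc)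

lemma dual_l_r: "dual_l D s (dual_r D \<gamma> t) = dual_r D (dual_l D s \<gamma>) t"
  by (auto simp: dual_r_def dual_l_def fun_eq_iff)

lemma dual_l_add: "dual_l D s (\<gamma> + \<delta>) = dual_l D s \<gamma> + dual_l D s \<delta>"
  by (auto simp: dual_l_def fun_eq_iff)

lemma dual_r_add: "dual_r D (\<gamma> + \<delta>) s = dual_r D \<gamma> s + dual_r D \<delta> s"
  by (auto simp: dual_r_def fun_eq_iff mmul_add_left)

lemma dual_l_add_left:
  "\<gamma> \<in> dualJ D \<Longrightarrow> s \<in> SS D \<Longrightarrow> t \<in> SS D \<Longrightarrow> dual_l D (s + t) \<gamma> = dual_l D s \<gamma> + dual_l D t \<gamma>"
  by (auto simp: dual_l_def fun_eq_iff mmul_add_right dualJ_add JJ_SS_mm)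

lemma dual_r_add_right: "dual_r D \<gamma> (s + t) = dual_r D \<gamma> s + dual_r D \<gamma> t"
  by (auto simp: dual_r_def fun_eq_iff mmul_add_right)

lemma dual_l_0 [simp]: "dual_l D s 0 = 0" and dual_r_0 [simp]: "dual_r D 0 s = 0"
  by (auto simp: dual_l_def dual_r_def fun_eq_iff)

lemma peirceD_iff:
  assumes e: "e \<in> SS D" "mm D e e = e" and f: "f \<in> SS D" "mm D f f = f"
  shows "\<gamma> \<in> peirceD D e f \<longleftrightarrow> \<gamma> \<in> dualJ D \<and> dual_l D e \<gamma> = \<gamma> \<and> dual_r D \<gamma> f = \<gamma>"
proof
  assume "\<gamma> \<in> peirceD D e f"
  then obtain \<gamma>' where "\<gamma>' \<in> dualJ D" "\<gamma> = dual_l D e (dual_r D \<gamma>' f)" by (auto simp: peirceD_def)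
  then show "\<gamma> \<in> dualJ D \<and> dual_l D e \<gamma> = \<gamma> \<and> dual_r D \<gamma> f = \<gamma>"
    using e f by (simp add: dual_l_dualJ dual_r_dualJ dual_l_l dual_l_r dual_r_r)
next
  assume "\<gamma> \<in> dualJ D \<and> dual_l D e \<gamma> = \<gamma> \<and> dual_r D \<gamma> f = \<gamma>"
  then show "\<gamma> \<in> peirceD D e f" unfolding peirceD_def by (intro CollectI exI[of _ \<gamma>]) simp
qed

text \<open>Covers \<open>ehat\<close> and the \<open>ee D x\<close> at once, so that one set of
  lemmas serves both \<open>W\<^sub>0\<close> and \<open>W\<^sub>1\<close>.\<close>

definition diag_idem :: "('a, 'p) imat \<Rightarrow> bool" where
  "diag_idem e \<longleftrightarrow> e \<in> SS D \<and> (\<forall>i\<in>uPm D. e i i = eps D i \<or> e i i = 0)"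

lemma diag_idem_SS: "diag_idem e \<Longrightarrow> e \<in> SS D"
  by (simp add: diag_idem_def)

lemma diag_idem_mm: "diag_idem e \<Longrightarrow> mm D e e = e"
proof (rule SS_eqI)
  show "diag_idem e \<Longrightarrow> i \<in> uPm D \<Longrightarrow> mm D e e i i = e i i" for i
    using eps_l[OF eps_in, of i] by (auto simp: diag_idem_def mm_SS_left)
qed (simp_all add: diag_idem_def SS_mm)

lemma diag_idem_ehat: "diag_idem (ehat D)"
  by (auto simp: diag_idem_def ehat_SS ehat_apply)

lemma diag_idem_ee: "x \<in> uPm D \<Longrightarrow> diag_idem (ee D x)"
  by (auto simp: diag_idem_def ee_SS ee_apply)

lemma peirceD_diag:
  "diag_idem e \<Longrightarrow> diag_idem f \<Longrightarrow>
    \<gamma> \<in> peirceD D e f \<longleftrightarrow> \<gamma> \<in> dualJ D \<and> dual_l D e \<gamma> = \<gamma> \<and> dual_r D \<gamma> f = \<gamma>"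
  by (intro peirceD_iff diag_idem_SS diag_idem_mm)

lemma peirceD_ehat:
  "diag_idem f \<Longrightarrow> \<gamma> \<in> peirceD D (ehat D) f \<longleftrightarrow> \<gamma> \<in> dualJ D \<and> dual_r D \<gamma> f = \<gamma>"
proof -
  have "dual_l D (ehat D) \<gamma> = \<gamma>" if "\<gamma> \<in> dualJ D"
    by (rule ext) (simp add: dual_l_def JJ_ehat dualJ_out[OF that])
  then show "diag_idem f \<Longrightarrow> ?thesis" by (auto simp: peirceD_diag diag_idem_ehat)
qed

lemma peirceD_entry:
  assumes "diag_idem f" "\<gamma> \<in> peirceD D (ehat D) f" "f z z = 0"
  shows "\<gamma> u z z = 0"
proof -
  have "dual_r D \<gamma> f = \<gamma>" using assms by (simp add: peirceD_ehat)
  then have "\<gamma> u = mm D (\<gamma> u) f" unfolding dual_r_def by metis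
  then have "\<gamma> u z z = \<gamma> u z z * f z z"
    using mm_SS_right[OF diag_idem_SS[OF assms(1)], of "\<gamma> u" z z] by simp
  then show ?thesis using assms(3) by simp
qed

text \<open>By \<open>dual_munit\<close> the image of a matrix with one entry \<open>t\<close> has
  this value as its only entry. The left linear forms \<open>pr \<gamma> z x\<close> on the spaces
  \<open>RR D z x\<close> thus carry all of \<open>\<gamma>\<close>, and the calculus below replaces
  identities in the dual bimodule by identities between ring elements.\<close>

definition pr :: "('a, 'p) dual \<Rightarrow> 'p xp \<Rightarrow> 'p xp \<Rightarrow> 'a \<Rightarrow> 'a" where
  "pr \<gamma> z x t = \<gamma> (munit z x t) z z"

text \<open>The argument is fixed by \<open>ee D z\<close> from the left, so linearity confines the
  value to row \<open>z\<close>, and values in \<open>S\<close> are diagonal.\<close>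

lemma dual_munit:
  assumes "\<gamma> \<in> dualJ D" "z \<in> uPm D" "x \<in> uPm D" "z < x" "t \<in> RR D z x"
  shows "\<gamma> (munit z x t) = munit z z (pr \<gamma> z x t)"
proof -
  have u: "munit z x t \<in> JJ D" using assms by (simp add: munit_JJ)
  have "mm D (ee D z) (munit z x t) = munit z x t"
    using assms by (simp add: ee_def mmul_munit_munit eps_l)
  then have *: "\<gamma> (munit z x t) = mm D (ee D z) (\<gamma> (munit z x t))"
    using dualJ_lin[OF assms(1) ee_SS[OF assms(2)] u] by simp
  have "\<gamma> (munit z x t) i j = munit z z (pr \<gamma> z x t) i j" for i j
  proof (cases "i = z \<and> j = z")
    case False
    have "\<gamma> (munit z x t) i j = 0"
    proof (cases "i = j")
      case True
      then have "ee D z i i = 0" using False by (simp add: ee_apply)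
      then show ?thesis by (subst *) (simp add: mm_SS_left ee_SS assms)
    qed (simp add: SS_zero[OF dualJ_SS[OF assms(1) u]])
    then show ?thesis using False by (auto simp: munit_def)
  qed (auto simp: munit_def pr_def)
  then show ?thesis by blast
qed

lemma pr_in: "\<gamma> \<in> dualJ D \<Longrightarrow> z \<in> uPm D \<Longrightarrow> x \<in> uPm D \<Longrightarrow> z < x \<Longrightarrow> t \<in> RR D z x \<Longrightarrow> pr \<gamma> z x t \<in> RR D z z"
  unfolding pr_def by (intro SS_in dualJ_SS munit_JJ)

lemma pr_add:
  "\<gamma> \<in> dualJ D \<Longrightarrow> z \<in> uPm D \<Longrightarrow> x \<in> uPm D \<Longrightarrow> z < x \<Longrightarrow> t \<in> RR D z x \<Longrightarrow> t' \<in> RR D z x \<Longrightarrow>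
    pr \<gamma> z x (t + t') = pr \<gamma> z x t + pr \<gamma> z x t'"
  by (simp add: pr_def munit_add dualJ_add munit_JJ)

lemma pr_diff:
  "\<gamma> \<in> dualJ D \<Longrightarrow> z \<in> uPm D \<Longrightarrow> x \<in> uPm D \<Longrightarrow> z < x \<Longrightarrow> t \<in> RR D z x \<Longrightarrow> t' \<in> RR D z x \<Longrightarrow>
    pr \<gamma> z x (t - t') = pr \<gamma> z x t - pr \<gamma> z x t'"
  by (simp add: pr_def munit_diff dualJ_diff munit_JJ)

lemma pr_0: "\<gamma> \<in> dualJ D \<Longrightarrow> pr \<gamma> z x 0 = 0"
  by (simp add: pr_def dualJ_0)

lemma pr_sum:
  "\<gamma> \<in> dualJ D \<Longrightarrow> z \<in> uPm D \<Longrightarrow> x \<in> uPm D \<Longrightarrow> z < x \<Longrightarrow> (\<And>a. a \<in> A \<Longrightarrow> f a \<in> RR D z x) \<Longrightarrow>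
    pr \<gamma> z x (\<Sum>a\<in>A. f a) = (\<Sum>a\<in>A. pr \<gamma> z x (f a))"
  by (simp add: pr_def munit_sum dualJ_sum munit_JJ sum_apply)

lemma pr_lin:
  assumes "\<gamma> \<in> dualJ D" "z \<in> uPm D" "x \<in> uPm D" "z < x" "t \<in> RR D z x" "r \<in> RR D z z"
  shows "pr \<gamma> z x (r * t) = r * pr \<gamma> z x t"
proof -
  have "munit z x (r * t) = mm D (munit z z r) (munit z x t)"
    using assms by (simp add: mmul_munit_munit)
  then show ?thesis using assms by (simp add: pr_def dualJ_lin munit_SS munit_JJ mmul_munit_left)
qed

lemma pr_plus: "pr (\<gamma> + \<delta>) z x t = pr \<gamma> z x t + pr \<delta> z x t"
  by (simp add: pr_def)

lemma pr_dual_r: "s \<in> SS D \<Longrightarrow> pr (dual_r D \<gamma> s) z x t = pr \<gamma> z x t * s z z"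
  by (simp add: pr_def dual_r_def mm_SS_right)

lemma pr_dual_l:
  assumes "s \<in> SS D" "z \<in> uPm D" "x \<in> uPm D" "z < x" "t \<in> RR D z x"
  shows "pr (dual_l D s \<gamma>) z x t = pr \<gamma> z x (t * s x x)"
proof -
  have "mm D (munit z x t) s = munit z x (t * s x x)"
    by (intro ext) (use assms in \<open>auto simp: mm_SS_right munit_def\<close>)
  then show ?thesis using assms by (simp add: pr_def dual_l_def munit_JJ)
qed

lemma pr_dual_l_JJ:
  assumes "z \<in> uPm D" "y \<in> uPm D" "z < y" "t \<in> RR D z y"
  shows "pr (dual_l D p \<gamma>) z y t = \<gamma> (mm D (munit z y t) p) z z"
  using assms by (simp add: pr_def dual_l_def munit_JJ)

end

subsection \<open>Dual bases\<close>

locale ext_poset_basis = ext_poset D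
  for D :: "('k::field, 'a::ring_1, 'p::order) eposet" +
  fixes B :: "('a, 'p) imat set"
  assumes basis: "basis_choice D B"
begin

abbreviation "dual_el \<equiv> dual_elt D B"

definition Bs :: "'p xp \<Rightarrow> 'p xp \<Rightarrow> ('a, 'p) imat set" where
  "Bs y x = (if y \<in> uPm D \<and> x \<in> uPm D \<and> y < x then B \<inter> peirceJ D (ee D y) (ee D x) else {})"

lemma peirceJ_ee:
  assumes "y \<in> uPm D" "x \<in> uPm D" "y < x"
  shows "peirceJ D (ee D y) (ee D x) = {munit y x r | r. r \<in> RR D y x}"
proof -
  have *: "mm D (ee D y) (mm D u (ee D x)) = munit y x (u y x)" if u: "u \<in> JJ D" for u
  proof -
    have "u y x \<in> RR D y x" using assms u by (simp add: JJ_in)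
    then have "eps D y * (u y x * eps D x) = u y x" using assms by (simp add: eps_l eps_r)
    then show ?thesis using assms
      by (intro ext) (simp add: mm_SS_left mm_SS_right ee_SS ee_apply munit_apply)
  qed
  show ?thesis
  proof (intro Set.set_eqI iffI)
    fix p assume "p \<in> peirceJ D (ee D y) (ee D x)"
    then obtain u where "u \<in> JJ D" "p = munit y x (u y x)" using * by (auto simp: peirceJ_def)
    then show "p \<in> {munit y x r | r. r \<in> RR D y x}" using assms by (auto simp: JJ_in)
  next
    fix p assume "p \<in> {munit y x r | r. r \<in> RR D y x}"
    then obtain r where r: "r \<in> RR D y x" "p = munit y x r" by auto
    then have "munit y x r \<in> JJ D" using assms by (simp add: munit_JJ)
    then show "p \<in> peirceJ D (ee D y) (ee D x)"
      using *[of "munit y x r"] r unfolding peirceJ_def by (auto simp: munit_apply intro!: exI[of _ p])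
  qed
qed

lemma Bs_left_basis:
  "y \<in> uPm D \<Longrightarrow> x \<in> uPm D \<Longrightarrow> y < x \<Longrightarrow>
    left_basis (RR D y y) (\<lambda>r u. mm D (munit y y r) u) (peirceJ D (ee D y) (ee D x)) (Bs y x)"
  using basis by (simp add: basis_choice_def Bs_def)

lemma finite_Bs [simp]: "finite (Bs y x)"
  using Bs_left_basis[of y x] by (cases "y \<in> uPm D \<and> x \<in> uPm D \<and> y < x") (auto simp: left_basis_def Bs_def)

lemma BsD: "p \<in> Bs y x \<Longrightarrow> y \<in> uPm D \<and> x \<in> uPm D \<and> y < x \<and> p \<in> B"
  by (auto simp: Bs_def split: if_splits)

lemma Bs_munit:
  assumes "p \<in> Bs y x"
  shows "p = munit y x (p y x)" "p y x \<in> RR D y x"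
  using assms peirceJ_ee[of y x] by (auto simp: Bs_def munit_apply split: if_splits)

lemma Bs_apply: "p \<in> Bs y x \<Longrightarrow> p i j = (if i = y \<and> j = x then p y x else 0)"
  using Bs_munit(1)[of p y x] by (metis munit_apply)

lemma Bs_zero: "p \<in> Bs y x \<Longrightarrow> i \<noteq> y \<or> j \<noteq> x \<Longrightarrow> p i j = 0"
  using Bs_apply[of p y x i j] by auto

lemma Bs_JJ: "p \<in> Bs y x \<Longrightarrow> p \<in> JJ D"
  using Bs_munit[of p y x] BsD[of p y x] munit_JJ by metis

lemma B_Bs: "p \<in> B \<Longrightarrow> \<exists>y x. p \<in> Bs y x"
  using basis unfolding basis_choice_def Bs_def by fastforce

lemma B_JJ: "p \<in> B \<Longrightarrow> p \<in> JJ D"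
  using B_Bs Bs_JJ by blast

lemma finite_B: "finite B"
proof (rule finite_subset)
  show "B \<subseteq> (\<Union>y\<in>uPm D. \<Union>x\<in>uPm D. Bs y x)" using B_Bs BsD by fast
qed auto

lemma Bs_act: "y \<in> uPm D \<Longrightarrow> p \<in> Bs y x \<Longrightarrow> mm D (munit y y a) p = munit y x (a * p y x)"
  by (intro ext) (auto simp: mmul_munit_left Bs_zero munit_apply)

lemma Bs_expand:
  assumes "y \<in> uPm D" "x \<in> uPm D" "y < x" "t \<in> RR D y x"
  shows "\<exists>c. c \<in> Bs y x \<rightarrow> RR D y y \<and> t = (\<Sum>b\<in>Bs y x. c b * b y x)"
proof -
  have "munit y x t \<in> peirceJ D (ee D y) (ee D x)" using assms by (auto simp: peirceJ_ee)
  then obtain c where c: "c \<in> Bs y x \<rightarrow> RR D y y" "munit y x t = (\<Sum>b\<in>Bs y x. mm D (munit y y (c b)) b)"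
    using Bs_left_basis[OF assms(1-3)] unfolding left_basis_def by blast
  have "munit y x t = munit y x (\<Sum>b\<in>Bs y x. c b * b y x)"
    unfolding c(2) munit_sum by (intro sum.cong) (simp_all add: Bs_act assms)
  then have "munit y x t y x = munit y x (\<Sum>b\<in>Bs y x. c b * b y x) y x" by simp
  then show ?thesis using c(1) by (auto simp: munit_apply)
qed

lemma Bs_indep:
  assumes "y \<in> uPm D" "x \<in> uPm D" "y < x" "c \<in> Bs y x \<rightarrow> RR D y y" "(\<Sum>b\<in>Bs y x. c b * b y x) = 0"
    "b \<in> Bs y x"
  shows "c b = 0"
proof -
  have "(\<Sum>b\<in>Bs y x. mm D (munit y y (c b)) b) = (\<Sum>b\<in>Bs y x. munit y x (c b * b y x))"
    by (intro sum.cong) (simp_all add: Bs_act assms)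
  also have "\<dots> = 0" by (simp add: assms(5) flip: munit_sum)
  finally show ?thesis using Bs_left_basis[OF assms(1-3)] assms(4,6) unfolding left_basis_def by blast
qed

text \<open>A vanishing entry would give a linear relation with the nonzero coefficient
  \<open>eps D y\<close> at \<open>p\<close>. It follows that a basis element determines its
  position (\<open>Bs_disjoint\<close>).\<close>

lemma Bs_nz:
  assumes "p \<in> Bs y x"
  shows "p y x \<noteq> 0"
proof
  assume p0: "p y x = 0"
  have y: "y \<in> uPm D" "x \<in> uPm D" "y < x" using BsD[OF assms] by auto
  let ?c = "\<lambda>b. if b = p then eps D y else 0"
  have "?c p = 0"
    by (rule Bs_indep[OF y _ _ assms]) (use y p0 in \<open>auto simp: eps_in RR_0 intro!: sum.neutral\<close>)
  then show False using eps_nz[OF y(1)] by simp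
qed

lemma Bs_disjoint: "p \<in> Bs y x \<Longrightarrow> p \<in> Bs y' x' \<Longrightarrow> y' = y \<and> x' = x"
  using Bs_apply[of p y x y' x'] Bs_nz[of p y' x'] by (auto split: if_splits)

definition coef :: "'p xp \<Rightarrow> 'p xp \<Rightarrow> 'a \<Rightarrow> ('a, 'p) imat \<Rightarrow> 'a" where
  "coef y x t = (SOME c. c \<in> Bs y x \<rightarrow> RR D y y \<and> t = (\<Sum>b\<in>Bs y x. c b * b y x))"

lemma coef:
  assumes "y \<in> uPm D" "x \<in> uPm D" "y < x" "t \<in> RR D y x"
  shows "coef y x t \<in> Bs y x \<rightarrow> RR D y y" "t = (\<Sum>b\<in>Bs y x. coef y x t b * b y x)"
  using someI_ex[OF Bs_expand[OF assms]] unfolding coef_def by auto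

lemma coef_eq:
  assumes "y \<in> uPm D" "x \<in> uPm D" "y < x" "c \<in> Bs y x \<rightarrow> RR D y y"
    "t = (\<Sum>b\<in>Bs y x. c b * b y x)" "b \<in> Bs y x"
  shows "coef y x t b = c b"
proof -
  have b: "c b' * b' y x \<in> RR D y x" if "b' \<in> Bs y x" for b'
    using assms(1-4) Bs_munit(2)[OF that] RR_mult[of y y x "c b'" "b' y x"] that
    by (auto simp: Pi_iff)
  have t: "t \<in> RR D y x" unfolding assms(5) using assms b by (intro RR_sum) auto
  note co = coef[OF assms(1-3) t]
  have "(\<lambda>b. coef y x t b - c b) b = 0"
  proof (rule Bs_indep[OF assms(1-3) _ _ assms(6)])
    show "(\<lambda>b. coef y x t b - c b) \<in> Bs y x \<rightarrow> RR D y y"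
      using co(1) assms by (auto intro!: RR_diff)
    show "(\<Sum>b\<in>Bs y x. (coef y x t b - c b) * b y x) = 0"
      using co(2) assms(5) by (simp add: left_diff_distrib sum_subtractf)
  qed
  then show ?thesis by simp
qed

text \<open>An explicit candidate for the dual basis element of \<open>p\<close>: take the
  coefficient at \<open>p\<close> of the entry at \<open>(y, x)\<close>. \<open>dual_el_gam\<close>
  identifies it with the definite description in \<open>dual_elt\<close>.\<close>

definition gam :: "'p xp \<Rightarrow> 'p xp \<Rightarrow> ('a, 'p) imat \<Rightarrow> ('a, 'p) dual" where
  "gam y x p u = (if u \<in> JJ D then munit y y (coef y x (u y x) p) else 0)"

lemma coef_add:
  assumes y: "y \<in> uPm D" "x \<in> uPm D" "y < x" and "t \<in> RR D y x" "t' \<in> RR D y x" "p \<in> Bs y x"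
  shows "coef y x (t + t') p = coef y x t p + coef y x t' p"
proof (rule coef_eq[OF y _ _ assms(6)])
  show "(\<lambda>b. coef y x t b + coef y x t' b) \<in> Bs y x \<rightarrow> RR D y y"
    using coef(1)[OF y assms(4)] coef(1)[OF y assms(5)] y by (auto intro!: RR_add)
  show "t + t' = (\<Sum>b\<in>Bs y x. (coef y x t b + coef y x t' b) * b y x)"
    using coef(2)[OF y assms(4)] coef(2)[OF y assms(5)] by (simp add: distrib_right sum.distrib)
qed

lemma coef_mult:
  assumes y: "y \<in> uPm D" "x \<in> uPm D" "y < x" and "r \<in> RR D y y" "t \<in> RR D y x" "p \<in> Bs y x"
  shows "coef y x (r * t) p = r * coef y x t p"
proof (rule coef_eq[OF y _ _ assms(6)])
  show "(\<lambda>b. r * coef y x t b) \<in> Bs y x \<rightarrow> RR D y y"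
    using coef(1)[OF y assms(5)] y assms(4) by (auto intro!: RR_mult[of y y y])
  have "r * t = r * (\<Sum>b\<in>Bs y x. coef y x t b * b y x)"
    using coef(2)[OF y assms(5)] by simp
  then show "r * t = (\<Sum>b\<in>Bs y x. (r * coef y x t b) * b y x)"
    by (simp add: sum_distrib_left mult.assoc)
qed

lemma gam_dualJ: "p \<in> Bs y x \<Longrightarrow> gam y x p \<in> dualJ D"
proof -
  assume p: "p \<in> Bs y x"
  then have y: "y \<in> uPm D" "x \<in> uPm D" "y < x" using BsD by auto
  show ?thesis
  proof (rule dualJ_I)
    fix u assume u: "u \<in> JJ D"
    then have uyx: "u y x \<in> RR D y x" using y by (simp add: JJ_in)
    then have c: "coef y x (u y x) p \<in> RR D y y" using coef(1)[OF y uyx] p by auto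
    then show "gam y x p u \<in> SS D" using u y by (simp add: gam_def munit_SS)
    show "gam y x p (u + v) = gam y x p u + gam y x p v" if v: "v \<in> JJ D" for v
      using coef_add[OF y uyx JJ_in[OF v y] p] u v by (simp add: gam_def JJ_add munit_add)
    show "gam y x p (mm D s u) = mm D s (gam y x p u)" if s: "s \<in> SS D" for s
    proof -
      have "coef y x (s y y * u y x) p = s y y * coef y x (u y x) p"
        by (rule coef_mult[OF y SS_in[OF s y(1)] uyx p])
      then show ?thesis using u s
        by (intro ext) (simp add: gam_def JJ_mm_SS mm_SS_left munit_apply)
    qed
  qed (simp add: gam_def)
qed

lemma gam_basis:
  assumes p: "p \<in> Bs y x" and q: "q \<in> B"
  shows "gam y x p q = (if q = p then ee D y else 0)"
proof -
  have y: "y \<in> uPm D" "x \<in> uPm D" "y < x" using BsD[OF p] by auto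
  obtain y' x' where q': "q \<in> Bs y' x'" using B_Bs[OF q] by auto
  have "coef y x (q y x) p = (if q = p then eps D y else 0)"
  proof (cases "y' = y \<and> x' = x")
    case True
    have "coef y x (q y x) p = (\<lambda>b. if b = q then eps D y else 0) p"
    proof (rule coef_eq[OF y _ _ p])
      have "(\<Sum>b\<in>Bs y x. (if b = q then eps D y else 0) * b y x) =
          (\<Sum>b\<in>Bs y x. if b = q then eps D y * q y x else 0)"
        by (intro sum.cong) auto
      then show "q y x = (\<Sum>b\<in>Bs y x. (if b = q then eps D y else 0) * b y x)"
        using q' True y Bs_munit(2)[of q y x] by (simp add: eps_l)
    qed (use y in \<open>auto simp: eps_in RR_0\<close>)
    then show ?thesis by auto
  next
    case False
    then have "q y x = 0" using Bs_apply[OF q', of y x] by auto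
    moreover have "coef y x 0 p = (\<lambda>b. 0) p" by (rule coef_eq[OF y _ _ p]) (use y in \<open>auto simp: RR_0\<close>)
    moreover have "q \<noteq> p" using False Bs_disjoint[OF p] q' by blast
    ultimately show ?thesis by simp
  qed
  then show ?thesis using B_JJ[OF q] by (simp add: gam_def ee_def)
qed

lemma gam_mm:
  assumes "p \<in> Bs y x" "u \<in> JJ D"
  shows "mm D (gam y x p u) p = munit y x (coef y x (u y x) p * p y x)"
  using assms BsD[OF assms(1)] by (simp add: gam_def Bs_act)

text \<open>Every \<open>u\<close> in \<open>J\<close> is the left combination of the basis with
  coefficients \<open>gam\<close>, so left linear maps are determined on \<open>B\<close>. This is
  the uniqueness behind the definite description of the dual basis.\<close>

lemma dual_ext:
  assumes "\<gamma> \<in> dualJ D" "\<gamma>' \<in> dualJ D" "\<And>p. p \<in> B \<Longrightarrow> \<gamma> p = \<gamma>' p"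
  shows "\<gamma> = \<gamma>'"
proof (rule ext)
  fix u
  show "\<gamma> u = \<gamma>' u"
  proof (cases "u \<in> JJ D")
    case True
    obtain y x where yx: "p \<in> B \<Longrightarrow> p \<in> Bs (y p) (x p)" for p using B_Bs by metis
    let ?s = "\<lambda>p. gam (y p) (x p) p u"
    have expand: "u = (\<Sum>p\<in>B. mm D (?s p) p)"
    proof (rule JJ_eqI[OF True])
      show J: "(\<Sum>p\<in>B. mm D (?s p) p) \<in> JJ D"
        by (intro JJ_sum JJ_mm_SS dualJ_SS gam_dualJ B_JJ yx True)
      fix i j assume ij: "i \<in> uPm D" "j \<in> uPm D" "i < j"
      have uij: "u i j \<in> RR D i j" using ij True by (simp add: JJ_in)
      have "(\<Sum>p\<in>B. mm D (?s p) p) i j = (\<Sum>p\<in>B. mm D (?s p) p i j)" by (simp add: sum_apply)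
      also have "\<dots> = (\<Sum>p\<in>Bs i j. mm D (?s p) p i j)"
      proof (rule sum.mono_neutral_right[OF finite_B])
        show "Bs i j \<subseteq> B" using BsD by blast
        show "\<forall>p\<in>B - Bs i j. mm D (?s p) p i j = 0"
          using yx by (auto simp: gam_mm[OF yx True] munit_apply)
      qed
      also have "\<dots> = (\<Sum>p\<in>Bs i j. coef i j (u i j) p * p i j)"
      proof (rule sum.cong[OF refl])
        fix p assume p: "p \<in> Bs i j"
        then have "y p = i" "x p = j" using Bs_disjoint[OF p yx] BsD by auto
        then show "mm D (?s p) p i j = coef i j (u i j) p * p i j"
          using gam_mm[OF p True] by (simp add: munit_apply)
      qed
      also have "\<dots> = u i j" using coef(2)[OF ij uij] by simp
      finally show "u i j = (\<Sum>p\<in>B. mm D (?s p) p) i j" by simp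
    qed
    have *: "\<delta> u = (\<Sum>p\<in>B. mm D (?s p) (\<delta> p))" if "\<delta> \<in> dualJ D" for \<delta>
    proof -
      have "\<delta> u = (\<Sum>p\<in>B. \<delta> (mm D (?s p) p))"
        by (subst expand, rule dualJ_sum[OF that])
          (intro JJ_mm_SS dualJ_SS gam_dualJ B_JJ yx True)
      also have "\<dots> = (\<Sum>p\<in>B. mm D (?s p) (\<delta> p))"
        by (intro sum.cong refl dualJ_lin that dualJ_SS gam_dualJ B_JJ yx True)
      finally show ?thesis .
    qed
    show ?thesis unfolding *[OF assms(1)] *[OF assms(2)] using assms(3) by simp
  qed (simp add: dualJ_out assms)
qed

lemma dual_el_gam:
  assumes p: "p \<in> Bs y x"
  shows "dual_el p = gam y x p"
  unfolding dual_elt_def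
proof (rule the_equality)
  show "gam y x p \<in> dualJ D \<and> (\<forall>q\<in>B. q \<noteq> p \<longrightarrow> gam y x p q = 0) \<and>
    (\<forall>y'\<in>uPm D. \<forall>x'\<in>uPm D. y' < x' \<and> p \<in> peirceJ D (ee D y') (ee D x') \<longrightarrow> gam y x p p = ee D y')"
  proof (intro conjI ballI impI)
    fix y' x' assume "y' \<in> uPm D" "x' \<in> uPm D" "y' < x' \<and> p \<in> peirceJ D (ee D y') (ee D x')"
    then have "p \<in> Bs y' x'" using BsD[OF p] by (simp add: Bs_def)
    then have "y' = y" using Bs_disjoint[OF p] by blast
    then show "gam y x p p = ee D y'" using gam_basis[OF p] BsD[OF p] by simp
  qed (use gam_dualJ[OF p] gam_basis[OF p] in auto)
next
  fix \<gamma> assume *: "\<gamma> \<in> dualJ D \<and> (\<forall>q\<in>B. q \<noteq> p \<longrightarrow> \<gamma> q = 0) \<and>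
    (\<forall>y'\<in>uPm D. \<forall>x'\<in>uPm D. y' < x' \<and> p \<in> peirceJ D (ee D y') (ee D x') \<longrightarrow> \<gamma> p = ee D y')"
  show "\<gamma> = gam y x p"
  proof (rule dual_ext)
    fix q assume q: "q \<in> B"
    have "\<gamma> p = ee D y" using * p BsD[OF p] by (auto simp: Bs_def)
    then show "\<gamma> q = gam y x p q" using * q gam_basis[OF p q] by auto
  qed (use * gam_dualJ[OF p] in auto)
qed

lemma dual_el_dualJ: "p \<in> B \<Longrightarrow> dual_el p \<in> dualJ D"
  using B_Bs dual_el_gam gam_dualJ by metis

text \<open>\<open>e\<close> is diagonal with entries units or zero, so \<open>e p\<close> is either
  \<open>p\<close> or zero, and \<open>p\<close> has a nonzero entry in row
  \<open>y\<close>.\<close>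

lemma Bs_peirceJ:
  assumes e: "diag_idem e" and p: "p \<in> Bs y x"
  shows "p \<in> peirceJ D e (ehat D) \<longleftrightarrow> e y y = eps D y"
proof -
  have y: "y \<in> uPm D" "x \<in> uPm D" "y < x" using BsD[OF p] by auto
  show ?thesis
  proof
    assume "p \<in> peirceJ D e (ehat D)"
    then obtain u where "u \<in> JJ D" "p = mm D e (mm D u (ehat D))" by (auto simp: peirceJ_def)
    then have "p y x = e y y * u y x" using e by (simp add: JJ_ehat mm_SS_left diag_idem_SS)
    then show "e y y = eps D y" using Bs_nz[OF p] e y by (auto simp: diag_idem_def)
  next
    assume ey: "e y y = eps D y"
    have "p = mm D e (mm D p (ehat D))"
    proof (rule JJ_eqI)
      fix i j
      have "eps D y * p y x = p y x" using Bs_munit(2)[OF p] y by (simp add: eps_l)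
      then show "p i j = mm D e (mm D p (ehat D)) i j"
        using ey e by (simp add: JJ_ehat Bs_JJ[OF p] mm_SS_left diag_idem_SS Bs_apply[OF p, of i j])
    qed (use e in \<open>simp_all add: JJ_ehat Bs_JJ[OF p] JJ_mm_SS diag_idem_SS\<close>)
    then show "p \<in> peirceJ D e (ehat D)" using Bs_JJ[OF p] unfolding peirceJ_def by blast
  qed
qed

lemma dual_el_peirceD:
  assumes e: "diag_idem e" and p: "p \<in> B \<inter> peirceJ D e (ehat D)"
  shows "dual_el p \<in> peirceD D (ehat D) e"
proof -
  obtain y x where yx: "p \<in> Bs y x" using B_Bs p by blast
  then have y: "y \<in> uPm D" "x \<in> uPm D" "y < x" using BsD by auto
  have ey: "e y y = eps D y" using Bs_peirceJ[OF e yx] p by simp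
  have "mm D (gam y x p u) e = gam y x p u" for u
  proof (cases "u \<in> JJ D")
    case True
    have "coef y x (u y x) p \<in> RR D y y" using coef(1)[OF y JJ_in[OF True y]] yx by auto
    then have "coef y x (u y x) p * eps D y = coef y x (u y x) p" using y by (simp add: eps_r)
    then show ?thesis using e ey True
      by (intro ext) (simp add: gam_def mm_SS_right diag_idem_SS munit_apply)
  qed (simp add: gam_def)
  then have "dual_r D (gam y x p) e = gam y x p" by (simp add: dual_r_def fun_eq_iff)
  then show ?thesis using e by (simp add: peirceD_ehat dual_el_gam[OF yx] gam_dualJ[OF yx])
qed

text \<open>The dual basis identity, restricted to the rows selected by \<open>e\<close>: a basis
  element lies in \<open>e J ehat\<close> exactly if \<open>e\<close> is the unit in its
  row.\<close>

lemma dual_expansion: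
  assumes e: "diag_idem e" and u: "u \<in> JJ D"
  shows "(\<Sum>p\<in>B \<inter> peirceJ D e (ehat D). mm D (dual_el p u) p) = mm D e u"
proof (rule JJ_eqI)
  show "mm D e u \<in> JJ D" using e u by (simp add: JJ_mm_SS diag_idem_SS)
  show "(\<Sum>p\<in>B \<inter> peirceJ D e (ehat D). mm D (dual_el p u) p) \<in> JJ D"
    by (intro JJ_sum JJ_mm_SS dualJ_SS dual_el_dualJ B_JJ u) auto
  fix i j assume ij: "i \<in> uPm D" "j \<in> uPm D" "i < j"
  have uij: "u i j \<in> RR D i j" using ij u by (simp add: JJ_in)
  have "(\<Sum>p\<in>B \<inter> peirceJ D e (ehat D). mm D (dual_el p u) p) i j =
      (\<Sum>p\<in>B \<inter> peirceJ D e (ehat D). mm D (dual_el p u) p i j)" by (simp add: sum_apply)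
  also have "\<dots> = (\<Sum>p\<in>Bs i j \<inter> peirceJ D e (ehat D). mm D (dual_el p u) p i j)"
  proof (rule sum.mono_neutral_right)
    show "Bs i j \<inter> peirceJ D e (ehat D) \<subseteq> B \<inter> peirceJ D e (ehat D)" using BsD by blast
    show "\<forall>p\<in>B \<inter> peirceJ D e (ehat D) - Bs i j \<inter> peirceJ D e (ehat D). mm D (dual_el p u) p i j = 0"
    proof
      fix p assume p: "p \<in> B \<inter> peirceJ D e (ehat D) - Bs i j \<inter> peirceJ D e (ehat D)"
      then obtain y x where yx: "p \<in> Bs y x" using B_Bs by blast
      then show "mm D (dual_el p u) p i j = 0" using p
        by (auto simp: dual_el_gam[OF yx] gam_mm[OF yx u] munit_apply)
    qed
  qed (simp add: finite_B)
  also have "\<dots> = (\<Sum>p\<in>Bs i j \<inter> peirceJ D e (ehat D). coef i j (u i j) p * p i j)"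
    by (intro sum.cong refl) (auto simp: dual_el_gam gam_mm[OF _ u] munit_apply)
  also have "\<dots> = e i i * u i j"
  proof (cases "e i i = eps D i")
    case True
    then have "Bs i j \<inter> peirceJ D e (ehat D) = Bs i j" using Bs_peirceJ[OF e] by blast
    then show ?thesis using coef(2)[OF ij uij] True ij uij by (simp add: eps_l)
  next
    case False
    then have "Bs i j \<inter> peirceJ D e (ehat D) = {}" using Bs_peirceJ[OF e] by blast
    moreover have "e i i = 0" using False e ij by (auto simp: diag_idem_def)
    ultimately show ?thesis by simp
  qed
  finally show "(\<Sum>p\<in>B \<inter> peirceJ D e (ehat D). mm D (dual_el p u) p) i j = mm D e u i j"
    using e by (simp add: mm_SS_left diag_idem_SS)
qed

lemma peirceD_mm:
  assumes "diag_idem e" "\<xi> \<in> peirceD D (ehat D) e"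
  shows "mm D (\<xi> u) e = \<xi> u"
  using assms unfolding peirceD_ehat[OF assms(1)] dual_r_def by metis

lemma peirceD_dual_r:
  assumes e: "diag_idem e" and "\<xi> \<in> peirceD D (ehat D) e" "\<gamma> \<in> dualJ D" "u \<in> JJ D"
  shows "dual_r D \<gamma> (\<xi> u) \<in> peirceD D (ehat D) e"
  using assms by (simp add: peirceD_ehat dual_r_dualJ dualJ_SS dual_r_r peirceD_mm[OF e])

lemma peirceD_dual_l:
  assumes e: "diag_idem e" and "\<xi> \<in> peirceD D (ehat D) e" "s \<in> SS D \<or> s \<in> JJ D"
  shows "dual_l D s \<xi> \<in> peirceD D (ehat D) e"
  using assms by (simp add: peirceD_ehat dual_l_dualJ flip: dual_l_r)

text \<open>This evaluates the sum over \<open>j\<close> in the definition of the differential.\<close>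
lemma dual_sum:
  assumes e: "diag_idem e" and \<xi>: "\<xi> \<in> peirceD D (ehat D) e" and s: "s \<in> JJ D"
  shows "(\<Sum>p\<in>B \<inter> peirceJ D e (ehat D). dual_r D (dual_el p) (\<xi> (mm D p s))) = dual_l D s \<xi>"
proof (rule ext)
  fix u
  have \<xi>J: "\<xi> \<in> dualJ D" using \<xi> e by (simp add: peirceD_ehat)
  show "(\<Sum>p\<in>B \<inter> peirceJ D e (ehat D). dual_r D (dual_el p) (\<xi> (mm D p s))) u = dual_l D s \<xi> u"
  proof (cases "u \<in> JJ D")
    case True
    have "(\<Sum>p\<in>B \<inter> peirceJ D e (ehat D). dual_r D (dual_el p) (\<xi> (mm D p s))) u =
        (\<Sum>p\<in>B \<inter> peirceJ D e (ehat D). mm D (dual_el p u) (\<xi> (mm D p s)))"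
      by (simp add: sum_apply dual_r_def)
    also have "\<dots> = (\<Sum>p\<in>B \<inter> peirceJ D e (ehat D). \<xi> (mm D (mm D (dual_el p u) p) s))"
    proof (rule sum.cong[OF refl])
      fix p assume "p \<in> B \<inter> peirceJ D e (ehat D)"
      then show "mm D (dual_el p u) (\<xi> (mm D p s)) = \<xi> (mm D (mm D (dual_el p u) p) s)"
        using dualJ_lin[OF \<xi>J dualJ_SS[OF dual_el_dualJ True] JJ_mm[OF B_JJ s], of p p]
        by (simp add: mmul_assoc)
    qed
    also have "\<dots> = \<xi> (\<Sum>p\<in>B \<inter> peirceJ D e (ehat D). mm D (mm D (dual_el p u) p) s)"
      by (rule dualJ_sum[OF \<xi>J, symmetric])
        (rule JJ_mm[OF JJ_mm_SS[OF dualJ_SS[OF dual_el_dualJ True] B_JJ] s], auto)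
    also have "\<dots> = \<xi> (mm D e (mm D u s))"
      by (simp add: dual_expansion[OF e True] mmul_assoc flip: mmul_sum_left)
    also have "\<dots> = mm D e (\<xi> (mm D u s))"
      by (rule dualJ_lin[OF \<xi>J diag_idem_SS[OF e] JJ_mm[OF True s]])
    \<comment> \<open>Each diagonal entry of \<open>e\<close> is a unit or zero, so \<open>e\<close>
      commutes with diagonal matrices.\<close>
    also have "\<dots> = mm D (\<xi> (mm D u s)) e"
    proof (rule SS_eqI)
      fix i assume i: "i \<in> uPm D"
      have "\<xi> (mm D u s) i i \<in> RR D i i" by (intro SS_in dualJ_SS \<xi>J JJ_mm True s i)
      then show "mm D e (\<xi> (mm D u s)) i i = mm D (\<xi> (mm D u s)) e i i"
        using e i by (auto simp: mm_SS_left mm_SS_right diag_idem_def eps_l eps_r)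
    qed (intro SS_mm diag_idem_SS[OF e] dualJ_SS[OF \<xi>J] JJ_mm True s)+
    also have "\<dots> = dual_l D s \<xi> u" using peirceD_mm[OF e \<xi>] True by (simp add: dual_l_def)
    finally show ?thesis .
  next
    case False
    then have "dual_el p u = 0" if "p \<in> B" for p
      using dualJ_out[OF dual_el_dualJ[OF that]] by blast
    then show ?thesis using False by (simp add: sum_apply dual_r_def dual_l_def)
  qed
qed

text \<open>The dual of the multiplication gives the multiplication back: each summand is
  \<open>\<xi>\<close> of \<open>e\<^sub>z\<^sub>,\<^sub>y a\<close> times
  \<open>\<gamma>\<^sub>p(u) p\<close> with \<open>u = e\<^sub>y\<^sub>,\<^sub>x t\<close>, and
  \<open>\<Sum> \<gamma>\<^sub>p(u) p = u\<close>. Here composition of morphisms turns into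
  multiplication of matrices.\<close>

lemma comp_sum:
  assumes z: "z \<in> uPm D" "y \<in> uPm D" "x \<in> uPm D" "z < y" "y < x"
    and a: "a \<in> RR D z y" and t: "t \<in> RR D y x" and \<xi>: "\<xi> \<in> dualJ D"
  shows "(\<Sum>p\<in>B \<inter> peirceJ D (ehat D) (ehat D). pr (dual_l D p \<xi>) z y (a * pr (dual_el p) y x t)) =
    pr \<xi> z x (a * t)"
proof -
  let ?B = "B \<inter> peirceJ D (ehat D) (ehat D)" and ?u = "munit y x t"
  have u: "?u \<in> JJ D" and za: "munit z y a \<in> JJ D" using z t a by (simp_all add: munit_JJ)
  have eq: "pr (dual_l D p \<xi>) z y (a * pr (dual_el p) y x t) =
      \<xi> (mm D (munit z y a) (mm D (dual_el p ?u) p)) z z" if p: "p \<in> ?B" for p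
  proof -
    have pb: "pr (dual_el p) y x t \<in> RR D y y" using p z t by (intro pr_in dual_el_dualJ) auto
    have "dual_el p ?u = munit y y (pr (dual_el p) y x t)"
      using p z t by (intro dual_munit dual_el_dualJ) auto
    then have "mm D (munit z y a) (mm D (dual_el p ?u) p) = mm D (munit z y (a * pr (dual_el p) y x t)) p"
      using z by (simp add: mmul_assoc mmul_munit_munit)
    then show ?thesis using z a pb by (simp add: pr_dual_l_JJ RR_mult[of z y y])
  qed
  have "(\<Sum>p\<in>?B. pr (dual_l D p \<xi>) z y (a * pr (dual_el p) y x t)) =
      (\<Sum>p\<in>?B. \<xi> (mm D (munit z y a) (mm D (dual_el p ?u) p))) z z"
    by (simp add: sum_apply eq)
  also have "(\<Sum>p\<in>?B. \<xi> (mm D (munit z y a) (mm D (dual_el p ?u) p))) =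
      \<xi> (\<Sum>p\<in>?B. mm D (munit z y a) (mm D (dual_el p ?u) p))"
    by (rule dualJ_sum[OF \<xi>, symmetric])
      (rule JJ_mm[OF za JJ_mm_SS[OF dualJ_SS[OF dual_el_dualJ u] B_JJ]], auto)
  also have "(\<Sum>p\<in>?B. mm D (munit z y a) (mm D (dual_el p ?u) p)) = mm D (munit z y a) (mm D (ehat D) ?u)"
    by (simp add: dual_expansion[OF diag_idem_ehat u] flip: mmul_sum_right)
  \<comment> \<open>\<open>z < y\<close> excludes \<open>y = Bot\<close>, so \<open>ehat\<close> is
    the unit in row \<open>y\<close>.\<close>
  also have "mm D (ehat D) ?u = ?u"
    using z t Bot_less[of y] by (intro ext) (auto simp: mm_SS_left ehat_SS ehat_apply munit_apply Pm_iff eps_l)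
  also have "mm D (munit z y a) ?u = munit z x (a * t)" using z by (simp add: mmul_munit_munit)
  finally show ?thesis by (simp add: pr_def)
qed

text \<open>The dual basis elements of the row \<open>z\<close> lie in the Peirce component over
  which \<open>\<xi>\<close> ranges, and by the dual basis identity their values are the
  coefficients of the argument. This later converts equations between actions into equations between
  matrix entries.\<close>

lemma pr_separate:
  assumes z: "z \<in> uPm D" "x \<in> uPm D" "z < x" and t: "t \<in> RR D z x" "t' \<in> RR D z x"
    and eq: "\<And>\<xi>. \<xi> \<in> peirceD D (ehat D) (ee D z) \<Longrightarrow> pr \<xi> z x t = pr \<xi> z x t'"
  shows "t = t'"
proof -
  have e: "diag_idem (ee D z)" using z by (simp add: diag_idem_ee)
  have *: "munit z x t = (\<Sum>p\<in>B \<inter> peirceJ D (ee D z) (ehat D). mm D (munit z z (pr (dual_el p) z x t)) p)"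
    if t: "t \<in> RR D z x" for t
  proof -
    have "munit z x t = mm D (ee D z) (munit z x t)" using z t by (simp add: ee_def mmul_munit_munit eps_l)
    also have "\<dots> = (\<Sum>p\<in>B \<inter> peirceJ D (ee D z) (ehat D). mm D (dual_el p (munit z x t)) p)"
      by (rule dual_expansion[OF e, symmetric]) (use z t in \<open>simp add: munit_JJ\<close>)
    also have "\<dots> = (\<Sum>p\<in>B \<inter> peirceJ D (ee D z) (ehat D). mm D (munit z z (pr (dual_el p) z x t)) p)"
      by (intro sum.cong refl) (use z t in \<open>auto simp: dual_munit dual_el_dualJ\<close>)
    finally show ?thesis .
  qed
  have "munit z x t = munit z x t'"
    unfolding *[OF t(1)] *[OF t(2)] using eq dual_el_peirceD[OF e] by (intro sum.cong) auto
  then have "munit z x t z x = munit z x t' z x" by simp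
  then show ?thesis by (simp add: munit_apply)
qed

end

section \<open>The tensor algebra of the ditalgebra and its modules\<close>

lemma fst_sum: "fst (\<Sum>i\<in>I. f i) = (\<Sum>i\<in>I. fst (f i))"
  and snd_sum: "snd (\<Sum>i\<in>I. f i) = (\<Sum>i\<in>I. snd (f i))"
  by (induction I rule: infinite_finite_induct) auto

lemma Re_simps [simp]:
  "(a, b) \<otimes>\<^bsub>Re D\<^esub> (a', b') = (mm D a a', mm D b b')" "r \<oplus>\<^bsub>Re D\<^esub> s = r + s" "\<one>\<^bsub>Re D\<^esub> = (ehat D, ee D Bot)"
  "c \<odot>\<^bsub>Re D\<^esub> (a, b) = (mscale (scal D) c a, mscale (scal D) c b)"
  by (simp_all add: Re_def)

lemma WW_simps [simp]:
  "bcarrier (WW D) = peirceD D (ehat D) (ee D Bot) \<times> peirceD D (ehat D) (ehat D)"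
  "lact (WW D) (a, b) (\<gamma>, \<delta>) = (dual_l D a \<gamma>, dual_l D a \<delta>)"
  "ract (WW D) (\<gamma>, \<delta>) (a, b) = (dual_r D \<gamma> b, dual_r D \<delta> a)"
  by (simp_all add: WW_def)

lemma T0alg_simps [simp]:
  "carrier (T0alg D) = Tdeg D 0" "x \<otimes>\<^bsub>T0alg D\<^esub> y = x \<otimes>\<^bsub>TT D\<^esub> y" "x \<oplus>\<^bsub>T0alg D\<^esub> y = x \<oplus>\<^bsub>TT D\<^esub> y"
  "\<one>\<^bsub>T0alg D\<^esub> = \<one>\<^bsub>TT D\<^esub>" "c \<odot>\<^bsub>T0alg D\<^esub> x = c \<odot>\<^bsub>TT D\<^esub> x"
  by (simp_all add: T0alg_def)

text \<open>\<open>R\<^sup>e\<close> is the product of the rings \<open>RR D x x\<close> over all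
  points, stored as two diagonal matrices. \<open>rc\<close> and \<open>rdiag\<close> are the
  projections and inclusions of this product and hide the special role of
  \<open>Bot\<close>.\<close>

definition rc :: "('a, 'p) re_el \<Rightarrow> 'p xp \<Rightarrow> 'a" where
  "rc r x = (if x = Bot then snd r x x else fst r x x)"

definition rdiag :: "'p xp \<Rightarrow> 'a::ring_1 \<Rightarrow> ('a, 'p) re_el" where
  "rdiag x a = (if x = Bot then (0, munit x x a) else (munit x x a, 0))"

lemma diag_elt_rdiag: "diag_elt D x a = in_Re D (rdiag x a)"
  by (simp add: diag_elt_def rdiag_def)

context ext_poset
begin

abbreviation "W0 \<equiv> peirceD D (ehat D) (ee D Bot)"
abbreviation "W1 \<equiv> peirceD D (ehat D) (ehat D)"

lemma W0_iff: "\<gamma> \<in> W0 \<longleftrightarrow> \<gamma> \<in> dualJ D \<and> dual_r D \<gamma> (ee D Bot) = \<gamma>"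
  by (simp add: peirceD_ehat diag_idem_ee)

lemma W1_iff: "\<gamma> \<in> W1 \<longleftrightarrow> \<gamma> \<in> dualJ D \<and> dual_r D \<gamma> (ehat D) = \<gamma>"
  by (simp add: peirceD_ehat diag_idem_ehat)

lemma Re_iff:
  "r \<in> carrier (Re D) \<longleftrightarrow> fst r \<in> SS D \<and> snd r \<in> SS D \<and> fst r Bot Bot = 0 \<and> (\<forall>x. x \<noteq> Bot \<longrightarrow> snd r x x = 0)"
proof
  assume "r \<in> carrier (Re D)"
  then obtain s s' where "r = (mm D (ehat D) s, mm D (ee D Bot) s')" "s \<in> SS D" "s' \<in> SS D"
    by (auto simp: Re_def)
  then show "fst r \<in> SS D \<and> snd r \<in> SS D \<and> fst r Bot Bot = 0 \<and> (\<forall>x. x \<noteq> Bot \<longrightarrow> snd r x x = 0)"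
    by (simp add: SS_mm ehat_SS ee_SS mm_SS_left ehat_apply ee_apply Pm_iff)
next
  assume r: "fst r \<in> SS D \<and> snd r \<in> SS D \<and> fst r Bot Bot = 0 \<and> (\<forall>x. x \<noteq> Bot \<longrightarrow> snd r x x = 0)"
  have "fst r = mm D (ehat D) (fst r)"
    by (rule SS_eqI)
      (use r in \<open>auto simp: SS_mm ehat_SS mm_SS_left ehat_apply Pm_iff eps_l[OF SS_in]\<close>)
  moreover have "snd r = mm D (ee D Bot) (snd r)"
    by (rule SS_eqI)
      (use r in \<open>auto simp: SS_mm ee_SS mm_SS_left ee_apply eps_l[OF SS_in]\<close>)
  ultimately have "r = (mm D (ehat D) (fst r), mm D (ee D Bot) (snd r))" by (metis prod.collapse)
  then show "r \<in> carrier (Re D)" using r unfolding Re_def by auto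
qed

lemma Re_eqI:
  assumes "r \<in> carrier (Re D)" "s \<in> carrier (Re D)" "\<And>x. x \<in> uPm D \<Longrightarrow> rc r x = rc s x"
  shows "r = s"
proof (rule prod_eqI)
  show "fst r = fst s"
  proof (rule SS_eqI)
    show "fst r i i = fst s i i" if "i \<in> uPm D" for i
      using assms(3)[OF that] assms(1,2) by (cases "i = Bot") (auto simp: Re_iff rc_def)
  qed (use assms in \<open>auto simp: Re_iff\<close>)
  show "snd r = snd s"
  proof (rule SS_eqI)
    show "snd r i i = snd s i i" if "i \<in> uPm D" for i
      using assms(3)[OF that] assms(1,2) by (cases "i = Bot") (auto simp: Re_iff rc_def)
  qed (use assms in \<open>auto simp: Re_iff\<close>)
qed

lemma rc_in: "r \<in> carrier (Re D) \<Longrightarrow> x \<in> uPm D \<Longrightarrow> rc r x \<in> RR D x x"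
  by (simp add: rc_def Re_iff SS_in)

lemma rdiag_Re: "x \<in> uPm D \<Longrightarrow> a \<in> RR D x x \<Longrightarrow> rdiag x a \<in> carrier (Re D)"
  by (auto simp: Re_iff rdiag_def munit_SS SS_0 munit_apply)

lemma rc_rdiag: "rc (rdiag x a) y = (if y = x then a else 0)"
  by (auto simp: rc_def rdiag_def munit_apply)

lemma rc_sum: "rc (\<Sum>i\<in>I. f i) x = (\<Sum>i\<in>I. rc (f i) x)"
  by (simp add: rc_def fst_sum snd_sum sum_apply)

lemma Re_mult_rc:
  "r \<in> carrier (Re D) \<Longrightarrow> s \<in> carrier (Re D) \<Longrightarrow> rc (r \<otimes>\<^bsub>Re D\<^esub> s) x = rc r x * rc s x"
  by (cases r; cases s) (simp add: rc_def Re_iff mm_SS_left)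

lemma Re_add: "r \<in> carrier (Re D) \<Longrightarrow> s \<in> carrier (Re D) \<Longrightarrow> r + s \<in> carrier (Re D)"
  by (simp add: Re_iff SS_add)

lemma Re_0: "0 \<in> carrier (Re D)"
  by (simp add: Re_iff SS_0)

lemma Re_sum: "(\<And>i. i \<in> I \<Longrightarrow> f i \<in> carrier (Re D)) \<Longrightarrow> (\<Sum>i\<in>I. f i) \<in> carrier (Re D)"
  by (induction I rule: infinite_finite_induct) (auto simp: Re_0 Re_add)

lemma Re_decomp: "r \<in> carrier (Re D) \<Longrightarrow> r = (\<Sum>x\<in>uPm D. rdiag x (rc r x))"
proof (rule Re_eqI)
  assume r: "r \<in> carrier (Re D)"
  then show "(\<Sum>x\<in>uPm D. rdiag x (rc r x)) \<in> carrier (Re D)" by (intro Re_sum rdiag_Re rc_in)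
  show "rc r x = rc (\<Sum>x\<in>uPm D. rdiag x (rc r x)) x" if "x \<in> uPm D" for x
    using that by (simp add: rc_sum rc_rdiag)
qed

lemma Re_mult_closed: "r \<in> carrier (Re D) \<Longrightarrow> s \<in> carrier (Re D) \<Longrightarrow> r \<otimes>\<^bsub>Re D\<^esub> s \<in> carrier (Re D)"
  by (cases r; cases s) (simp add: Re_iff SS_mm mm_SS_left)

lemma Re_one: "(ehat D, ee D Bot) \<in> carrier (Re D)"
  by (simp add: Re_iff ehat_SS ee_SS ehat_apply ee_apply Pm_iff)

lemma rc_one: "x \<in> uPm D \<Longrightarrow> rc (ehat D, ee D Bot) x = eps D x"
  by (simp add: rc_def ehat_apply ee_apply Pm_iff)

text \<open>The image of the scalar \<open>c\<close> in \<open>R\<^sup>e\<close>; on the tensor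
  algebra and on its modules scalars act through this element.\<close>

definition cscal :: "'k \<Rightarrow> ('a, 'p) re_el" where
  "cscal c = (mscale (scal D) c (ehat D), mscale (scal D) c (ee D Bot))"

lemma cscal_Re: "cscal c \<in> carrier (Re D)"
  by (auto simp: cscal_def Re_iff mscale_def ehat_apply ee_apply Pm_iff scal_0 SS_iff scal_eps RR_0)

lemma rc_cscal: "x \<in> uPm D \<Longrightarrow> rc (cscal c) x = scal D c (eps D x)"
  by (simp add: rc_def cscal_def mscale_def ehat_apply ee_apply Pm_iff)

lemma Re_acts:
  assumes "(a, b) \<in> carrier (Re D)"
  shows "a \<in> SS D" "b \<in> SS D" "mm D a (ehat D) = a" "mm D b (ee D Bot) = b"
proof -
  show a: "a \<in> SS D" and b: "b \<in> SS D" using assms by (simp_all add: Re_iff)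
  show "mm D a (ehat D) = a"
    by (rule SS_eqI)
      (use assms a in \<open>auto simp: Re_iff SS_mm ehat_SS mm_SS_right ehat_apply Pm_iff eps_r[OF SS_in]\<close>)
  show "mm D b (ee D Bot) = b"
    by (rule SS_eqI)
      (use assms b in \<open>auto simp: Re_iff SS_mm ee_SS mm_SS_right ee_apply eps_r[OF SS_in]\<close>)
qed

lemma W_dual_l: "diag_idem e \<Longrightarrow> \<gamma> \<in> peirceD D (ehat D) e \<Longrightarrow> s \<in> SS D \<Longrightarrow> dual_l D s \<gamma> \<in> peirceD D (ehat D) e"
  by (simp add: peirceD_ehat dual_l_dualJ flip: dual_l_r)

lemma W_dual_r:
  "diag_idem e \<Longrightarrow> \<gamma> \<in> peirceD D (ehat D) e \<Longrightarrow> s \<in> SS D \<Longrightarrow> mm D s e = s \<Longrightarrow>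
    dual_r D \<gamma> s \<in> peirceD D (ehat D) e"
  by (simp add: peirceD_ehat dual_r_dualJ dual_r_r)

lemma W_add:
  "diag_idem e \<Longrightarrow> \<gamma> \<in> peirceD D (ehat D) e \<Longrightarrow> \<delta> \<in> peirceD D (ehat D) e \<Longrightarrow> \<gamma> + \<delta> \<in> peirceD D (ehat D) e"
  by (simp add: peirceD_ehat add_dualJ dual_r_add)

lemma W_0: "diag_idem e \<Longrightarrow> 0 \<in> peirceD D (ehat D) e"
  by (simp add: peirceD_ehat zero_dualJ)

lemmas diag_idems = diag_idem_ehat diag_idem_ee[OF Bot_in_uPm]

lemma W_dualJ: "diag_idem e \<Longrightarrow> \<gamma> \<in> peirceD D (ehat D) e \<Longrightarrow> \<gamma> \<in> dualJ D"
  by (simp add: peirceD_ehat)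

sublocale T: ring_bimodule "Re D" "WW D"
proof
  fix r s t :: "('a, 'p) re_el" and w w' :: "('a, 'p) w_el" and c :: 'k
  obtain a b a' b' a'' b'' where rst: "r = (a, b)" "s = (a', b')" "t = (a'', b'')" by (metis prod.exhaust)
  obtain \<gamma> \<delta> \<gamma>' \<delta>' where w: "w = (\<gamma>, \<delta>)" "w' = (\<gamma>', \<delta>')" by (metis prod.exhaust)
  note acts = Re_acts[of a b] Re_acts[of a' b']
  show "\<one>\<^bsub>Re D\<^esub> \<in> carrier (Re D)" by (simp add: Re_one)
  show "c \<odot>\<^bsub>Re D\<^esub> \<one>\<^bsub>Re D\<^esub> \<in> carrier (Re D)" using cscal_Re[of c] by (simp add: cscal_def)
  assume r: "r \<in> carrier (Re D)"
  show "r \<otimes>\<^bsub>Re D\<^esub> \<one>\<^bsub>Re D\<^esub> = r" using r acts by (simp add: rst)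
  { assume "w \<in> bcarrier (WW D)"
    then show "lact (WW D) r w \<in> bcarrier (WW D)" "ract (WW D) w r \<in> bcarrier (WW D)"
      using r acts by (simp_all add: rst w W_dual_l W_dual_r diag_idems)
    assume "w' \<in> bcarrier (WW D)"
    show "lact (WW D) r (w + w') = lact (WW D) r w + lact (WW D) r w'"
      by (simp add: rst w dual_l_add)
    show "ract (WW D) (w + w') r = ract (WW D) w r + ract (WW D) w' r"
      by (simp add: rst w dual_r_add) }
  assume s: "s \<in> carrier (Re D)"
  show "r \<oplus>\<^bsub>Re D\<^esub> s \<in> carrier (Re D)" "r \<otimes>\<^bsub>Re D\<^esub> s \<in> carrier (Re D)"
    using Re_add[OF r s] Re_mult_closed[OF r s] by simp_all
  { assume w': "w \<in> bcarrier (WW D)"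
    show "lact (WW D) (r \<oplus>\<^bsub>Re D\<^esub> s) w = lact (WW D) r w + lact (WW D) s w"
      using r s acts w' diag_idems by (simp add: rst w dual_l_add_left W_dualJ)
    show "ract (WW D) w (r \<oplus>\<^bsub>Re D\<^esub> s) = ract (WW D) w r + ract (WW D) w s"
      by (simp add: rst w dual_r_add_right)
    show "lact (WW D) r (ract (WW D) w s) = ract (WW D) (lact (WW D) r w) s"
      by (simp add: rst w dual_l_r) }
  assume t: "t \<in> carrier (Re D)"
  show "(r \<oplus>\<^bsub>Re D\<^esub> s) \<otimes>\<^bsub>Re D\<^esub> t = r \<otimes>\<^bsub>Re D\<^esub> t \<oplus>\<^bsub>Re D\<^esub> s \<otimes>\<^bsub>Re D\<^esub> t"
    by (simp add: rst mmul_add_left)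
  show "t \<otimes>\<^bsub>Re D\<^esub> (r \<oplus>\<^bsub>Re D\<^esub> s) = t \<otimes>\<^bsub>Re D\<^esub> r \<oplus>\<^bsub>Re D\<^esub> t \<otimes>\<^bsub>Re D\<^esub> s"
    by (simp add: rst mmul_add_right)
next
  fix w w' assume "w \<in> bcarrier (WW D)" "w' \<in> bcarrier (WW D)"
  then show "w + w' \<in> bcarrier (WW D)" by (auto simp: W_add diag_idems)
qed

section \<open>Operations and grading of \<open>T\<close> on representatives\<close>

lemma TT_add: "Tcl D x \<oplus>\<^bsub>TT D\<^esub> Tcl D y = Tcl D (x + y)"
  by (simp add: TT_def T.tcl_add)

lemma TT_mult:
  "Poly_Mapping.keys x \<subseteq> twords (Re D) (WW D) \<Longrightarrow> Poly_Mapping.keys y \<subseteq> twords (Re D) (WW D) \<Longrightarrow>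
    Tcl D x \<otimes>\<^bsub>TT D\<^esub> Tcl D y = Tcl D (tmult (Re D) (WW D) x y)"
  by (simp add: TT_def T.tcl_mult)

lemma TT_smult: "c \<odot>\<^bsub>TT D\<^esub> Tcl D x = Tcl D (tmult (Re D) (WW D) (frag_of (Sc (cscal c))) x)"
  by (simp add: TT_def T.tcl_smult cscal_def)

lemma TT_zero: "\<zero>\<^bsub>TT D\<^esub> = Tcl D 0"
  by (simp add: TT_def T.tcl_zero)

lemma TT_one: "\<one>\<^bsub>TT D\<^esub> = in_Re D (ehat D, ee D Bot)"
  by (simp add: TT_def T.tcl_one in_Re_def)

lemma TT_scalar: "c \<odot>\<^bsub>TT D\<^esub> \<one>\<^bsub>TT D\<^esub> = in_Re D (cscal c)"
  using T.scalar_eq[of c] by (simp add: TT_def cscal_def in_Re_def)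

lemma TT_carrier: "Poly_Mapping.keys x \<subseteq> twords (Re D) (WW D) \<Longrightarrow> Tcl D x \<in> carrier (TT D)"
  by (simp add: TT_def T.tcl_carrier)

text \<open>A relation between degrees and words, not a function of the word: the letter
  \<open>(0, 0)\<close> belongs to both degrees.\<close>

definition deg_word :: "nat \<Rightarrow> ('a, 'p) w_el list \<Rightarrow> bool" where
  "deg_word n ws \<longleftrightarrow> (\<exists>ks. list_all2 (\<lambda>w k. w \<in> letters D k) ws ks \<and> sum_list ks = n)"

lemma letters_iff: "(\<gamma>, \<delta>) \<in> letters D k \<longleftrightarrow> k = 0 \<and> \<gamma> \<in> W0 \<and> \<delta> = 0 \<or> k = 1 \<and> \<delta> \<in> W1 \<and> \<gamma> = 0"
  by (auto simp: letters_def)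

lemma letters_W: "w \<in> letters D k \<Longrightarrow> w \<in> bcarrier (WW D)"
  by (cases w) (auto simp: letters_iff W_0 diag_idems)

lemma deg_word_Nil: "deg_word n [] \<longleftrightarrow> n = 0"
  by (auto simp: deg_word_def)

lemma deg_word_Cons:
  "deg_word n (w # ws) \<longleftrightarrow> w \<in> letters D 0 \<and> deg_word n ws \<or> (\<exists>n'. n = Suc n' \<and> w \<in> letters D 1 \<and> deg_word n' ws)"
    (is "_ = ?R")
proof
  assume "deg_word n (w # ws)"
  then obtain k ks where k: "w \<in> letters D k" "list_all2 (\<lambda>w k. w \<in> letters D k) ws ks" "k + sum_list ks = n"
    by (auto simp: deg_word_def list_all2_Cons1)
  then have "k = 0 \<or> k = 1" by (cases w) (auto simp: letters_iff)
  then show ?R using k by (auto simp: deg_word_def)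
next
  assume ?R
  then show "deg_word n (w # ws)"
  proof (elim disjE exE conjE)
    assume w: "w \<in> letters D 0" "deg_word n ws"
    then obtain ks where "list_all2 (\<lambda>w k. w \<in> letters D k) ws ks" "sum_list ks = n"
      by (auto simp: deg_word_def)
    then show ?thesis using w unfolding deg_word_def by (intro exI[of _ "0 # ks"]) auto
  next
    fix n' assume w: "n = Suc n'" "w \<in> letters D 1" "deg_word n' ws"
    then obtain ks where "list_all2 (\<lambda>w k. w \<in> letters D k) ws ks" "sum_list ks = n'"
      by (auto simp: deg_word_def)
    then show ?thesis using w unfolding deg_word_def by (intro exI[of _ "1 # ks"]) auto
  qed
qed

lemma deg_word_W: "deg_word n ws \<Longrightarrow> set ws \<subseteq> bcarrier (WW D)"
  by (induction ws arbitrary: n) (auto simp: deg_word_Cons simp del: WW_simps dest: letters_W)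

lemma hom_words_Tw: "Tw ws \<in> hom_words D n \<longleftrightarrow> ws \<noteq> [] \<and> deg_word n ws"
  and hom_words_Sc: "Sc r \<in> hom_words D n \<longleftrightarrow> r \<in> carrier (Re D) \<and> n = 0"
  by (auto simp: hom_words_def deg_word_def simp del: split_paired_Ex)

lemma hom_words_twords: "hom_words D n \<subseteq> twords (Re D) (WW D)"
proof
  fix w assume "w \<in> hom_words D n"
  then show "w \<in> twords (Re D) (WW D)"
    by (cases w) (auto simp: hom_words_Tw hom_words_Sc twords_def simp del: WW_simps dest: deg_word_W)
qed

lemma Tdeg_I: "Poly_Mapping.keys x \<subseteq> hom_words D n \<Longrightarrow> Tcl D x \<in> Tdeg D n"
  by (auto simp: Tdeg_def)

lemma Tdeg_carrier: "t \<in> Tdeg D n \<Longrightarrow> t \<in> carrier (TT D)"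
  using hom_words_twords by (fastforce simp: Tdeg_def intro!: TT_carrier)

lemma in_Re_Tdeg: "r \<in> carrier (Re D) \<Longrightarrow> in_Re D r \<in> Tdeg D 0"
  unfolding in_Re_def by (intro Tdeg_I) (simp add: keys_frag_of hom_words_Sc)

lemma W0_word: "\<gamma> \<in> W0 \<Longrightarrow> Tw [(\<gamma>, 0)] \<in> hom_words D 0"
  and W1_word: "\<delta> \<in> W1 \<Longrightarrow> Tw [(0, \<delta>)] \<in> hom_words D 1"
  by (simp_all add: hom_words_Tw deg_word_Cons deg_word_Nil letters_iff)

lemma in_W0_Tdeg: "\<gamma> \<in> W0 \<Longrightarrow> in_W0 D \<gamma> \<in> Tdeg D 0"
  unfolding in_W0_def by (intro Tdeg_I) (simp add: keys_frag_of W0_word)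

lemma in_W1_Tdeg: "\<delta> \<in> W1 \<Longrightarrow> in_W1 D \<delta> \<in> Tdeg D 1"
  unfolding in_W1_def by (intro Tdeg_I) (simp add: keys_frag_of W1_word del: One_nat_def)

subsection \<open>Modules as representations\<close>

definition mal :: "(('a, 'p) t_el, 'm) rmod \<Rightarrow> ('a, 'p) re_el \<Rightarrow> 'm \<Rightarrow> 'm" where
  "mal M r m = mact M m (in_Re D r)"

text \<open>The component in \<open>W\<^sub>1\<close> acts by zero. In this way a module over
  \<open>T\<^sub>0\<close> becomes a representation of all of \<open>T\<close>, to which the results
  on representations apply.\<close>

definition mbe :: "(('a, 'p) t_el, 'm) rmod \<Rightarrow> ('a, 'p) w_el \<Rightarrow> 'm \<Rightarrow> 'm" where
  "mbe M w m = mact M m (in_W0 D (fst w))"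

abbreviation De_mod :: "(('a, 'p) t_el, 'm::ab_group_add) rmod \<Rightarrow> bool" where
  "De_mod M \<equiv> right_module (T0alg D) M"

context
  fixes M :: "(('a, 'p) t_el, 'm::ab_group_add) rmod"
  assumes M: "De_mod M"
begin

lemma mod_0: "0 \<in> mcar M"
  and mod_diff: "m \<in> mcar M \<Longrightarrow> m' \<in> mcar M \<Longrightarrow> m - m' \<in> mcar M"
  and mact_closed: "m \<in> mcar M \<Longrightarrow> a \<in> Tdeg D 0 \<Longrightarrow> mact M m a \<in> mcar M"
  and mact_add: "m \<in> mcar M \<Longrightarrow> m' \<in> mcar M \<Longrightarrow> a \<in> Tdeg D 0 \<Longrightarrow> mact M (m + m') a = mact M m a + mact M m' a"
  and mact_add_right: "m \<in> mcar M \<Longrightarrow> a \<in> Tdeg D 0 \<Longrightarrow> b \<in> Tdeg D 0 \<Longrightarrow>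
    mact M m (a \<oplus>\<^bsub>TT D\<^esub> b) = mact M m a + mact M m b"
  and mact_mult: "m \<in> mcar M \<Longrightarrow> a \<in> Tdeg D 0 \<Longrightarrow> b \<in> Tdeg D 0 \<Longrightarrow>
    mact M m (a \<otimes>\<^bsub>TT D\<^esub> b) = mact M (mact M m a) b"
  and mact_one: "m \<in> mcar M \<Longrightarrow> mact M m \<one>\<^bsub>TT D\<^esub> = m"
  using M unfolding right_module_def T0alg_simps by blast+

lemma mod_uminus: "m \<in> mcar M \<Longrightarrow> - m \<in> mcar M"
  using mod_diff[OF mod_0, of m] by simp

lemma mod_add: "m \<in> mcar M \<Longrightarrow> m' \<in> mcar M \<Longrightarrow> m + m' \<in> mcar M"
  using mod_diff[of m "- m'"] mod_uminus by simp

lemma mod_sum: "(\<And>i. i \<in> I \<Longrightarrow> f i \<in> mcar M) \<Longrightarrow> (\<Sum>i\<in>I. f i) \<in> mcar M"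
  by (induction I rule: infinite_finite_induct) (auto simp: mod_0 mod_add)

lemma mact_diff:
  "m \<in> mcar M \<Longrightarrow> m' \<in> mcar M \<Longrightarrow> a \<in> Tdeg D 0 \<Longrightarrow> mact M (m - m') a = mact M m a - mact M m' a"
  using mact_add[of "m - m'" m' a] by (simp add: mod_diff)

lemma mact_Tcl_add:
  assumes "m \<in> mcar M" "Poly_Mapping.keys x \<subseteq> hom_words D 0" "Poly_Mapping.keys y \<subseteq> hom_words D 0"
  shows "mact M m (Tcl D (x + y)) = mact M m (Tcl D x) + mact M m (Tcl D y)"
  using mact_add_right[OF assms(1) Tdeg_I Tdeg_I, OF assms(2,3)] by (simp add: TT_add)

lemma mact_Tcl_diff:
  assumes "m \<in> mcar M" "Poly_Mapping.keys x \<subseteq> hom_words D 0" "Poly_Mapping.keys y \<subseteq> hom_words D 0"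
  shows "mact M m (Tcl D (x - y)) = mact M m (Tcl D x) - mact M m (Tcl D y)"
  using mact_Tcl_add[of m "x - y" y] assms keys_diff_subset[of x _ y] by simp

lemma mact_Tcl_mult:
  assumes "m \<in> mcar M" "Poly_Mapping.keys x \<subseteq> hom_words D 0" "Poly_Mapping.keys y \<subseteq> hom_words D 0"
  shows "mact M m (Tcl D (tmult (Re D) (WW D) x y)) = mact M (mact M m (Tcl D x)) (Tcl D y)"
  using mact_mult[OF assms(1) Tdeg_I Tdeg_I, OF assms(2,3)]
    TT_mult[OF assms(2)[THEN order_trans] assms(3)[THEN order_trans], OF hom_words_twords hom_words_twords]
  by simp

lemma module_rep: "talg_rep (Re D) (WW D) (mcar M) (mal M) (mbe M)"
proof
  fix r s :: "('a, 'p) re_el" and m m' :: 'm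
  assume r: "r \<in> carrier (Re D)" and m: "m \<in> mcar M"
  note r0 = in_Re_Tdeg[OF r]
  show "mal M r m \<in> mcar M" using m r0 by (simp add: mal_def mact_closed)
  show "mal M r (m - m') = mal M r m - mal M r m'" if "m' \<in> mcar M"
    using m r0 that by (simp add: mal_def mact_diff)
  assume s: "s \<in> carrier (Re D)"
  have "mact M m (Tcl D (frag_of (Sc r) + frag_of (Sc s))) =
      mact M m (Tcl D (frag_of (Sc r))) + mact M m (Tcl D (frag_of (Sc s)))"
    by (rule mact_Tcl_add) (use m r s in \<open>auto simp: keys_frag_of hom_words_Sc\<close>)
  then show "mal M (r \<oplus>\<^bsub>Re D\<^esub> s) m = mal M r m + mal M s m"
    using T.tcl_Sc_add[OF r s] by (simp add: mal_def in_Re_def)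
  have "mact M m (Tcl D (tmult (Re D) (WW D) (frag_of (Sc r)) (frag_of (Sc s)))) =
      mact M (mact M m (Tcl D (frag_of (Sc r)))) (Tcl D (frag_of (Sc s)))"
    by (rule mact_Tcl_mult) (use m r s in \<open>auto simp: keys_frag_of hom_words_Sc\<close>)
  then show "mal M (r \<otimes>\<^bsub>Re D\<^esub> s) m = mal M s (mal M r m)"
    by (simp add: mal_def in_Re_def tmult_of)
next
  fix r and w w' :: "('a, 'p) w_el" and m m' :: 'm
  assume w: "w \<in> bcarrier (WW D)" and m: "m \<in> mcar M"
  obtain \<gamma> \<delta> where wg: "w = (\<gamma>, \<delta>)" by force
  then have g: "\<gamma> \<in> W0" using w by simp
  note g0 = in_W0_Tdeg[OF g]
  show "mbe M w m \<in> mcar M" using m g0 by (simp add: mbe_def wg mact_closed)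
  show "mbe M w (m - m') = mbe M w m - mbe M w m'" if "m' \<in> mcar M"
    using m g0 that by (simp add: mbe_def wg mact_diff)
  show "mbe M (w + w') m = mbe M w m + mbe M w' m" if w': "w' \<in> bcarrier (WW D)"
  proof -
    obtain \<gamma>' \<delta>' where wg': "w' = (\<gamma>', \<delta>')" by force
    then have g': "\<gamma>' \<in> W0" using w' by simp
    have "mact M m (Tcl D (frag_of (Tw [(\<gamma>, 0)]) + frag_of (Tw [(\<gamma>', 0)]))) =
        mact M m (Tcl D (frag_of (Tw [(\<gamma>, 0)]))) + mact M m (Tcl D (frag_of (Tw [(\<gamma>', 0)])))"
      by (rule mact_Tcl_add) (use m g g' in \<open>auto simp: keys_frag_of W0_word\<close>)
    then show ?thesis using T.tcl_Tw_add[of "(\<gamma>, 0)" "(\<gamma>', 0)"] g g'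
      by (simp add: mbe_def wg wg' in_W0_def W_0 diag_idems)
  qed
  assume r: "r \<in> carrier (Re D)"
  obtain a b where ab: "r = (a, b)" by force
  have "mact M m (Tcl D (tmult (Re D) (WW D) (frag_of (Sc r)) (frag_of (Tw [(\<gamma>, 0)])))) =
      mact M (mact M m (Tcl D (frag_of (Sc r)))) (Tcl D (frag_of (Tw [(\<gamma>, 0)])))"
    by (rule mact_Tcl_mult) (use m r g in \<open>auto simp: keys_frag_of hom_words_Sc W0_word\<close>)
  then show "mbe M (lact (WW D) r w) m = mbe M w (mal M r m)"
    by (simp add: mbe_def mal_def wg ab in_W0_def in_Re_def tmult_of)
  have "mact M m (Tcl D (tmult (Re D) (WW D) (frag_of (Tw [(\<gamma>, 0)])) (frag_of (Sc r)))) =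
      mact M (mact M m (Tcl D (frag_of (Tw [(\<gamma>, 0)])))) (Tcl D (frag_of (Sc r)))"
    by (rule mact_Tcl_mult) (use m r g in \<open>auto simp: keys_frag_of hom_words_Sc W0_word\<close>)
  then show "mbe M (ract (WW D) w r) m = mal M r (mbe M w m)"
    by (simp add: mbe_def mal_def wg ab in_W0_def in_Re_def tmult_of)
qed (auto simp: mod_0 mod_diff)

abbreviation (input) "mrep \<equiv> talg_rep.act (mal M) (mbe M)"

lemma foldl_mact:
  "ws \<noteq> [] \<Longrightarrow> deg_word 0 ws \<Longrightarrow> m \<in> mcar M \<Longrightarrow>
    foldl (\<lambda>u w. mbe M w u) m ws = mact M m (Tcl D (frag_of (Tw ws)))"
proof (induction ws arbitrary: m)
  case (Cons w ws)
  obtain \<gamma> where w: "w = (\<gamma>, 0)" "\<gamma> \<in> W0" "deg_word 0 ws"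
    using Cons.prems by (cases w) (auto simp: deg_word_Cons letters_iff)
  show ?case
  proof (cases "ws = []")
    case True
    then show ?thesis by (simp add: w mbe_def in_W0_def)
  next
    case False
    have "mact M m (Tcl D (tmult (Re D) (WW D) (frag_of (Tw [w])) (frag_of (Tw ws)))) =
        mact M (mact M m (Tcl D (frag_of (Tw [w])))) (Tcl D (frag_of (Tw ws)))"
      by (rule mact_Tcl_mult) (use Cons.prems w False in \<open>auto simp: keys_frag_of hom_words_Tw deg_word_Cons deg_word_Nil letters_iff\<close>)
    then show ?thesis using Cons.IH[OF False w(3), of "mbe M w m"] Cons.prems in_W0_Tdeg[OF w(2)]
      by (simp add: w(1) mbe_def in_W0_def tmult_of mact_closed)
  qed
qed simp

text \<open>In degree zero the representation returns the given module structure: both are additive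
  and multiplicative and they agree on scalars and letters.\<close>

lemma act_mact:
  assumes x: "Poly_Mapping.keys x \<subseteq> hom_words D 0" and m: "m \<in> mcar M"
  shows "mrep x m = mact M m (Tcl D x)"
proof -
  interpret M: talg_rep "Re D" "WW D" "mcar M" "mal M" "mbe M" by (rule module_rep)
  from x have "Poly_Mapping.keys x \<subseteq> hom_words D 0 \<and> M.act x m = mact M m (Tcl D x)"
  proof (induction x rule: frag_induction)
    case zero
    show ?case using mact_Tcl_diff[OF m, of 0 0] by (simp add: M.act_0_left)
  next
    case (one a)
    then show ?case
      by (cases a) (auto simp: M.act_of keys_frag_of hom_words_Tw hom_words_Sc foldl_mact m
          mal_def[of M _ m] in_Re_def)
  next
    case (diff a b)
    then show ?case by (auto simp: M.act_diff_left mact_Tcl_diff m dest: keys_diff_subset[of a _ b])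
  qed
  then show ?thesis by simp
qed

lemma mact_scalar: "mod_scale (T0alg D) M c m = mal M (cscal c) m"
  by (simp add: mod_scale_def TT_scalar mal_def)

end

end

section \<open>Morphisms of modules over the ditalgebra\<close>

context ring_bimodule
begin

lemma keys_tmult:
  assumes "Poly_Mapping.keys x \<subseteq> twords R W" "Poly_Mapping.keys y \<subseteq> twords R W"
  shows "Poly_Mapping.keys (tmult R W x y) \<subseteq> twords R W"
proof -
  have "Poly_Mapping.keys (frag_extend (\<lambda>b. frag_of (tword_mult R W a b)) y) \<subseteq> twords R W"
    if "a \<in> twords R W" for a
    using keys_frag_extend[of "\<lambda>b. frag_of (tword_mult R W a b)" y] that assms(2)
    by (auto simp: keys_frag_of dest!: subsetD intro: tword_mult_closed)
  then show ?thesis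
    using keys_frag_extend[of "\<lambda>a. frag_extend (\<lambda>b. frag_of (tword_mult R W a b)) y" x] assms(1)
    unfolding tmult_def by fast
qed

end

context talg_rep
begin

lemma \<alpha>_0: "r \<in> carrier R \<Longrightarrow> \<alpha> r 0 = 0" and \<beta>_0: "w \<in> bcarrier W \<Longrightarrow> \<beta> w 0 = 0"
  using \<alpha>_diff[of r 0 0] \<beta>_diff[of w 0 0] C_0 by auto

lemma \<alpha>_plus: "r \<in> carrier R \<Longrightarrow> u \<in> C \<Longrightarrow> v \<in> C \<Longrightarrow> \<alpha> r (u + v) = \<alpha> r u + \<alpha> r v"
  using \<alpha>_diff[of r "u + v" v] by (simp add: C_add)

lemma act_0: "Poly_Mapping.keys x \<subseteq> twords R W \<Longrightarrow> act x 0 = 0"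
  using act_diff[of x 0 0] C_0 by simp

lemma act_add: "Poly_Mapping.keys x \<subseteq> twords R W \<Longrightarrow> u \<in> C \<Longrightarrow> v \<in> C \<Longrightarrow> act x (u + v) = act x u + act x v"
  using act_diff[of x "u + v" v] by (simp add: C_add)

end

context ext_poset
begin

lemma cscal_central:
  assumes "r \<in> carrier (Re D)"
  shows "cscal c \<otimes>\<^bsub>Re D\<^esub> r = r \<otimes>\<^bsub>Re D\<^esub> cscal c"
proof (rule Re_eqI)
  show "rc (cscal c \<otimes>\<^bsub>Re D\<^esub> r) x = rc (r \<otimes>\<^bsub>Re D\<^esub> cscal c) x" if "x \<in> uPm D" for x
    using that rc_in[OF assms that]
    by (simp add: Re_mult_rc assms cscal_Re rc_cscal scal_l scal_r eps_l eps_r)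
qed (use assms in \<open>simp_all add: Re_mult_closed cscal_Re\<close>)

lemma mscale_apply: "mscale sc c X i j = sc c (X i j)"
  by (simp add: mscale_def)

lemma mscale_SS: "t \<in> SS D \<Longrightarrow> mscale (scal D) c t \<in> SS D"
proof (rule SS_I)
  fix i assume t: "t \<in> SS D" and i: "i \<in> uPm D"
  then have "scal D c (eps D i) * t i i \<in> RR D i i" by (intro RR_mult[of i i i] scal_eps SS_in) auto
  then show "mscale (scal D) c t i i \<in> RR D i i"
    using eps_l[OF SS_in[OF t i]] i by (simp add: mscale_def scal_l)
qed (auto simp: mscale_def SS_zero scal_0)

text \<open>The field acts centrally on \<open>J\<close>: a scalar to the right of \<open>u\<close>
  may be moved to its left and then leaves \<open>\<gamma>\<close> by left linearity. This is what
  makes the maps \<open>f\<^sup>1(v)\<close> linear over \<open>K\<close>.\<close>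

lemma dual_scalar:
  assumes e: "diag_idem e" and g: "\<gamma> \<in> peirceD D (ehat D) e"
  shows "dual_l D (mscale (scal D) c (ehat D)) \<gamma> = dual_r D \<gamma> (mscale (scal D) c e)"
proof (rule ext)
  fix u
  have gJ: "\<gamma> \<in> dualJ D" using e g by (rule W_dualJ)
  show "dual_l D (mscale (scal D) c (ehat D)) \<gamma> u = dual_r D \<gamma> (mscale (scal D) c e) u"
  proof (cases "u \<in> JJ D")
    case True
    let ?s = "mscale (scal D) c (mone (uPm D) (eps D))"
    have "mone (uPm D) (eps D) \<in> SS D" by (auto simp: SS_iff mone_def eps_in)
    then have s: "?s \<in> SS D" by (rule mscale_SS)
    have mo: "mone (uPm D) (eps D) i i = eps D i" if "i \<in> uPm D" for i using that by (simp add: mone_def)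
    have eS: "e \<in> SS D" using e by (rule diag_idem_SS)
    have "mm D u (mscale (scal D) c (ehat D)) = mm D ?s u"
    proof (rule JJ_eqI)
      fix i j assume ij: "i \<in> uPm D" "j \<in> uPm D" "i < j"
      then have "j \<in> Pm D" by (auto simp: Pm_iff)
      then show "mm D u (mscale (scal D) c (ehat D)) i j = mm D ?s u i j"
        using ij eps_l[OF JJ_in[OF True ij]] eps_r[OF JJ_in[OF True ij]]
        by (simp add: mm_SS_left[OF s] mm_SS_right mscale_SS ehat_SS mscale_apply mo
            ehat_apply scal_l scal_r)
    qed (use True s in \<open>simp_all add: JJ_mm_SS JJ_SS_mm mscale_SS ehat_SS\<close>)
    then have "dual_l D (mscale (scal D) c (ehat D)) \<gamma> u = mm D ?s (\<gamma> u)"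
      using True by (simp add: dual_l_def dualJ_lin[OF gJ s True])
    also have "\<dots> = mm D (\<gamma> u) (mscale (scal D) c e)"
    proof (rule SS_eqI)
      fix i assume i: "i \<in> uPm D"
      have "\<gamma> u i i * e i i = \<gamma> u i i"
        using g eS unfolding peirceD_ehat[OF e] dual_r_def by (metis mm_SS_right)
      then show "mm D ?s (\<gamma> u) i i = mm D (\<gamma> u) (mscale (scal D) c e) i i"
        using i eps_l[OF SS_in[OF dualJ_SS[OF gJ True] i]]
        by (simp add: mm_SS_left[OF s] mm_SS_right mscale_SS eS mscale_apply mo scal_l scal_r)
    qed (intro SS_mm s mscale_SS eS dualJ_SS gJ True)+
    finally show ?thesis by (simp add: dual_r_def)
  qed (simp add: dual_l_def dual_r_def dualJ_out[OF gJ])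
qed

lemma cscal_W:
  assumes "w \<in> bcarrier (WW D)"
  shows "lact (WW D) (cscal c) w = ract (WW D) w (cscal c)"
  using assms by (cases w) (simp add: cscal_def dual_scalar diag_idems)

lemma cscal_1: "cscal 1 = \<one>\<^bsub>Re D\<^esub>"
  by (simp add: cscal_def mscale_def scal_1)

lemma cscal_minus: "cscal (- 1) + cscal 1 = 0"
  by (simp add: cscal_def mscale_def scal_1 scal_minus fun_eq_iff zero_prod_def)

text \<open>A word of positive degree contains a letter of \<open>W\<^sub>1\<close>, and these act
  on \<open>M\<close> by zero.\<close>

lemma deg_word_foldl_0:
  assumes M: "De_mod M"
  shows "deg_word (Suc n) ws \<Longrightarrow> m \<in> mcar M \<Longrightarrow> foldl (\<lambda>u w. mbe M w u) m ws = 0"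
proof (induction ws arbitrary: m)
  case (Cons w ws)
  interpret M: talg_rep "Re D" "WW D" "mcar M" "mal M" "mbe M" by (rule module_rep[OF M])
  have Z: "foldl (\<lambda>u w. mbe M w u) 0 ws = 0"  if "set ws \<subseteq> bcarrier (WW D)" for ws
    using that by (induction ws) (simp_all del: WW_simps add: M.\<beta>_0)
  from Cons.prems(1) consider "w \<in> letters D 0" "deg_word (Suc n) ws" | "w \<in> letters D 1" "deg_word n ws"
    by (auto simp: deg_word_Cons)
  then show ?case
  proof cases
    case 1
    then show ?thesis using Cons.IH[of "mbe M w m"] Cons.prems(2) M.\<beta>_closed[OF letters_W] by simp
  next
    case 2
    then have "mbe M w m = mbe M 0 m" by (cases w) (simp add: letters_iff mbe_def)
    also have "\<dots> = 0"
      using M.\<beta>_add[of 0 0 m] Cons.prems(2) by (simp add: zero_prod_def W_0 diag_idems)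
    finally show ?thesis using Z[OF deg_word_W[OF 2(2)]] by simp
  qed
qed (simp add: deg_word_Nil)

text \<open>Conditions on a family of maps indexed by \<open>w\<^sub>1 \<delta> \<in> W\<^sub>1\<close> for being the restriction of
  the second component \<open>f\<^sup>1\<close> of a morphism.\<close>

definition bimap ::
    "(('a, 'p) t_el, 'm::ab_group_add) rmod \<Rightarrow> (('a, 'p) t_el, 'n::ab_group_add) rmod \<Rightarrow>
     (('a, 'p) dual \<Rightarrow> 'm \<Rightarrow> 'n) \<Rightarrow> bool" where
  "bimap M N \<phi> \<longleftrightarrow>
     (\<forall>\<delta>\<in>W1. \<forall>m\<in>mcar M. \<phi> \<delta> m \<in> mcar N) \<and>
     (\<forall>\<delta>\<in>W1. \<forall>m\<in>mcar M. \<forall>m'\<in>mcar M. \<phi> \<delta> (m - m') = \<phi> \<delta> m - \<phi> \<delta> m') \<and>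
     (\<forall>\<delta>\<in>W1. \<forall>\<delta>'\<in>W1. \<forall>m\<in>mcar M. \<phi> (\<delta> + \<delta>') m = \<phi> \<delta> m + \<phi> \<delta>' m) \<and>
     (\<forall>a b. (a, b) \<in> carrier (Re D) \<longrightarrow> (\<forall>\<delta>\<in>W1. \<forall>m\<in>mcar M.
        \<phi> (dual_l D a \<delta>) m = \<phi> \<delta> (mal M (a, b) m) \<and> \<phi> (dual_r D \<delta> a) m = mal N (a, b) (\<phi> \<delta> m)))"

definition pal where "pal M N = sum_act (mal M) (mal N)"

definition pbe where "pbe M N \<phi> = ext_act (mbe M) (mbe N) (\<lambda>w. \<phi> (snd w))"

text \<open>Letting \<open>w\<^sub>1 \<delta>\<close> act on \<open>M \<oplus> N\<close> by \<open>\<phi> \<delta> : M \<rightarrow> N\<close> makes \<open>M \<oplus> N\<close> a module over \<open>T\<close>. An element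
  of \<open>T\<^sub>1\<close> then maps \<open>M\<close> to \<open>N\<close>, and this is the only possible \<open>f\<^sup>1\<close> restricting to \<open>\<phi>\<close>.\<close>

definition tmap where
  "tmap M N \<phi> t m = snd (talg_rep.tact (pal M N) (pbe M N \<phi>) t (m, 0))"

end

section \<open>The action of \<open>T\<close> on \<open>M \<oplus> N\<close>\<close>

locale bimap_pair = ext_poset D
  for D :: "('k::field, 'a::ring_1, 'p::order) eposet" +
  fixes M :: "(('a, 'p) t_el, 'm::ab_group_add) rmod" and N :: "(('a, 'p) t_el, 'n::ab_group_add) rmod"
    and \<phi> :: "('a, 'p) dual \<Rightarrow> 'm \<Rightarrow> 'n"
  assumes M: "right_module (T0alg D) M" and N: "right_module (T0alg D) N"
    and bm: "bimap M N \<phi>"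
begin

sublocale MR: talg_rep "Re D" "WW D" "mcar M" "mal M" "mbe M"
  by (rule module_rep[OF M])

sublocale NR: talg_rep "Re D" "WW D" "mcar N" "mal N" "mbe N"
  by (rule module_rep[OF N])

lemma bm_closed: "\<delta> \<in> W1 \<Longrightarrow> m \<in> mcar M \<Longrightarrow> \<phi> \<delta> m \<in> mcar N"
  and bm_diff: "\<delta> \<in> W1 \<Longrightarrow> m \<in> mcar M \<Longrightarrow> m' \<in> mcar M \<Longrightarrow> \<phi> \<delta> (m - m') = \<phi> \<delta> m - \<phi> \<delta> m'"
  and bm_add: "\<delta> \<in> W1 \<Longrightarrow> \<delta>' \<in> W1 \<Longrightarrow> m \<in> mcar M \<Longrightarrow> \<phi> (\<delta> + \<delta>') m = \<phi> \<delta> m + \<phi> \<delta>' m"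
  and bm_l: "(a, b) \<in> carrier (Re D) \<Longrightarrow> \<delta> \<in> W1 \<Longrightarrow> m \<in> mcar M \<Longrightarrow> \<phi> (dual_l D a \<delta>) m = \<phi> \<delta> (mal M (a, b) m)"
  and bm_r: "(a, b) \<in> carrier (Re D) \<Longrightarrow> \<delta> \<in> W1 \<Longrightarrow> m \<in> mcar M \<Longrightarrow> \<phi> (dual_r D \<delta> a) m = mal N (a, b) (\<phi> \<delta> m)"
  using bm unfolding bimap_def by blast+

lemma bm_0: "\<delta> \<in> W1 \<Longrightarrow> \<phi> \<delta> 0 = 0"
  using bm_diff[of \<delta> 0 0] MR.C_0 by simp

lemma bm_zero: "m \<in> mcar M \<Longrightarrow> \<phi> 0 m = 0"
  using bm_add[of 0 0 m] by (simp add: W_0 diag_idems)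

sublocale P: talg_rep "Re D" "WW D" "mcar M \<times> mcar N" "pal M N" "pbe M N \<phi>"
  unfolding pal_def pbe_def
proof (rule ext_talg_rep[OF MR.talg_rep_axioms NR.talg_rep_axioms])
  fix r w v assume "r \<in> carrier (Re D)" "w \<in> bcarrier (WW D)" "v \<in> mcar M"
  then show "\<phi> (snd (lact (WW D) r w)) v = \<phi> (snd w) (mal M r v)"
    "\<phi> (snd (ract (WW D) w r)) v = mal N r (\<phi> (snd w) v)"
    by (cases w; cases r; simp add: bm_l bm_r)+
qed (auto simp: bm_closed bm_diff bm_add)

lemma pbe_apply: "pbe M N \<phi> w (m, n) = (mbe M w m, mbe N w n + \<phi> (snd w) m)"
  and pal_apply: "pal M N r (m, n) = (mal M r m, mal N r n)"
  by (simp_all add: pbe_def ext_act_def pal_def sum_act_def)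

lemma snd_W1: "w \<in> bcarrier (WW D) \<Longrightarrow> snd w \<in> W1"
  by (cases w) simp

lemma fst_act:
  assumes "Poly_Mapping.keys x \<subseteq> twords (Re D) (WW D)" "m \<in> mcar M" "n \<in> mcar N"
  shows "fst (P.act x (m, n)) = MR.act x m"
  using act_hom[OF P.talg_rep_axioms MR.talg_rep_axioms, of fst x "(m, n)"] assms
  by (auto simp: pal_apply pbe_apply)

text \<open>A letter of degree zero has second component \<open>0\<close>, where
  \<open>\<phi>\<close> vanishes. So degree zero acts diagonally and nothing from \<open>M\<close>
  reaches \<open>N\<close>.\<close>

lemma snd_act_deg0:
  assumes "Poly_Mapping.keys x \<subseteq> hom_words D 0" "m \<in> mcar M" "n \<in> mcar N"
  shows "snd (P.act x (m, n)) = mact N n (Tcl D x)"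
proof -
  have fold: "snd (foldl (\<lambda>u w. pbe M N \<phi> w u) (m, n) ws) = foldl (\<lambda>u w. mbe N w u) n ws"
    if "deg_word 0 ws" "m \<in> mcar M" "n \<in> mcar N" for ws m n
    using that
  proof (induction ws arbitrary: m n)
    case (Cons w ws)
    then have w: "w \<in> letters D 0" "deg_word 0 ws" by (simp_all add: deg_word_Cons)
    then have "snd w = 0" by (cases w) (simp add: letters_iff)
    then show ?case using Cons.IH[OF w(2), of "mbe M w m" "mbe N w n"] Cons.prems(2,3) letters_W[OF w(1)]
      by (simp add: pbe_apply bm_zero MR.\<beta>_closed NR.\<beta>_closed del: WW_simps)
  qed simp
  have "snd (P.act x (m, n)) = NR.act x n"
    using assms(1)
  proof (induction x rule: frag_induction)
    case (one w)
    then show ?case using fold[OF _ assms(2,3)]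
      by (cases w) (auto simp: P.act_of NR.act_of hom_words_Sc hom_words_Tw pal_apply)
  qed (auto simp: P.act_0_left NR.act_0_left P.act_diff_left NR.act_diff_left)
  then show ?thesis using act_mact[OF N assms(1,3)] by simp
qed

lemma act_deg_pos:
  assumes "Poly_Mapping.keys x \<subseteq> hom_words D (Suc n)" "m \<in> mcar M"
  shows "MR.act x m = 0"
  using assms(1)
proof (induction x rule: frag_induction)
  case (one w)
  then show ?case using deg_word_foldl_0[OF M] assms(2)
    by (cases w) (auto simp: MR.act_of hom_words_Sc hom_words_Tw)
qed (auto simp: MR.act_0_left MR.act_diff_left)

abbreviation "f1 \<equiv> tmap M N \<phi>"

lemma f1_Tcl: "m \<in> mcar M \<Longrightarrow> f1 (Tcl D x) m = snd (P.act x (m, 0))"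
  by (simp add: tmap_def P.tact_tcl NR.C_0)

lemma act_deg1:
  assumes "Poly_Mapping.keys x \<subseteq> hom_words D 1" "m \<in> mcar M"
  shows "P.act x (m, 0) = (0, f1 (Tcl D x) m)"
  using fst_act[of x m 0] act_deg_pos[of x 0 m] assms hom_words_twords[of 1]
  by (simp add: f1_Tcl prod_eq_iff NR.C_0)

lemma f1_closed:
  assumes "Poly_Mapping.keys x \<subseteq> twords (Re D) (WW D)" "m \<in> mcar M"
  shows "f1 (Tcl D x) m \<in> mcar N"
proof -
  have "P.act x (m, 0) \<in> mcar M \<times> mcar N" by (rule P.act_closed) (use assms NR.C_0 in auto)
  then show ?thesis using assms by (simp add: f1_Tcl mem_Times_iff)
qed

lemma f1_diff:
  assumes "Poly_Mapping.keys x \<subseteq> twords (Re D) (WW D)" "m \<in> mcar M" "m' \<in> mcar M"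
  shows "f1 (Tcl D x) (m - m') = f1 (Tcl D x) m - f1 (Tcl D x) m'"
  using P.act_diff[of x "(m, 0)" "(m', 0)"] assms by (simp add: f1_Tcl MR.C_diff NR.C_0)

lemma f1_plus:
  assumes "Poly_Mapping.keys x \<subseteq> twords (Re D) (WW D)" "m \<in> mcar M" "m' \<in> mcar M"
  shows "f1 (Tcl D x) (m + m') = f1 (Tcl D x) m + f1 (Tcl D x) m'"
  using P.act_add[of x "(m, 0)" "(m', 0)"] assms by (simp add: f1_Tcl MR.C_add NR.C_0)

lemma f1_add: "m \<in> mcar M \<Longrightarrow> f1 (Tcl D (x + y)) m = f1 (Tcl D x) m + f1 (Tcl D y) m"
  and f1_sub: "m \<in> mcar M \<Longrightarrow> f1 (Tcl D (x - y)) m = f1 (Tcl D x) m - f1 (Tcl D y) m"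
  and f1_zero: "m \<in> mcar M \<Longrightarrow> f1 (Tcl D 0) m = 0"
  by (simp_all add: f1_Tcl P.act_add_left P.act_diff_left P.act_0_left)

lemma f1_W1: "\<delta> \<in> W1 \<Longrightarrow> m \<in> mcar M \<Longrightarrow> f1 (in_W1 D \<delta>) m = \<phi> \<delta> m"
  using NR.\<beta>_0[of "(0, \<delta>)"]
  by (simp add: in_W1_def f1_Tcl P.act_of pbe_apply W_0 diag_idems)

text \<open>Multiplicativity of the action on \<open>M \<oplus> N\<close>: a factor of degree zero
  keeps \<open>(m, 0)\<close> inside \<open>M\<close>. For \<open>f1_right\<close> the factor of
  degree zero acts last, when the element already lies in \<open>N\<close>.\<close>

lemma f1_left:
  assumes x: "Poly_Mapping.keys x \<subseteq> hom_words D 0" and y: "Poly_Mapping.keys y \<subseteq> twords (Re D) (WW D)"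
    and m: "m \<in> mcar M"
  shows "f1 (Tcl D (tmult (Re D) (WW D) x y)) m = f1 (Tcl D y) (mact M m (Tcl D x))"
proof -
  have x': "Poly_Mapping.keys x \<subseteq> twords (Re D) (WW D)" using x hom_words_twords by blast
  have "mact N 0 (Tcl D x) = 0"
    using NR.act_0[OF x'] act_mact[OF N x NR.C_0] by simp
  then have "P.act x (m, 0) = (mact M m (Tcl D x), 0)"
    using fst_act[OF x' m NR.C_0] snd_act_deg0[OF x m NR.C_0] act_mact[OF M x m] by (simp add: prod_eq_iff)
  then show ?thesis
    using m P.act_mult[OF x' y, of "(m, 0)"] mact_closed[OF M m Tdeg_I[OF x]] by (simp add: f1_Tcl NR.C_0)
qed

lemma f1_right:
  assumes x: "Poly_Mapping.keys x \<subseteq> hom_words D 1" and y: "Poly_Mapping.keys y \<subseteq> hom_words D 0"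
    and m: "m \<in> mcar M"
  shows "f1 (Tcl D (tmult (Re D) (WW D) x y)) m = mact N (f1 (Tcl D x) m) (Tcl D y)"
proof -
  have x': "Poly_Mapping.keys x \<subseteq> twords (Re D) (WW D)" "Poly_Mapping.keys y \<subseteq> twords (Re D) (WW D)"
    using x y hom_words_twords by blast+
  show ?thesis
    using m P.act_mult[OF x', of "(m, 0)"] act_deg1[OF x m] snd_act_deg0[OF y MR.C_0 f1_closed[OF x'(1) m]]
    by (simp add: f1_Tcl[of m "tmult (Re D) (WW D) x y"] NR.C_0)
qed

text \<open>Scalars commute with \<open>R\<^sup>e\<close> and with the letters, so acting by a
  scalar is an endomorphism of the representation \<open>M \<oplus> N\<close> and commutes with
  every element of \<open>T\<close>.\<close>

lemma f1_scalar:
  assumes x: "Poly_Mapping.keys x \<subseteq> twords (Re D) (WW D)" and m: "m \<in> mcar M"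
  shows "f1 (Tcl D x) (mal M (cscal c) m) = mal N (cscal c) (f1 (Tcl D x) m)"
proof -
  have "pal M N (cscal c) (P.act x (m, 0)) = P.act x (pal M N (cscal c) (m, 0))"
  proof (rule act_hom[OF P.talg_rep_axioms P.talg_rep_axioms])
    fix r u assume "r \<in> carrier (Re D)" "u \<in> mcar M \<times> mcar N"
    then show "pal M N (cscal c) (pal M N r u) = pal M N r (pal M N (cscal c) u)"
      using P.\<alpha>_mult[of r "cscal c" u] P.\<alpha>_mult[of "cscal c" r u] by (simp add: cscal_Re cscal_central)
  next
    fix w u assume "w \<in> bcarrier (WW D)" "u \<in> mcar M \<times> mcar N"
    then show "pal M N (cscal c) (pbe M N \<phi> w u) = pbe M N \<phi> w (pal M N (cscal c) u)"
      using P.\<beta>_lact[of "cscal c" w u] P.\<beta>_ract[of "cscal c" w u] by (simp add: cscal_Re cscal_W del: WW_simps)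
  qed (use x m NR.C_0 in \<open>auto simp: P.\<alpha>_closed P.\<alpha>_diff cscal_Re simp del: mem_Times_iff\<close>)
  moreover have "snd (pal M N r u) = mal N r (snd u)" for r u by (cases u) (simp add: pal_apply)
  ultimately have "mal N (cscal c) (snd (P.act x (m, 0))) = snd (P.act x (mal M (cscal c) m, 0))"
    using NR.\<alpha>_0[OF cscal_Re] by (metis pal_apply)
  then show ?thesis using m by (simp add: f1_Tcl MR.\<alpha>_closed cscal_Re)
qed

end

section \<open>The differential on representatives\<close>

locale ditalgebra = ext_poset_basis D B
  for D :: "('k::field, 'a::ring_1, 'p::order) eposet" and B :: "('a, 'p) imat set" +
  fixes d :: "('a, 'p) t_el \<Rightarrow> ('a, 'p) t_el"
  assumes diff: "is_differential D B d"
begin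

abbreviation "BJ \<equiv> B \<inter> peirceJ D (ehat D) (ehat D)"

lemma d_deg: "t \<in> Tdeg D n \<Longrightarrow> d t \<in> Tdeg D (Suc n)"
  and d_add: "s \<in> carrier (TT D) \<Longrightarrow> t \<in> carrier (TT D) \<Longrightarrow> d (s \<oplus>\<^bsub>TT D\<^esub> t) = d s \<oplus>\<^bsub>TT D\<^esub> d t"
  and d_Re: "r \<in> carrier (Re D) \<Longrightarrow> d (in_Re D r) = \<zero>\<^bsub>TT D\<^esub>"
  and d_mult: "a \<in> Tdeg D n \<Longrightarrow> b \<in> carrier (TT D) \<Longrightarrow>
    d (a \<otimes>\<^bsub>TT D\<^esub> b) = d a \<otimes>\<^bsub>TT D\<^esub> b \<oplus>\<^bsub>TT D\<^esub> ((-1) ^ n) \<odot>\<^bsub>TT D\<^esub> (a \<otimes>\<^bsub>TT D\<^esub> d b)"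
  using diff unfolding is_differential_def by blast+

lemma d_W0:
  "\<gamma> \<in> W0 \<Longrightarrow> d (in_W0 D \<gamma>) = Tcl D (- (\<Sum>p\<in>BJ. \<Sum>q\<in>B \<inter> peirceJ D (ee D Bot) (ehat D).
     frag_of (Tw [(0, dual_el p), (dual_r D (dual_el q) (\<gamma> (mm D q p)), 0)])))"
  and d_W1: "\<delta> \<in> W1 \<Longrightarrow> d (in_W1 D \<delta>) = Tcl D (- (\<Sum>p\<in>BJ. \<Sum>q\<in>BJ.
     frag_of (Tw [(0, dual_el p), (0, dual_r D (dual_el q) (\<delta> (mm D q p)))])))"
  using diff unfolding is_differential_def by blast+

lemma d_Tcl:
  assumes "Poly_Mapping.keys x \<subseteq> hom_words D n"
  obtains x' where "Poly_Mapping.keys x' \<subseteq> hom_words D (Suc n)" "d (Tcl D x) = Tcl D x'"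
  using d_deg[OF Tdeg_I[OF assms]] by (auto simp: Tdeg_def)

lemma d_diff:
  assumes x: "Poly_Mapping.keys x \<subseteq> hom_words D n" and y: "Poly_Mapping.keys y \<subseteq> hom_words D n"
    and x': "d (Tcl D x) = Tcl D x'" and y': "d (Tcl D y) = Tcl D y'"
  shows "d (Tcl D (x - y)) = Tcl D (x' - y')"
proof -
  have xy: "Poly_Mapping.keys (x - y) \<subseteq> hom_words D n" using x y by (rule keys_diff_subset)
  obtain z' where z': "d (Tcl D (x - y)) = Tcl D z'" using d_Tcl[OF xy] by metis
  have "d (Tcl D (x - y) \<oplus>\<^bsub>TT D\<^esub> Tcl D y) = d (Tcl D (x - y)) \<oplus>\<^bsub>TT D\<^esub> d (Tcl D y)"
    by (rule d_add[OF Tdeg_carrier[OF Tdeg_I[OF xy]] Tdeg_carrier[OF Tdeg_I[OF y]]])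
  then have "Tcl D x' = Tcl D (z' + y')" by (simp add: TT_add x' y' z')
  then have "- (x' - (z' + y')) \<in> T.rel_hull" by (intro add_hull_uminus) (simp add: T.tcl_eq_iff)
  then show ?thesis by (simp add: z' T.tcl_eq_iff algebra_simps)
qed

lemma d_zero: "d (Tcl D 0) = Tcl D 0"
proof -
  obtain x' where "d (Tcl D 0) = Tcl D x'" by (rule d_Tcl[of 0 0]) auto
  then show ?thesis using d_diff[of 0 0 0 x' x'] by simp
qed

lemma Leibniz:
  assumes x: "Poly_Mapping.keys x \<subseteq> hom_words D n" and y: "Poly_Mapping.keys y \<subseteq> hom_words D k"
    and x': "Poly_Mapping.keys x' \<subseteq> hom_words D (Suc n)" "d (Tcl D x) = Tcl D x'"
    and y': "Poly_Mapping.keys y' \<subseteq> hom_words D (Suc k)" "d (Tcl D y) = Tcl D y'"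
  shows "d (Tcl D (tmult (Re D) (WW D) x y)) = Tcl D (tmult (Re D) (WW D) x' y +
    tmult (Re D) (WW D) (frag_of (Sc (cscal ((-1) ^ n)))) (tmult (Re D) (WW D) x y'))"
proof -
  have tw: "Poly_Mapping.keys x \<subseteq> twords (Re D) (WW D)" "Poly_Mapping.keys y \<subseteq> twords (Re D) (WW D)"
    "Poly_Mapping.keys x' \<subseteq> twords (Re D) (WW D)" "Poly_Mapping.keys y' \<subseteq> twords (Re D) (WW D)"
    using x y x'(1) y'(1) hom_words_twords by blast+
  show ?thesis
    using d_mult[OF Tdeg_I[OF x] Tdeg_carrier[OF Tdeg_I[OF y]]]
    by (simp add: TT_mult tw x' y' TT_smult TT_add)
qed

lemma Sc_keys: "Poly_Mapping.keys (frag_of (Sc (cscal c))) \<subseteq> hom_words D 0"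
  by (simp add: keys_frag_of hom_words_Sc cscal_Re)

lemma BJ_W1: "p \<in> BJ \<Longrightarrow> dual_el p \<in> W1"
  by (rule dual_el_peirceD[OF diag_idem_ehat])

lemma BJ_JJ: "p \<in> BJ \<Longrightarrow> p \<in> JJ D"
  by (simp add: B_JJ)

end

context talg_rep
begin

lemma \<beta>_sum:
  assumes "\<And>i. i \<in> I \<Longrightarrow> g i \<in> bcarrier W" "0 \<in> bcarrier W" "v \<in> C"
  shows "\<beta> (\<Sum>i\<in>I. g i) v = (\<Sum>i\<in>I. \<beta> (g i) v)"
proof -
  have 0: "\<beta> 0 v = 0" using \<beta>_add[of 0 0 v] assms by simp
  have "(\<Sum>i\<in>I. g i) \<in> bcarrier W \<and> \<beta> (\<Sum>i\<in>I. g i) v = (\<Sum>i\<in>I. \<beta> (g i) v)"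
    using assms(1)
    by (induction I rule: infinite_finite_induct) (auto simp: 0 assms w_add \<beta>_add simp del: plus_fun_apply zero_fun_apply)
  then show ?thesis by simp
qed

end

locale De_pair = ditalgebra D B d + bimap_pair D M N \<phi>
  for D :: "('k::field, 'a::ring_1, 'p::order) eposet" and B :: "('a, 'p) imat set"
    and d :: "('a, 'p) t_el \<Rightarrow> ('a, 'p) t_el"
    and M :: "(('a, 'p) t_el, 'm::ab_group_add) rmod" and N :: "(('a, 'p) t_el, 'n::ab_group_add) rmod"
    and \<phi> :: "('a, 'p) dual \<Rightarrow> 'm \<Rightarrow> 'n"
begin

lemma mact_W0_sum:
  assumes "\<And>i. i \<in> I \<Longrightarrow> \<gamma> i \<in> W0" "n \<in> mcar N"
  shows "mact N n (in_W0 D (\<Sum>i\<in>I. \<gamma> i)) = (\<Sum>i\<in>I. mact N n (in_W0 D (\<gamma> i)))"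
  using NR.\<beta>_sum[of I "\<lambda>i. (\<gamma> i, 0)" n] assms
  by (simp add: mbe_def W_0 diag_idems zero_prod_def fst_sum)

text \<open>In each term of the differential the letter of degree one acts first and carries
  \<open>m\<close> into \<open>N\<close>, where the letter of \<open>W\<^sub>0\<close> acts next.
  The sum over the second basis element is then evaluated by \<open>dual_sum\<close>.\<close>

lemma f1_d_W0:
  assumes g: "\<gamma> \<in> W0" and m: "m \<in> mcar M"
  shows "f1 (d (in_W0 D \<gamma>)) m = - (\<Sum>p\<in>BJ. mact N (\<phi> (dual_el p) m) (in_W0 D (dual_l D p \<gamma>)))"
proof -
  let ?B0 = "B \<inter> peirceJ D (ee D Bot) (ehat D)"
  have "f1 (d (in_W0 D \<gamma>)) m = - (\<Sum>p\<in>BJ. \<Sum>q\<in>?B0.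
      snd (P.act (frag_of (Tw [(0, dual_el p), (dual_r D (dual_el q) (\<gamma> (mm D q p)), 0)])) (m, 0)))"
    by (simp add: d_W0[OF g] f1_Tcl[OF m] P.act_uminus_left P.act_sum_left snd_sum)
  also have "\<dots> = - (\<Sum>p\<in>BJ. \<Sum>q\<in>?B0. mact N (\<phi> (dual_el p) m) (in_W0 D (dual_r D (dual_el q) (\<gamma> (mm D q p)))))"
  proof (intro arg_cong[of _ _ uminus] sum.cong refl)
    fix p q assume p: "p \<in> BJ" and q: "q \<in> ?B0"
    have "mbe M (0, dual_el p) m \<in> mcar M"
      by (rule MR.\<beta>_closed) (use BJ_W1[OF p] m in \<open>auto simp: W_0 diag_idems\<close>)
    moreover have "mbe N (0, dual_el p) 0 = 0"
      by (rule NR.\<beta>_0) (use BJ_W1[OF p] in \<open>auto simp: W_0 diag_idems\<close>)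
    ultimately show "snd (P.act (frag_of (Tw [(0, dual_el p), (dual_r D (dual_el q) (\<gamma> (mm D q p)), 0)])) (m, 0)) =
        mact N (\<phi> (dual_el p) m) (in_W0 D (dual_r D (dual_el q) (\<gamma> (mm D q p))))"
      by (simp add: P.act_of pbe_apply bm_zero) (simp add: mbe_def)
  qed
  also have "\<dots> = - (\<Sum>p\<in>BJ. mact N (\<phi> (dual_el p) m) (in_W0 D (dual_l D p \<gamma>)))"
  proof (intro arg_cong[of _ _ uminus] sum.cong refl)
    fix p assume p: "p \<in> BJ"
    have e: "diag_idem (ee D Bot)" by (simp add: diag_idems)
    have "(\<Sum>q\<in>?B0. mact N (\<phi> (dual_el p) m) (in_W0 D (dual_r D (dual_el q) (\<gamma> (mm D q p))))) =
        mact N (\<phi> (dual_el p) m) (in_W0 D (\<Sum>q\<in>?B0. dual_r D (dual_el q) (\<gamma> (mm D q p))))"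
      by (rule mact_W0_sum[symmetric])
        (auto intro!: peirceD_dual_r[OF e g dual_el_dualJ JJ_mm[OF B_JJ BJ_JJ[OF p]]] bm_closed[OF BJ_W1[OF p] m])
    then show "(\<Sum>q\<in>?B0. mact N (\<phi> (dual_el p) m) (in_W0 D (dual_r D (dual_el q) (\<gamma> (mm D q p))))) =
        mact N (\<phi> (dual_el p) m) (in_W0 D (dual_l D p \<gamma>))"
      by (simp add: dual_sum[OF e g BJ_JJ[OF p]])
  qed
  finally show ?thesis .
qed

definition dcond :: "('m \<Rightarrow> 'n) \<Rightarrow> bool" where
  "dcond f0 \<longleftrightarrow> (\<forall>a\<in>Tdeg D 0. \<forall>m\<in>mcar M. mact N (f0 m) a = f0 (mact M m a) + f1 (d a) m)"

text \<open>The condition passes to products. The Leibniz rule gives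
  \<open>f1 (d (a b)) m = (f1 (d a) m) b + f1 (d b) (m a)\<close>, and these two terms are the
  differences between \<open>f0(m) a b\<close>, \<open>f0(m a) b\<close> and
  \<open>f0(m a b)\<close>.\<close>

lemma dcond_extend:
  assumes f0: "\<And>m. m \<in> mcar M \<Longrightarrow> f0 m \<in> mcar N"
    and f0_diff: "\<And>m m'. m \<in> mcar M \<Longrightarrow> m' \<in> mcar M \<Longrightarrow> f0 (m - m') = f0 m - f0 m'"
    and f0_Re: "\<And>r m. r \<in> carrier (Re D) \<Longrightarrow> m \<in> mcar M \<Longrightarrow> f0 (mal M r m) = mal N r (f0 m)"
    and W0: "\<And>\<gamma> m. \<gamma> \<in> W0 \<Longrightarrow> m \<in> mcar M \<Longrightarrow>
      mact N (f0 m) (in_W0 D \<gamma>) = f0 (mact M m (in_W0 D \<gamma>)) + f1 (d (in_W0 D \<gamma>)) m"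
  shows "dcond f0"
proof -
  let ?P = "\<lambda>x. \<forall>m\<in>mcar M. mact N (f0 m) (Tcl D x) = f0 (mact M m (Tcl D x)) + f1 (d (Tcl D x)) m"
  have words: "?P (frag_of (Tw ws))" if "ws \<noteq> []" "deg_word 0 ws" for ws
    using that
  proof (induction ws)
    case (Cons w ws)
    obtain \<gamma> where w: "w = (\<gamma>, 0)" "\<gamma> \<in> W0" "deg_word 0 ws"
      using Cons.prems by (cases w) (auto simp: deg_word_Cons letters_iff)
    show ?case
    proof (cases "ws = []")
      case True
      then show ?thesis using W0[OF w(2)] by (simp add: w(1) in_W0_def)
    next
      case False
      let ?x = "frag_of (Tw [w])" and ?y = "frag_of (Tw ws)"
      have x: "Poly_Mapping.keys ?x \<subseteq> hom_words D 0" and y: "Poly_Mapping.keys ?y \<subseteq> hom_words D 0"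
        using w False by (simp_all add: keys_frag_of hom_words_Tw deg_word_Cons deg_word_Nil letters_iff)
      obtain x' where x': "Poly_Mapping.keys x' \<subseteq> hom_words D 1" "d (Tcl D ?x) = Tcl D x'"
        using d_Tcl[OF x] by auto
      obtain y' where y': "Poly_Mapping.keys y' \<subseteq> hom_words D 1" "d (Tcl D ?y) = Tcl D y'"
        using d_Tcl[OF y] by auto
      have tw: "Poly_Mapping.keys ?x \<subseteq> twords (Re D) (WW D)" "Poly_Mapping.keys y' \<subseteq> twords (Re D) (WW D)"
        using x y'(1) hom_words_twords by blast+
      have Tw: "Tcl D (frag_of (Tw (w # ws))) = Tcl D (tmult (Re D) (WW D) ?x ?y)"
        by (simp add: tmult_of)
      show ?thesis
      proof
        fix m assume m: "m \<in> mcar M"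
        let ?m' = "mact M m (Tcl D ?x)"
        have m': "?m' \<in> mcar M" using mact_closed[OF M m Tdeg_I[OF x]] .
        \<comment> \<open>In degree zero the sign of the Leibniz rule is the scalar
          \<open>1\<close>, which must be seen to act trivially.\<close>
        have sc: "mact M m (Tcl D (frag_of (Sc (cscal 1)))) = m"
          using mact_one[OF M m] by (simp add: TT_one in_Re_def cscal_1)
        have "f1 (d (Tcl D (tmult (Re D) (WW D) ?x ?y))) m =
            mact N (f1 (Tcl D x') m) (Tcl D ?y) + f1 (Tcl D y') ?m'"
          using Leibniz[OF x y, of x' y'] x' y' m
          by (simp add: f1_add f1_right[OF x'(1) y m] f1_left[OF Sc_keys T.keys_tmult[OF tw] m] sc
              f1_left[OF x tw(2) m])
        moreover have "mact N (f0 m) (Tcl D (tmult (Re D) (WW D) ?x ?y)) =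
            mact N (f0 ?m' + f1 (Tcl D x') m) (Tcl D ?y)"
          using W0[OF w(2) m] x'(2) mact_Tcl_mult[OF N f0[OF m] x y] by (simp add: w(1) in_W0_def)
        moreover have "\<dots> = mact N (f0 ?m') (Tcl D ?y) + mact N (f1 (Tcl D x') m) (Tcl D ?y)"
          using x'(1) hom_words_twords[of 1] m
          by (intro mact_add[OF N] f0 m' f1_closed Tdeg_I y) auto
        moreover have "mact N (f0 ?m') (Tcl D ?y) = f0 (mact M ?m' (Tcl D ?y)) + f1 (Tcl D y') ?m'"
          using Cons.IH[OF False w(3)] m' y'(2) by simp
        ultimately show "mact N (f0 m) (Tcl D (frag_of (Tw (w # ws)))) =
            f0 (mact M m (Tcl D (frag_of (Tw (w # ws))))) + f1 (d (Tcl D (frag_of (Tw (w # ws))))) m"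
          unfolding Tw by (simp add: mact_Tcl_mult[OF M m x y])
      qed
    qed
  qed simp
  have "Poly_Mapping.keys x \<subseteq> hom_words D 0 \<and> ?P x" if "Poly_Mapping.keys x \<subseteq> hom_words D 0" for x
    using that
  proof (induction x rule: frag_induction)
    case zero
    show ?case
      using mact_Tcl_diff[OF M, of _ 0 0] mact_Tcl_diff[OF N, of _ 0 0] f0 f0_diff[OF mod_0[OF M] mod_0[OF M]]
      by (auto simp: d_zero f1_zero)
  next
    case (one w)
    show ?case
    proof (cases w)
      case (Sc r)
      then show ?thesis using one d_Re[of r] f0_Re[of r]
        by (auto simp: keys_frag_of hom_words_Sc in_Re_def mal_def TT_zero f1_zero)
    qed (use one words in \<open>auto simp: keys_frag_of hom_words_Tw\<close>)
  next
    case (diff a b)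
    then have a: "Poly_Mapping.keys a \<subseteq> hom_words D 0" and b: "Poly_Mapping.keys b \<subseteq> hom_words D 0" by auto
    obtain a' where a': "d (Tcl D a) = Tcl D a'" using d_Tcl[OF a] by metis
    obtain b' where b': "d (Tcl D b) = Tcl D b'" using d_Tcl[OF b] by metis
    show ?case using diff f0 keys_diff_subset[OF a b]
      by (auto simp: d_diff[OF a b a' b'] a' b' f1_sub mact_Tcl_diff[OF M _ a b] mact_Tcl_diff[OF N _ a b]
          f0_diff mact_closed[OF M _ Tdeg_I[OF a]] mact_closed[OF M _ Tdeg_I[OF b]])
  qed
  then show ?thesis by (auto simp: dcond_def Tdeg_def)
qed

lemma De_morphism_f1:
  assumes f0: "\<And>m. m \<in> mcar M \<Longrightarrow> f0 m \<in> mcar N"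
    and f0_diff: "\<And>m m'. m \<in> mcar M \<Longrightarrow> m' \<in> mcar M \<Longrightarrow> f0 (m - m') = f0 m - f0 m'"
    and f0_Re: "\<And>r m. r \<in> carrier (Re D) \<Longrightarrow> m \<in> mcar M \<Longrightarrow> f0 (mal M r m) = mal N r (f0 m)"
    and dc: "dcond f0"
  shows "De_morphism D d M N (f0, f1)"
proof -
  have f0_add: "f0 (m + m') = f0 m + f0 m'" if "m \<in> mcar M" "m' \<in> mcar M" for m m'
    using f0_diff[of "m + m'" m'] that by (simp add: MR.C_add)
  have hom: "hom_K D M N (f1 v)" if vT: "v \<in> Tdeg D 1" for v
  proof -
    obtain x where v: "v = Tcl D x" "Poly_Mapping.keys x \<subseteq> hom_words D 1" using vT unfolding Tdeg_def by blast
    have x: "Poly_Mapping.keys x \<subseteq> twords (Re D) (WW D)" using v(2) hom_words_twords by blast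
    show ?thesis unfolding hom_K_def v(1)
      using x by (auto simp: f1_closed f1_plus f1_scalar mact_scalar[OF M] mact_scalar[OF N])
  qed
  have left: "f1 (a \<otimes>\<^bsub>TT D\<^esub> v) m = f1 v (mact M m a)" and right: "f1 (v \<otimes>\<^bsub>TT D\<^esub> a) m = mact N (f1 v m) a"
    if av: "a \<in> Tdeg D 0" "v \<in> Tdeg D 1" "m \<in> mcar M" for a v m
  proof -
    obtain x y where v: "v = Tcl D x" "Poly_Mapping.keys x \<subseteq> hom_words D 1"
      and a: "a = Tcl D y" "Poly_Mapping.keys y \<subseteq> hom_words D 0" using av(1,2) unfolding Tdeg_def by blast
    have xy: "Poly_Mapping.keys x \<subseteq> twords (Re D) (WW D)" "Poly_Mapping.keys y \<subseteq> twords (Re D) (WW D)"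
      using v(2) a(2) hom_words_twords by blast+
    show "f1 (a \<otimes>\<^bsub>TT D\<^esub> v) m = f1 v (mact M m a)" "f1 (v \<otimes>\<^bsub>TT D\<^esub> a) m = mact N (f1 v m) a"
      unfolding v(1) a(1)
      by (simp_all add: TT_mult xy f1_left[OF a(2) xy(1) av(3)] f1_right[OF v(2) a(2) av(3)])
  qed
  have add: "f1 (v \<oplus>\<^bsub>TT D\<^esub> v') m = f1 v m + f1 v' m" if "v \<in> Tdeg D 1" "v' \<in> Tdeg D 1" "m \<in> mcar M" for v v' m
    using that by (auto simp: Tdeg_def TT_add f1_add)
  show ?thesis
    unfolding De_morphism_def prod.case
    using f0 f0_add f0_Re hom left right add dc unfolding dcond_def mal_def by blast
qed

end

subsection \<open>Composition of morphisms\<close>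

locale De_pair2 = F: De_pair D B d M N \<phi> + G: De_pair D B d N Q \<psi>
  for D :: "('k::field, 'a::ring_1, 'p::order) eposet" and B :: "('a, 'p) imat set"
    and d :: "('a, 'p) t_el \<Rightarrow> ('a, 'p) t_el"
    and M :: "(('a, 'p) t_el, 'm::ab_group_add) rmod" and N :: "(('a, 'p) t_el, 'n::ab_group_add) rmod"
    and Q :: "(('a, 'p) t_el, 'q::ab_group_add) rmod"
    and \<phi> :: "('a, 'p) dual \<Rightarrow> 'm \<Rightarrow> 'n" and \<psi> :: "('a, 'p) dual \<Rightarrow> 'n \<Rightarrow> 'q"
begin

definition "pal2 = sum_act (F.pal M N) (F.mal Q)"
text \<open>A three step extension: letters of degree one carry \<open>M\<close> to \<open>N\<close>
  by \<open>\<phi>\<close> and \<open>N\<close> to \<open>Q\<close> by \<open>\<psi>\<close>, with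
  no direct map from \<open>M\<close> to \<open>Q\<close>. Hence an element of degree one
  contributes nothing from \<open>M\<close> to \<open>Q\<close>, and a product of two contributes
  the composite of its factors.\<close>

definition "pbe2 = ext_act (F.pbe M N \<phi>) (F.mbe Q) (\<lambda>w e. \<psi> (snd w) (snd e))"

lemma pal2_apply: "pal2 r (e, q) = (F.pal M N r e, F.mal Q r q)"
  and pbe2_apply: "pbe2 w (e, q) = (F.pbe M N \<phi> w e, F.mbe Q w q + \<psi> (snd w) (snd e))"
  by (simp_all add: pal2_def pbe2_def sum_act_def ext_act_def)

sublocale P2: talg_rep "Re D" "WW D" "(mcar M \<times> mcar N) \<times> mcar Q" pal2 pbe2
  unfolding pal2_def pbe2_def
proof (rule ext_talg_rep[OF F.P.talg_rep_axioms G.NR.talg_rep_axioms])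
  fix r w v assume r: "r \<in> carrier (Re D)" "w \<in> bcarrier (WW D)" and v: "v \<in> mcar M \<times> mcar N"
  obtain m n where mn: "v = (m, n)" "n \<in> mcar N" using v by auto
  from r mn(2) show "\<psi> (snd (lact (WW D) r w)) (snd v) = \<psi> (snd w) (snd (F.pal M N r v))"
    "\<psi> (snd (ract (WW D) w r)) (snd v) = F.mal Q r (\<psi> (snd w) (snd v))"
    unfolding mn(1) by (cases w; cases r; simp add: G.bm_l G.bm_r F.pal_apply)+
qed (auto simp: G.bm_closed G.bm_diff G.bm_add)

text \<open>The sum of the \<open>g\<^sup>1(v'') f\<^sup>1(v')\<close> for \<open>t = \<Sum> v' \<otimes> v''\<close>.\<close>
definition comp2 :: "('a, 'p) t_el \<Rightarrow> 'm \<Rightarrow> 'q" where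
  "comp2 t m = snd (P2.tact t ((m, 0), 0))"

abbreviation "g1 \<equiv> F.tmap N Q \<psi>"

lemma C0: "m \<in> mcar M \<Longrightarrow> ((m, 0), 0) \<in> (mcar M \<times> mcar N) \<times> mcar Q"
  by (simp add: F.NR.C_0 G.NR.C_0)

lemma comp2_Tcl: "m \<in> mcar M \<Longrightarrow> comp2 (Tcl D x) m = snd (P2.act x ((m, 0), 0))"
  unfolding comp2_def by (subst P2.tact_tcl[OF C0]) simp_all

lemma comp2_add: "m \<in> mcar M \<Longrightarrow> comp2 (Tcl D (x + y)) m = comp2 (Tcl D x) m + comp2 (Tcl D y) m"
  and comp2_diff: "m \<in> mcar M \<Longrightarrow> comp2 (Tcl D (x - y)) m = comp2 (Tcl D x) m - comp2 (Tcl D y) m"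
  and comp2_zero: "m \<in> mcar M \<Longrightarrow> comp2 (Tcl D 0) m = 0"
  by (simp_all add: comp2_Tcl P2.act_add_left P2.act_diff_left P2.act_0_left)

lemma fst_act2:
  assumes "Poly_Mapping.keys x \<subseteq> twords (Re D) (WW D)" "e \<in> mcar M \<times> mcar N" "q \<in> mcar Q"
  shows "fst (P2.act x (e, q)) = F.P.act x e"
  using act_hom[OF P2.talg_rep_axioms F.P.talg_rep_axioms, of fst x "(e, q)"] assms
  by (auto simp: pal2_apply pbe2_apply simp del: WW_simps)

text \<open>\<open>\<phi>\<close> moves only elements of \<open>M\<close>, so
  \<open>N \<oplus> Q\<close> is a subrepresentation, and it is the extension built from
  \<open>\<psi>\<close>.\<close>

lemma act2_0n:
  assumes "Poly_Mapping.keys x \<subseteq> twords (Re D) (WW D)" "n \<in> mcar N" "q \<in> mcar Q"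
  shows "snd (P2.act x ((0, n), q)) = snd (G.P.act x (n, q))"
proof -
  let ?h = "\<lambda>(n, q). ((0::'m, n::'n), q::'q)"
  have "?h (G.P.act x (n, q)) = P2.act x (?h (n, q))"
  proof (rule act_hom[OF G.P.talg_rep_axioms P2.talg_rep_axioms])
    show "?h (F.pal N Q r u) = pal2 r (?h u)" if "r \<in> carrier (Re D)" "u \<in> mcar N \<times> mcar Q" for r u
      using that by (cases u) (simp add: pal2_apply F.pal_apply G.pal_apply F.MR.\<alpha>_0)
    show "?h (F.pbe N Q \<psi> w u) = pbe2 w (?h u)" if "w \<in> bcarrier (WW D)" "u \<in> mcar N \<times> mcar Q" for w u
      using that by (cases u)
        (simp add: pbe2_apply F.pbe_apply G.pbe_apply F.MR.\<beta>_0 F.bm_0 F.snd_W1 del: WW_simps)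
  qed (use assms F.MR.C_0 in auto)
  moreover have "snd (?h u) = snd u" for u by (cases u) simp
  ultimately show ?thesis by (metis case_prod_conv)
qed

lemma snd_act2_deg0:
  assumes x: "Poly_Mapping.keys x \<subseteq> hom_words D 0" and e: "e \<in> mcar M \<times> mcar N" and q: "q \<in> mcar Q"
  shows "snd (P2.act x (e, q)) = mact Q q (Tcl D x)"
proof -
  have fold: "snd (foldl (\<lambda>u w. pbe2 w u) (e, q) ws) = foldl (\<lambda>u w. F.mbe Q w u) q ws"
    if "F.deg_word 0 ws" "e \<in> mcar M \<times> mcar N" "q \<in> mcar Q" for ws e q
    using that
  proof (induction ws arbitrary: e q)
    case (Cons w ws)
    then have w: "w \<in> letters D 0" "F.deg_word 0 ws" by (simp_all add: F.deg_word_Cons)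
    then have "snd w = 0" by (cases w) (simp add: F.letters_iff)
    moreover have "snd e \<in> mcar N" using Cons.prems by auto
    ultimately show ?case
      using Cons.IH[OF w(2), of "F.pbe M N \<phi> w e" "F.mbe Q w q"] Cons.prems(2,3) F.letters_W[OF w(1)]
      by (simp add: pbe2_apply G.bm_zero F.P.\<beta>_closed G.NR.\<beta>_closed del: WW_simps mem_Times_iff)
  qed simp
  have "snd (P2.act x (e, q)) = G.NR.act x q"
    using x
  proof (induction x rule: frag_induction)
    case (one w)
    then show ?case using fold[OF _ e q]
      by (cases w) (auto simp: P2.act_of G.NR.act_of F.hom_words_Sc F.hom_words_Tw pal2_apply)
  qed (auto simp: P2.act_0_left G.NR.act_0_left P2.act_diff_left G.NR.act_diff_left)
  then show ?thesis using F.act_mact[OF G.N x q] by simp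
qed

text \<open>A single letter of degree one carries \<open>M\<close> as far as \<open>N\<close>;
  reaching \<open>Q\<close> takes two.\<close>

lemma comp2_deg1:
  assumes "Poly_Mapping.keys x \<subseteq> hom_words D 1" "m \<in> mcar M"
  shows "snd (P2.act x ((m, 0), 0)) = 0"
proof -
  have deg0: "snd (foldl (\<lambda>u w. pbe2 w u) (e, 0) ws) = 0"
    if "F.deg_word 0 ws" "e \<in> mcar M \<times> mcar N" for ws e
  proof (cases "ws = []")
    case False
    have k: "Poly_Mapping.keys (frag_of (Tw ws)) \<subseteq> hom_words D 0"
      using that False by (simp add: keys_frag_of F.hom_words_Tw)
    have "mact Q 0 (Tcl D (frag_of (Tw ws))) = 0"
      using F.act_mact[OF G.N k G.NR.C_0] G.NR.act_0[OF order_trans[OF k F.hom_words_twords]] by simp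
    then show ?thesis using snd_act2_deg0[OF k that(2) G.NR.C_0] by (simp add: P2.act_of)
  qed simp
  have fold: "snd (foldl (\<lambda>u w. pbe2 w u) ((m, 0), 0) ws) = 0" if "F.deg_word 1 ws" "m \<in> mcar M" for ws m
    using that
  proof (induction ws arbitrary: m)
    case (Cons w ws)
    then have wW: "w \<in> bcarrier (WW D)" using F.deg_word_W by force
    have Q0: "F.mbe Q w 0 + \<psi> (snd w) 0 = 0"
      using wW by (simp add: G.NR.\<beta>_0 G.bm_0 F.snd_W1 del: WW_simps)
    from Cons.prems(1) consider "w \<in> letters D 0" "F.deg_word 1 ws" | "F.deg_word 0 ws"
      by (auto simp: F.deg_word_Cons)
    then show ?case
    proof cases
      case 1
      then have "snd w = 0" by (cases w) (simp add: F.letters_iff)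
      then have "F.pbe M N \<phi> w (m, 0) = (F.mbe M w m, 0)"
        using wW Cons.prems(2) by (simp add: F.pbe_apply F.bm_zero F.NR.\<beta>_0 del: WW_simps)
      then show ?thesis using Cons.IH[OF 1(2) F.MR.\<beta>_closed[OF wW Cons.prems(2)]] Q0
        by (simp add: pbe2_apply)
    next
      case 2
      then show ?thesis using deg0[OF 2 F.P.\<beta>_closed[OF wW, of "(m, 0)"]] Cons.prems(2) F.NR.C_0 Q0
        by (simp add: pbe2_apply)
    qed
  qed (simp add: F.deg_word_Nil)
  show ?thesis using assms(1)
  proof (induction x rule: frag_induction)
    case (one w)
    then show ?case using fold[OF _ assms(2)]
      by (cases w) (auto simp: P2.act_of F.hom_words_Sc F.hom_words_Tw)
  qed (auto simp: P2.act_0_left P2.act_diff_left)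
qed

lemma act2_deg1:
  assumes x: "Poly_Mapping.keys x \<subseteq> hom_words D 1" and m: "m \<in> mcar M"
  shows "P2.act x ((m, 0), 0) = ((0, F.f1 (Tcl D x) m), 0)"
proof -
  have x': "Poly_Mapping.keys x \<subseteq> twords (Re D) (WW D)" using x F.hom_words_twords by blast
  have "fst (P2.act x ((m, 0), 0)) = (0, F.f1 (Tcl D x) m)"
    using fst_act2[OF x', of "(m, 0)" 0] F.act_deg1[OF x m] m F.NR.C_0 G.NR.C_0 by simp
  then show ?thesis using comp2_deg1[OF x m] by (simp add: prod_eq_iff)
qed

text \<open>After \<open>x\<close> has acted, the element lies in \<open>N\<close>, and
  \<open>y\<close> continues inside the subrepresentation \<open>N \<oplus> Q\<close>.\<close>

lemma comp2_mult:
  assumes x: "Poly_Mapping.keys x \<subseteq> hom_words D 1" and y: "Poly_Mapping.keys y \<subseteq> twords (Re D) (WW D)"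
    and m: "m \<in> mcar M"
  shows "comp2 (Tcl D (tmult (Re D) (WW D) x y)) m = g1 (Tcl D y) (F.f1 (Tcl D x) m)"
proof -
  have x': "Poly_Mapping.keys x \<subseteq> twords (Re D) (WW D)" using x F.hom_words_twords by blast
  have n: "F.f1 (Tcl D x) m \<in> mcar N" by (rule F.f1_closed[OF x' m])
  show ?thesis
    using P2.act_mult[OF x' y C0[OF m]]
    by (simp add: comp2_Tcl[OF m] act2_deg1[OF x m] act2_0n[OF y n G.NR.C_0] G.f1_Tcl[OF n])
qed

lemma comp2_left:
  assumes x: "Poly_Mapping.keys x \<subseteq> hom_words D 0" and y: "Poly_Mapping.keys y \<subseteq> twords (Re D) (WW D)"
    and m: "m \<in> mcar M"
  shows "comp2 (Tcl D (tmult (Re D) (WW D) x y)) m = comp2 (Tcl D y) (mact M m (Tcl D x))"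
proof -
  have x': "Poly_Mapping.keys x \<subseteq> twords (Re D) (WW D)" using x F.hom_words_twords by blast
  have N0: "mact N 0 (Tcl D x) = 0" and Q0: "mact Q 0 (Tcl D x) = 0"
    using F.NR.act_0[OF x'] F.act_mact[OF F.N x F.NR.C_0] G.NR.act_0[OF x'] F.act_mact[OF G.N x G.NR.C_0]
    by simp_all
  have "F.P.act x (m, 0) = (mact M m (Tcl D x), 0)"
    using F.fst_act[OF x' m F.NR.C_0] F.snd_act_deg0[OF x m F.NR.C_0] F.act_mact[OF F.M x m] N0
    by (simp add: prod_eq_iff)
  then have "P2.act x ((m, 0), 0) = ((mact M m (Tcl D x), 0), 0)"
    using fst_act2[OF x', of "(m, 0)" 0] snd_act2_deg0[OF x, of "(m, 0)" 0] m F.NR.C_0 G.NR.C_0 Q0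
    by (simp add: prod_eq_iff)
  then show ?thesis
    using P2.act_mult[OF x' y C0[OF m]] m F.mact_closed[OF F.M m F.Tdeg_I[OF x]]
    by (simp add: comp2_Tcl)
qed

lemma comp2_right:
  assumes x: "Poly_Mapping.keys x \<subseteq> twords (Re D) (WW D)" and y: "Poly_Mapping.keys y \<subseteq> hom_words D 0"
    and m: "m \<in> mcar M"
  shows "comp2 (Tcl D (tmult (Re D) (WW D) x y)) m = mact Q (comp2 (Tcl D x) m) (Tcl D y)"
proof -
  have y': "Poly_Mapping.keys y \<subseteq> twords (Re D) (WW D)" using y F.hom_words_twords by blast
  have "P2.act x ((m, 0), 0) \<in> (mcar M \<times> mcar N) \<times> mcar Q" by (rule P2.act_closed[OF x C0[OF m]])
  then obtain e q where eq: "P2.act x ((m, 0), 0) = (e, q)" "e \<in> mcar M \<times> mcar N" "q \<in> mcar Q" by blast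
  show ?thesis
    using P2.act_mult[OF x y' C0[OF m]] snd_act2_deg0[OF y eq(2,3)]
    by (simp add: comp2_Tcl[OF m] eq(1))
qed

text \<open>As in \<open>f1_d_W0\<close>, except that the second letter has degree one as well and
  carries the element from \<open>N\<close> on to \<open>Q\<close>.\<close>

lemma comp2_d_W1:
  assumes g: "\<delta> \<in> F.W1" and m: "m \<in> mcar M"
  shows "comp2 (d (in_W1 D \<delta>)) m = - (\<Sum>p\<in>F.BJ. \<psi> (dual_l D p \<delta>) (\<phi> (F.dual_el p) m))"
proof -
  have one: "comp2 (Tcl D (frag_of (Tw [(0, F.dual_el p), (0, \<zeta>)]))) m = \<psi> \<zeta> (\<phi> (F.dual_el p) m)"
    if p: "p \<in> F.BJ" and z: "\<zeta> \<in> F.W1" for p \<zeta>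
  proof -
    have k: "Poly_Mapping.keys (frag_of (Tw [(0, F.dual_el p)])) \<subseteq> hom_words D 1"
      "Poly_Mapping.keys (frag_of (Tw [(0, \<zeta>)])) \<subseteq> twords (Re D) (WW D)"
      using F.W1_word[OF F.BJ_W1[OF p]] F.W1_word[OF z] F.hom_words_twords[of 1]
      by (auto simp: keys_frag_of simp del: One_nat_def)
    show ?thesis
      using comp2_mult[OF k m] G.f1_W1[OF z F.bm_closed[OF F.BJ_W1[OF p] m]] F.f1_W1[OF F.BJ_W1[OF p] m]
      by (simp add: tmult_of in_W1_def)
  qed
  have \<zeta>: "dual_r D (F.dual_el q) (\<delta> (mm D q p)) \<in> F.W1" if "p \<in> F.BJ" "q \<in> F.BJ" for p q
    using that by (intro F.peirceD_dual_r[OF F.diag_idem_ehat g] F.dual_el_dualJ F.JJ_mm F.BJ_JJ) auto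
  have "comp2 (d (in_W1 D \<delta>)) m = - (\<Sum>p\<in>F.BJ. \<Sum>q\<in>F.BJ.
      comp2 (Tcl D (frag_of (Tw [(0, F.dual_el p), (0, dual_r D (F.dual_el q) (\<delta> (mm D q p)))]))) m)"
    by (simp add: F.d_W1[OF g] comp2_Tcl[OF m] P2.act_uminus_left P2.act_sum_left snd_sum)
  also have "\<dots> = - (\<Sum>p\<in>F.BJ. \<Sum>q\<in>F.BJ. \<psi> (dual_r D (F.dual_el q) (\<delta> (mm D q p))) (\<phi> (F.dual_el p) m))"
    by (intro arg_cong[of _ _ uminus] sum.cong refl one \<zeta>)
  also have "\<dots> = - (\<Sum>p\<in>F.BJ. \<psi> (dual_l D p \<delta>) (\<phi> (F.dual_el p) m))"
  proof (intro arg_cong[of _ _ uminus] sum.cong refl)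
    fix p assume p: "p \<in> F.BJ"
    let ?n = "\<phi> (F.dual_el p) m"
    have n: "?n \<in> mcar N" by (rule F.bm_closed[OF F.BJ_W1[OF p] m])
    have "\<psi> (\<Sum>q\<in>I. h q) ?n = (\<Sum>q\<in>I. \<psi> (h q) ?n) \<and> (\<Sum>q\<in>I. h q) \<in> F.W1"
      if "\<And>q. q \<in> I \<Longrightarrow> h q \<in> F.W1" for I h
      using that
      by (induction I rule: infinite_finite_induct)
        (auto simp: G.bm_zero n G.bm_add F.W_0 F.W_add F.diag_idems simp del: plus_fun_apply zero_fun_apply)
    from this[of F.BJ "\<lambda>q. dual_r D (F.dual_el q) (\<delta> (mm D q p))", OF \<zeta>[OF p]]
    show "(\<Sum>q\<in>F.BJ. \<psi> (dual_r D (F.dual_el q) (\<delta> (mm D q p))) ?n) = \<psi> (dual_l D p \<delta>) ?n"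
      by (simp add: F.dual_sum[OF F.diag_idem_ehat g F.BJ_JJ[OF p]])
  qed
  finally show ?thesis .
qed

text \<open>The second component of the composition is again determined by its values on \<open>W\<^sub>1\<close>.\<close>

lemma comp_extend:
  assumes f0: "\<And>m. m \<in> mcar M \<Longrightarrow> f0 m \<in> mcar N"
    and g0: "\<And>n. n \<in> mcar N \<Longrightarrow> g0 n \<in> mcar Q"
    and f0_diff: "\<And>m m'. m \<in> mcar M \<Longrightarrow> m' \<in> mcar M \<Longrightarrow> f0 (m - m') = f0 m - f0 m'"
    and g0_diff: "\<And>m m'. m \<in> mcar N \<Longrightarrow> m' \<in> mcar N \<Longrightarrow> g0 (m - m') = g0 m - g0 m'"
    and f: "F.dcond f0" and g: "G.dcond g0"
    and W1: "\<And>\<delta> m. \<delta> \<in> F.W1 \<Longrightarrow> m \<in> mcar M \<Longrightarrow> \<psi> \<delta> (f0 m) + g0 (\<phi> \<delta> m) = comp2 (d (in_W1 D \<delta>)) m"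
    and v: "v \<in> Tdeg D 1" and m: "m \<in> mcar M"
  shows "g1 v (f0 m) + g0 (F.f1 v m) = comp2 (d v) m"
proof -
  have fc: "mact N (f0 m) (Tcl D x) = f0 (mact M m (Tcl D x)) + F.f1 (d (Tcl D x)) m"
    if "Poly_Mapping.keys x \<subseteq> hom_words D 0" "m \<in> mcar M" for x m
    using f that F.Tdeg_I unfolding F.dcond_def by blast
  have gc: "mact Q (g0 n) (Tcl D x) = g0 (mact N n (Tcl D x)) + g1 (d (Tcl D x)) n"
    if "Poly_Mapping.keys x \<subseteq> hom_words D 0" "n \<in> mcar N" for x n
    using g that F.Tdeg_I unfolding G.dcond_def by blast
  have g0_add: "g0 (n + n') = g0 n + g0 n'" if "n \<in> mcar N" "n' \<in> mcar N" for n n'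
    using g0_diff[of "n + n'" n'] that by (simp add: F.NR.C_add)
  have sc1: "mact M m (Tcl D (frag_of (Sc (F.cscal 1)))) = m" if "m \<in> mcar M" for m
    using F.mact_one[OF F.M that] by (simp add: F.TT_one in_Re_def F.cscal_1)
  \<comment> \<open>In degree one the sign of the Leibniz rule is the scalar \<open>-1\<close>; it
    acts as negation because \<open>cscal (- 1) + cscal 1 = 0\<close>.\<close>
  have scm: "mact M m (Tcl D (frag_of (Sc (F.cscal (- 1))))) = - m" if "m \<in> mcar M" for m
  proof -
    have "F.mal M (F.cscal (- 1) \<oplus>\<^bsub>Re D\<^esub> F.cscal 1) m = F.mal M (F.cscal (- 1)) m + F.mal M (F.cscal 1) m"
      by (rule F.MR.\<alpha>_add[OF F.cscal_Re F.cscal_Re that])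
    moreover have "F.mal M 0 m = 0" using F.MR.\<alpha>_add[OF F.Re_0 F.Re_0 that] by simp
    ultimately show ?thesis
      using sc1[OF that] by (simp add: F.cscal_minus F.mal_def in_Re_def eq_neg_iff_add_eq_0)
  qed
  let ?P = "\<lambda>x. \<forall>m\<in>mcar M. g1 (Tcl D x) (f0 m) + g0 (F.f1 (Tcl D x) m) = comp2 (d (Tcl D x)) m"
  have words: "?P (frag_of (Tw ws))" if "F.deg_word 1 ws" for ws
    using that
  proof (induction ws)
    case (Cons w ws)
    let ?x = "frag_of (Tw [w])" and ?y = "frag_of (Tw ws)"
    show ?case
    proof (cases "ws = []")
      case True
      then have "w \<in> letters D 1" using Cons.prems by (auto simp: F.deg_word_Cons F.deg_word_Nil)
      then obtain \<delta> where "w = (0, \<delta>)" "\<delta> \<in> F.W1" by (cases w) (auto simp: F.letters_iff)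
      then show ?thesis using W1 True f0 F.f1_W1[unfolded in_W1_def] G.f1_W1[unfolded in_W1_def]
        by (simp add: in_W1_def)
    next
      case False
      have Tw: "Tcl D (frag_of (Tw (w # ws))) = Tcl D (tmult (Re D) (WW D) ?x ?y)"
        by (simp add: tmult_of)
      from Cons.prems consider "w \<in> letters D 0" "F.deg_word 1 ws" | "w \<in> letters D 1" "F.deg_word 0 ws"
        by (auto simp: F.deg_word_Cons)
      then show ?thesis
      proof cases
        case 1
        have x: "Poly_Mapping.keys ?x \<subseteq> hom_words D 0" and y: "Poly_Mapping.keys ?y \<subseteq> hom_words D 1"
          using 1 False by (simp_all add: keys_frag_of F.hom_words_Tw F.deg_word_Cons F.deg_word_Nil)
        obtain x' where x': "Poly_Mapping.keys x' \<subseteq> hom_words D 1" "d (Tcl D ?x) = Tcl D x'"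
          using F.d_Tcl[OF x] by auto
        obtain y' where y': "Poly_Mapping.keys y' \<subseteq> hom_words D (Suc 1)" "d (Tcl D ?y) = Tcl D y'"
          using F.d_Tcl[OF y] by auto
        have tw: "Poly_Mapping.keys ?x \<subseteq> twords (Re D) (WW D)" "Poly_Mapping.keys ?y \<subseteq> twords (Re D) (WW D)"
          "Poly_Mapping.keys x' \<subseteq> twords (Re D) (WW D)" "Poly_Mapping.keys y' \<subseteq> twords (Re D) (WW D)"
          using x y x'(1) y'(1) F.hom_words_twords by blast+
        show ?thesis
        proof
          fix m assume m: "m \<in> mcar M"
          let ?m' = "mact M m (Tcl D ?x)"
          have m': "?m' \<in> mcar M" by (rule F.mact_closed[OF F.M m F.Tdeg_I[OF x]])
          have n: "F.f1 (Tcl D x') m \<in> mcar N" by (rule F.f1_closed[OF tw(3) m])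
          have "comp2 (d (Tcl D (tmult (Re D) (WW D) ?x ?y))) m =
              g1 (Tcl D ?y) (F.f1 (Tcl D x') m) + comp2 (Tcl D y') ?m'"
            using F.Leibniz[OF x y, of x' y'] x' y' m
            by (simp add: comp2_add comp2_mult[OF x'(1) tw(2) m] sc1
                comp2_left[OF F.Sc_keys F.T.keys_tmult[OF tw(1,4)] m] comp2_left[OF x tw(4) m])
          moreover have "g1 (Tcl D (tmult (Re D) (WW D) ?x ?y)) (f0 m) =
              g1 (Tcl D ?y) (f0 ?m') + g1 (Tcl D ?y) (F.f1 (Tcl D x') m)"
            by (simp add: G.f1_left[OF x tw(2) f0[OF m]] fc[OF x m] x'(2) G.f1_plus[OF tw(2) f0[OF m'] n])
          moreover have "g0 (F.f1 (Tcl D (tmult (Re D) (WW D) ?x ?y)) m) = g0 (F.f1 (Tcl D ?y) ?m')"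
            by (simp add: F.f1_left[OF x tw(2) m])
          moreover have "g1 (Tcl D ?y) (f0 ?m') + g0 (F.f1 (Tcl D ?y) ?m') = comp2 (Tcl D y') ?m'"
            using Cons.IH[OF 1(2)] m' y'(2) by simp
          ultimately show "g1 (Tcl D (frag_of (Tw (w # ws)))) (f0 m) + g0 (F.f1 (Tcl D (frag_of (Tw (w # ws)))) m) =
              comp2 (d (Tcl D (frag_of (Tw (w # ws))))) m"
            unfolding Tw by (simp add: algebra_simps)
        qed
      next
        case 2
        obtain \<delta> where w: "w = (0, \<delta>)" "\<delta> \<in> F.W1" using 2 by (cases w) (auto simp: F.letters_iff)
        have x: "Poly_Mapping.keys ?x \<subseteq> hom_words D 1" and y: "Poly_Mapping.keys ?y \<subseteq> hom_words D 0"
          using 2 False by (simp_all add: keys_frag_of F.hom_words_Tw F.deg_word_Cons F.deg_word_Nil)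
        obtain x' where x': "Poly_Mapping.keys x' \<subseteq> hom_words D (Suc 1)" "d (Tcl D ?x) = Tcl D x'"
          using F.d_Tcl[OF x] by auto
        obtain y' where y': "Poly_Mapping.keys y' \<subseteq> hom_words D 1" "d (Tcl D ?y) = Tcl D y'"
          using F.d_Tcl[OF y] by auto
        have tw: "Poly_Mapping.keys ?x \<subseteq> twords (Re D) (WW D)" "Poly_Mapping.keys ?y \<subseteq> twords (Re D) (WW D)"
          "Poly_Mapping.keys x' \<subseteq> twords (Re D) (WW D)" "Poly_Mapping.keys y' \<subseteq> twords (Re D) (WW D)"
          using x y x'(1) y'(1) F.hom_words_twords by blast+
        show ?thesis
        proof
          fix m assume m: "m \<in> mcar M"
          let ?n = "F.f1 (Tcl D ?x) m" and ?q = "g1 (Tcl D ?x) (f0 m)"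
          have mm: "- m \<in> mcar M" by (rule F.mod_uminus[OF F.M m])
          have n: "?n \<in> mcar N" by (rule F.f1_closed[OF tw(1) m])
          have q: "?q \<in> mcar Q" by (rule G.f1_closed[OF tw(1) f0[OF m]])
          have "F.f1 (Tcl D ?x) (- m) = - ?n"
            using F.f1_diff[OF tw(1) F.MR.C_0 m] F.f1_diff[OF tw(1) m m] F.f1_diff[OF tw(1) F.MR.C_0 F.MR.C_0]
            by simp
          moreover have "g1 (Tcl D y') (- ?n) = - g1 (Tcl D y') ?n"
            using G.f1_diff[OF tw(4) F.NR.C_0 n] G.f1_diff[OF tw(4) F.NR.C_0 F.NR.C_0] by simp
          ultimately have "comp2 (d (Tcl D (tmult (Re D) (WW D) ?x ?y))) m =
              mact Q (comp2 (Tcl D x') m) (Tcl D ?y) - g1 (Tcl D y') ?n"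
            using F.Leibniz[OF x y, of x' y'] x' y' m
            by (simp add: comp2_add comp2_right[OF tw(3) y m] scm
                comp2_left[OF F.Sc_keys F.T.keys_tmult[OF tw(1,4)] m] comp2_mult[OF x tw(4) mm])
          moreover have "comp2 (Tcl D x') m = ?q + g0 ?n"
            using W1[OF w(2) m] x'(2) F.f1_W1[OF w(2) m, unfolded in_W1_def]
              G.f1_W1[OF w(2) f0[OF m], unfolded in_W1_def] by (simp add: w(1) in_W1_def)
          moreover have "mact Q (?q + g0 ?n) (Tcl D ?y) = mact Q ?q (Tcl D ?y) + mact Q (g0 ?n) (Tcl D ?y)"
            by (rule F.mact_add[OF G.N q g0[OF n] F.Tdeg_I[OF y]])
          \<comment> \<open>The failure of \<open>g0\<close> to commute with the factor of degree
            zero cancels the term that the Leibniz rule contributes with negative sign.\<close>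
          moreover have "mact Q (g0 ?n) (Tcl D ?y) = g0 (mact N ?n (Tcl D ?y)) + g1 (Tcl D y') ?n"
            using gc[OF y n] y'(2) by simp
          ultimately show "g1 (Tcl D (frag_of (Tw (w # ws)))) (f0 m) + g0 (F.f1 (Tcl D (frag_of (Tw (w # ws)))) m) =
              comp2 (d (Tcl D (frag_of (Tw (w # ws))))) m"
            unfolding Tw by (simp add: F.f1_right[OF x y m] G.f1_right[OF x y f0[OF m]])
        qed
      qed
    qed
  qed (simp add: F.deg_word_Nil)
  obtain x where x: "v = Tcl D x" "Poly_Mapping.keys x \<subseteq> hom_words D 1" using v unfolding Tdeg_def by blast
  from x(2) have "Poly_Mapping.keys x \<subseteq> hom_words D 1 \<and> ?P x"
  proof (induction x rule: frag_induction)
    case zero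
    show ?case using f0 g0_diff[OF F.NR.C_0 F.NR.C_0]
      by (auto simp: F.d_zero comp2_zero F.f1_zero G.f1_zero)
  next
    case (one w)
    then show ?case using words by (cases w) (auto simp: keys_frag_of F.hom_words_Tw F.hom_words_Sc)
  next
    case (diff a b)
    then have a: "Poly_Mapping.keys a \<subseteq> hom_words D 1" and b: "Poly_Mapping.keys b \<subseteq> hom_words D 1" by auto
    obtain a' where a': "d (Tcl D a) = Tcl D a'" using F.d_Tcl[OF a] by metis
    obtain b' where b': "d (Tcl D b) = Tcl D b'" using F.d_Tcl[OF b] by metis
    have tw: "Poly_Mapping.keys a \<subseteq> twords (Re D) (WW D)" "Poly_Mapping.keys b \<subseteq> twords (Re D) (WW D)"
      using a b F.hom_words_twords by blast+
    show ?case
    proof (intro conjI ballI)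
      fix m assume m: "m \<in> mcar M"
      have "g1 (Tcl D a) (f0 m) + g0 (F.f1 (Tcl D a) m) = comp2 (Tcl D a') m"
        "g1 (Tcl D b) (f0 m) + g0 (F.f1 (Tcl D b) m) = comp2 (Tcl D b') m"
        using diff m a' b' by auto
      then show "g1 (Tcl D (a - b)) (f0 m) + g0 (F.f1 (Tcl D (a - b)) m) = comp2 (d (Tcl D (a - b))) m"
        by (simp add: F.d_diff[OF a b a' b'] comp2_diff[OF m] F.f1_sub[OF m] G.f1_sub[OF f0[OF m]]
            g0_diff F.f1_closed[OF tw(1) m] F.f1_closed[OF tw(2) m] algebra_simps flip: add_diff_eq)
    qed (rule keys_diff_subset[OF a b])
  qed
  then show ?thesis using m x(1) by blast
qed

text \<open>For any list of pairs from \<open>T\<^sub>1\<close> the sum equals \<open>comp2\<close>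
  at the sum of the products, so it depends on \<open>d v\<close> alone. Since
  \<open>splitting\<close> is a choice, the rest of the proof shows that there is such a list to
  choose: every element of degree two is a sum of products from \<open>T\<^sub>1\<close>.\<close>

lemma splitting:
  assumes v: "v \<in> Tdeg D 1" and m: "m \<in> mcar M"
  shows "(\<Sum>(v', v'')\<leftarrow>splitting D d v. g1 v'' (F.f1 v' m)) = comp2 (d v) m"
proof -
  let ?f = "\<lambda>ps. foldr (\<lambda>(v', v'') t. (v' \<otimes>\<^bsub>TT D\<^esub> v'') \<oplus>\<^bsub>TT D\<^esub> t) ps \<zero>\<^bsub>TT D\<^esub>"
  let ?T = "Tdeg D 1 \<times> Tdeg D 1"
  have mult: "\<exists>x y. v' = Tcl D x \<and> v'' = Tcl D y \<and> Poly_Mapping.keys x \<subseteq> hom_words D 1 \<and>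
      Poly_Mapping.keys y \<subseteq> twords (Re D) (WW D) \<and> v' \<otimes>\<^bsub>TT D\<^esub> v'' = Tcl D (tmult (Re D) (WW D) x y)"
    if T: "(v', v'') \<in> ?T" for v' v''
  proof -
    obtain x y where xy: "v' = Tcl D x" "v'' = Tcl D y" "Poly_Mapping.keys x \<subseteq> hom_words D 1"
      "Poly_Mapping.keys y \<subseteq> hom_words D 1" using T unfolding Tdeg_def by blast
    then have "Poly_Mapping.keys x \<subseteq> twords (Re D) (WW D)" "Poly_Mapping.keys y \<subseteq> twords (Re D) (WW D)"
      using F.hom_words_twords by blast+
    then show ?thesis using xy F.TT_mult by blast
  qed
  have val: "\<exists>z. ?f ps = Tcl D z \<and> comp2 (Tcl D z) m = (\<Sum>(v', v'')\<leftarrow>ps. g1 v'' (F.f1 v' m))"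
    if "set ps \<subseteq> ?T" for ps
    using that
  proof (induction ps)
    case Nil
    then show ?case using m by (auto simp: F.TT_zero comp2_zero intro!: exI[of _ 0])
  next
    case (Cons p ps)
    obtain v' v'' where p: "p = (v', v'')" by force
    then obtain x y where xy: "v' = Tcl D x" "v'' = Tcl D y" "Poly_Mapping.keys x \<subseteq> hom_words D 1"
      "Poly_Mapping.keys y \<subseteq> twords (Re D) (WW D)" "v' \<otimes>\<^bsub>TT D\<^esub> v'' = Tcl D (tmult (Re D) (WW D) x y)"
      using mult[of v' v''] Cons.prems by auto
    obtain z where z: "?f ps = Tcl D z" "comp2 (Tcl D z) m = (\<Sum>(v', v'')\<leftarrow>ps. g1 v'' (F.f1 v' m))"
      using Cons by auto
    show ?case
      using z xy(5) by (intro exI[of _ "tmult (Re D) (WW D) x y + z"])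
        (simp add: p F.TT_add comp2_add[OF m] comp2_mult[OF xy(3,4) m] xy(1,2))
  qed
  have add: "?f (ps @ qs) = Tcl D (x + y)" if "set ps \<subseteq> ?T" "?f ps = Tcl D x" "?f qs = Tcl D y" for ps qs x y
    using that(1,2)
  proof (induction ps arbitrary: x)
    case Nil
    then have "Tcl D (x + y) = Tcl D y" using F.TT_add[of 0 y] F.TT_add[of x y] by (simp add: F.TT_zero)
    then show ?case using that(3) by simp
  next
    case (Cons p ps)
    obtain v' v'' where p: "p = (v', v'')" by force
    then obtain a where a: "v' \<otimes>\<^bsub>TT D\<^esub> v'' = Tcl D a" using mult[of v' v''] Cons.prems by auto
    obtain z where z: "?f ps = Tcl D z" using val Cons.prems by fastforce
    have "Tcl D x = Tcl D (a + z)" using Cons.prems(2) by (simp add: p a z F.TT_add)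
    then have "Tcl D (x + y) = Tcl D (a + (z + y))"
      using F.TT_add[of x y] F.TT_add[of "a + z" y] by (simp add: add.assoc)
    then show ?case using Cons.IH[OF _ z] Cons.prems by (simp add: p a F.TT_add)
  qed
  \<comment> \<open>The sign is absorbed by the first factor of each pair.\<close>
  have neg: "\<exists>qs. set qs \<subseteq> ?T \<and> ?f qs = Tcl D (- x)" if "set ps \<subseteq> ?T" "?f ps = Tcl D x" for ps x
    using that
  proof (induction ps arbitrary: x)
    case Nil
    then have "x \<in> F.T.rel_hull" by (auto simp: F.TT_zero F.T.tcl_eq_iff[of 0 x] dest: add_hull_uminus)
    then show ?case by (intro exI[of _ "[]"]) (simp add: F.TT_zero F.T.tcl_eq_iff)
  next
    case (Cons p ps)
    obtain v' v'' where p: "p = (v', v'')" by force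
    then obtain a b where ab: "v' = Tcl D a" "v'' = Tcl D b" "Poly_Mapping.keys a \<subseteq> hom_words D 1"
      "Poly_Mapping.keys b \<subseteq> twords (Re D) (WW D)" "v' \<otimes>\<^bsub>TT D\<^esub> v'' = Tcl D (tmult (Re D) (WW D) a b)"
      using mult[of v' v''] Cons.prems by auto
    obtain z where z: "?f ps = Tcl D z" using val Cons.prems by fastforce
    obtain qs where qs: "set qs \<subseteq> ?T" "?f qs = Tcl D (- z)" using Cons.IH[OF _ z] Cons.prems by auto
    have na: "Poly_Mapping.keys (- a) \<subseteq> hom_words D 1" using ab(3) by simp
    then have "Poly_Mapping.keys (- a) \<subseteq> twords (Re D) (WW D)" using F.hom_words_twords by blast
    then have m: "Tcl D (- a) \<otimes>\<^bsub>TT D\<^esub> v'' = Tcl D (- tmult (Re D) (WW D) a b)"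
      using ab(2,4) tmult_diff_left[of "Re D" "WW D" 0 a b] by (simp add: F.TT_mult)
    have "Tcl D x = Tcl D (tmult (Re D) (WW D) a b + z)" using Cons.prems(2) by (simp add: p ab(5) z F.TT_add)
    then have "x - (tmult (Re D) (WW D) a b + z) \<in> F.T.rel_hull" by (simp add: F.T.tcl_eq_iff)
    then have "Tcl D (- x) = Tcl D (- tmult (Re D) (WW D) a b + - z)"
      using add_hull_uminus[of "x - (tmult (Re D) (WW D) a b + z)"] by (simp add: F.T.tcl_eq_iff algebra_simps)
    then show ?case using qs m Cons.prems F.Tdeg_I[OF na]
      by (intro exI[of _ "(Tcl D (- a), v'') # qs"]) (auto simp: p F.TT_add)
  qed
  \<comment> \<open>The cut is made just behind the first letter counted with degree one.\<close>
  have split: "\<exists>us vs. ws = us @ vs \<and> F.deg_word 1 us \<and> F.deg_word n vs" if "F.deg_word (Suc n) ws" for ws n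
    using that
  proof (induction ws)
    case (Cons w ws)
    from Cons.prems consider "w \<in> letters D 0" "F.deg_word (Suc n) ws" | "w \<in> letters D 1" "F.deg_word n ws"
      by (auto simp: F.deg_word_Cons)
    then show ?case
    proof cases
      case 1
      then obtain us vs where "ws = us @ vs" "F.deg_word 1 us" "F.deg_word n vs" using Cons.IH by auto
      then show ?thesis using 1 by (intro exI[of _ "w # us"] exI[of _ vs]) (simp add: F.deg_word_Cons)
    next
      case 2
      then show ?thesis
        by (intro exI[of _ "[w]"] exI[of _ ws]) (simp add: F.deg_word_Cons F.deg_word_Nil)
    qed
  qed (simp add: F.deg_word_Nil)
  have ex: "\<exists>ps. set ps \<subseteq> ?T \<and> Tcl D y = ?f ps" if "Poly_Mapping.keys y \<subseteq> hom_words D (Suc 1)" for y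
    using that
  proof (induction y rule: frag_induction)
    case zero
    show ?case by (intro exI[of _ "[]"]) (simp add: F.TT_zero)
  next
    case (one w)
    then obtain ws where ws: "w = Tw ws" "F.deg_word (Suc 1) ws"
      by (cases w) (auto simp: F.hom_words_Tw F.hom_words_Sc)
    then obtain us vs where uv: "ws = us @ vs" "F.deg_word 1 us" "F.deg_word 1 vs" using split by blast
    then have k: "Poly_Mapping.keys (frag_of (Tw us)) \<subseteq> hom_words D 1"
      "Poly_Mapping.keys (frag_of (Tw vs)) \<subseteq> hom_words D 1"
      by (auto simp: keys_frag_of F.hom_words_Tw F.deg_word_Nil)
    then have "Poly_Mapping.keys (frag_of (Tw us)) \<subseteq> twords (Re D) (WW D)"
      "Poly_Mapping.keys (frag_of (Tw vs)) \<subseteq> twords (Re D) (WW D)" using F.hom_words_twords by blast+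
    then show ?case using F.Tdeg_I[OF k(1)] F.Tdeg_I[OF k(2)]
      by (intro exI[of _ "[(Tcl D (frag_of (Tw us)), Tcl D (frag_of (Tw vs)))]"])
        (simp add: ws(1) uv(1) F.TT_zero F.TT_add F.TT_mult tmult_of)
  next
    case (diff a b)
    then obtain ps qs where ps: "set ps \<subseteq> ?T" "?f ps = Tcl D a" and "set qs \<subseteq> ?T" "?f qs = Tcl D b" by metis
    then obtain rs where "set rs \<subseteq> ?T" "?f rs = Tcl D (- b)" using neg by blast
    then show ?case using ps add[OF ps] by (intro exI[of _ "ps @ rs"]) auto
  qed
  have "\<exists>ps. set ps \<subseteq> ?T \<and> d v = ?f ps"
    using F.d_deg[OF v] ex unfolding Tdeg_def by auto
  then have s: "set (splitting D d v) \<subseteq> ?T \<and> d v = ?f (splitting D d v)"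
    unfolding splitting_def by (rule someI_ex)
  then show ?thesis using val[of "splitting D d v"] by metis
qed

text \<open>The minus sign in the differential and the one in the composition cancel, hence the plus
  sign before the sum in the hypothesis on \<open>W\<^sub>1\<close>.\<close>

lemma comp_is_id:
  assumes f0: "\<And>m. m \<in> mcar M \<Longrightarrow> f0 m \<in> mcar N"
    and g0: "\<And>n. n \<in> mcar N \<Longrightarrow> g0 n \<in> mcar Q"
    and f0_diff: "\<And>m m'. m \<in> mcar M \<Longrightarrow> m' \<in> mcar M \<Longrightarrow> f0 (m - m') = f0 m - f0 m'"
    and g0_diff: "\<And>m m'. m \<in> mcar N \<Longrightarrow> m' \<in> mcar N \<Longrightarrow> g0 (m - m') = g0 m - g0 m'"
    and f: "F.dcond f0" and g: "G.dcond g0"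
    and W1: "\<And>\<delta> m. \<delta> \<in> F.W1 \<Longrightarrow> m \<in> mcar M \<Longrightarrow>
      \<psi> \<delta> (f0 m) + g0 (\<phi> \<delta> m) + (\<Sum>p\<in>F.BJ. \<psi> (dual_l D p \<delta>) (\<phi> (F.dual_el p) m)) = 0"
    and v: "v \<in> Tdeg D 1" and m: "m \<in> mcar M"
  shows "snd (De_comp D d (g0, g1) (f0, F.f1)) v m = 0"
proof -
  have "\<psi> \<delta> (f0 m) + g0 (\<phi> \<delta> m) = comp2 (d (in_W1 D \<delta>)) m" if "\<delta> \<in> F.W1" "m \<in> mcar M" for \<delta> m
    using W1[OF that] by (simp add: comp2_d_W1[OF that] eq_neg_iff_add_eq_0)
  from comp_extend[OF f0 g0 f0_diff g0_diff f g this v m]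
  have "g1 v (f0 m) + g0 (F.f1 v m) = comp2 (d v) m" .
  then show ?thesis by (simp add: De_comp_def splitting[OF v m])
qed

end

section \<open>Coordinates\<close>

lemma add_hull_trans:
  "a - b - c \<in> add_hull X \<Longrightarrow> c - e \<in> add_hull X \<Longrightarrow> a - (b + e) \<in> add_hull X"
  using add_hull_add[of "a - b - c" X "c - e"] by (simp add: algebra_simps)

context ext_poset_basis
begin

text \<open>Apply \<open>\<xi>\<close> to \<open>u = \<Sum> \<gamma>\<^sub>p(u) p\<close>: by left
  linearity \<open>\<xi>(u) = \<Sum> \<gamma>\<^sub>p(u) \<xi>(p)\<close>. So the
  \<open>\<gamma>\<^sub>p\<close> generate the dual from the right, and a right linear map is known
  from its values on them.\<close>

lemma dual_repr:
  assumes e: "diag_idem e" and \<xi>: "\<xi> \<in> peirceD D (ehat D) e"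
  shows "(\<Sum>p\<in>B \<inter> peirceJ D e (ehat D). dual_r D (dual_el p) (\<xi> p)) = \<xi>"
proof (rule ext)
  fix u
  have \<xi>J: "\<xi> \<in> dualJ D" using \<xi> e by (simp add: peirceD_ehat)
  show "(\<Sum>p\<in>B \<inter> peirceJ D e (ehat D). dual_r D (dual_el p) (\<xi> p)) u = \<xi> u"
  proof (cases "u \<in> JJ D")
    case True
    have "(\<Sum>p\<in>B \<inter> peirceJ D e (ehat D). dual_r D (dual_el p) (\<xi> p)) u =
        (\<Sum>p\<in>B \<inter> peirceJ D e (ehat D). mm D (dual_el p u) (\<xi> p))"
      by (simp add: sum_apply dual_r_def)
    also have "\<dots> = (\<Sum>p\<in>B \<inter> peirceJ D e (ehat D). \<xi> (mm D (dual_el p u) p))"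
      by (intro sum.cong refl dualJ_lin[symmetric] \<xi>J dualJ_SS dual_el_dualJ True B_JJ) auto
    also have "\<dots> = \<xi> (\<Sum>p\<in>B \<inter> peirceJ D e (ehat D). mm D (dual_el p u) p)"
      by (rule dualJ_sum[OF \<xi>J, symmetric])
        (rule JJ_mm_SS[OF dualJ_SS[OF dual_el_dualJ True] B_JJ], auto)
    also have "\<dots> = mm D e (\<xi> u)"
      by (simp add: dual_expansion[OF e True] dualJ_lin[OF \<xi>J diag_idem_SS[OF e] True])
    also have "\<dots> = mm D (\<xi> u) e"
    proof (rule SS_eqI)
      fix i assume i: "i \<in> uPm D"
      have "\<xi> u i i \<in> RR D i i" by (intro SS_in dualJ_SS \<xi>J True i)
      then show "mm D e (\<xi> u) i i = mm D (\<xi> u) e i i"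
        using e i by (auto simp: mm_SS_left mm_SS_right diag_idem_def eps_l eps_r)
    qed (intro SS_mm diag_idem_SS[OF e] dualJ_SS[OF \<xi>J] True)+
    also have "\<dots> = \<xi> u" by (rule peirceD_mm[OF e \<xi>])
    finally show ?thesis .
  next
    case False
    then have "dual_el p u = 0" if "p \<in> B" for p
      using dualJ_out[OF dual_el_dualJ[OF that]] by blast
    then show ?thesis using False by (simp add: sum_apply dual_r_def dualJ_out[OF \<xi>J])
  qed
qed

text \<open>Elements of the dual are extended by zero outside \<open>J\<close>. With this convention
  sums of \<open>pr\<close> may run over all of \<open>Pm D\<close> instead of the points above
  \<open>z\<close>.\<close>

lemma pr_out: "\<xi> \<in> dualJ D \<Longrightarrow> \<not> z < x \<Longrightarrow> pr \<xi> z x t = 0"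
proof -
  assume x: "\<xi> \<in> dualJ D" "\<not> z < x"
  show ?thesis
  proof (cases "t = 0")
    case False
    then have "munit z x t \<notin> JJ D" using x(2) JJ_zero[of "munit z x t" z x] by (auto simp: munit_apply)
    then show ?thesis using x by (simp add: pr_def dualJ_out)
  qed (simp add: pr_0 x)
qed

lemma pr_Sum:
  assumes "\<xi> \<in> dualJ D" "z \<in> uPm D" "x \<in> uPm D" "\<And>a. a \<in> A \<Longrightarrow> z < x \<Longrightarrow> f a \<in> RR D z x"
  shows "pr \<xi> z x (\<Sum>a\<in>A. f a) = (\<Sum>a\<in>A. pr \<xi> z x (f a))"
  using assms pr_sum[of \<xi> z x A f] by (cases "z < x") (auto simp: pr_out)

text \<open>A dual basis element depends only on the entry at the position of its basis
  element.\<close>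

lemma dual_el_zero:
  assumes p: "p \<in> Bs y x" and u: "u \<in> JJ D" "u y x = 0"
  shows "dual_el p u = 0"
proof -
  have y: "y \<in> uPm D" "x \<in> uPm D" "y < x" using BsD[OF p] by auto
  have "coef y x 0 p = (\<lambda>b. 0) p" by (rule coef_eq[OF y _ _ p]) (use y in \<open>auto simp: RR_0\<close>)
  then show ?thesis using u by (simp add: dual_el_gam[OF p] gam_def)
qed

end

section \<open>Coordinates with respect to a local basis\<close>

locale De_basis = ext_poset_basis D B
  for D :: "('k::field, 'a::ring_1, 'p::order) eposet" and B :: "('a, 'p) imat set" +
  fixes M :: "(('a, 'p) t_el, 'm::ab_group_add) rmod" and b :: "'p xp \<Rightarrow> nat \<Rightarrow> 'm"
  assumes M: "right_module (T0alg D) M" and lb: "local_basis D M b"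
begin

sublocale R: talg_rep "Re D" "WW D" "mcar M" "mal M" "mbe M"
  by (rule module_rep[OF M])

abbreviation "dm \<equiv> dimvec D M"
abbreviation "ac x a m \<equiv> mal M (rdiag x a) m"

lemma act_at_ac: "act_at D M x m a = ac x a m"
  by (simp add: act_at_def mal_def diag_elt_rdiag)

lemma comp_at_ac: "comp_at D M x = {ac x (eps D x) m | m. m \<in> mcar M}"
  by (simp add: comp_at_def mal_def diag_elt_rdiag)

lemma rdiag_mult:
  assumes "x \<in> uPm D" "y \<in> uPm D" "a \<in> RR D x x" "c \<in> RR D y y"
  shows "rdiag x a \<otimes>\<^bsub>Re D\<^esub> rdiag y c = (if x = y then rdiag x (a * c) else 0)"
  by (rule Re_eqI)
    (use assms in \<open>auto simp: Re_mult_closed rdiag_Re Re_0 Re_mult_rc rc_rdiag RR_mult\<close>,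
     simp_all add: rc_def)

lemma ac_ac:
  assumes "x \<in> uPm D" "y \<in> uPm D" "a \<in> RR D x x" "c \<in> RR D y y" "m \<in> mcar M"
  shows "ac y c (ac x a m) = (if x = y then ac x (a * c) m else 0)"
proof -
  have "mal M 0 m = 0" using R.\<alpha>_add[OF Re_0 Re_0 assms(5)] by simp
  then show ?thesis
    using R.\<alpha>_mult[of "rdiag x a" "rdiag y c" m] assms rdiag_mult[of x y a c] by (auto simp: rdiag_Re)
qed

lemma ac_closed: "x \<in> uPm D \<Longrightarrow> a \<in> RR D x x \<Longrightarrow> m \<in> mcar M \<Longrightarrow> ac x a m \<in> mcar M"
  by (simp add: R.\<alpha>_closed rdiag_Re)

lemma rdiag_add: "rdiag x (a + c) = rdiag x a + rdiag x c"
  by (simp add: rdiag_def munit_add)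

lemma ac_add:
  "x \<in> uPm D \<Longrightarrow> a \<in> RR D x x \<Longrightarrow> c \<in> RR D x x \<Longrightarrow> m \<in> mcar M \<Longrightarrow> ac x (a + c) m = ac x a m + ac x c m"
  using R.\<alpha>_add[of "rdiag x a" "rdiag x c" m] by (simp add: rdiag_Re rdiag_add)

lemma ac_diff:
  "x \<in> uPm D \<Longrightarrow> a \<in> RR D x x \<Longrightarrow> c \<in> RR D x x \<Longrightarrow> m \<in> mcar M \<Longrightarrow> ac x (a - c) m = ac x a m - ac x c m"
  using ac_add[of x "a - c" c m] by (simp add: RR_diff)

lemma ac_zero: "m \<in> mcar M \<Longrightarrow> ac x 0 m = 0"
  using R.\<alpha>_add[OF Re_0 Re_0, of m] by (simp add: rdiag_def zero_prod_def flip: zero_prod_def)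

lemma mal_sum:
  "(\<And>i. i \<in> I \<Longrightarrow> f i \<in> mcar M) \<Longrightarrow> r \<in> carrier (Re D) \<Longrightarrow> mal M r (\<Sum>i\<in>I. f i) = (\<Sum>i\<in>I. mal M r (f i))"
  by (induction I rule: infinite_finite_induct) (auto simp: R.\<alpha>_0 R.\<alpha>_plus mod_sum[OF M])

lemma mal_sum_left:
  assumes "m \<in> mcar M" "\<And>i. i \<in> I \<Longrightarrow> f i \<in> carrier (Re D)"
  shows "mal M (\<Sum>i\<in>I. f i) m = (\<Sum>i\<in>I. mal M (f i) m)"
proof -
  have "mal M 0 m = 0" using R.\<alpha>_add[OF Re_0 Re_0 assms(1)] by simp
  moreover have "mal M (r + s) m = mal M r m + mal M s m" if "r \<in> carrier (Re D)" "s \<in> carrier (Re D)" for r s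
    using R.\<alpha>_add[OF that assms(1)] by simp
  ultimately show ?thesis using assms(2)
    by (induction I rule: infinite_finite_induct) (auto simp: Re_sum)
qed

lemma lb_basis: "x \<in> uPm D \<Longrightarrow> right_basis (RR D x x) (act_at D M x) (comp_at D M x) (dm x) (b x)"
  using lb by (simp add: local_basis_def)

lemma b_comp:
  assumes "x \<in> uPm D" "i \<in> {1..dm x}"
  shows "b x i \<in> mcar M" "ac x (eps D x) (b x i) = b x i"
proof -
  have "b x i \<in> comp_at D M x" using lb_basis[OF assms(1)] assms(2) by (auto simp: right_basis_def)
  then obtain m where m: "m \<in> mcar M" "b x i = ac x (eps D x) m" by (auto simp: comp_at_ac)
  then show "b x i \<in> mcar M" "ac x (eps D x) (b x i) = b x i"
    using assms by (simp_all add: ac_closed eps_in ac_ac eps_l[OF eps_in])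
qed

text \<open>The element is first projected to its component at \<open>x\<close>, so coordinates are
  defined on all of \<open>M\<close>. The choice is harmless since the basis property makes the
  coefficients unique (\<open>crd_eqI\<close>).\<close>

definition crd :: "'p xp \<Rightarrow> nat \<Rightarrow> 'm \<Rightarrow> 'a" where
  "crd x i m = (SOME c. c \<in> {1..dm x} \<rightarrow> RR D x x \<and>
     ac x (eps D x) m = (\<Sum>i=1..dm x. ac x (c i) (b x i))) i"

definition elt :: "('p xp \<Rightarrow> nat \<Rightarrow> 'a) \<Rightarrow> 'm" where
  "elt a = (\<Sum>x\<in>uPm D. \<Sum>i=1..dm x. ac x (a x i) (b x i))"

lemma crd:
  assumes "x \<in> uPm D" "m \<in> mcar M"
  shows "i \<in> {1..dm x} \<Longrightarrow> crd x i m \<in> RR D x x"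
    "ac x (eps D x) m = (\<Sum>i=1..dm x. ac x (crd x i m) (b x i))"
proof -
  have "ac x (eps D x) m \<in> comp_at D M x" using assms by (auto simp: comp_at_ac)
  then have "\<exists>c. c \<in> {1..dm x} \<rightarrow> RR D x x \<and> ac x (eps D x) m = (\<Sum>i=1..dm x. ac x (c i) (b x i))"
    using lb_basis[OF assms(1)] unfolding right_basis_def act_at_ac by blast
  from someI_ex[OF this]
  show "i \<in> {1..dm x} \<Longrightarrow> crd x i m \<in> RR D x x"
    "ac x (eps D x) m = (\<Sum>i=1..dm x. ac x (crd x i m) (b x i))"
    unfolding crd_def by auto
qed

lemma crd_eqI:
  assumes x: "x \<in> uPm D" and m: "m \<in> mcar M" and c: "\<And>i. i \<in> {1..dm x} \<Longrightarrow> c i \<in> RR D x x"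
    and eq: "ac x (eps D x) m = (\<Sum>i=1..dm x. ac x (c i) (b x i))" and i: "i \<in> {1..dm x}"
  shows "crd x i m = c i"
proof -
  let ?e = "\<lambda>i. crd x i m - c i"
  have "(\<Sum>i=1..dm x. ac x (?e i) (b x i)) = (\<Sum>i=1..dm x. ac x (crd x i m) (b x i) - ac x (c i) (b x i))"
    by (intro sum.cong refl ac_diff) (use x m c crd b_comp in auto)
  also have "\<dots> = 0" using crd(2)[OF x m] eq by (simp add: sum_subtractf)
  finally have sum0: "(\<Sum>i=1..dm x. ac x (?e i) (b x i)) = 0" .
  have e: "?e \<in> {1..dm x} \<rightarrow> RR D x x" using x m c crd(1) by (auto intro!: RR_diff)
  have "\<forall>c\<in>{1..dm x} \<rightarrow> RR D x x. (\<Sum>i=1..dm x. ac x (c i) (b x i)) = 0 \<longrightarrow> (\<forall>i\<in>{1..dm x}. c i = 0)"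
    using lb_basis[OF x] unfolding right_basis_def act_at_ac by (elim conjE)
  from this[THEN bspec, OF e] sum0 have "\<forall>i\<in>{1..dm x}. ?e i = 0" by (rule mp)
  then show ?thesis using i by simp
qed

lemma elt_crd:
  assumes m: "m \<in> mcar M"
  shows "elt (\<lambda>x i. crd x i m) = m"
proof -
  have "m = mal M \<one>\<^bsub>Re D\<^esub> m" using mact_one[OF M m] by (simp add: mal_def TT_one)
  also have "\<one>\<^bsub>Re D\<^esub> = (\<Sum>x\<in>uPm D. rdiag x (eps D x))"
    using Re_decomp[OF Re_one] by (simp add: rc_one)
  also have "mal M (\<Sum>x\<in>uPm D. rdiag x (eps D x)) m = (\<Sum>x\<in>uPm D. ac x (eps D x) m)"
    by (rule mal_sum_left) (auto simp: m rdiag_Re eps_in)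
  also have "\<dots> = elt (\<lambda>x i. crd x i m)" unfolding elt_def by (intro sum.cong refl crd(2) m)
  finally show ?thesis by simp
qed

lemma elt_closed:
  assumes "\<And>x i. x \<in> uPm D \<Longrightarrow> i \<in> {1..dm x} \<Longrightarrow> a x i \<in> RR D x x"
  shows "elt a \<in> mcar M"
  unfolding elt_def by (intro mod_sum[OF M] ac_closed assms b_comp)

lemma ac_b:
  "x \<in> uPm D \<Longrightarrow> y \<in> uPm D \<Longrightarrow> i \<in> {1..dm x} \<Longrightarrow> a \<in> RR D x x \<Longrightarrow> c \<in> RR D y y \<Longrightarrow>
    ac y c (ac x a (b x i)) = (if x = y then ac x (a * c) (b x i) else 0)"
  by (simp add: ac_ac b_comp)

lemma crd_elt:
  assumes a: "\<And>x i. x \<in> uPm D \<Longrightarrow> i \<in> {1..dm x} \<Longrightarrow> a x i \<in> RR D x x"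
    and x: "x \<in> uPm D" and i: "i \<in> {1..dm x}"
  shows "crd x i (elt a) = a x i"
proof (rule crd_eqI[OF x elt_closed[OF a] _ _ i])
  have "ac x (eps D x) (elt a) = (\<Sum>y\<in>uPm D. ac x (eps D x) (\<Sum>i=1..dm y. ac y (a y i) (b y i)))"
    unfolding elt_def
    by (intro mal_sum mod_sum[OF M] ac_closed a b_comp rdiag_Re x eps_in) auto
  also have "\<dots> = (\<Sum>y\<in>uPm D. \<Sum>i=1..dm y. ac x (eps D x) (ac y (a y i) (b y i)))"
    by (intro sum.cong refl mal_sum ac_closed a b_comp rdiag_Re x eps_in) auto
  also have "\<dots> = (\<Sum>y\<in>uPm D. if y = x then \<Sum>i=1..dm x. ac x (a x i) (b x i) else 0)"
  proof (rule sum.cong[OF refl])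
    fix y assume y: "y \<in> uPm D"
    have "(\<Sum>i=1..dm y. ac x (eps D x) (ac y (a y i) (b y i))) =
        (\<Sum>i=1..dm y. if y = x then ac x (a x i) (b x i) else 0)"
    proof (rule sum.cong[OF refl])
      fix i assume i: "i \<in> {1..dm y}"
      show "ac x (eps D x) (ac y (a y i) (b y i)) = (if y = x then ac x (a x i) (b x i) else 0)"
        using x y i a[OF y i] eps_r[OF a[OF y i] y y]
          by (cases "y = x") (simp_all add: ac_b eps_in)
    qed
    then show "(\<Sum>i=1..dm y. ac x (eps D x) (ac y (a y i) (b y i))) =
        (if y = x then \<Sum>i=1..dm x. ac x (a x i) (b x i) else 0)" by simp
  qed
  also have "\<dots> = (\<Sum>i=1..dm x. ac x (a x i) (b x i))" using x by simp
  finally show "ac x (eps D x) (elt a) = (\<Sum>i=1..dm x. ac x (a x i) (b x i))" .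
qed (use a x in auto)

lemma crd_ext:
  assumes "m \<in> mcar M" "m' \<in> mcar M" "\<And>x i. x \<in> uPm D \<Longrightarrow> i \<in> {1..dm x} \<Longrightarrow> crd x i m = crd x i m'"
  shows "m = m'"
proof -
  have "elt (\<lambda>x i. crd x i m) = elt (\<lambda>x i. crd x i m')"
    unfolding elt_def by (intro sum.cong refl) (simp add: assms(3))
  then show ?thesis using elt_crd assms by simp
qed

lemma crd_diff:
  assumes m: "m \<in> mcar M" "m' \<in> mcar M" and x: "x \<in> uPm D" and i: "i \<in> {1..dm x}"
  shows "crd x i (m - m') = crd x i m - crd x i m'"
proof (rule crd_eqI[OF x R.C_diff[OF m] _ _ i])
  have "(\<Sum>i=1..dm x. ac x (crd x i m - crd x i m') (b x i)) =
      (\<Sum>i=1..dm x. ac x (crd x i m) (b x i) - ac x (crd x i m') (b x i))"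
    by (intro sum.cong refl ac_diff x crd b_comp m) auto
  then show "ac x (eps D x) (m - m') = (\<Sum>i=1..dm x. ac x (crd x i m - crd x i m') (b x i))"
    using crd(2)[OF x m(1)] crd(2)[OF x m(2)] x m
    by (simp add: R.\<alpha>_diff rdiag_Re eps_in sum_subtractf)
qed (use x m crd RR_diff in auto)

lemma crd_0: "x \<in> uPm D \<Longrightarrow> i \<in> {1..dm x} \<Longrightarrow> crd x i 0 = 0"
  using crd_diff[of 0 0 x i] R.C_0 by simp

lemma crd_add:
  assumes "m \<in> mcar M" "m' \<in> mcar M" "x \<in> uPm D" "i \<in> {1..dm x}"
  shows "crd x i (m + m') = crd x i m + crd x i m'"
  using crd_diff[of "m + m'" m' x i] assms by (simp add: R.C_add)

lemma crd_sum:
  assumes "\<And>a. a \<in> A \<Longrightarrow> f a \<in> mcar M" "x \<in> uPm D" "i \<in> {1..dm x}"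
  shows "crd x i (\<Sum>a\<in>A. f a) = (\<Sum>a\<in>A. crd x i (f a))"
  using assms(1)
  by (induction A rule: infinite_finite_induct) (use assms(2,3) in \<open>auto simp: crd_0 crd_add mod_sum[OF M]\<close>)

lemma crd_mal:
  assumes r: "r \<in> carrier (Re D)" and m: "m \<in> mcar M" and x: "x \<in> uPm D" and i: "i \<in> {1..dm x}"
  shows "crd x i (mal M r m) = crd x i m * rc r x"
proof (rule crd_eqI[OF x R.\<alpha>_closed[OF r m] _ _ i])
  have c: "crd x i m * rc r x \<in> RR D x x" if "i \<in> {1..dm x}" for i
    by (rule RR_mult[of x x x]) (use x m r that crd rc_in in auto)
  then show "crd x i m * rc r x \<in> RR D x x" if "i \<in> {1..dm x}" for i using that .
  have e: "rdiag x (eps D x) \<in> carrier (Re D)" by (simp add: rdiag_Re eps_in x)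
  have rx: "rdiag x (rc r x) \<in> carrier (Re D)" by (simp add: rdiag_Re rc_in r x)
  have "r \<otimes>\<^bsub>Re D\<^esub> rdiag x (eps D x) = rdiag x (eps D x) \<otimes>\<^bsub>Re D\<^esub> rdiag x (rc r x)"
    by (rule Re_eqI)
      (use r x e rx in \<open>auto simp: Re_mult_closed Re_mult_rc rc_rdiag eps_l[OF rc_in] eps_r[OF rc_in]\<close>)
  then have "ac x (eps D x) (mal M r m) = ac x (rc r x) (ac x (eps D x) m)"
    using R.\<alpha>_mult[OF r e m] R.\<alpha>_mult[OF e rx m] by simp
  also have "\<dots> = (\<Sum>i=1..dm x. ac x (rc r x) (ac x (crd x i m) (b x i)))"
    unfolding crd(2)[OF x m] by (rule mal_sum) (use rx x m crd b_comp ac_closed in auto)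
  also have "\<dots> = (\<Sum>i=1..dm x. ac x (crd x i m * rc r x) (b x i))"
    by (rule sum.cong[OF refl]) (use r x m in \<open>simp add: ac_b crd rc_in\<close>)
  finally show "ac x (eps D x) (mal M r m) = (\<Sum>i=1..dm x. ac x (crd x i m * rc r x) (b x i))" .
qed

lemma crd_b:
  assumes x: "x \<in> uPm D" "y \<in> uPm D" and i: "i \<in> {1..dm x}" "k \<in> {1..dm y}"
  shows "crd x i (b y k) = (if x = y \<and> i = k then eps D x else 0)"
proof (rule crd_eqI[OF x(1) b_comp(1)[OF x(2) i(2)] _ _ i(1)])
  show "ac x (eps D x) (b y k) = (\<Sum>i=1..dm x. ac x (if x = y \<and> i = k then eps D x else 0) (b x i))"
  proof (cases "x = y")
    case True
    have "(\<Sum>i=1..dm x. ac x (if x = y \<and> i = k then eps D x else 0) (b x i)) =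
        (\<Sum>i=1..dm x. if i = k then ac x (eps D x) (b x i) else 0)"
      by (rule sum.cong[OF refl]) (use True x b_comp in \<open>auto simp: ac_zero\<close>)
    then show ?thesis using True i by simp
  next
    case False
    have "ac x (eps D x) (b y k) = ac x (eps D x) (ac y (eps D y) (b y k))"
      by (simp only: b_comp(2)[OF x(2) i(2)])
    also have "\<dots> = 0" using False x i by (subst ac_b) (auto simp: eps_in)
    finally show ?thesis using False x b_comp by (simp add: ac_zero)
  qed
qed (use x in \<open>auto simp: eps_in RR_0\<close>)

definition W0_act :: "('a, 'p) dual \<Rightarrow> 'm \<Rightarrow> 'm" where
  "W0_act \<gamma> m = mact M m (in_W0 D \<gamma>)"

lemma W0_act_mbe: "W0_act \<gamma> m = mbe M (\<gamma>, 0) m"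
  by (simp add: W0_act_def mbe_def)

lemma W0_W: "\<gamma> \<in> W0 \<Longrightarrow> (\<gamma>, 0) \<in> bcarrier (WW D)"
  by (simp add: W_0 diag_idems)

lemma W0_act_closed: "\<gamma> \<in> W0 \<Longrightarrow> m \<in> mcar M \<Longrightarrow> W0_act \<gamma> m \<in> mcar M"
  by (simp add: W0_act_mbe R.\<beta>_closed W_0 diag_idems)

lemma W0_act_zero: "m \<in> mcar M \<Longrightarrow> W0_act 0 m = 0"
  using R.\<beta>_add[OF W0_W[of 0] W0_W[of 0], of m] by (simp add: W0_act_mbe W_0 diag_idems)

lemma W0_act_0: "\<gamma> \<in> W0 \<Longrightarrow> W0_act \<gamma> 0 = 0"
  using R.\<beta>_0[OF W0_W] by (simp add: W0_act_mbe)

lemma W0_act_diff: "\<gamma> \<in> W0 \<Longrightarrow> m \<in> mcar M \<Longrightarrow> m' \<in> mcar M \<Longrightarrow> W0_act \<gamma> (m - m') = W0_act \<gamma> m - W0_act \<gamma> m'"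
  using R.\<beta>_diff[OF W0_W] by (simp add: W0_act_mbe)

lemma W0_act_add: "\<gamma> \<in> W0 \<Longrightarrow> m \<in> mcar M \<Longrightarrow> m' \<in> mcar M \<Longrightarrow> W0_act \<gamma> (m + m') = W0_act \<gamma> m + W0_act \<gamma> m'"
  using W0_act_diff[of \<gamma> "m + m'" m'] by (simp add: R.C_add)

lemma W0_act_sum_right:
  assumes "\<gamma> \<in> W0" "\<And>i. i \<in> I \<Longrightarrow> f i \<in> mcar M"
  shows "W0_act \<gamma> (\<Sum>i\<in>I. f i) = (\<Sum>i\<in>I. W0_act \<gamma> (f i))"
  using assms(2)
  by (induction I rule: infinite_finite_induct) (use assms(1) in \<open>auto simp: W0_act_0 W0_act_add mod_sum[OF M]\<close>)

lemma W0_act_sum: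
  assumes "\<And>i. i \<in> I \<Longrightarrow> \<gamma> i \<in> W0" "m \<in> mcar M"
  shows "W0_act (\<Sum>i\<in>I. \<gamma> i) m = (\<Sum>i\<in>I. W0_act (\<gamma> i) m)"
  using R.\<beta>_sum[of I "\<lambda>i. (\<gamma> i, 0)" m] assms
  by (simp add: W0_act_def mbe_def W_0 diag_idems zero_prod_def fst_sum)

lemma W0_act_l: "(a, c) \<in> carrier (Re D) \<Longrightarrow> \<gamma> \<in> W0 \<Longrightarrow> m \<in> mcar M \<Longrightarrow> W0_act (dual_l D a \<gamma>) m = W0_act \<gamma> (mal M (a, c) m)"
  using R.\<beta>_lact[of "(a, c)" "(\<gamma>, 0)" m] by (simp add: W0_act_mbe W_0 diag_idems)

lemma W0_act_r: "(a, c) \<in> carrier (Re D) \<Longrightarrow> \<gamma> \<in> W0 \<Longrightarrow> m \<in> mcar M \<Longrightarrow> W0_act (dual_r D \<gamma> c) m = mal M (a, c) (W0_act \<gamma> m)"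
  using R.\<beta>_ract[of "(a, c)" "(\<gamma>, 0)" m] by (simp add: W0_act_mbe W_0 diag_idems)

lemma W0_act_Bot:
  assumes g: "\<gamma> \<in> W0" and m: "m \<in> mcar M"
  shows "W0_act \<gamma> m = ac Bot (eps D Bot) (W0_act \<gamma> m)"
proof -
  have "rdiag Bot (eps D Bot) = (0, ee D Bot)" by (simp add: rdiag_def ee_def)
  moreover have "rdiag Bot (eps D Bot) \<in> carrier (Re D)" by (simp add: rdiag_Re eps_in)
  ultimately show ?thesis using W0_act_r[of 0 "ee D Bot" \<gamma> m] g m by (simp add: W0_iff)
qed

lemma crd_W0_act_out:
  assumes g: "\<gamma> \<in> W0" and m: "m \<in> mcar M" and x: "x \<in> Pm D" "i \<in> {1..dm x}"
  shows "crd x i (W0_act \<gamma> m) = 0"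
proof -
  have "rdiag Bot (eps D Bot) \<in> carrier (Re D)" by (simp add: rdiag_Re eps_in)
  then show ?thesis
    using crd_mal[of "rdiag Bot (eps D Bot)" "W0_act \<gamma> m" x i] W0_act_Bot[OF g m] g m x
    by (simp add: W0_act_closed rc_rdiag Pm_iff)
qed

end

section \<open>Stripes and the action of \<open>W\<^sub>0\<close>\<close>

locale De_stripe = De_basis D B M b
  for D :: "('k::field, 'a::ring_1, 'p::order) eposet" and B :: "('a, 'p) imat set"
    and M :: "(('a, 'p) t_el, 'm::ab_group_add) rmod" and b :: "'p xp \<Rightarrow> nat \<Rightarrow> 'm" +
  fixes v :: "'p xp \<Rightarrow> 'a"
  assumes v_gen: "\<And>x. x \<in> Pm D \<Longrightarrow> v x \<in> RR D Bot x \<and> RR D Bot x = {v x * r | r. r \<in> RR D x x}"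
begin

abbreviation "B0 \<equiv> B \<inter> peirceJ D (ee D Bot) (ehat D)"
abbreviation "rels \<equiv> tensor_rels (RR D Bot Bot) (comp_at D M Bot) (act_at D M Bot)
     (peirceJ D (ee D Bot) (ehat D)) (\<lambda>r u. mm D (munit Bot Bot r) u)"

lemma M0J_eq: "M0J_cl D M x = M0J_cl D M y \<longleftrightarrow> x - y \<in> add_hull rels"
  by (simp add: M0J_cl_def add_coset_eq_iff)

lemma peirceJ_Bot: "u \<in> peirceJ D (ee D Bot) (ehat D) \<longleftrightarrow> u \<in> JJ D \<and> mm D (ee D Bot) u = u"
proof
  assume "u \<in> peirceJ D (ee D Bot) (ehat D)"
  then obtain u' where u': "u' \<in> JJ D" "u = mm D (ee D Bot) u'" by (auto simp: peirceJ_def JJ_ehat)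
  then show "u \<in> JJ D \<and> mm D (ee D Bot) u = u"
    using diag_idem_mm[OF diag_idems(2)] by (simp add: JJ_mm_SS ee_SS mmul_assoc)
next
  assume "u \<in> JJ D \<and> mm D (ee D Bot) u = u"
  then have "u = mm D (ee D Bot) (mm D u (ehat D))" "u \<in> JJ D" by (simp_all add: JJ_ehat)
  then show "u \<in> peirceJ D (ee D Bot) (ehat D)" unfolding peirceJ_def by blast
qed

lemma comp_Bot_iff: "m \<in> comp_at D M Bot \<longleftrightarrow> m \<in> mcar M \<and> ac Bot (eps D Bot) m = m"
proof
  assume "m \<in> comp_at D M Bot"
  then obtain m' where "m' \<in> mcar M" "m = ac Bot (eps D Bot) m'" by (auto simp: comp_at_ac)
  then show "m \<in> mcar M \<and> ac Bot (eps D Bot) m = m"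
    by (simp add: ac_closed eps_in ac_ac eps_l[OF eps_in])
qed (auto simp: comp_at_ac intro: exI[of _ m])

text \<open>A linear form on the tensor product recovering the action of \<open>w\<^sub>1\<^sub>,\<^sub>2 \<gamma>\<close> from \<open>htilde\<close>.\<close>
definition pairing :: "('a, 'p) dual \<Rightarrow> 'm \<times> ('a, 'p) imat \<Rightarrow> 'm" where
  "pairing \<gamma> = (\<lambda>(m, u). ac Bot (\<gamma> u Bot Bot) m)"

text \<open>The form is additive in both arguments, and it is balanced because
  \<open>\<gamma>\<close> is left linear over \<open>R\<^sub>0\<close>.\<close>

lemma pairing_rels:
  assumes g: "\<gamma> \<in> W0" and h: "h \<in> add_hull rels"
  shows "fext (pairing \<gamma>) h = 0"
  using h
proof (induction h rule: add_hull.induct)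
  case (base h)
  have gJ: "\<gamma> \<in> dualJ D" using g by (simp add: W0_iff)
  have gu: "\<gamma> u Bot Bot \<in> RR D Bot Bot" if "u \<in> JJ D" for u by (simp add: SS_in dualJ_SS[OF gJ that])
  from base consider
    m m' u where "h = frag_of (m + m', u) - frag_of (m, u) - frag_of (m', u)" "m \<in> comp_at D M Bot"
      "m' \<in> comp_at D M Bot" "u \<in> peirceJ D (ee D Bot) (ehat D)"
  | m u u' where "h = frag_of (m, u + u') - frag_of (m, u) - frag_of (m, u')" "m \<in> comp_at D M Bot"
      "u \<in> peirceJ D (ee D Bot) (ehat D)" "u' \<in> peirceJ D (ee D Bot) (ehat D)"
  | m a u where "h = frag_of (act_at D M Bot m a, u) - frag_of (m, mm D (munit Bot Bot a) u)"
      "m \<in> comp_at D M Bot" "a \<in> RR D Bot Bot" "u \<in> peirceJ D (ee D Bot) (ehat D)"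
    unfolding tensor_rels_def by blast
  then show ?case
  proof cases
    case 1
    then show ?thesis
      by (simp add: fext_diff pairing_def comp_Bot_iff peirceJ_Bot R.\<alpha>_plus rdiag_Re gu)
  next
    case 2
    then show ?thesis
      by (simp add: fext_diff pairing_def comp_Bot_iff peirceJ_Bot dualJ_add[OF gJ] ac_add gu)
  next
    case 3
    then show ?thesis
      by (simp add: fext_diff pairing_def comp_Bot_iff peirceJ_Bot act_at_ac ac_ac gu munit_SS
          dualJ_lin[OF gJ] mmul_munit_left)
  qed
qed (simp_all add: fext_diff)

lemma hull_sum_left:
  assumes u: "u \<in> peirceJ D (ee D Bot) (ehat D)" and f: "\<And>i. i \<in> I \<Longrightarrow> f i \<in> comp_at D M Bot"
  shows "frag_of (\<Sum>i\<in>I. f i, u) - (\<Sum>i\<in>I. frag_of (f i, u)) \<in> add_hull rels \<and> (\<Sum>i\<in>I. f i) \<in> comp_at D M Bot"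
  using f
proof (induction I rule: infinite_finite_induct)
  case (insert x F)
  then have s: "(\<Sum>i\<in>F. f i) \<in> comp_at D M Bot" "f x \<in> comp_at D M Bot" by auto
  have "frag_of (f x + (\<Sum>i\<in>F. f i), u) - frag_of (f x, u) - frag_of (\<Sum>i\<in>F. f i, u) \<in> add_hull rels"
    by (rule add_hull.base) (use s u in \<open>auto simp: tensor_rels_def\<close>)
  moreover have "frag_of (\<Sum>i\<in>F. f i, u) - (\<Sum>i\<in>F. frag_of (f i, u)) \<in> add_hull rels" using insert by simp
  ultimately have "frag_of (f x + (\<Sum>i\<in>F. f i), u) - (frag_of (f x, u) + (\<Sum>i\<in>F. frag_of (f i, u))) \<in> add_hull rels"
    by (rule add_hull_trans)
  moreover have "f x + (\<Sum>i\<in>F. f i) \<in> comp_at D M Bot"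
    using s by (simp add: comp_Bot_iff R.C_add R.\<alpha>_plus rdiag_Re eps_in)
  ultimately show ?case using insert by simp
next
  case empty
  have c0: "0 \<in> comp_at D M Bot" by (simp add: comp_Bot_iff R.C_0 R.\<alpha>_0 rdiag_Re eps_in)
  \<comment> \<open>Additivity at \<open>0 + 0\<close> leaves \<open>- frag_of (0, u)\<close>, so
    the empty sum is covered by the relations.\<close>
  have "frag_of (0 + 0, u) - frag_of (0, u) - frag_of (0, u) \<in> add_hull rels"
    unfolding tensor_rels_def by (rule add_hull.base) (use c0 u in blast)
  then show ?case using add_hull_uminus[of "- frag_of (0, u)"] c0 by simp
next
  case (infinite A)
  have c0: "0 \<in> comp_at D M Bot" by (simp add: comp_Bot_iff R.C_0 R.\<alpha>_0 rdiag_Re eps_in)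
  have "frag_of (0 + 0, u) - frag_of (0, u) - frag_of (0, u) \<in> add_hull rels"
    unfolding tensor_rels_def by (rule add_hull.base) (use c0 u in blast)
  then show ?case using add_hull_uminus[of "- frag_of (0, u)"] c0 infinite by simp
qed

lemma peirceJ_Bot_add:
  "u \<in> peirceJ D (ee D Bot) (ehat D) \<Longrightarrow> u' \<in> peirceJ D (ee D Bot) (ehat D) \<Longrightarrow>
    u + u' \<in> peirceJ D (ee D Bot) (ehat D)"
  by (simp add: peirceJ_Bot JJ_add mmul_add_right)

lemma hull_sum_right:
  assumes m: "m \<in> comp_at D M Bot" and f: "\<And>i. i \<in> I \<Longrightarrow> f i \<in> peirceJ D (ee D Bot) (ehat D)" and I: "finite I"
  shows "frag_of (m, \<Sum>i\<in>I. f i) - (\<Sum>i\<in>I. frag_of (m, f i)) \<in> add_hull rels \<and>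
    (\<Sum>i\<in>I. f i) \<in> peirceJ D (ee D Bot) (ehat D)"
  using I f
proof (induction I rule: finite_induct)
  case (insert x F)
  then have s: "(\<Sum>i\<in>F. f i) \<in> peirceJ D (ee D Bot) (ehat D)" "f x \<in> peirceJ D (ee D Bot) (ehat D)" by auto
  have "frag_of (m, f x + (\<Sum>i\<in>F. f i)) - frag_of (m, f x) - frag_of (m, \<Sum>i\<in>F. f i) \<in> add_hull rels"
    unfolding tensor_rels_def by (rule add_hull.base) (use s m in blast)
  moreover have "frag_of (m, \<Sum>i\<in>F. f i) - (\<Sum>i\<in>F. frag_of (m, f i)) \<in> add_hull rels" using insert by simp
  ultimately have "frag_of (m, f x + (\<Sum>i\<in>F. f i)) - (frag_of (m, f x) + (\<Sum>i\<in>F. frag_of (m, f i))) \<in> add_hull rels"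
    by (rule add_hull_trans)
  then show ?case using insert peirceJ_Bot_add[OF s(2,1)] by (simp del: plus_fun_apply)
next
  case empty
  have z: "0 \<in> peirceJ D (ee D Bot) (ehat D)" by (simp add: peirceJ_Bot JJ_0)
  have "frag_of (m, 0 + 0) - frag_of (m, 0) - frag_of (m, 0) \<in> add_hull rels"
    unfolding tensor_rels_def by (rule add_hull.base) (use z m in blast)
  then have "- frag_of (m, 0) \<in> add_hull rels" by (simp only: add_0_right diff_self diff_0)
  then have "frag_of (m, 0) \<in> add_hull rels" using add_hull_uminus by fastforce
  then show ?case using z by (simp only: sum.empty diff_0_right simp_thms)
qed


text \<open>The coefficients of the action of \<open>\<gamma>\<^sub>p\<close> on the basis vector
  are moved across the tensor sign onto \<open>p\<close>. For each \<open>j\<close> the terms then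
  add up to a single element of \<open>e\<^sub>0 J\<close>, and it lies in
  \<open>e\<^sub>0 J e\<^sub>x\<close>. Dividing by \<open>v\<^sub>x\<close> later gives the
  stripe.\<close>

lemma htilde_expand:
  assumes x: "x \<in> Pm D" and i: "i \<in> {1..dm x}"
  shows "\<exists>t. (\<forall>j\<in>{1..dm Bot}. t j \<in> RR D Bot x) \<and>
    htilde D B M (b x i) = M0J_cl D M (\<Sum>j=1..dm Bot. frag_of (b Bot j, munit Bot x (t j)))"
proof -
  let ?m = "b x i"
  have xu: "x \<in> uPm D" "x \<noteq> Bot" "Bot < x" using x by (simp_all add: Pm_iff Bot_less)
  have m: "?m \<in> mcar M" by (rule b_comp(1)[OF xu(1) i])
  have g: "dual_el p \<in> W0" if "p \<in> B0" for p by (rule dual_el_peirceD[OF diag_idems(2) that])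
  define c where "c p j = crd Bot j (W0_act (dual_el p) ?m)" for p j
  have cR: "c p j \<in> RR D Bot Bot" if "p \<in> B0" "j \<in> {1..dm Bot}" for p j
    unfolding c_def using that by (intro crd W0_act_closed g m) auto
  have W0_act: "W0_act (dual_el p) ?m = (\<Sum>j=1..dm Bot. ac Bot (c p j) (b Bot j))" if p: "p \<in> B0" for p
    using W0_act_Bot[OF g[OF p] m] crd(2)[OF Bot_in_uPm W0_act_closed[OF g[OF p] m]] by (simp add: c_def)
  have bB: "b Bot j \<in> comp_at D M Bot" "ac Bot a (b Bot j) \<in> comp_at D M Bot"
    if "j \<in> {1..dm Bot}" "a \<in> RR D Bot Bot" for j a
    using that by (simp_all add: comp_Bot_iff b_comp ac_closed ac_b eps_in eps_r)
  have B0J: "p \<in> peirceJ D (ee D Bot) (ehat D)" "p \<in> JJ D" if "p \<in> B0" for p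
    using that by (auto simp: B_JJ)
  have mmJ: "mm D (munit Bot Bot a) p \<in> peirceJ D (ee D Bot) (ehat D)" if "p \<in> B0" "a \<in> RR D Bot Bot" for a p
    using that B0J(2)[OF that(1)]
    by (simp add: peirceJ_Bot JJ_mm_SS munit_SS mmul_assoc)
      (simp add: ee_def mmul_munit_munit eps_l)
  define t where "t j = (\<Sum>p\<in>Bs Bot x. c p j * p Bot x)" for j
  have BsB0: "Bs Bot x \<subseteq> B0" using Bs_peirceJ[OF diag_idems(2)] BsD by (auto simp: ee_apply)
  have tR: "t j \<in> RR D Bot x" if "j \<in> {1..dm Bot}" for j
    unfolding t_def
  proof (rule RR_sum)
    fix p assume p: "p \<in> Bs Bot x"
    show "c p j * p Bot x \<in> RR D Bot x"
      by (rule RR_mult[of Bot Bot x]) (use xu cR[of p j] p BsB0 that Bs_munit(2)[OF p] in auto)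
  qed (use xu in auto)
  \<comment> \<open>If \<open>p\<close> lies in a column other than \<open>x\<close>, then
    \<open>e\<^sub>x \<gamma>\<^sub>p = 0\<close>, so \<open>\<gamma>\<^sub>p\<close> kills the
    component of \<open>M\<close> at \<open>x\<close>.\<close>
  have c0: "c p j = 0" if p: "p \<in> B0" "p \<notin> Bs Bot x" and j: "j \<in> {1..dm Bot}" for p j
  proof -
    obtain y x' where yx: "p \<in> Bs y x'" using B_Bs p by blast
    have "ee D Bot y y = eps D y" using Bs_peirceJ[OF diag_idems(2) yx] p(1) by blast
    then have "y = Bot" using eps_nz[of y] BsD[OF yx] by (metis ee_apply)
    then have x': "x' \<noteq> x" using p yx by auto
    have r: "rdiag x (eps D x) = (ee D x, 0)" "rdiag x (eps D x) \<in> carrier (Re D)"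
      using xu by (simp add: rdiag_def ee_def, intro rdiag_Re eps_in)
    have "dual_l D (ee D x) (dual_el p) = 0"
    proof (rule ext)
      fix u
      show "dual_l D (ee D x) (dual_el p) u = 0 u"
      proof (cases "u \<in> JJ D")
        case True
        have "dual_el p (mm D u (ee D x)) = 0"
          by (rule dual_el_zero[OF yx]) (use True xu x' in \<open>simp_all add: JJ_SS_mm ee_SS mm_SS_right ee_apply\<close>)
        then show ?thesis using True by (simp add: dual_l_def)
      qed (simp add: dual_l_def)
    qed
    then have "W0_act (dual_el p) ?m = 0"
      using W0_act_l[of "ee D x" 0 "dual_el p" ?m] r g[OF p(1)] m b_comp(2)[OF xu(1) i] W0_act_zero[OF m] by simp
    then show ?thesis using j by (simp add: c_def crd_0)
  qed
  have sum_t: "(\<Sum>p\<in>B0. mm D (munit Bot Bot (c p j)) p) = munit Bot x (t j)" if j: "j \<in> {1..dm Bot}" for j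
  proof -
    have "(\<Sum>p\<in>B0. mm D (munit Bot Bot (c p j)) p) = (\<Sum>p\<in>Bs Bot x. mm D (munit Bot Bot (c p j)) p)"
      by (rule sum.mono_neutral_right) (use BsB0 c0 j in \<open>auto simp: finite_B\<close>)
    then show ?thesis by (simp add: t_def munit_sum Bs_act)
  qed
  let ?F = "\<Sum>p\<in>B0. \<Sum>j=1..dm Bot. frag_of (b Bot j, mm D (munit Bot Bot (c p j)) p)"
  have "(\<Sum>p\<in>B0. frag_of (W0_act (dual_el p) ?m, p) - (\<Sum>j=1..dm Bot. frag_of (b Bot j, mm D (munit Bot Bot (c p j)) p)))
      \<in> add_hull rels"
  proof (rule add_hull_sum)
    fix p assume p: "p \<in> B0"
    have A: "frag_of (W0_act (dual_el p) ?m, p) - (\<Sum>j=1..dm Bot. frag_of (ac Bot (c p j) (b Bot j), p)) \<in> add_hull rels"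
      unfolding W0_act[OF p] by (rule hull_sum_left[THEN conjunct1]) (use p cR bB B0J in auto)
    have B: "(\<Sum>j=1..dm Bot. frag_of (ac Bot (c p j) (b Bot j), p) -
        frag_of (b Bot j, mm D (munit Bot Bot (c p j)) p)) \<in> add_hull rels"
    proof (intro add_hull_sum add_hull.base)
      fix j assume j: "j \<in> {1..dm Bot}"
      show "frag_of (ac Bot (c p j) (b Bot j), p) - frag_of (b Bot j, mm D (munit Bot Bot (c p j)) p) \<in> rels"
        using bB(1)[OF j eps_in[OF Bot_in_uPm]] cR[OF p j] B0J(1)[OF p] unfolding tensor_rels_def act_at_ac by blast
    qed
    show "frag_of (W0_act (dual_el p) ?m, p) -
        (\<Sum>j=1..dm Bot. frag_of (b Bot j, mm D (munit Bot Bot (c p j)) p)) \<in> add_hull rels"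
      using add_hull_add[OF A B] by (simp add: sum_subtractf)
  qed
  then have 1: "(\<Sum>p\<in>B0. frag_of (W0_act (dual_el p) ?m, p)) - ?F \<in> add_hull rels" by (simp add: sum_subtractf)
  have "(\<Sum>j=1..dm Bot. frag_of (b Bot j, munit Bot x (t j)) -
      (\<Sum>p\<in>B0. frag_of (b Bot j, mm D (munit Bot Bot (c p j)) p))) \<in> add_hull rels"
  proof (rule add_hull_sum)
    fix j assume j: "j \<in> {1..dm Bot}"
    show "frag_of (b Bot j, munit Bot x (t j)) -
      (\<Sum>p\<in>B0. frag_of (b Bot j, mm D (munit Bot Bot (c p j)) p)) \<in> add_hull rels"
      unfolding sum_t[OF j, symmetric]
      by (rule hull_sum_right[THEN conjunct1]) (use j bB(1)[OF j eps_in[OF Bot_in_uPm]] mmJ cR in \<open>auto simp: finite_B\<close>)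
  qed
  then have 2: "(\<Sum>j=1..dm Bot. frag_of (b Bot j, munit Bot x (t j))) - ?F \<in> add_hull rels"
    by (simp add: sum_subtractf) (subst sum.swap, simp)
  have "(\<Sum>p\<in>B0. frag_of (W0_act (dual_el p) ?m, p)) - (\<Sum>j=1..dm Bot. frag_of (b Bot j, munit Bot x (t j)))
      \<in> add_hull rels"
    using add_hull.diff[OF 1 2] by simp
  then have "htilde D B M ?m = M0J_cl D M (\<Sum>j=1..dm Bot. frag_of (b Bot j, munit Bot x (t j)))"
    by (simp add: htilde_def M0J_eq W0_act_def)
  then show ?thesis using tR by blast
qed

text \<open>\<open>stripe\<close> chooses all columns at once; the columns, obtained one at a time
  from \<open>htilde_expand\<close> and the generator \<open>v x\<close>, are first assembled into a
  single matrix.\<close>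

lemma stripe_spec:
  assumes x: "x \<in> Pm D" and i: "i \<in> {1..dm x}"
  shows "j \<in> {1..dm Bot} \<Longrightarrow> stripe D B v M b x j i \<in> RR D x x"
    "htilde D B M (b x i) = M0J_cl D M (\<Sum>j=1..dm Bot. frag_of (b Bot j, munit Bot x (v x * stripe D B v M b x j i)))"
proof -
  let ?P = "\<lambda>X. \<forall>i\<in>{1..dm x}. (\<forall>j\<in>{1..dm Bot}. X j i \<in> RR D x x) \<and>
    htilde D B M (b x i) = M0J_cl D M (\<Sum>j=1..dm Bot. frag_of (b Bot j, munit Bot x (v x * X j i)))"
  have "\<exists>Y. (\<forall>j\<in>{1..dm Bot}. Y j \<in> RR D x x) \<and>
    htilde D B M (b x i) = M0J_cl D M (\<Sum>j=1..dm Bot. frag_of (b Bot j, munit Bot x (v x * Y j)))"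
    if i: "i \<in> {1..dm x}" for i
  proof -
    obtain t where t: "\<And>j. j \<in> {1..dm Bot} \<Longrightarrow> t j \<in> RR D Bot x"
      "htilde D B M (b x i) = M0J_cl D M (\<Sum>j=1..dm Bot. frag_of (b Bot j, munit Bot x (t j)))"
      using htilde_expand[OF x i] by blast
    have "\<forall>j. \<exists>r. j \<in> {1..dm Bot} \<longrightarrow> r \<in> RR D x x \<and> t j = v x * r" using t(1) v_gen[OF x] by blast
    then obtain Y where Y: "\<And>j. j \<in> {1..dm Bot} \<Longrightarrow> Y j \<in> RR D x x \<and> t j = v x * Y j" by metis
    then have "(\<Sum>j=1..dm Bot. frag_of (b Bot j, munit Bot x (t j))) =
        (\<Sum>j=1..dm Bot. frag_of (b Bot j, munit Bot x (v x * Y j)))" by (intro sum.cong) simp_all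
    with t(2) have "htilde D B M (b x i) = M0J_cl D M (\<Sum>j=1..dm Bot. frag_of (b Bot j, munit Bot x (v x * Y j)))"
      by (simp only:)
    then show ?thesis using Y by blast
  qed
  then have "\<forall>i\<in>{1..dm x}. \<exists>Y. (\<forall>j\<in>{1..dm Bot}. Y j \<in> RR D x x) \<and>
    htilde D B M (b x i) = M0J_cl D M (\<Sum>j=1..dm Bot. frag_of (b Bot j, munit Bot x (v x * Y j)))"
    by blast
  from bchoice[OF this] obtain Y where "\<forall>i\<in>{1..dm x}. (\<forall>j\<in>{1..dm Bot}. Y i j \<in> RR D x x) \<and>
    htilde D B M (b x i) = M0J_cl D M (\<Sum>j=1..dm Bot. frag_of (b Bot j, munit Bot x (v x * Y i j)))" ..
  then have "?P (\<lambda>j i. Y i j)" .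
  then have "?P (stripe D B v M b x)" unfolding stripe_def by (rule someI[of ?P])
  then show "j \<in> {1..dm Bot} \<Longrightarrow> stripe D B v M b x j i \<in> RR D x x"
    "htilde D B M (b x i) = M0J_cl D M (\<Sum>j=1..dm Bot. frag_of (b Bot j, munit Bot x (v x * stripe D B v M b x j i)))"
    using i by blast+
qed

lemma v_stripe:
  assumes "x \<in> Pm D" "i \<in> {1..dm x}" "j \<in> {1..dm Bot}"
  shows "v x * stripe D B v M b x j i \<in> RR D Bot x"
  using v_gen[OF assms(1)] stripe_spec(1)[OF assms] by blast

text \<open>The linear form of \<open>\<gamma>\<close> is applied to both sides of the equation that
  defines the stripe. On the side of \<open>htilde\<close> it yields the action of
  \<open>\<Sum> \<gamma>\<^sub>p \<gamma>(p)\<close>, which is \<open>\<gamma>\<close> by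
  \<open>dual_repr\<close>.\<close>

lemma W0_act_b:
  assumes g: "\<gamma> \<in> W0" and x: "x \<in> Pm D" and i: "i \<in> {1..dm x}"
  shows "W0_act \<gamma> (b x i) = (\<Sum>j=1..dm Bot. ac Bot (pr \<gamma> Bot x (v x * stripe D B v M b x j i)) (b Bot j))"
proof -
  have m: "b x i \<in> mcar M" using x i by (intro b_comp) (auto simp: Pm_iff)
  have gJ: "\<gamma> \<in> dualJ D" using g by (simp add: W0_iff)
  have d: "dual_el p \<in> W0" if "p \<in> B0" for p by (rule dual_el_peirceD[OF diag_idems(2) that])
  have "(\<Sum>p\<in>B0. frag_of (W0_act (dual_el p) (b x i), p)) -
      (\<Sum>j=1..dm Bot. frag_of (b Bot j, munit Bot x (v x * stripe D B v M b x j i))) \<in> add_hull rels"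
    using stripe_spec(2)[OF x i] by (simp add: htilde_def M0J_eq W0_act_def)
  from pairing_rels[OF g this]
  have "(\<Sum>p\<in>B0. ac Bot (\<gamma> p Bot Bot) (W0_act (dual_el p) (b x i))) =
      (\<Sum>j=1..dm Bot. ac Bot (pr \<gamma> Bot x (v x * stripe D B v M b x j i)) (b Bot j))"
    by (simp add: fext_diff fext_sum pairing_def pr_def)
  moreover have "ac Bot (\<gamma> p Bot Bot) (W0_act (dual_el p) (b x i)) = W0_act (dual_r D (dual_el p) (\<gamma> p)) (b x i)"
    if p: "p \<in> B0" for p
  proof -
    have pJ: "p \<in> JJ D" using p by (auto simp: B_JJ)
    have "\<gamma> p = munit Bot Bot (\<gamma> p Bot Bot)"
    proof (rule SS_eqI[OF dualJ_SS[OF gJ pJ] munit_SS])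
      fix y
      show "\<gamma> p y y = munit Bot Bot (\<gamma> p Bot Bot) y y"
        using peirceD_entry[OF diag_idems(2) g, of y p] by (auto simp: munit_apply ee_apply)
    qed (use SS_in[OF dualJ_SS[OF gJ pJ], of Bot] in auto)
    then have "rdiag Bot (\<gamma> p Bot Bot) = (0, \<gamma> p)" by (simp add: rdiag_def)
    then show ?thesis
      using W0_act_r[of 0 "\<gamma> p" "dual_el p" "b x i"] d[OF p] m rdiag_Re[of Bot "\<gamma> p Bot Bot"]
        SS_in[OF dualJ_SS[OF gJ pJ], of Bot] by simp
  qed
  moreover have "(\<Sum>p\<in>B0. W0_act (dual_r D (dual_el p) (\<gamma> p)) (b x i)) = W0_act \<gamma> (b x i)"
    using W0_act_sum[of B0 "\<lambda>p. dual_r D (dual_el p) (\<gamma> p)" "b x i"] m dual_repr[OF diag_idems(2) g]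
      peirceD_dual_r[OF diag_idems(2) g dual_el_dualJ B_JJ] by simp
  ultimately show ?thesis by simp
qed

text \<open>A coordinate of \<open>m\<close> is absorbed by \<open>\<gamma>\<close> as a left factor
  and from there enters the argument of \<open>pr\<close> as a right factor, next to the entry of
  the stripe. Stripes therefore act on coordinate vectors by matrix multiplication.\<close>

lemma crd_W0_act:
  assumes g: "\<gamma> \<in> W0" and m: "m \<in> mcar M" and j: "j \<in> {1..dm Bot}"
  shows "crd Bot j (W0_act \<gamma> m) = (\<Sum>x\<in>Pm D. \<Sum>k=1..dm x. pr \<gamma> Bot x (v x * stripe D B v M b x j k * crd x k m))"
proof -
  have gJ: "\<gamma> \<in> dualJ D" using g by (simp add: W0_iff)
  have tm: "crd Bot j (W0_act \<gamma> (ac x (crd x k m) (b x k))) =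
      (if x = Bot then 0 else pr \<gamma> Bot x (v x * stripe D B v M b x j k * crd x k m))"
    if x: "x \<in> uPm D" and k: "k \<in> {1..dm x}" for x k
  proof -
    let ?c = "crd x k m"
    have c: "?c \<in> RR D x x" using x k m by (intro crd) auto
    have r: "rdiag x ?c \<in> carrier (Re D)" using x c by (simp add: rdiag_Re)
    have bk: "b x k \<in> mcar M" by (rule b_comp[OF x k])
    show ?thesis
    proof (cases "x = Bot")
      case True
      \<comment> \<open>The left action on \<open>W\<^sub>0\<close> goes through
        \<open>w\<^sub>1\<close>, where a diagonal element at \<open>0\<close> has component zero;
        so \<open>W\<^sub>0\<close> kills \<open>M\<^sub>0\<close>.\<close>
      then have "W0_act \<gamma> (ac x ?c (b x k)) = W0_act (dual_l D 0 \<gamma>) (b x k)"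
        using W0_act_l[of 0 "munit Bot Bot ?c" \<gamma> "b x k"] r g bk by (simp add: rdiag_def)
      moreover have "dual_l D 0 \<gamma> = 0" using gJ by (auto simp: dual_l_def fun_eq_iff dualJ_0)
      ultimately show ?thesis using True bk j by (simp add: W0_act_zero crd_0)
    next
      case False
      then have xP: "x \<in> Pm D" "Bot < x" using x by (simp_all add: Pm_iff Bot_less)
      let ?g = "dual_l D (munit x x ?c) \<gamma>"
      have cS: "munit x x ?c \<in> SS D" using x c by (simp add: munit_SS)
      have gW: "?g \<in> W0" by (rule W_dual_l[OF diag_idems(2) g cS])
      have prR: "pr ?g Bot x (v x * stripe D B v M b x i k) \<in> RR D Bot Bot" if "i \<in> {1..dm Bot}" for i
        by (rule pr_in[OF W_dualJ[OF diag_idems(2) gW] Bot_in_uPm x xP(2) v_stripe[OF xP(1) k that]])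
      have "W0_act \<gamma> (ac x ?c (b x k)) = W0_act ?g (b x k)"
        using W0_act_l[of "munit x x ?c" 0 \<gamma> "b x k"] r g bk False by (simp add: rdiag_def)
      also have "\<dots> = (\<Sum>j=1..dm Bot. ac Bot (pr ?g Bot x (v x * stripe D B v M b x j k)) (b Bot j))"
        by (rule W0_act_b[OF gW xP(1) k])
      finally have "crd Bot j (W0_act \<gamma> (ac x ?c (b x k))) =
          crd Bot j (\<Sum>i=1..dm Bot. ac Bot (pr ?g Bot x (v x * stripe D B v M b x i k)) (b Bot i))"
        by (rule arg_cong)
      also have "\<dots> = (\<Sum>i=1..dm Bot. crd Bot j (ac Bot (pr ?g Bot x (v x * stripe D B v M b x i k)) (b Bot i)))"
      proof (rule crd_sum[OF _ Bot_in_uPm j])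
        fix i assume i: "i \<in> {1..dm Bot}"
        show "ac Bot (pr ?g Bot x (v x * stripe D B v M b x i k)) (b Bot i) \<in> mcar M"
          by (rule ac_closed[OF Bot_in_uPm prR[OF i] b_comp(1)[OF Bot_in_uPm i]])
      qed
      also have "\<dots> = (\<Sum>i=1..dm Bot. if i = j then pr ?g Bot x (v x * stripe D B v M b x j k) else 0)"
      proof (rule sum.cong[OF refl])
        fix i assume i: "i \<in> {1..dm Bot}"
        note prR[OF i]
        then show "crd Bot j (ac Bot (pr ?g Bot x (v x * stripe D B v M b x i k)) (b Bot i)) =
            (if i = j then pr ?g Bot x (v x * stripe D B v M b x j k) else 0)"
          using i j eps_l[OF prR[OF j] Bot_in_uPm Bot_in_uPm order_refl]
          by (simp add: crd_mal rdiag_Re b_comp crd_b rc_rdiag)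
      qed
      also have "\<dots> = pr ?g Bot x (v x * stripe D B v M b x j k)" using j by simp
      also have "\<dots> = pr \<gamma> Bot x (v x * stripe D B v M b x j k * ?c)"
        using pr_dual_l[OF cS Bot_in_uPm x xP(2) v_stripe[OF xP(1) k j], of \<gamma>] by (simp add: munit_apply)
      finally show ?thesis using False by simp
    qed
  qed
  have acM: "ac x (crd x k m) (b x k) \<in> mcar M" if "x \<in> uPm D" "k \<in> {1..dm x}" for x k
    using that m by (intro ac_closed crd b_comp) auto
  have "crd Bot j (W0_act \<gamma> m) = crd Bot j (W0_act \<gamma> (\<Sum>x\<in>uPm D. \<Sum>k=1..dm x. ac x (crd x k m) (b x k)))"
    using elt_crd[OF m] by (simp add: elt_def)
  also have "\<dots> = crd Bot j (\<Sum>x\<in>uPm D. W0_act \<gamma> (\<Sum>k=1..dm x. ac x (crd x k m) (b x k)))"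
    by (rule arg_cong[of _ _ "crd Bot j"], rule W0_act_sum_right[OF g], rule mod_sum[OF M], rule acM)
  also have "\<dots> = crd Bot j (\<Sum>x\<in>uPm D. \<Sum>k=1..dm x. W0_act \<gamma> (ac x (crd x k m) (b x k)))"
    by (intro arg_cong[of _ _ "crd Bot j"] sum.cong refl W0_act_sum_right[OF g] acM)
  also have "\<dots> = (\<Sum>x\<in>uPm D. crd Bot j (\<Sum>k=1..dm x. W0_act \<gamma> (ac x (crd x k m) (b x k))))"
    by (rule crd_sum[OF _ Bot_in_uPm j], rule mod_sum[OF M], rule W0_act_closed[OF g acM])
  also have "\<dots> = (\<Sum>x\<in>uPm D. \<Sum>k=1..dm x. crd Bot j (W0_act \<gamma> (ac x (crd x k m) (b x k))))"
    by (intro sum.cong refl crd_sum[OF _ Bot_in_uPm j] W0_act_closed[OF g acM])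
  also have "\<dots> = (\<Sum>x\<in>uPm D. \<Sum>k=1..dm x. if x = Bot then 0 else pr \<gamma> Bot x (v x * stripe D B v M b x j k * crd x k m))"
    by (intro sum.cong refl tm)
  also have "\<dots> = (\<Sum>x\<in>Pm D. \<Sum>k=1..dm x. pr \<gamma> Bot x (v x * stripe D B v M b x j k * crd x k m))"
    by (rule sum.mono_neutral_cong_right) (auto simp: Pm_iff)
  finally show ?thesis .
qed

end

section \<open>Matrices\<close>

lemma sum_swap4:
  "(\<Sum>y\<in>A. \<Sum>j\<in>J y. \<Sum>x\<in>B. \<Sum>k\<in>K x. f y j x k) = (\<Sum>x\<in>B. \<Sum>k\<in>K x. \<Sum>y\<in>A. \<Sum>j\<in>J y. f y j x k)"
proof -
  have "(\<Sum>y\<in>A. \<Sum>j\<in>J y. \<Sum>x\<in>B. \<Sum>k\<in>K x. f y j x k) = (\<Sum>y\<in>A. \<Sum>x\<in>B. \<Sum>k\<in>K x. \<Sum>j\<in>J y. f y j x k)"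
    by (intro sum.cong refl, subst sum.swap, intro sum.cong refl, rule sum.swap)
  also have "\<dots> = (\<Sum>x\<in>B. \<Sum>y\<in>A. \<Sum>k\<in>K x. \<Sum>j\<in>J y. f y j x k)" by (rule sum.swap)
  also have "\<dots> = (\<Sum>x\<in>B. \<Sum>k\<in>K x. \<Sum>y\<in>A. \<Sum>j\<in>J y. f y j x k)"
    by (intro sum.cong refl, rule sum.swap)
  finally show ?thesis .
qed

section \<open>Products of block matrices seen through the forms \<open>pr\<close>\<close>

context ext_poset_basis
begin

text \<open>An entry of a product at \<open>(z, x)\<close> with \<open>z < x\<close> is split by its
  middle index \<open>y\<close>. This lemma treats \<open>y = x\<close>, \<open>pr_sum_left\<close>
  treats \<open>y = z\<close>, and \<open>pr_sum_strict\<close> treats \<open>z < y < x\<close>;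
  they correspond to \<open>g\<^sup>1 f\<^sup>0\<close>, \<open>g\<^sup>0 f\<^sup>1\<close> and the
  sum over \<open>d(v)\<close>.\<close>

lemma pr_sum_diag:
  assumes \<xi>: "\<xi> \<in> dualJ D" and z: "z \<in> uPm D"
    and Y: "\<And>x j. x \<in> Pm D \<Longrightarrow> z < x \<Longrightarrow> j \<in> {1..dN x} \<Longrightarrow> Y x j \<in> RR D z x"
    and F: "\<And>x j k. x \<in> Pm D \<Longrightarrow> j \<in> {1..dN x} \<Longrightarrow> k \<in> {1..dM x} \<Longrightarrow> F x j k \<in> RR D x x"
    and c: "\<And>x k. x \<in> Pm D \<Longrightarrow> k \<in> {1..dM x} \<Longrightarrow> c x k \<in> RR D x x"
  shows "(\<Sum>x\<in>Pm D. \<Sum>j=1..dN x. pr \<xi> z x (Y x j * (\<Sum>k=1..dM x. F x j k * c x k))) =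
    (\<Sum>x\<in>Pm D. \<Sum>k=1..dM x. pr \<xi> z x ((\<Sum>j=1..dN x. Y x j * F x j k) * c x k))"
proof (rule sum.cong[OF refl])
  fix x assume x: "x \<in> Pm D"
  then have xu: "x \<in> uPm D" by (simp add: Pm_iff)
  show "(\<Sum>j=1..dN x. pr \<xi> z x (Y x j * (\<Sum>k=1..dM x. F x j k * c x k))) =
    (\<Sum>k=1..dM x. pr \<xi> z x ((\<Sum>j=1..dN x. Y x j * F x j k) * c x k))"
  proof (cases "z < x")
    case True
    have m: "Y x j * F x j k * c x k \<in> RR D z x" if "j \<in> {1..dN x}" "k \<in> {1..dM x}" for j k
      using RR_mult[of z x x "Y x j" "F x j k"] RR_mult[of z x x "Y x j * F x j k" "c x k"]
        Y[OF x True that(1)] F[OF x that] c[OF x that(2)] z xu True by simp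
    have "(\<Sum>j=1..dN x. pr \<xi> z x (Y x j * (\<Sum>k=1..dM x. F x j k * c x k))) =
        (\<Sum>j=1..dN x. \<Sum>k=1..dM x. pr \<xi> z x (Y x j * F x j k * c x k))"
      unfolding sum_distrib_left mult.assoc[symmetric] by (intro sum.cong refl pr_Sum[OF \<xi> z xu] m)
    also have "\<dots> = (\<Sum>k=1..dM x. \<Sum>j=1..dN x. pr \<xi> z x (Y x j * F x j k * c x k))" by (rule sum.swap)
    also have "\<dots> = (\<Sum>k=1..dM x. pr \<xi> z x ((\<Sum>j=1..dN x. Y x j * F x j k) * c x k))"
      unfolding sum_distrib_right by (intro sum.cong refl pr_Sum[OF \<xi> z xu, symmetric] m)
    finally show ?thesis .
  qed (simp add: pr_out \<xi>)
qed

lemma pr_sum_left: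
  assumes \<xi>: "\<xi> \<in> dualJ D" and z: "z \<in> uPm D"
    and g: "\<And>j. j \<in> J \<Longrightarrow> g j \<in> RR D z z"
    and X: "\<And>x j k. x \<in> Pm D \<Longrightarrow> z < x \<Longrightarrow> j \<in> J \<Longrightarrow> k \<in> {1..dM x} \<Longrightarrow> X x j k \<in> RR D z x"
    and c: "\<And>x k. x \<in> Pm D \<Longrightarrow> k \<in> {1..dM x} \<Longrightarrow> c x k \<in> RR D x x"
  shows "(\<Sum>j\<in>J. g j * (\<Sum>x\<in>Pm D. \<Sum>k=1..dM x. pr \<xi> z x (X x j k * c x k))) =
    (\<Sum>x\<in>Pm D. \<Sum>k=1..dM x. pr \<xi> z x ((\<Sum>j\<in>J. g j * X x j k) * c x k))"
proof -
  have "(\<Sum>j\<in>J. g j * (\<Sum>x\<in>Pm D. \<Sum>k=1..dM x. pr \<xi> z x (X x j k * c x k))) =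
      (\<Sum>j\<in>J. \<Sum>x\<in>Pm D. \<Sum>k=1..dM x. g j * pr \<xi> z x (X x j k * c x k))"
    by (simp add: sum_distrib_left)
  also have "\<dots> = (\<Sum>x\<in>Pm D. \<Sum>j\<in>J. \<Sum>k=1..dM x. g j * pr \<xi> z x (X x j k * c x k))" by (rule sum.swap)
  also have "\<dots> = (\<Sum>x\<in>Pm D. \<Sum>k=1..dM x. \<Sum>j\<in>J. g j * pr \<xi> z x (X x j k * c x k))"
    by (intro sum.cong refl sum.swap)
  also have "\<dots> = (\<Sum>x\<in>Pm D. \<Sum>k=1..dM x. pr \<xi> z x ((\<Sum>j\<in>J. g j * X x j k) * c x k))"
  proof (intro sum.cong refl)
    fix x k assume x: "x \<in> Pm D" and k: "k \<in> {1..dM x}"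
    then have xu: "x \<in> uPm D" by (simp add: Pm_iff)
    show "(\<Sum>j\<in>J. g j * pr \<xi> z x (X x j k * c x k)) = pr \<xi> z x ((\<Sum>j\<in>J. g j * X x j k) * c x k)"
    proof (cases "z < x")
      case True
      have m: "X x j k * c x k \<in> RR D z x" "g j * (X x j k * c x k) \<in> RR D z x" if "j \<in> J" for j
        using RR_mult[of z x x "X x j k" "c x k"] RR_mult[of z z x "g j" "X x j k * c x k"]
          X[OF x True that k] g[OF that] c[OF x k] z xu True by simp_all
      show ?thesis
        by (simp add: sum_distrib_right mult.assoc pr_Sum[OF \<xi> z xu] m)
          (intro sum.cong refl pr_lin[symmetric] \<xi> z xu True m g)
    qed (simp add: pr_out \<xi>)
  qed
  finally show ?thesis .
qed

text \<open>For \<open>z < y < x\<close> the sum over the dual basis is evaluated by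
  \<open>comp_sum\<close>. If one of the inequalities fails, one of the two nested values of
  \<open>pr\<close> vanishes.\<close>

lemma pr_sum_strict:
  fixes n :: "('a, 'p) imat \<Rightarrow> 'p xp \<Rightarrow> nat \<Rightarrow> 'a"
  assumes \<xi>: "\<xi> \<in> dualJ D" and z: "z \<in> uPm D"
    and Y: "\<And>x j. x \<in> Pm D \<Longrightarrow> z < x \<Longrightarrow> j \<in> {1..dN x} \<Longrightarrow> Y x j \<in> RR D z x"
    and X: "\<And>y x j k. y \<in> Pm D \<Longrightarrow> x \<in> Pm D \<Longrightarrow> y < x \<Longrightarrow> j \<in> {1..dN y} \<Longrightarrow> k \<in> {1..dM x} \<Longrightarrow>
      X y x j k \<in> RR D y x"
    and c: "\<And>x k. x \<in> Pm D \<Longrightarrow> k \<in> {1..dM x} \<Longrightarrow> c x k \<in> RR D x x"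
    and n: "\<And>p y j. p \<in> B \<inter> peirceJ D (ehat D) (ehat D) \<Longrightarrow> y \<in> Pm D \<Longrightarrow> j \<in> {1..dN y} \<Longrightarrow>
      n p y j = (\<Sum>x\<in>Pm D. \<Sum>k=1..dM x. pr (dual_el p) y x (X y x j k * c x k))"
  shows "(\<Sum>p\<in>B \<inter> peirceJ D (ehat D) (ehat D). \<Sum>y\<in>Pm D. \<Sum>j=1..dN y. pr (dual_l D p \<xi>) z y (Y y j * n p y j)) =
    (\<Sum>x\<in>Pm D. \<Sum>k=1..dM x. pr \<xi> z x
      ((\<Sum>y\<in>Pm D. \<Sum>j=1..dN y. if z < y \<and> y < x then Y y j * X y x j k else 0) * c x k))"
proof -
  let ?B = "B \<inter> peirceJ D (ehat D) (ehat D)"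
  let ?t = "\<lambda>y j x k. if z < y \<and> y < x then pr \<xi> z x (Y y j * X y x j k * c x k) else 0"
  have PJ: "p \<in> JJ D" "dual_el p \<in> dualJ D" "dual_l D p \<xi> \<in> dualJ D" if "p \<in> ?B" for p
    using that B_JJ by (auto simp: dual_el_dualJ dual_l_dualJ \<xi>)
  have XC: "X y x j k * c x k \<in> RR D y x"
    if "y \<in> Pm D" "x \<in> Pm D" "y < x" "j \<in> {1..dN y}" "k \<in> {1..dM x}" for y x j k
    using RR_mult[of y x x "X y x j k" "c x k"] X[OF that] c[OF that(2,5)] that by (simp add: Pm_iff)
  have prn: "pr (dual_el p) y x (X y x j k * c x k) \<in> RR D y y"
    if "p \<in> ?B" "y \<in> Pm D" "x \<in> Pm D" "j \<in> {1..dN y}" "k \<in> {1..dM x}" for p y x j k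
  proof (cases "y < x")
    case True
    then show ?thesis using that PJ(2)[OF that(1)] XC by (intro pr_in) (auto simp: Pm_iff)
  next
    case False
    then show ?thesis using that PJ(2)[OF that(1)] by (simp add: pr_out RR_0 Pm_iff)
  qed
  have "(\<Sum>p\<in>?B. \<Sum>y\<in>Pm D. \<Sum>j=1..dN y. pr (dual_l D p \<xi>) z y (Y y j * n p y j)) =
      (\<Sum>y\<in>Pm D. \<Sum>j=1..dN y. \<Sum>p\<in>?B. pr (dual_l D p \<xi>) z y (Y y j * n p y j))"
    by (subst sum.swap, intro sum.cong refl, rule sum.swap)
  also have "\<dots> = (\<Sum>y\<in>Pm D. \<Sum>j=1..dN y. \<Sum>x\<in>Pm D. \<Sum>k=1..dM x. ?t y j x k)"
  proof (intro sum.cong refl)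
    fix y j assume y: "y \<in> Pm D" and j: "j \<in> {1..dN y}"
    then have yu: "y \<in> uPm D" by (simp add: Pm_iff)
    have "(\<Sum>p\<in>?B. pr (dual_l D p \<xi>) z y (Y y j * n p y j)) =
        (\<Sum>p\<in>?B. \<Sum>x\<in>Pm D. \<Sum>k=1..dM x. pr (dual_l D p \<xi>) z y (Y y j * pr (dual_el p) y x (X y x j k * c x k)))"
    proof (rule sum.cong[OF refl])
      fix p assume p: "p \<in> ?B"
      have m: "z < y \<Longrightarrow> Y y j * pr (dual_el p) y x (X y x j k * c x k) \<in> RR D z y"
        if "x \<in> Pm D" "k \<in> {1..dM x}" for x k
        by (rule RR_mult[of z y y]) (use z y yu Y[OF y _ j] prn[OF p y that(1) j that(2)] in auto)
      have e: "Y y j * n p y j = (\<Sum>x\<in>Pm D. \<Sum>k=1..dM x. Y y j * pr (dual_el p) y x (X y x j k * c x k))"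
        by (simp add: n[OF p y j] sum_distrib_left)
      have "pr (dual_l D p \<xi>) z y (Y y j * n p y j) =
          (\<Sum>x\<in>Pm D. pr (dual_l D p \<xi>) z y (\<Sum>k=1..dM x. Y y j * pr (dual_el p) y x (X y x j k * c x k)))"
        unfolding e by (rule pr_Sum[OF PJ(3)[OF p] z yu], rule RR_sum) (use z yu m in auto)
      also have "\<dots> = (\<Sum>x\<in>Pm D. \<Sum>k=1..dM x. pr (dual_l D p \<xi>) z y (Y y j * pr (dual_el p) y x (X y x j k * c x k)))"
        by (intro sum.cong refl pr_Sum[OF PJ(3)[OF p] z yu] m)
      finally show "pr (dual_l D p \<xi>) z y (Y y j * n p y j) =
          (\<Sum>x\<in>Pm D. \<Sum>k=1..dM x. pr (dual_l D p \<xi>) z y (Y y j * pr (dual_el p) y x (X y x j k * c x k)))" .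
    qed
    also have "\<dots> = (\<Sum>x\<in>Pm D. \<Sum>k=1..dM x. \<Sum>p\<in>?B. pr (dual_l D p \<xi>) z y (Y y j * pr (dual_el p) y x (X y x j k * c x k)))"
      by (subst sum.swap, intro sum.cong refl, rule sum.swap)
    also have "\<dots> = (\<Sum>x\<in>Pm D. \<Sum>k=1..dM x. ?t y j x k)"
    proof (intro sum.cong refl)
      fix x k assume x: "x \<in> Pm D" and k: "k \<in> {1..dM x}"
      show "(\<Sum>p\<in>?B. pr (dual_l D p \<xi>) z y (Y y j * pr (dual_el p) y x (X y x j k * c x k))) = ?t y j x k"
      proof (cases "z < y \<and> y < x")
        case True
        then show ?thesis
          using comp_sum[OF z yu _ _ _ Y[OF y _ j] XC[OF y x _ j k] \<xi>] x by (simp add: Pm_iff mult.assoc)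
      next
        case False
        have "pr (dual_l D p \<xi>) z y (Y y j * pr (dual_el p) y x (X y x j k * c x k)) = 0" if p: "p \<in> ?B" for p
        proof (cases "z < y")
          case True
          then have "pr (dual_el p) y x (X y x j k * c x k) = 0" using False PJ(2)[OF p] by (simp add: pr_out)
          then show ?thesis using PJ(3)[OF p] by (simp add: pr_0)
        qed (use PJ(3)[OF p] in \<open>simp add: pr_out\<close>)
        then have "(\<Sum>p\<in>?B. pr (dual_l D p \<xi>) z y (Y y j * pr (dual_el p) y x (X y x j k * c x k))) = 0"
          by (intro sum.neutral ballI)
        then show ?thesis using False by (simp only: if_False)
      qed
    qed
    finally show "(\<Sum>p\<in>?B. pr (dual_l D p \<xi>) z y (Y y j * n p y j)) = (\<Sum>x\<in>Pm D. \<Sum>k=1..dM x. ?t y j x k)" .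
  qed
  also have "\<dots> = (\<Sum>x\<in>Pm D. \<Sum>k=1..dM x. \<Sum>y\<in>Pm D. \<Sum>j=1..dN y. ?t y j x k)" by (rule sum_swap4)
  also have "\<dots> = (\<Sum>x\<in>Pm D. \<Sum>k=1..dM x. pr \<xi> z x
      ((\<Sum>y\<in>Pm D. \<Sum>j=1..dN y. if z < y \<and> y < x then Y y j * X y x j k else 0) * c x k))"
  proof (intro sum.cong refl)
    fix x k assume x: "x \<in> Pm D" and k: "k \<in> {1..dM x}"
    then have xu: "x \<in> uPm D" by (simp add: Pm_iff)
    let ?s = "\<lambda>y j. if z < y \<and> y < x then Y y j * X y x j k * c x k else 0"
    have s: "?s y j \<in> RR D z x" if zx: "z < x" and y: "y \<in> Pm D" and j: "j \<in> {1..dN y}" for y j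
    proof (cases "z < y \<and> y < x")
      case True
      then have "Y y j * (X y x j k * c x k) \<in> RR D z x"
        using RR_mult[OF z _ xu _ _ Y[OF y _ j] XC[OF y x _ j k]] y by (auto simp: Pm_iff)
      then show ?thesis using True by (simp add: mult.assoc)
    next
      case False
      then show ?thesis using zx z xu by (simp only: if_False) (simp add: RR_0)
    qed
    have "(\<Sum>y\<in>Pm D. \<Sum>j=1..dN y. if z < y \<and> y < x then Y y j * X y x j k else 0) * c x k =
        (\<Sum>y\<in>Pm D. \<Sum>j=1..dN y. ?s y j)"
      unfolding sum_distrib_right by (intro sum.cong refl) auto
    moreover have "pr \<xi> z x (\<Sum>y\<in>Pm D. \<Sum>j=1..dN y. ?s y j) = (\<Sum>y\<in>Pm D. pr \<xi> z x (\<Sum>j=1..dN y. ?s y j))"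
      by (rule pr_Sum[OF \<xi> z xu], rule RR_sum) (use z xu s in auto)
    moreover have "\<dots> = (\<Sum>y\<in>Pm D. \<Sum>j=1..dN y. pr \<xi> z x (?s y j))"
      by (intro sum.cong refl pr_Sum[OF \<xi> z xu] s)
    moreover have "\<dots> = (\<Sum>y\<in>Pm D. \<Sum>j=1..dN y. ?t y j x k)"
      by (intro sum.cong refl) (auto simp: pr_0 \<xi>)
    ultimately show "(\<Sum>y\<in>Pm D. \<Sum>j=1..dN y. ?t y j x k) = pr \<xi> z x
      ((\<Sum>y\<in>Pm D. \<Sum>j=1..dN y. if z < y \<and> y < x then Y y j * X y x j k else 0) * c x k)" by simp
  qed
  finally show ?thesis .
qed

end

subsection \<open>Triangular block matrices\<close>

context ext_poset
begin

text \<open>The order of \<open>P\<^sup>m\<close>, with \<open>0\<close> as an isolated point.\<close>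
definition iso_le :: "'p xp \<Rightarrow> 'p xp \<Rightarrow> bool" where
  "iso_le z x \<longleftrightarrow> z \<le> x \<and> (z = Bot \<longrightarrow> x = Bot)"

lemma iso_le_trans: "iso_le x y \<Longrightarrow> iso_le y z \<Longrightarrow> iso_le x z"
  and iso_le_antisym: "iso_le x y \<Longrightarrow> iso_le y x \<Longrightarrow> x = y"
  and iso_le_refl: "iso_le x x"
  and iso_le_le: "iso_le x y \<Longrightarrow> x \<le> y"
  by (auto simp: iso_le_def)

lemma iso_le_Bot: "iso_le z Bot \<longleftrightarrow> z = Bot" "iso_le Bot z \<longleftrightarrow> z = Bot"
  by (auto simp: iso_le_def)

definition idx :: "('p xp \<Rightarrow> nat) \<Rightarrow> ('p xp \<times> nat) set" where
  "idx n = (SIGMA x:uPm D. {1..n x})"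

text \<open>Matrices are functions on all index pairs that vanish outside the permitted blocks, so
  equality of matrices is equality of functions. With \<open>iso_le\<close> there are no blocks
  between \<open>0\<close> and the other points.\<close>

definition tri :: "('p xp \<Rightarrow> nat) \<Rightarrow> ('p xp \<times> nat \<Rightarrow> 'p xp \<times> nat \<Rightarrow> 'a) set" where
  "tri n = {X. \<forall>a c. if a \<in> idx n \<and> c \<in> idx n \<and> iso_le (fst a) (fst c)
     then X a c \<in> RR D (fst a) (fst c) else X a c = 0}"

abbreviation "tri_id n \<equiv> mone (idx n) (\<lambda>a. eps D (fst a))"

lemma finite_idx [simp]: "finite (idx n)"
  by (simp add: idx_def)

lemma idx_uPm: "a \<in> idx n \<Longrightarrow> fst a \<in> uPm D"
  by (auto simp: idx_def)

lemma tri_in: "X \<in> tri n \<Longrightarrow> a \<in> idx n \<Longrightarrow> c \<in> idx n \<Longrightarrow> iso_le (fst a) (fst c) \<Longrightarrow> X a c \<in> RR D (fst a) (fst c)"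
  and tri_zero: "X \<in> tri n \<Longrightarrow> \<not> (a \<in> idx n \<and> c \<in> idx n \<and> iso_le (fst a) (fst c)) \<Longrightarrow> X a c = 0"
  unfolding tri_def by (metis (mono_tags, lifting) mem_Collect_eq)+

lemma tri_I:
  assumes "\<And>a c. a \<in> idx n \<Longrightarrow> c \<in> idx n \<Longrightarrow> iso_le (fst a) (fst c) \<Longrightarrow> X a c \<in> RR D (fst a) (fst c)"
    "\<And>a c. \<not> (a \<in> idx n \<and> c \<in> idx n \<and> iso_le (fst a) (fst c)) \<Longrightarrow> X a c = 0"
  shows "X \<in> tri n"
  using assms unfolding tri_def by (simp del: split_paired_All)

lemma tri_diff: "X \<in> tri n \<Longrightarrow> Y \<in> tri n \<Longrightarrow> X - Y \<in> tri n"
  by (rule tri_I) (auto simp: tri_in tri_zero RR_diff idx_uPm iso_le_le)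

lemma tri_0: "0 \<in> tri n"
  by (rule tri_I) (auto simp: RR_0 idx_uPm iso_le_le)

lemma tri_one: "tri_id n \<in> tri n"
  by (rule tri_I) (auto simp: mone_def RR_0 idx_uPm iso_le_le eps_in iso_le_refl)

lemma tri_mmul:
  assumes X: "X \<in> tri n" and Y: "Y \<in> tri n"
  shows "mmul (idx n) X Y \<in> tri n"
proof (rule tri_I)
  fix a c assume ac: "a \<in> idx n" "c \<in> idx n" "iso_le (fst a) (fst c)"
  have "X a l * Y l c \<in> RR D (fst a) (fst c)" if l: "l \<in> idx n" for l
  proof (cases "iso_le (fst a) (fst l) \<and> iso_le (fst l) (fst c)")
    case True
    then show ?thesis
      using RR_mult[of "fst a" "fst l" "fst c"] tri_in[OF X ac(1) l] tri_in[OF Y l ac(2)] ac l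
      by (simp add: idx_uPm iso_le_le)
  next
    case False
    then have "X a l * Y l c = 0" using tri_zero[OF X, of a l] tri_zero[OF Y, of l c] by auto
    then show ?thesis using ac by (simp add: RR_0 idx_uPm iso_le_le)
  qed
  then show "mmul (idx n) X Y a c \<in> RR D (fst a) (fst c)"
    unfolding mmul_def using ac by (intro RR_sum) (auto simp: idx_uPm iso_le_le)
next
  fix a c assume ac: "\<not> (a \<in> idx n \<and> c \<in> idx n \<and> iso_le (fst a) (fst c))"
  have "X a l * Y l c = 0" for l
    using tri_zero[OF X, of a l] tri_zero[OF Y, of l c] ac iso_le_trans[of "fst a" "fst l" "fst c"] by fastforce
  then show "mmul (idx n) X Y a c = 0" by (simp add: mmul_def)
qed

lemma tri_one_right: "X \<in> tri n \<Longrightarrow> mmul (idx n) X (tri_id n) = X"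
proof (intro ext)
  fix a c assume X: "X \<in> tri n"
  have "mmul (idx n) X (tri_id n) a c = (\<Sum>l\<in>idx n. if l = c then X a c * eps D (fst c) else 0)"
    unfolding mmul_def by (intro sum.cong refl) (auto simp: mone_def)
  also have "\<dots> = X a c"
    using eps_r[OF tri_in[OF X]] tri_zero[OF X, of a c]
    by (cases "a \<in> idx n \<and> c \<in> idx n \<and> iso_le (fst a) (fst c)") (auto simp: idx_uPm iso_le_le)
  finally show "mmul (idx n) X (tri_id n) a c = X a c" .
qed

lemma tri_one_left: "X \<in> tri n \<Longrightarrow> mmul (idx n) (tri_id n) X = X"
proof (intro ext)
  fix a c assume X: "X \<in> tri n"
  have "mmul (idx n) (tri_id n) X a c = (\<Sum>l\<in>idx n. if l = a then eps D (fst a) * X a c else 0)"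
    unfolding mmul_def by (intro sum.cong refl) (auto simp: mone_def)
  also have "\<dots> = X a c"
    using eps_l[OF tri_in[OF X]] tri_zero[OF X, of a c]
    by (cases "a \<in> idx n \<and> c \<in> idx n \<and> iso_le (fst a) (fst c)") (auto simp: idx_uPm iso_le_le)
  finally show "mmul (idx n) (tri_id n) X a c = X a c" .
qed

text \<open>An approximate left inverse \<open>G\<close> of \<open>F\<close> is improved to \<open>G - (G F - 1) E\<close>, where \<open>E\<close> inverts
  \<open>F\<close> on the diagonal blocks; each step makes further columns correct.\<close>

lemma tri_left_inverse:
  assumes F: "F \<in> tri n" and E: "E \<in> tri n"
    and EF: "\<And>a c. a \<in> idx n \<Longrightarrow> c \<in> idx n \<Longrightarrow> fst a = fst c \<Longrightarrow> mmul (idx n) E F a c = tri_id n a c"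
  shows "\<exists>G\<in>tri n. mmul (idx n) G F = tri_id n"
proof -
  \<comment> \<open>\<open>?h x\<close> counts the points below \<open>x\<close>. It grows strictly
    along the order and serves as induction measure for the columns.\<close>
  let ?m = "mmul (idx n)" and ?h = "\<lambda>x. card {y \<in> uPm D. y < x}"
  have "\<exists>G\<in>tri n. \<forall>a c. ?h (fst c) < N \<longrightarrow> ?m G F a c = tri_id n a c" for N
  proof (induction N)
    case 0
    then show ?case using tri_0 by auto
  next
    case (Suc N)
    then obtain G where G: "G \<in> tri n" "\<And>a c. ?h (fst c) < N \<Longrightarrow> ?m G F a c = tri_id n a c" by blast
    let ?X = "?m G F - tri_id n"
    have X: "?X \<in> tri n" by (intro tri_diff tri_mmul G F tri_one)
    have X0: "?X a c = 0" if "?h (fst c) < N" for a c using G(2)[OF that] by simp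
    let ?G = "G - ?m ?X E"
    have "?m ?G F a c = tri_id n a c" if c: "?h (fst c) < Suc N" for a c
    proof -
      \<comment> \<open>Three cases: in the block of \<open>c\<close> the matrix \<open>E F\<close>
        is already the identity; in a strictly lower block the column \<open>l\<close> of the error
        \<open>?X\<close> is zero by induction; otherwise both factors on the right vanish.\<close>
      have "?X a l * ?m E F l c = ?X a l * tri_id n l c" if l: "l \<in> idx n" for l
      proof (cases "c \<in> idx n \<and> iso_le (fst l) (fst c)")
        case False
        then have "?m E F l c = 0" "tri_id n l c = 0"
          using tri_zero[OF tri_mmul[OF E F], of l c] iso_le_refl by (auto simp: mone_def)
        then show ?thesis by simp
      next
        case True
        show ?thesis
        proof (cases "fst l = fst c")
          case False
          then have lc: "fst l < fst c" using True by (auto simp: iso_le_def)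
          have "{y \<in> uPm D. y < fst l} \<subset> {y \<in> uPm D. y < fst c}"
            using lc idx_uPm[OF l] by auto
          then have "?h (fst l) < ?h (fst c)" by (intro psubset_card_mono) auto
          then show ?thesis using X0[of l a] c by simp
        qed (use EF l True in simp)
      qed
      then have "?m ?X (?m E F) a c = ?m ?X (tri_id n) a c" by (simp add: mmul_def)
      moreover have "?m ?X (tri_id n) = ?X" by (rule tri_one_right[OF X])
      moreover have "?m ?G F = ?m G F - ?m ?X (?m E F)" by (simp add: mmul_diff_left mmul_assoc)
      ultimately show ?thesis by simp
    qed
    moreover have "?G \<in> tri n" by (intro tri_diff tri_mmul G X E)
    ultimately show ?case by blast
  qed
  then obtain G where G: "G \<in> tri n" "\<And>a c. ?h (fst c) < Suc (card (uPm D)) \<Longrightarrow> ?m G F a c = tri_id n a c"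
    by blast
  have "?h x < Suc (card (uPm D))" for x by (simp add: less_Suc_eq_le card_mono)
  then have "?m G F = tri_id n" using G(2) by (intro ext) blast
  then show ?thesis using G(1) by blast
qed

text \<open>By antisymmetry of \<open>iso_le\<close>, only diagonal blocks contribute to a diagonal
  block of a product.\<close>

lemma tri_block_cong:
  assumes "X \<in> tri n" "Y \<in> tri n" "Y' \<in> tri n" "fst a = fst c"
    "\<And>l. l \<in> idx n \<Longrightarrow> fst l = fst c \<Longrightarrow> Y l c = Y' l c"
  shows "mmul (idx n) X Y a c = mmul (idx n) X Y' a c"
  unfolding mmul_def
proof (rule sum.cong[OF refl])
  fix l assume l: "l \<in> idx n"
  show "X a l * Y l c = X a l * Y' l c"
  proof (cases "fst l = fst c")
    case False
    then have "\<not> iso_le (fst a) (fst l) \<or> \<not> iso_le (fst l) (fst c)" using assms(4) iso_le_antisym by metis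
    then have "X a l = 0 \<or> Y l c = 0 \<and> Y' l c = 0"
      using tri_zero[OF assms(1)] tri_zero[OF assms(2)] tri_zero[OF assms(3)] by blast
    then show ?thesis by auto
  qed (use assms(5)[OF l] in simp)
qed

text \<open>A left inverse \<open>G\<close> of \<open>F\<close> has the diagonal blocks of
  \<open>E\<close>, as the comparison with \<open>G F E\<close> shows. So \<open>F\<close> inverts
  \<open>G\<close> on the diagonal blocks, \<open>G\<close> has a left inverse in turn, and this
  must be \<open>F\<close>.\<close>

lemma tri_inverse:
  assumes F: "F \<in> tri n" and E: "E \<in> tri n"
    and EF: "\<And>a c. a \<in> idx n \<Longrightarrow> c \<in> idx n \<Longrightarrow> fst a = fst c \<Longrightarrow> mmul (idx n) E F a c = tri_id n a c"
    and FE: "\<And>a c. a \<in> idx n \<Longrightarrow> c \<in> idx n \<Longrightarrow> fst a = fst c \<Longrightarrow> mmul (idx n) F E a c = tri_id n a c"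
  shows "\<exists>G\<in>tri n. mmul (idx n) G F = tri_id n \<and> mmul (idx n) F G = tri_id n"
proof -
  let ?m = "mmul (idx n)"
  obtain G where G: "G \<in> tri n" "?m G F = tri_id n" using tri_left_inverse[OF F E EF] by blast
  have GE: "E a c = G a c" if "a \<in> idx n" "c \<in> idx n" "fst a = fst c" for a c
  proof -
    have "?m G (?m F E) a c = ?m G (tri_id n) a c"
      by (rule tri_block_cong[OF G(1) tri_mmul[OF F E] tri_one that(3)]) (use FE that in auto)
    then show ?thesis using G E by (simp add: mmul_assoc tri_one_left tri_one_right)
  qed
  have "?m F G a c = tri_id n a c" if "a \<in> idx n" "c \<in> idx n" "fst a = fst c" for a c
    using tri_block_cong[OF F G(1) E that(3)] GE FE that by auto
  then obtain K where K: "K \<in> tri n" "?m K G = tri_id n" using tri_left_inverse[OF G(1) F] by blast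
  have "K = ?m K (?m G F)" using K G(2) by (simp add: tri_one_right)
  also have "\<dots> = F" using K F by (simp add: mmul_assoc tri_one_left)
  finally show ?thesis using G K by blast
qed

end

section \<open>Morphisms as matrices\<close>

lemma (in ext_poset) sum_idx: "(\<Sum>a\<in>idx n. g a) = (\<Sum>x\<in>uPm D. \<Sum>i=1..n x. g (x, i))"
  unfolding idx_def by (subst sum.Sigma) (auto intro: sum.cong)

lemma (in ext_poset) mmul_idx:
  "mmul (idx n) X Y a c = (\<Sum>y\<in>uPm D. \<Sum>j=1..n y. X a (y, j) * Y (y, j) c)"
  by (simp add: mmul_def sum_idx)

lemma (in ext_poset) sum_between:
  assumes z: "z \<in> uPm D" "x \<in> uPm D" "z < x" and T: "\<And>y. y \<in> uPm D \<Longrightarrow> \<not> (z \<le> y \<and> y \<le> x) \<Longrightarrow> T y = 0"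
  shows "(\<Sum>y\<in>uPm D. T y) = (T x :: 'a) + T z + (\<Sum>y\<in>Pm D. if z < y \<and> y < x then T y else 0)"
proof -
  have "T y = (if y = x then T x else 0) + (if y = z then T z else 0) + (if z < y \<and> y < x then T y else 0)"
    if y: "y \<in> uPm D" for y
    using z T[OF y] by (cases "y = x"; cases "y = z") (auto simp: less_le)
  then have "(\<Sum>y\<in>uPm D. T y) = (\<Sum>y\<in>uPm D. (if y = x then T x else 0) + (if y = z then T z else 0)
      + (if z < y \<and> y < x then T y else 0))" by (intro sum.cong refl)
  also have "\<dots> = T x + T z + (\<Sum>y\<in>uPm D. if z < y \<and> y < x then T y else 0)"
    using z by (simp add: sum.distrib)
  also have "(\<Sum>y\<in>uPm D. if z < y \<and> y < x then T y else 0) = (\<Sum>y\<in>Pm D. if z < y \<and> y < x then T y else 0)"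
    by (rule sum.mono_neutral_right) (auto simp: Pm_iff)
  finally show ?thesis .
qed

text \<open>\<open>T\<^sub>1\<close> is generated by \<open>W\<^sub>1\<close> as a bimodule over
  \<open>T\<^sub>0\<close>, and both maps respect the two actions. Thus the second component of an
  arbitrary morphism is of the form \<open>tmap\<close>.\<close>

lemma (in De_pair) tmap_unique:
  assumes add: "\<And>v v' m. v \<in> Tdeg D 1 \<Longrightarrow> v' \<in> Tdeg D 1 \<Longrightarrow> m \<in> mcar M \<Longrightarrow> g (v \<oplus>\<^bsub>TT D\<^esub> v') m = g v m + g v' m"
    and left: "\<And>a v m. a \<in> Tdeg D 0 \<Longrightarrow> v \<in> Tdeg D 1 \<Longrightarrow> m \<in> mcar M \<Longrightarrow> g (a \<otimes>\<^bsub>TT D\<^esub> v) m = g v (mact M m a)"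
    and right: "\<And>a v m. a \<in> Tdeg D 0 \<Longrightarrow> v \<in> Tdeg D 1 \<Longrightarrow> m \<in> mcar M \<Longrightarrow> g (v \<otimes>\<^bsub>TT D\<^esub> a) m = mact N (g v m) a"
    and W1: "\<And>\<delta> m. \<delta> \<in> W1 \<Longrightarrow> m \<in> mcar M \<Longrightarrow> g (in_W1 D \<delta>) m = \<phi> \<delta> m"
    and v: "v \<in> Tdeg D 1" and m: "m \<in> mcar M"
  shows "g v m = f1 v m"
proof -
  let ?P = "\<lambda>x. \<forall>m\<in>mcar M. g (Tcl D x) m = f1 (Tcl D x) m"
  have words: "?P (frag_of (Tw ws))" if "deg_word 1 ws" for ws
    using that
  proof (induction ws)
    case (Cons w ws)
    let ?x = "frag_of (Tw [w])" and ?y = "frag_of (Tw ws)"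
    show ?case
    proof (cases "ws = []")
      case True
      then have "w \<in> letters D 1" using Cons.prems by (auto simp: deg_word_Cons deg_word_Nil)
      then obtain \<delta> where "w = (0, \<delta>)" "\<delta> \<in> W1" by (cases w) (auto simp: letters_iff)
      then show ?thesis using W1 f1_W1 True by (simp add: in_W1_def)
    next
      case False
      from Cons.prems consider "w \<in> letters D 0" "deg_word 1 ws" | "w \<in> letters D 1" "deg_word 0 ws"
        by (auto simp: deg_word_Cons)
      then show ?thesis
      proof cases
        case 1
        have x: "Poly_Mapping.keys ?x \<subseteq> hom_words D 0" and y: "Poly_Mapping.keys ?y \<subseteq> hom_words D 1"
          using 1 False by (simp_all add: keys_frag_of hom_words_Tw deg_word_Cons deg_word_Nil)
        have tw: "Poly_Mapping.keys ?x \<subseteq> twords (Re D) (WW D)" "Poly_Mapping.keys ?y \<subseteq> twords (Re D) (WW D)"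
          using x y hom_words_twords by blast+
        have Tw: "Tcl D (frag_of (Tw (w # ws))) = Tcl D (tmult (Re D) (WW D) ?x ?y)"
          by (simp add: tmult_of)
        show ?thesis
        proof
          fix m assume m: "m \<in> mcar M"
          have "mact M m (Tcl D ?x) \<in> mcar M" by (rule mact_closed[OF M m Tdeg_I[OF x]])
          then show "g (Tcl D (frag_of (Tw (w # ws)))) m = f1 (Tcl D (frag_of (Tw (w # ws)))) m"
            using left[OF Tdeg_I[OF x] Tdeg_I[OF y] m] Cons.IH[OF 1(2)] f1_left[OF x tw(2) m]
            unfolding Tw by (simp add: TT_mult[OF tw])
        qed
      next
        case 2
        obtain \<delta> where w: "w = (0, \<delta>)" "\<delta> \<in> W1" using 2 by (cases w) (auto simp: letters_iff)
        have x: "Poly_Mapping.keys ?x \<subseteq> hom_words D 1" and y: "Poly_Mapping.keys ?y \<subseteq> hom_words D 0"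
          using 2 False by (simp_all add: keys_frag_of hom_words_Tw deg_word_Cons deg_word_Nil)
        have tw: "Poly_Mapping.keys ?x \<subseteq> twords (Re D) (WW D)" "Poly_Mapping.keys ?y \<subseteq> twords (Re D) (WW D)"
          using x y hom_words_twords by blast+
        have Tw: "Tcl D (frag_of (Tw (w # ws))) = Tcl D (tmult (Re D) (WW D) ?x ?y)"
          by (simp add: tmult_of)
        show ?thesis
        proof
          fix m assume m: "m \<in> mcar M"
          have "g (Tcl D ?x) m = f1 (Tcl D ?x) m"
            using W1[OF w(2) m] f1_W1[OF w(2) m] by (simp add: w(1) in_W1_def)
          then show "g (Tcl D (frag_of (Tw (w # ws)))) m = f1 (Tcl D (frag_of (Tw (w # ws)))) m"
            using right[OF Tdeg_I[OF y] Tdeg_I[OF x] m] f1_right[OF x y m]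
            unfolding Tw by (simp add: TT_mult[OF tw])
        qed
      qed
    qed
  qed (simp add: deg_word_Nil)
  obtain x where x: "v = Tcl D x" "Poly_Mapping.keys x \<subseteq> hom_words D 1" using v unfolding Tdeg_def by blast
  from x(2) have "Poly_Mapping.keys x \<subseteq> hom_words D 1 \<and> ?P x"
  proof (induction x rule: frag_induction)
    case zero
    have "Tcl D 0 \<in> Tdeg D 1" by (rule Tdeg_I) simp
    then have "g (Tcl D 0) m = 0" if "m \<in> mcar M" for m
      using add[of "Tcl D 0" "Tcl D 0" m] that by (simp add: TT_add)
    then show ?case by (simp add: f1_zero)
  next
    case (one w)
    then show ?case using words by (cases w) (auto simp: keys_frag_of hom_words_Tw hom_words_Sc)
  next
    case (diff a b)
    then have a: "Poly_Mapping.keys a \<subseteq> hom_words D 1" and b: "Poly_Mapping.keys b \<subseteq> hom_words D 1" by auto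
    have ab: "Poly_Mapping.keys (a - b) \<subseteq> hom_words D 1" by (rule keys_diff_subset[OF a b])
    have "g (Tcl D (a - b)) m = f1 (Tcl D (a - b)) m" if "m \<in> mcar M" for m
      using add[OF Tdeg_I[OF ab] Tdeg_I[OF b] that] diff that by (simp add: TT_add f1_sub)
    then show ?case using ab by blast
  qed
  then show ?thesis using m x(1) by blast
qed

context De_stripe
begin

text \<open>The stripes, multiplied by the \<open>v\<^sub>x\<close>, as one matrix with a single non-zero row of blocks.\<close>

definition H :: "'p xp \<times> nat \<Rightarrow> 'p xp \<times> nat \<Rightarrow> 'a" where
  "H a c = (if fst a = Bot \<and> fst c \<in> Pm D \<and> a \<in> idx dm \<and> c \<in> idx dm
     then v (fst c) * stripe D B v M b (fst c) (snd a) (snd c) else 0)"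

lemma H_in: "x \<in> Pm D \<Longrightarrow> j \<in> {1..dm Bot} \<Longrightarrow> k \<in> {1..dm x} \<Longrightarrow> H (Bot, j) (x, k) \<in> RR D Bot x"
  using v_stripe[of x k j] by (simp add: H_def idx_def Pm_iff)

lemma crd_W0_act_H:
  assumes g: "\<gamma> \<in> W0" and m: "m \<in> mcar M" and j: "j \<in> {1..dm Bot}"
  shows "crd Bot j (W0_act \<gamma> m) = (\<Sum>x\<in>Pm D. \<Sum>k=1..dm x. pr \<gamma> Bot x (H (Bot, j) (x, k) * crd x k m))"
  unfolding crd_W0_act[OF assms] using j by (intro sum.cong refl) (simp add: H_def idx_def Pm_iff)

end

section \<open>From matrices to morphisms and back\<close>

locale De_two = ditalgebra D B d + X: De_stripe D B M bM v + Y: De_stripe D B N bN v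
  for D :: "('k::field, 'a::ring_1, 'p::order) eposet" and B :: "('a, 'p) imat set"
    and d :: "('a, 'p) t_el \<Rightarrow> ('a, 'p) t_el"
    and M :: "(('a, 'p) t_el, 'm::ab_group_add) rmod" and N :: "(('a, 'p) t_el, 'n::ab_group_add) rmod"
    and bM :: "'p xp \<Rightarrow> nat \<Rightarrow> 'm" and bN :: "'p xp \<Rightarrow> nat \<Rightarrow> 'n" and v :: "'p xp \<Rightarrow> 'a" +
  assumes dims: "\<And>x. x \<in> uPm D \<Longrightarrow> dimvec D N x = dimvec D M x"
    and v_inj: "\<And>x r. x \<in> Pm D \<Longrightarrow> r \<in> RR D x x \<Longrightarrow> v x * r = 0 \<Longrightarrow> r = 0"
begin

abbreviation "n \<equiv> dimvec D M"

lemma dimsP: "x \<in> Pm D \<Longrightarrow> dimvec D N x = n x"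
  by (simp add: dims Pm_iff)

lemma idx_dims: "idx (dimvec D N) = idx n"
  unfolding idx_def by (rule Sigma_cong) (auto simp: dims)

text \<open>The morphism with matrix \<open>F\<close>: if \<open>m\<close> has coordinates \<open>m\<^sub>x\<close>, then \<open>f\<^sup>0(m)\<close> has coordinates
  \<open>F\<^sub>z\<^sub>,\<^sub>z m\<^sub>z\<close> and \<open>f\<^sup>1(w\<^sub>1 \<delta>)(m)\<close> has coordinates \<open>\<Sum>\<^sub>x \<delta>(e\<^sub>z\<^sub>,\<^sub>x F\<^sub>z\<^sub>,\<^sub>x m\<^sub>x)\<close>.\<close>

definition f0 :: "('p xp \<times> nat \<Rightarrow> 'p xp \<times> nat \<Rightarrow> 'a) \<Rightarrow> 'm \<Rightarrow> 'n" where
  "f0 F m = Y.elt (\<lambda>z j. \<Sum>k=1..n z. F (z, j) (z, k) * X.crd z k m)"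

definition W1_map :: "('p xp \<times> nat \<Rightarrow> 'p xp \<times> nat \<Rightarrow> 'a) \<Rightarrow> ('a, 'p) dual \<Rightarrow> 'm \<Rightarrow> 'n" where
  "W1_map F \<delta> m = Y.elt (\<lambda>z j. \<Sum>x\<in>Pm D. \<Sum>k=1..n x. pr \<delta> z x (F (z, j) (x, k) * X.crd x k m))"

lemma F_in:
  assumes "F \<in> tri n" "z \<in> uPm D" "x \<in> uPm D" "iso_le z x" "j \<in> {1..n z}" "k \<in> {1..n x}"
  shows "F (z, j) (x, k) \<in> RR D z x"
  using tri_in[OF assms(1), of "(z, j)" "(x, k)"] assms by (simp add: idx_def)

lemma F_less:
  assumes "F \<in> tri n" "z \<in> Pm D" "x \<in> Pm D" "z < x" "j \<in> {1..n z}" "k \<in> {1..n x}"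
  shows "F (z, j) (x, k) \<in> RR D z x"
  using F_in[OF assms(1) _ _ _ assms(5,6)] assms by (simp add: Pm_iff iso_le_def)

lemma F_diag:
  assumes "F \<in> tri n" "z \<in> uPm D" "j \<in> {1..n z}" "k \<in> {1..n z}"
  shows "F (z, j) (z, k) \<in> RR D z z"
  using F_in[OF assms(1,2,2) iso_le_refl assms(3,4)] .

lemma cX: "m \<in> mcar M \<Longrightarrow> x \<in> Pm D \<Longrightarrow> k \<in> {1..n x} \<Longrightarrow> X.crd x k m \<in> RR D x x"
  by (rule X.crd) (auto simp: Pm_iff)

lemma f0_coord:
  "F \<in> tri n \<Longrightarrow> m \<in> mcar M \<Longrightarrow> z \<in> uPm D \<Longrightarrow> j \<in> {1..dimvec D N z} \<Longrightarrow>
    (\<Sum>k=1..n z. F (z, j) (z, k) * X.crd z k m) \<in> RR D z z"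
  by (intro RR_sum RR_mult[of z z z] F_diag X.crd) (auto simp: dims)

lemma f0_closed: "F \<in> tri n \<Longrightarrow> m \<in> mcar M \<Longrightarrow> f0 F m \<in> mcar N"
  unfolding f0_def by (intro Y.elt_closed f0_coord)

lemma f0_crd:
  assumes "F \<in> tri n" "m \<in> mcar M" "z \<in> uPm D" "j \<in> {1..n z}"
  shows "Y.crd z j (f0 F m) = (\<Sum>k=1..n z. F (z, j) (z, k) * X.crd z k m)"
  unfolding f0_def by (rule Y.crd_elt[OF f0_coord[OF assms(1,2)] assms(3)]) (use assms in \<open>simp_all add: dims\<close>)

lemma f0_diff:
  assumes F: "F \<in> tri n" and m: "m \<in> mcar M" "m' \<in> mcar M"
  shows "f0 F (m - m') = f0 F m - f0 F m'"
  by (rule Y.crd_ext)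
    (use F m in \<open>simp_all add: f0_closed X.R.C_diff Y.R.C_diff Y.crd_diff f0_crd dims X.crd_diff
      right_diff_distrib sum_subtractf\<close>)

lemma f0_mal:
  assumes F: "F \<in> tri n" and r: "r \<in> carrier (Re D)" and m: "m \<in> mcar M"
  shows "f0 F (mal M r m) = mal N r (f0 F m)"
  by (rule Y.crd_ext)
    (use F r m in \<open>simp_all add: f0_closed X.R.\<alpha>_closed Y.R.\<alpha>_closed Y.crd_mal f0_crd dims X.crd_mal
      sum_distrib_right mult.assoc\<close>)

lemma W1_map_coord:
  assumes F: "F \<in> tri n" and g: "\<delta> \<in> W1" and m: "m \<in> mcar M" and z: "z \<in> uPm D" "j \<in> {1..dimvec D N z}"
  shows "(\<Sum>x\<in>Pm D. \<Sum>k=1..n x. pr \<delta> z x (F (z, j) (x, k) * X.crd x k m)) \<in> RR D z z"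
proof (intro RR_sum z order_refl)
  fix x k assume x: "x \<in> Pm D" and k: "k \<in> {1..n x}"
  have dJ: "\<delta> \<in> dualJ D" using g by (simp add: W1_iff)
  show "pr \<delta> z x (F (z, j) (x, k) * X.crd x k m) \<in> RR D z z"
  proof (cases "z \<noteq> Bot \<and> z < x")
    case True
    then show ?thesis using z x k dJ
      by (intro pr_in RR_mult[of z x x] F_less[OF F] cX[OF m]) (auto simp: Pm_iff dims)
  next
    case False
    moreover have "pr \<delta> Bot x t = 0" for t
      unfolding pr_def by (rule peirceD_entry[OF diag_idem_ehat g]) (simp add: ehat_apply Pm_iff)
    ultimately have "pr \<delta> z x (F (z, j) (x, k) * X.crd x k m) = 0" using pr_out[OF dJ] by auto
    then show ?thesis using z by (simp add: RR_0)
  qed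
qed

lemma W1_map_closed: "F \<in> tri n \<Longrightarrow> \<delta> \<in> W1 \<Longrightarrow> m \<in> mcar M \<Longrightarrow> W1_map F \<delta> m \<in> mcar N"
  unfolding W1_map_def by (intro Y.elt_closed W1_map_coord)

lemma W1_map_crd:
  assumes "F \<in> tri n" "\<delta> \<in> W1" "m \<in> mcar M" "z \<in> uPm D" "j \<in> {1..n z}"
  shows "Y.crd z j (W1_map F \<delta> m) = (\<Sum>x\<in>Pm D. \<Sum>k=1..n x. pr \<delta> z x (F (z, j) (x, k) * X.crd x k m))"
  unfolding W1_map_def by (rule Y.crd_elt[OF W1_map_coord[OF assms(1-3)] assms(4)]) (use assms in \<open>simp_all add: dims\<close>)

lemma pr_Bot: "\<delta> \<in> W1 \<Longrightarrow> pr \<delta> Bot x t = 0"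
  unfolding pr_def by (rule peirceD_entry[OF diag_idem_ehat]) (simp_all add: ehat_apply Pm_iff)

lemma W1_map_Bot: "F \<in> tri n \<Longrightarrow> \<delta> \<in> W1 \<Longrightarrow> m \<in> mcar M \<Longrightarrow> j \<in> {1..n Bot} \<Longrightarrow> Y.crd Bot j (W1_map F \<delta> m) = 0"
  by (simp add: W1_map_crd pr_Bot)

lemma pr_diff':
  "\<xi> \<in> dualJ D \<Longrightarrow> z \<in> uPm D \<Longrightarrow> x \<in> uPm D \<Longrightarrow> (z < x \<Longrightarrow> t \<in> RR D z x) \<Longrightarrow> (z < x \<Longrightarrow> t' \<in> RR D z x) \<Longrightarrow>
    pr \<xi> z x (t - t') = pr \<xi> z x t - pr \<xi> z x t'"
  by (cases "z < x") (auto simp: pr_diff pr_out)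

lemma FC:
  assumes F: "F \<in> tri n" and m: "m \<in> mcar M" and z: "z \<in> Pm D" and x: "x \<in> Pm D" and zx: "z < x"
    and j: "j \<in> {1..n z}" and k: "k \<in> {1..n x}"
  shows "F (z, j) (x, k) * X.crd x k m \<in> RR D z x"
  by (rule RR_mult[of z x x]) (use z x zx F_less[OF F z x zx j k] cX[OF m x k] in \<open>auto simp: Pm_iff\<close>)

text \<open>Inside \<open>pr\<close>, acting on \<open>\<delta>\<close> from the left multiplies the
  argument from the right, as does acting on \<open>m\<close>; acting on \<open>\<delta>\<close>
  from the right multiplies the value from the right, as does acting on the result in
  \<open>N\<close>.\<close>

lemma W1_map_bimap:
  assumes F: "F \<in> tri n"
  shows "bimap M N (W1_map F)"
  unfolding bimap_def
proof (intro conjI ballI allI impI)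
  fix \<delta> m assume g: "\<delta> \<in> W1" and m: "m \<in> mcar M"
  have dJ: "\<delta> \<in> dualJ D" using g by (simp add: W1_iff)
  show "W1_map F \<delta> m \<in> mcar N" by (rule W1_map_closed[OF F g m])
  show "W1_map F \<delta> (m - m') = W1_map F \<delta> m - W1_map F \<delta> m'" if m': "m' \<in> mcar M" for m'
  proof (rule Y.crd_ext)
    fix z j assume z: "z \<in> uPm D" and j: "j \<in> {1..dimvec D N z}"
    then have j': "j \<in> {1..n z}" by (simp add: dims)
    show "Y.crd z j (W1_map F \<delta> (m - m')) = Y.crd z j (W1_map F \<delta> m - W1_map F \<delta> m')"
    proof (cases "z = Bot")
      case True
      then show ?thesis using F g m m' j j'
        by (simp add: W1_map_Bot Y.crd_diff W1_map_closed X.R.C_diff)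
    next
      case False
      then have zP: "z \<in> Pm D" using z by (simp add: Pm_iff)
      have "pr \<delta> z x (F (z, j) (x, k) * X.crd x k (m - m')) =
          pr \<delta> z x (F (z, j) (x, k) * X.crd x k m) - pr \<delta> z x (F (z, j) (x, k) * X.crd x k m')"
        if x: "x \<in> Pm D" and k: "k \<in> {1..n x}" for x k
      proof -
        have xu: "x \<in> uPm D" using x by (simp add: Pm_iff)
        have "F (z, j) (x, k) * X.crd x k (m - m') = F (z, j) (x, k) * X.crd x k m - F (z, j) (x, k) * X.crd x k m'"
          by (simp only: X.crd_diff[OF m m' xu k] right_diff_distrib)
        then show ?thesis
          using pr_diff'[OF dJ z xu FC[OF F m zP x _ j' k] FC[OF F m' zP x _ j' k]] by simp
      qed
      then show ?thesis
        using F g m m' z j j'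
        by (simp add: Y.crd_diff W1_map_closed X.R.C_diff W1_map_crd sum_subtractf)
    qed
  qed (use F g m m' in \<open>simp_all add: W1_map_closed X.R.C_diff Y.R.C_diff\<close>)
next
  fix \<delta> \<delta>' m assume g: "\<delta> \<in> W1" "\<delta>' \<in> W1" and m: "m \<in> mcar M"
  show "W1_map F (\<delta> + \<delta>') m = W1_map F \<delta> m + W1_map F \<delta>' m"
    by (rule Y.crd_ext)
      (use F g m in \<open>simp_all add: W1_map_closed W_add diag_idems Y.R.C_add Y.crd_add W1_map_crd dims pr_plus sum.distrib\<close>)
next
  fix a c \<delta> m assume r: "(a, c) \<in> carrier (Re D)" and g: "\<delta> \<in> W1" and m: "m \<in> mcar M"
  have dJ: "\<delta> \<in> dualJ D" using g by (simp add: W1_iff)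
  have aS: "a \<in> SS D" and aE: "mm D a (ehat D) = a" using Re_acts[OF r] by simp_all
  have rW: "dual_r D \<delta> a \<in> W1" by (rule W_dual_r[OF diag_idem_ehat g aS aE])
  have lW: "dual_l D a \<delta> \<in> W1" by (rule W_dual_l[OF diag_idem_ehat g aS])
  show "W1_map F (dual_r D \<delta> a) m = mal N (a, c) (W1_map F \<delta> m)"
  proof (rule Y.crd_ext)
    fix z j assume z: "z \<in> uPm D" and j: "j \<in> {1..dimvec D N z}"
    then have j': "j \<in> {1..n z}" by (simp add: dims)
    show "Y.crd z j (W1_map F (dual_r D \<delta> a) m) = Y.crd z j (mal N (a, c) (W1_map F \<delta> m))"
    proof (cases "z = Bot")
      case True
      then show ?thesis using F g rW m j j' r by (simp add: W1_map_Bot Y.crd_mal W1_map_closed)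
    next
      case False
      then show ?thesis using F g rW m z j j' r
        by (simp add: Y.crd_mal W1_map_closed W1_map_crd pr_dual_r aS rc_def sum_distrib_right)
    qed
  qed (use F g rW m r in \<open>simp_all add: W1_map_closed Y.R.\<alpha>_closed\<close>)
  show "W1_map F (dual_l D a \<delta>) m = W1_map F \<delta> (mal M (a, c) m)"
  proof (rule Y.crd_ext)
    fix z j assume z: "z \<in> uPm D" and j: "j \<in> {1..dimvec D N z}"
    then have j': "j \<in> {1..n z}" by (simp add: dims)
    show "Y.crd z j (W1_map F (dual_l D a \<delta>) m) = Y.crd z j (W1_map F \<delta> (mal M (a, c) m))"
    proof (cases "z = Bot")
      case True
      then show ?thesis using F g lW m j j' r by (simp add: W1_map_Bot X.R.\<alpha>_closed)
    next
      case False
      then have zP: "z \<in> Pm D" using z by (simp add: Pm_iff)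
      have "pr (dual_l D a \<delta>) z x (F (z, j) (x, k) * X.crd x k m) =
          pr \<delta> z x (F (z, j) (x, k) * X.crd x k (mal M (a, c) m))"
        if x: "x \<in> Pm D" and k: "k \<in> {1..n x}" for x k
      proof (cases "z < x")
        case True
        have xu: "x \<in> uPm D" "x \<noteq> Bot" using x by (simp_all add: Pm_iff)
        show ?thesis
          using pr_dual_l[OF aS z xu(1) True FC[OF F m zP x True j' k]] X.crd_mal[OF r m xu(1) k] xu(2)
          by (simp add: rc_def mult.assoc)
      qed (use dJ lW in \<open>simp add: pr_out W_dualJ[OF diag_idem_ehat]\<close>)
      then show ?thesis using F g lW m z j j' r by (simp add: W1_map_crd X.R.\<alpha>_closed)
    qed
  qed (use F g lW m r in \<open>simp_all add: W1_map_closed X.R.\<alpha>_closed\<close>)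
qed

lemma pair: "F \<in> tri n \<Longrightarrow> De_pair D B d M N (W1_map F)"
  by unfold_locales (rule X.M, rule Y.M, rule W1_map_bimap)

lemma mmul_H_F:
  assumes F: "F \<in> tri n" and x: "x \<in> Pm D"
  shows "mmul (idx n) Y.H F (Bot, l) (x, k) = (\<Sum>j=1..n x. Y.H (Bot, l) (x, j) * F (x, j) (x, k)) +
    (\<Sum>y\<in>Pm D. \<Sum>j=1..n y. if Bot < y \<and> y < x then Y.H (Bot, l) (y, j) * F (y, j) (x, k) else 0)"
proof -
  let ?T = "\<lambda>y. \<Sum>j=1..n y. Y.H (Bot, l) (y, j) * F (y, j) (x, k)"
  have xu: "x \<in> uPm D" "Bot < x" using x by (simp_all add: Pm_iff Bot_less)
  have "?T y = 0" if "\<not> (Bot \<le> y \<and> y \<le> x)" for y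
    using tri_zero[OF F] that by (intro sum.neutral ballI) (auto simp: less_eq_xp_def[of Bot] iso_le_def)
  then have "mmul (idx n) Y.H F (Bot, l) (x, k) = ?T x + ?T Bot + (\<Sum>y\<in>Pm D. if Bot < y \<and> y < x then ?T y else 0)"
    unfolding mmul_idx by (intro sum_between xu Bot_in_uPm) auto
  \<comment> \<open>\<open>Y.H\<close> has no entries in the columns at \<open>0\<close>.\<close>
  moreover have "?T Bot = 0" by (simp add: Y.H_def Pm_iff)
  moreover have "(\<Sum>y\<in>Pm D. if Bot < y \<and> y < x then ?T y else 0) =
      (\<Sum>y\<in>Pm D. \<Sum>j=1..n y. if Bot < y \<and> y < x then Y.H (Bot, l) (y, j) * F (y, j) (x, k) else 0)"
    by (intro sum.cong refl) auto
  ultimately show ?thesis by simp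
qed

lemma mmul_F_H:
  assumes F: "F \<in> tri n" and x: "x \<in> Pm D"
  shows "mmul (idx n) F X.H (Bot, l) (x, k) = (\<Sum>j=1..n Bot. F (Bot, l) (Bot, j) * X.H (Bot, j) (x, k))"
proof -
  have "(\<Sum>j=1..n y. F (Bot, l) (y, j) * X.H (y, j) (x, k)) = 0" if "y \<noteq> Bot" for y
    using that by (intro sum.neutral ballI) (simp add: X.H_def)
  then have "(\<Sum>y\<in>uPm D. \<Sum>j=1..n y. F (Bot, l) (y, j) * X.H (y, j) (x, k)) =
      (\<Sum>y\<in>uPm D. if y = Bot then \<Sum>j=1..n Bot. F (Bot, l) (Bot, j) * X.H (Bot, j) (x, k) else 0)"
    by (intro sum.cong refl) auto
  then show ?thesis by (simp add: mmul_idx)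
qed

definition intertwines :: "('p xp \<times> nat \<Rightarrow> 'p xp \<times> nat \<Rightarrow> 'a) \<Rightarrow> bool" where
  "intertwines F \<longleftrightarrow> mmul (idx n) F X.H = mmul (idx n) Y.H F"

text \<open>Outside the row of blocks at \<open>0\<close> and the columns over \<open>Pm D\<close>
  both products vanish: \<open>H\<close> lives there, and \<open>F\<close> has no blocks leading
  from or to \<open>0\<close>.\<close>

lemma intertwines_iff:
  assumes F: "F \<in> tri n"
  shows "intertwines F \<longleftrightarrow> (\<forall>x\<in>Pm D. \<forall>l\<in>{1..n Bot}. \<forall>k\<in>{1..n x}.
    mmul (idx n) F X.H (Bot, l) (x, k) = mmul (idx n) Y.H F (Bot, l) (x, k))"
proof
  assume *: "\<forall>x\<in>Pm D. \<forall>l\<in>{1..n Bot}. \<forall>k\<in>{1..n x}.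
    mmul (idx n) F X.H (Bot, l) (x, k) = mmul (idx n) Y.H F (Bot, l) (x, k)"
  have "mmul (idx n) F X.H a c = mmul (idx n) Y.H F a c" for a c
  proof (cases "fst a = Bot \<and> a \<in> idx n \<and> c \<in> idx n \<and> fst c \<in> Pm D")
    case True
    then show ?thesis using * by (cases a; cases c) (auto simp: idx_def)
  next
    case False
    have "F a b * X.H b c = 0" for b
      using False tri_zero[OF F, of a b] by (cases "fst b = Bot") (auto simp: X.H_def iso_le_Bot)
    moreover have "Y.H a b * F b c = 0" for b
      using False tri_zero[OF F, of b c] idx_uPm[of c n] by (cases "c \<in> idx n"; cases "fst b = Bot") (auto simp: Y.H_def idx_dims iso_le_def Pm_iff idx_uPm)
    ultimately show ?thesis by (simp add: mmul_def)
  qed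
  then show "intertwines F" unfolding intertwines_def by (intro ext)
qed (simp add: intertwines_def)

text \<open>Left and right hand side of the compatibility of \<open>(f\<^sup>0, f\<^sup>1)\<close> with the action of \<open>W\<^sub>0\<close>.\<close>

lemma crd_W0_left:
  assumes F: "F \<in> tri n" and g: "\<gamma> \<in> W0" and m: "m \<in> mcar M" and l: "l \<in> {1..n Bot}"
  shows "Y.crd Bot l (Y.W0_act \<gamma> (f0 F m) + (\<Sum>p\<in>BJ. Y.W0_act (dual_l D p \<gamma>) (W1_map F (dual_el p) m))) =
    (\<Sum>x\<in>Pm D. \<Sum>k=1..n x. pr \<gamma> Bot x (mmul (idx n) Y.H F (Bot, l) (x, k) * X.crd x k m))"
proof -
  have gJ: "\<gamma> \<in> dualJ D" using g by (simp add: W0_iff)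
  have lN: "l \<in> {1..dimvec D N Bot}" using l by (simp add: dims)
  have pW: "dual_l D p \<gamma> \<in> W0" if "p \<in> BJ" for p
    using peirceD_dual_l[OF diag_idems(2) g] BJ_JJ[OF that] by blast
  have phM: "W1_map F (dual_el p) m \<in> mcar N" if "p \<in> BJ" for p by (rule W1_map_closed[OF F BJ_W1[OF that] m])
  have omM: "Y.W0_act (dual_l D p \<gamma>) (W1_map F (dual_el p) m) \<in> mcar N" if "p \<in> BJ" for p
    by (rule Y.W0_act_closed[OF pW[OF that] phM[OF that]])
  have HY: "Y.H (Bot, l) (x, j) \<in> RR D Bot x" if "x \<in> Pm D" "j \<in> {1..n x}" for x j
    using Y.H_in[OF that(1) lN] that by (simp add: dimsP)
  have Fd: "F (x, j) (x, k) \<in> RR D x x" if "x \<in> Pm D" "j \<in> {1..n x}" "k \<in> {1..n x}" for x j k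
    using F_diag[OF F _ that(2,3)] that(1) by (simp add: Pm_iff)
  have 1: "Y.crd Bot l (Y.W0_act \<gamma> (f0 F m)) = (\<Sum>x\<in>Pm D. \<Sum>k=1..n x. pr \<gamma> Bot x
      ((\<Sum>j=1..n x. Y.H (Bot, l) (x, j) * F (x, j) (x, k)) * X.crd x k m))"
  proof -
    have "Y.crd Bot l (Y.W0_act \<gamma> (f0 F m)) =
        (\<Sum>x\<in>Pm D. \<Sum>j=1..dimvec D N x. pr \<gamma> Bot x (Y.H (Bot, l) (x, j) * Y.crd x j (f0 F m)))"
      by (rule Y.crd_W0_act_H[OF g f0_closed[OF F m] lN])
    also have "\<dots> = (\<Sum>x\<in>Pm D. \<Sum>j=1..n x. pr \<gamma> Bot x (Y.H (Bot, l) (x, j) *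
        (\<Sum>k=1..n x. F (x, j) (x, k) * X.crd x k m)))"
      by (intro sum.cong) (auto simp: dimsP f0_crd[OF F m] Pm_iff)
    also have "\<dots> = (\<Sum>x\<in>Pm D. \<Sum>k=1..n x. pr \<gamma> Bot x
      ((\<Sum>j=1..n x. Y.H (Bot, l) (x, j) * F (x, j) (x, k)) * X.crd x k m))"
      by (rule pr_sum_diag[OF gJ Bot_in_uPm]) (use HY Fd cX[OF m] in auto)
    finally show ?thesis .
  qed
  have 2: "Y.crd Bot l (\<Sum>p\<in>BJ. Y.W0_act (dual_l D p \<gamma>) (W1_map F (dual_el p) m)) =
      (\<Sum>x\<in>Pm D. \<Sum>k=1..n x. pr \<gamma> Bot x
        ((\<Sum>y\<in>Pm D. \<Sum>j=1..n y. if Bot < y \<and> y < x then Y.H (Bot, l) (y, j) * F (y, j) (x, k) else 0)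
          * X.crd x k m))"
  proof -
    have "Y.crd Bot l (\<Sum>p\<in>BJ. Y.W0_act (dual_l D p \<gamma>) (W1_map F (dual_el p) m)) =
        (\<Sum>p\<in>BJ. Y.crd Bot l (Y.W0_act (dual_l D p \<gamma>) (W1_map F (dual_el p) m)))"
      by (rule Y.crd_sum[OF omM Bot_in_uPm lN])
    also have "\<dots> = (\<Sum>p\<in>BJ. \<Sum>y\<in>Pm D. \<Sum>j=1..dimvec D N y. pr (dual_l D p \<gamma>) Bot y
        (Y.H (Bot, l) (y, j) * Y.crd y j (W1_map F (dual_el p) m)))"
      by (intro sum.cong refl Y.crd_W0_act_H pW phM lN)
    also have "\<dots> = (\<Sum>p\<in>BJ. \<Sum>y\<in>Pm D. \<Sum>j=1..n y. pr (dual_l D p \<gamma>) Bot y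
        (Y.H (Bot, l) (y, j) * Y.crd y j (W1_map F (dual_el p) m)))"
      by (intro sum.cong refl) (simp add: dimsP)
    also have "\<dots> = (\<Sum>x\<in>Pm D. \<Sum>k=1..n x. pr \<gamma> Bot x
        ((\<Sum>y\<in>Pm D. \<Sum>j=1..n y. if Bot < y \<and> y < x then Y.H (Bot, l) (y, j) * F (y, j) (x, k) else 0)
          * X.crd x k m))"
    proof (rule pr_sum_strict[OF gJ Bot_in_uPm, where n = "\<lambda>p y j. Y.crd y j (W1_map F (dual_el p) m)"])
      fix p y j assume "p \<in> BJ" "y \<in> Pm D" "j \<in> {1..n y}"
      then show "Y.crd y j (W1_map F (dual_el p) m) =
          (\<Sum>x\<in>Pm D. \<Sum>k=1..n x. pr (dual_el p) y x (F (y, j) (x, k) * X.crd x k m))"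
        by (intro W1_map_crd F BJ_W1 m) (simp_all add: Pm_iff)
    qed (use HY F_less[OF F] cX[OF m] in auto)
    finally show ?thesis .
  qed
  have HF: "(\<Sum>j=1..n x. Y.H (Bot, l) (x, j) * F (x, j) (x, k)) * X.crd x k m \<in> RR D Bot x"
    "(\<Sum>y\<in>Pm D. \<Sum>j=1..n y. if Bot < y \<and> y < x then Y.H (Bot, l) (y, j) * F (y, j) (x, k) else 0) * X.crd x k m
      \<in> RR D Bot x" if x: "x \<in> Pm D" and k: "k \<in> {1..n x}" for x k
  proof -
    have xu: "x \<in> uPm D" "Bot \<le> x" using x by (simp_all add: Pm_iff less_eq_xp_def)
    note R = RR_mult[OF Bot_in_uPm xu(1) xu(1) xu(2) order_refl _ cX[OF m x k]]
    show "(\<Sum>j=1..n x. Y.H (Bot, l) (x, j) * F (x, j) (x, k)) * X.crd x k m \<in> RR D Bot x"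
      by (intro R RR_sum RR_mult[OF Bot_in_uPm xu(1) xu(1) xu(2) order_refl] HY Fd x k Bot_in_uPm xu)
    have "(if Bot < y \<and> y < x then Y.H (Bot, l) (y, j) * F (y, j) (x, k) else 0) \<in> RR D Bot x"
      if y: "y \<in> Pm D" and j: "j \<in> {1..n y}" for y j
      using RR_mult[of Bot y x, OF Bot_in_uPm _ xu(1) _ _ HY[OF y j] F_less[OF F y x _ j k]] y xu
      by (auto simp: RR_0 Pm_iff)
    then show "(\<Sum>y\<in>Pm D. \<Sum>j=1..n y. if Bot < y \<and> y < x then Y.H (Bot, l) (y, j) * F (y, j) (x, k) else 0)
        * X.crd x k m \<in> RR D Bot x"
      by (intro R RR_sum Bot_in_uPm xu)
  qed
  have "Y.crd Bot l (Y.W0_act \<gamma> (f0 F m) + (\<Sum>p\<in>BJ. Y.W0_act (dual_l D p \<gamma>) (W1_map F (dual_el p) m))) =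
      Y.crd Bot l (Y.W0_act \<gamma> (f0 F m)) + Y.crd Bot l (\<Sum>p\<in>BJ. Y.W0_act (dual_l D p \<gamma>) (W1_map F (dual_el p) m))"
    by (rule Y.crd_add[OF Y.W0_act_closed[OF g f0_closed[OF F m]] mod_sum[OF Y.M omM] Bot_in_uPm lN])
  also have "\<dots> = (\<Sum>x\<in>Pm D. \<Sum>k=1..n x.
      pr \<gamma> Bot x ((\<Sum>j=1..n x. Y.H (Bot, l) (x, j) * F (x, j) (x, k)) * X.crd x k m) +
      pr \<gamma> Bot x ((\<Sum>y\<in>Pm D. \<Sum>j=1..n y. if Bot < y \<and> y < x then Y.H (Bot, l) (y, j) * F (y, j) (x, k) else 0)
          * X.crd x k m))"
    by (simp only: 1 2 sum.distrib)
  also have "\<dots> = (\<Sum>x\<in>Pm D. \<Sum>k=1..n x. pr \<gamma> Bot x (mmul (idx n) Y.H F (Bot, l) (x, k) * X.crd x k m))"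
  proof (intro sum.cong refl)
    fix x k assume x: "x \<in> Pm D" and k: "k \<in> {1..n x}"
    then have xu: "x \<in> uPm D" "Bot < x" by (simp_all add: Pm_iff Bot_less)
    show "pr \<gamma> Bot x ((\<Sum>j=1..n x. Y.H (Bot, l) (x, j) * F (x, j) (x, k)) * X.crd x k m) +
      pr \<gamma> Bot x ((\<Sum>y\<in>Pm D. \<Sum>j=1..n y. if Bot < y \<and> y < x then Y.H (Bot, l) (y, j) * F (y, j) (x, k) else 0)
          * X.crd x k m) = pr \<gamma> Bot x (mmul (idx n) Y.H F (Bot, l) (x, k) * X.crd x k m)"
      unfolding mmul_H_F[OF F x] distrib_right by (rule pr_add[OF gJ Bot_in_uPm xu HF[OF x k], symmetric])
  qed
  finally show ?thesis .
qed

lemma crd_W0_right: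
  assumes F: "F \<in> tri n" and g: "\<gamma> \<in> W0" and m: "m \<in> mcar M" and l: "l \<in> {1..n Bot}"
  shows "Y.crd Bot l (f0 F (X.W0_act \<gamma> m)) =
    (\<Sum>x\<in>Pm D. \<Sum>k=1..n x. pr \<gamma> Bot x (mmul (idx n) F X.H (Bot, l) (x, k) * X.crd x k m))"
proof -
  have gJ: "\<gamma> \<in> dualJ D" using g by (simp add: W0_iff)
  have "Y.crd Bot l (f0 F (X.W0_act \<gamma> m)) = (\<Sum>j\<in>{1..n Bot}. F (Bot, l) (Bot, j) *
      (\<Sum>x\<in>Pm D. \<Sum>k=1..n x. pr \<gamma> Bot x (X.H (Bot, j) (x, k) * X.crd x k m)))"
    unfolding f0_crd[OF F X.W0_act_closed[OF g m] Bot_in_uPm l]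
    by (intro sum.cong refl) (simp only: X.crd_W0_act_H[OF g m])
  also have "\<dots> = (\<Sum>x\<in>Pm D. \<Sum>k=1..n x. pr \<gamma> Bot x
      ((\<Sum>j\<in>{1..n Bot}. F (Bot, l) (Bot, j) * X.H (Bot, j) (x, k)) * X.crd x k m))"
    by (rule pr_sum_left[OF gJ Bot_in_uPm]) (use F_diag[OF F Bot_in_uPm l] X.H_in cX[OF m] in auto)
  finally show ?thesis by (simp add: mmul_F_H[OF F])
qed


lemma mmul_HF_in:
  assumes F: "F \<in> tri n" and x: "x \<in> Pm D" and l: "l \<in> {1..n Bot}" and k: "k \<in> {1..n x}"
  shows "mmul (idx n) Y.H F (Bot, l) (x, k) \<in> RR D Bot x"
proof -
  have xu: "x \<in> uPm D" "Bot \<le> x" using x by (simp_all add: Pm_iff less_eq_xp_def)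
  have HY: "Y.H (Bot, l) (y, j) \<in> RR D Bot y" if "y \<in> Pm D" "j \<in> {1..n y}" for y j
    using Y.H_in[OF that(1)] that l by (simp add: dimsP dims)
  have "Y.H (Bot, l) (x, j) * F (x, j) (x, k) \<in> RR D Bot x" if "j \<in> {1..n x}" for j
    by (rule RR_mult[OF Bot_in_uPm xu(1) xu(1) xu(2) order_refl HY[OF x that] F_diag[OF F xu(1) that k]])
  moreover have "(if Bot < y \<and> y < x then Y.H (Bot, l) (y, j) * F (y, j) (x, k) else 0) \<in> RR D Bot x"
    if y: "y \<in> Pm D" and j: "j \<in> {1..n y}" for y j
    using RR_mult[of Bot y x, OF Bot_in_uPm _ xu(1) _ _ HY[OF y j] F_less[OF F y x _ j k]] y xu
    by (auto simp: RR_0 Pm_iff)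
  ultimately show ?thesis
    unfolding mmul_H_F[OF F x] by (intro RR_add RR_sum Bot_in_uPm xu)
qed

lemma mmul_FH_in:
  assumes F: "F \<in> tri n" and x: "x \<in> Pm D" and l: "l \<in> {1..n Bot}" and k: "k \<in> {1..n x}"
  shows "mmul (idx n) F X.H (Bot, l) (x, k) \<in> RR D Bot x"
proof -
  have xu: "x \<in> uPm D" "Bot \<le> x" using x by (simp_all add: Pm_iff less_eq_xp_def)
  show ?thesis unfolding mmul_F_H[OF F x]
    by (intro RR_sum RR_mult[OF Bot_in_uPm Bot_in_uPm xu(1) order_refl xu(2)] F_diag[OF F Bot_in_uPm l]
        X.H_in x k Bot_in_uPm xu)
qed

text \<open>The compatibility with the action of \<open>W\<^sub>0\<close> after inserting
  \<open>f1_d_W0\<close>, whose minus sign brings the sum to the left hand side.\<close>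

definition W0_compat :: "('p xp \<times> nat \<Rightarrow> 'p xp \<times> nat \<Rightarrow> 'a) \<Rightarrow> bool" where
  "W0_compat F \<longleftrightarrow> (\<forall>\<gamma>\<in>W0. \<forall>m\<in>mcar M.
     Y.W0_act \<gamma> (f0 F m) + (\<Sum>p\<in>BJ. Y.W0_act (dual_l D p \<gamma>) (W1_map F (dual_el p) m)) = f0 F (X.W0_act \<gamma> m))"

text \<open>The action of \<open>W\<^sub>0\<close> ends in the component at \<open>0\<close>. There
  the two coordinate formulas contain the entries of the two matrix products; at all other points
  both sides have coordinate zero.\<close>

lemma intertwines_W0:
  assumes F: "F \<in> tri n" and intertwines: "intertwines F"
  shows "W0_compat F"
  unfolding W0_compat_def
proof (intro ballI)
  fix \<gamma> m assume g: "\<gamma> \<in> W0" and m: "m \<in> mcar M"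
  have omM: "Y.W0_act (dual_l D p \<gamma>) (W1_map F (dual_el p) m) \<in> mcar N"
    "dual_l D p \<gamma> \<in> W0" "W1_map F (dual_el p) m \<in> mcar N" if p: "p \<in> BJ" for p
  proof -
    show w: "dual_l D p \<gamma> \<in> W0" using peirceD_dual_l[OF diag_idems(2) g] BJ_JJ[OF p] by blast
    show q: "W1_map F (dual_el p) m \<in> mcar N" by (rule W1_map_closed[OF F BJ_W1[OF p] m])
    show "Y.W0_act (dual_l D p \<gamma>) (W1_map F (dual_el p) m) \<in> mcar N" by (rule Y.W0_act_closed[OF w q])
  qed
  have 1: "Y.W0_act \<gamma> (f0 F m) \<in> mcar N" by (rule Y.W0_act_closed[OF g f0_closed[OF F m]])
  have 2: "(\<Sum>p\<in>BJ. Y.W0_act (dual_l D p \<gamma>) (W1_map F (dual_el p) m)) \<in> mcar N" by (rule mod_sum[OF Y.M omM(1)])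
  show "Y.W0_act \<gamma> (f0 F m) + (\<Sum>p\<in>BJ. Y.W0_act (dual_l D p \<gamma>) (W1_map F (dual_el p) m)) = f0 F (X.W0_act \<gamma> m)"
  proof (rule Y.crd_ext[OF Y.R.C_add[OF 1 2] f0_closed[OF F X.W0_act_closed[OF g m]]])
    fix z l assume z: "z \<in> uPm D" and l: "l \<in> {1..dimvec D N z}"
    then have l': "l \<in> {1..n z}" by (simp add: dims)
    show "Y.crd z l (Y.W0_act \<gamma> (f0 F m) + (\<Sum>p\<in>BJ. Y.W0_act (dual_l D p \<gamma>) (W1_map F (dual_el p) m))) =
        Y.crd z l (f0 F (X.W0_act \<gamma> m))"
    proof (cases "z = Bot")
      case True
      then show ?thesis using crd_W0_left[OF F g m] crd_W0_right[OF F g m] intertwines l' by (simp add: intertwines_def)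
    next
      case False
      then have zP: "z \<in> Pm D" using z by (simp add: Pm_iff)
      have "Y.crd z l (\<Sum>p\<in>BJ. Y.W0_act (dual_l D p \<gamma>) (W1_map F (dual_el p) m)) =
          (\<Sum>p\<in>BJ. Y.crd z l (Y.W0_act (dual_l D p \<gamma>) (W1_map F (dual_el p) m)))"
        by (rule Y.crd_sum[OF omM(1) z l])
      also have "\<dots> = 0" by (intro sum.neutral ballI Y.crd_W0_act_out omM zP l)
      finally have "Y.crd z l (Y.W0_act \<gamma> (f0 F m) + (\<Sum>p\<in>BJ. Y.W0_act (dual_l D p \<gamma>) (W1_map F (dual_el p) m))) = 0"
        using Y.crd_add[OF 1 2 z l] Y.crd_W0_act_out[OF g f0_closed[OF F m] zP l] by simp
      moreover have "Y.crd z l (f0 F (X.W0_act \<gamma> m)) = 0"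
        using X.crd_W0_act_out[OF g m zP] by (simp add: f0_crd[OF F X.W0_act_closed[OF g m] z l'])
      ultimately show ?thesis by simp
    qed
  qed
qed

text \<open>On a basis vector the coordinate formulas reduce to \<open>pr \<xi> Bot x\<close> of a
  single entry of each product, and the elements \<open>\<xi>\<close> of \<open>W\<^sub>0\<close>
  separate these entries by \<open>pr_separate\<close>.\<close>

lemma W0_intertwines:
  assumes F: "F \<in> tri n" and W: "W0_compat F"
  shows "intertwines F"
  unfolding intertwines_iff[OF F]
proof (intro ballI)
  fix x l k assume x: "x \<in> Pm D" and l: "l \<in> {1..n Bot}" and k: "k \<in> {1..n x}"
  have xu: "x \<in> uPm D" "Bot < x" "Bot \<le> x" using x by (simp_all add: Pm_iff Bot_less less_eq_xp_def)
  let ?m = "bM x k"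
  have m: "?m \<in> mcar M" by (rule X.b_comp(1)[OF xu(1) k])
  \<comment> \<open>All coordinates of the basis vector vanish except for one unit, which leaves one
    summand.\<close>
  have eval: "(\<Sum>y\<in>Pm D. \<Sum>i=1..n y. pr \<xi> Bot y (A (y, i) * X.crd y i ?m)) = pr \<xi> Bot x (A (x, k))"
    if \<xi>: "\<xi> \<in> dualJ D" and A: "A (x, k) \<in> RR D Bot x" for \<xi> A
  proof -
    have "(\<Sum>y\<in>Pm D. \<Sum>i=1..n y. pr \<xi> Bot y (A (y, i) * X.crd y i ?m)) =
        (\<Sum>y\<in>Pm D. if y = x then \<Sum>i=1..n x. if i = k then pr \<xi> Bot x (A (x, k)) else 0 else 0)"
    proof (rule sum.cong[OF refl])
      fix y assume y: "y \<in> Pm D"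
      have "pr \<xi> Bot y (A (y, i) * X.crd y i ?m) = (if y = x \<and> i = k then pr \<xi> Bot x (A (x, k)) else 0)"
        if i: "i \<in> {1..n y}" for i
        using X.crd_b[OF _ xu(1) i k] y eps_r[OF A Bot_in_uPm xu(1,3)] \<xi> by (auto simp: Pm_iff pr_0)
      then show "(\<Sum>i=1..n y. pr \<xi> Bot y (A (y, i) * X.crd y i ?m)) =
          (if y = x then \<Sum>i=1..n x. if i = k then pr \<xi> Bot x (A (x, k)) else 0 else 0)" by simp
    qed
    then show ?thesis using x k by simp
  qed
  show "mmul (idx n) F X.H (Bot, l) (x, k) = mmul (idx n) Y.H F (Bot, l) (x, k)"
  proof (rule pr_separate[OF Bot_in_uPm xu(1,2) mmul_FH_in[OF F x l k] mmul_HF_in[OF F x l k]])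
    fix \<xi> assume \<xi>: "\<xi> \<in> W0"
    then have \<xi>J: "\<xi> \<in> dualJ D" by (simp add: W0_iff)
    have "Y.crd Bot l (f0 F (X.W0_act \<xi> ?m)) =
        Y.crd Bot l (Y.W0_act \<xi> (f0 F ?m) + (\<Sum>p\<in>BJ. Y.W0_act (dual_l D p \<xi>) (W1_map F (dual_el p) ?m)))"
      using W \<xi> m unfolding W0_compat_def by simp
    then show "pr \<xi> Bot x (mmul (idx n) F X.H (Bot, l) (x, k)) = pr \<xi> Bot x (mmul (idx n) Y.H F (Bot, l) (x, k))"
      unfolding crd_W0_left[OF F \<xi> m l] crd_W0_right[OF F \<xi> m l]
      using eval[of \<xi> "mmul (idx n) F X.H (Bot, l)", OF \<xi>J mmul_FH_in[OF F x l k]]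
        eval[of \<xi> "mmul (idx n) Y.H F (Bot, l)", OF \<xi>J mmul_HF_in[OF F x l k]] by simp
  qed
qed

lemma dcond_F:
  assumes F: "F \<in> tri n" and intertwines: "intertwines F"
  shows "De_pair.dcond D d M N (W1_map F) (f0 F)"
proof -
  interpret P: De_pair D B d M N "W1_map F" by (rule pair[OF F])
  show ?thesis
  proof (rule P.dcond_extend)
    fix \<gamma> m assume g: "\<gamma> \<in> W0" and m: "m \<in> mcar M"
    have "Y.W0_act \<gamma> (f0 F m) + (\<Sum>p\<in>BJ. Y.W0_act (dual_l D p \<gamma>) (W1_map F (dual_el p) m)) = f0 F (X.W0_act \<gamma> m)"
      using intertwines_W0[OF F intertwines] g m unfolding W0_compat_def by blast
    then show "mact N (f0 F m) (in_W0 D \<gamma>) = f0 F (mact M m (in_W0 D \<gamma>)) + P.f1 (d (in_W0 D \<gamma>)) m"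
      unfolding P.f1_d_W0[OF g m] by (simp add: X.W0_act_def Y.W0_act_def eq_diff_eq)
  qed (use F in \<open>simp_all add: f0_closed f0_diff f0_mal\<close>)
qed

lemma morphism_F:
  assumes F: "F \<in> tri n" and intertwines: "intertwines F"
  shows "De_morphism D d M N (f0 F, tmap M N (W1_map F))"
proof -
  interpret P: De_pair D B d M N "W1_map F" by (rule pair[OF F])
  show ?thesis
    by (rule P.De_morphism_f1) (use F intertwines in \<open>simp_all add: f0_closed f0_diff f0_mal dcond_F\<close>)
qed

text \<open>The columns of the matrix are read off from basis vectors. The second component need
  only be compared on \<open>W\<^sub>1\<close>, thanks to \<open>tmap_unique\<close>; there it is
  right linear and hence determined on the dual basis.\<close>

lemma morphism_matrix:
  assumes f: "De_morphism D d M N f"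
  shows "\<exists>F\<in>tri n. intertwines F \<and> (\<forall>m\<in>mcar M. fst f m = f0 F m)"
proof -
  obtain h0 h1 where fh: "f = (h0, h1)" by force
  define \<phi> where "\<phi> \<delta> = h1 (in_W1 D \<delta>)" for \<delta>
  have h0: "h0 m \<in> mcar N" and h0_add: "m' \<in> mcar M \<Longrightarrow> h0 (m + m') = h0 m + h0 m'"
    and h0_Re: "r \<in> carrier (Re D) \<Longrightarrow> h0 (mal M r m) = mal N r (h0 m)" if "m \<in> mcar M" for m m' r
    using f that unfolding De_morphism_def fh prod.case mal_def by blast+
  have h1_hom: "hom_K D M N (h1 w)" if "w \<in> Tdeg D 1" for w
    using f that unfolding De_morphism_def fh prod.case by blast
  have h1_add: "h1 (w \<oplus>\<^bsub>TT D\<^esub> w') m = h1 w m + h1 w' m"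
    if "w \<in> Tdeg D 1" "w' \<in> Tdeg D 1" "m \<in> mcar M" for w w' m
    using f that unfolding De_morphism_def fh prod.case by blast
  have h1_l: "h1 (a \<otimes>\<^bsub>TT D\<^esub> w) m = h1 w (mact M m a)" and h1_r: "h1 (w \<otimes>\<^bsub>TT D\<^esub> a) m = mact N (h1 w m) a"
    if "a \<in> Tdeg D 0" "w \<in> Tdeg D 1" "m \<in> mcar M" for a w m
    using f that unfolding De_morphism_def fh prod.case by blast+
  have h1_d: "mact N (h0 m) a = h0 (mact M m a) + h1 (d a) m" if "a \<in> Tdeg D 0" "m \<in> mcar M" for a m
    using f that unfolding De_morphism_def fh prod.case by blast
  have closed: "h1 w m \<in> mcar N" and h1_plus: "m' \<in> mcar M \<Longrightarrow> h1 w (m + m') = h1 w m + h1 w m'"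
    if "w \<in> Tdeg D 1" "m \<in> mcar M" for w m m'
    using h1_hom[OF that(1)] that(2) unfolding hom_K_def by auto
  have bim: "bimap M N \<phi>"
    unfolding bimap_def
  proof (intro conjI ballI allI impI)
    fix \<delta> m assume g: "\<delta> \<in> W1" and m: "m \<in> mcar M"
    note t = in_W1_Tdeg[OF g]
    show "\<phi> \<delta> m \<in> mcar N" unfolding \<phi>_def by (rule closed[OF t m])
    show "\<phi> \<delta> (m - m') = \<phi> \<delta> m - \<phi> \<delta> m'" if m': "m' \<in> mcar M" for m'
      using h1_plus[OF t X.R.C_diff[OF m m'] m'] by (simp add: \<phi>_def)
  next
    fix \<delta> \<delta>' m assume g: "\<delta> \<in> W1" "\<delta>' \<in> W1" and m: "m \<in> mcar M"
    have "in_W1 D (\<delta> + \<delta>') = in_W1 D \<delta> \<oplus>\<^bsub>TT D\<^esub> in_W1 D \<delta>'"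
      using T.tcl_Tw_add[of "(0, \<delta>)" "(0, \<delta>')"] g by (simp add: in_W1_def TT_add W_0 diag_idems)
    then show "\<phi> (\<delta> + \<delta>') m = \<phi> \<delta> m + \<phi> \<delta>' m"
      using h1_add[OF in_W1_Tdeg[OF g(1)] in_W1_Tdeg[OF g(2)] m] by (simp add: \<phi>_def)
  next
    fix a c \<delta> m assume r: "(a, c) \<in> carrier (Re D)" and g: "\<delta> \<in> W1" and m: "m \<in> mcar M"
    have k: "Poly_Mapping.keys (frag_of (Sc (a, c))) \<subseteq> twords (Re D) (WW D)"
      "Poly_Mapping.keys (frag_of (Tw [(0, \<delta>)])) \<subseteq> twords (Re D) (WW D)"
      using r g by (auto simp: keys_frag_of twords_def W_0 diag_idems)
    have "in_Re D (a, c) \<otimes>\<^bsub>TT D\<^esub> in_W1 D \<delta> = in_W1 D (dual_l D a \<delta>)"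
      using TT_mult[OF k] by (simp add: in_Re_def in_W1_def tmult_of)
    then show "\<phi> (dual_l D a \<delta>) m = \<phi> \<delta> (mal M (a, c) m)"
      using h1_l[OF in_Re_Tdeg[OF r] in_W1_Tdeg[OF g] m] by (simp add: \<phi>_def mal_def)
    have "in_W1 D \<delta> \<otimes>\<^bsub>TT D\<^esub> in_Re D (a, c) = in_W1 D (dual_r D \<delta> a)"
      using TT_mult[OF k(2,1)] by (simp add: in_Re_def in_W1_def tmult_of)
    then show "\<phi> (dual_r D \<delta> a) m = mal N (a, c) (\<phi> \<delta> m)"
      using h1_r[OF in_Re_Tdeg[OF r] in_W1_Tdeg[OF g] m] by (simp add: \<phi>_def mal_def)
  qed
  interpret P: De_pair D B d M N \<phi> by unfold_locales (rule X.M, rule Y.M, rule bim)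
  have h1_tmap: "h1 w m = P.f1 w m" if "w \<in> Tdeg D 1" "m \<in> mcar M" for w m
    by (rule P.tmap_unique[of h1]) (use that in \<open>simp_all add: h1_add h1_l h1_r \<phi>_def del: One_nat_def\<close>)
  \<comment> \<open>For \<open>z < x\<close> the wanted entry \<open>t\<close> must satisfy
    \<open>pr \<delta> z x t = crd (\<phi> \<delta> b)\<close> for all \<open>\<delta>\<close>. The
    dual basis dictates \<open>t = \<Sum> crd (\<phi> \<gamma>\<^sub>p b) p\<close>, the sum over
    the basis elements \<open>p\<close> of \<open>e\<^sub>z J e\<^sub>x\<close>.\<close>
  define F where "F = (\<lambda>(z, j) (x, k). if (z, j) \<in> idx n \<and> (x, k) \<in> idx n \<and> iso_le z x
    then if z = x then Y.crd z j (h0 (bM z k))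
      else \<Sum>p\<in>Bs z x. Y.crd z j (\<phi> (dual_el p) (bM x k)) * p z x else 0)"
  have bM: "bM x k \<in> mcar M" if "x \<in> uPm D" "k \<in> {1..n x}" for x k by (rule X.b_comp(1)[OF that])
  have Bs_BJ: "Bs z x \<subseteq> BJ" if "z \<in> Pm D" for z x
    using Bs_peirceJ[OF diag_idem_ehat] BsD that by (auto simp: ehat_apply)
  have F: "F \<in> tri n"
  proof (rule tri_I)
    fix a c assume ac: "a \<in> idx n" "c \<in> idx n" "iso_le (fst a) (fst c)"
    obtain z j x k where zx: "a = (z, j)" "c = (x, k)" by force
    have z: "z \<in> uPm D" "j \<in> {1..n z}" and x: "x \<in> uPm D" "k \<in> {1..n x}" and le: "iso_le z x"
      using ac by (auto simp: zx idx_def)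
    have jN: "j \<in> {1..dimvec D N z}" using z by (simp add: dims)
    show "F a c \<in> RR D (fst a) (fst c)"
    proof (cases "z = x")
      case True
      then have "Y.crd z j (h0 (bM z k)) \<in> RR D z z" using x by (intro Y.crd z jN h0 bM) simp_all
      then show ?thesis using ac True by (simp add: zx F_def)
    next
      case False
      then have zP: "z \<in> Pm D" using le z by (auto simp: Pm_iff iso_le_def)
      have "(\<Sum>p\<in>Bs z x. Y.crd z j (\<phi> (dual_el p) (bM x k)) * p z x) \<in> RR D z x"
      proof (rule RR_sum)
        fix p assume p: "p \<in> Bs z x"
        then have "\<phi> (dual_el p) (bM x k) \<in> mcar N"
          using Bs_BJ[OF zP] by (intro P.bm_closed BJ_W1 bM x) auto
        then show "Y.crd z j (\<phi> (dual_el p) (bM x k)) * p z x \<in> RR D z x"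
          using z x le by (intro RR_mult[of z z x] Y.crd Bs_munit(2)[OF p] jN) (auto simp: iso_le_def)
      qed (use z x le in \<open>auto simp: iso_le_def\<close>)
      then show ?thesis using ac False by (simp add: zx F_def)
    qed
  qed (auto simp: F_def)
  have decomp: "m = (\<Sum>x\<in>uPm D. \<Sum>k=1..n x. X.ac x (X.crd x k m) (bM x k))" if "m \<in> mcar M" for m
    using X.elt_crd[OF that] by (simp add: X.elt_def)
  have acM: "X.ac x (X.crd x k m) (bM x k) \<in> mcar M" if "m \<in> mcar M" "x \<in> uPm D" "k \<in> {1..n x}" for m x k
    using that by (intro X.ac_closed X.crd bM) auto
  have addsum: "h (\<Sum>i\<in>I. g i) = (\<Sum>i\<in>I. h (g i))" if "\<And>m m'. m \<in> mcar M \<Longrightarrow> m' \<in> mcar M \<Longrightarrow> h (m - m') = h m - h m'"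
    "\<And>i. i \<in> I \<Longrightarrow> g i \<in> mcar M" for h :: "'m \<Rightarrow> 'n" and g :: "'i \<Rightarrow> 'm" and I
  proof -
    have h0: "h 0 = 0" using that(1)[OF X.R.C_0 X.R.C_0] by simp
    have "h (m + m') = h m + h m'" if "m \<in> mcar M" "m' \<in> mcar M" for m m'
      using \<open>\<And>m m'. m \<in> mcar M \<Longrightarrow> m' \<in> mcar M \<Longrightarrow> h (m - m') = h m - h m'\<close>[of "m + m'" m'] that
      by (simp add: X.R.C_add)
    then show ?thesis using that(2)
      by (induction I rule: infinite_finite_induct) (simp_all add: h0 mod_sum[OF X.M])
  qed
  have expand: "h m = (\<Sum>x\<in>uPm D. \<Sum>k=1..n x. h (X.ac x (X.crd x k m) (bM x k)))"
    if h: "\<And>m m'. m \<in> mcar M \<Longrightarrow> m' \<in> mcar M \<Longrightarrow> h (m - m') = h m - h m'" and m: "m \<in> mcar M" for h :: "'m \<Rightarrow> 'n" and m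
  proof -
    have "h m = h (\<Sum>x\<in>uPm D. \<Sum>k=1..n x. X.ac x (X.crd x k m) (bM x k))"
      by (rule arg_cong[OF decomp[OF m]])
    also have "\<dots> = (\<Sum>x\<in>uPm D. h (\<Sum>k=1..n x. X.ac x (X.crd x k m) (bM x k)))"
      by (rule addsum[OF h mod_sum[OF X.M acM[OF m]]])
    also have "\<dots> = (\<Sum>x\<in>uPm D. \<Sum>k=1..n x. h (X.ac x (X.crd x k m) (bM x k)))"
      by (intro sum.cong refl addsum[OF h acM[OF m]])
    finally show ?thesis .
  qed
  have h0_diff: "h0 (m - m') = h0 m - h0 m'" if "m \<in> mcar M" "m' \<in> mcar M" for m m'
    using h0_add[OF X.R.C_diff[OF that] that(2)] by simp
  have crd_expand: "Y.crd z j (\<Sum>x\<in>uPm D. \<Sum>k=1..n x. g x k) = (\<Sum>x\<in>uPm D. \<Sum>k=1..n x. Y.crd z j (g x k))"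
    if "\<And>x k. x \<in> uPm D \<Longrightarrow> k \<in> {1..n x} \<Longrightarrow> g x k \<in> mcar N" "z \<in> uPm D" "j \<in> {1..dimvec D N z}" for g z j
  proof -
    have "Y.crd z j (\<Sum>x\<in>uPm D. \<Sum>k=1..n x. g x k) = (\<Sum>x\<in>uPm D. Y.crd z j (\<Sum>k=1..n x. g x k))"
      by (rule Y.crd_sum[OF mod_sum[OF Y.M that(1)] that(2,3)])
    also have "\<dots> = (\<Sum>x\<in>uPm D. \<Sum>k=1..n x. Y.crd z j (g x k))"
      by (intro sum.cong refl Y.crd_sum that)
    finally show ?thesis .
  qed
  have f0F: "h0 m = f0 F m" if m: "m \<in> mcar M" for m
  proof (rule Y.crd_ext[OF h0[OF m] f0_closed[OF F m]])
    fix z j assume z: "z \<in> uPm D" and j: "j \<in> {1..dimvec D N z}"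
    then have j': "j \<in> {1..n z}" by (simp add: dims)
    have "Y.crd z j (h0 (X.ac x (X.crd x k m) (bM x k))) = (if x = z then F (z, j) (z, k) * X.crd z k m else 0)"
      if x: "x \<in> uPm D" and k: "k \<in> {1..n x}" for x k
    proof -
      have r: "rdiag x (X.crd x k m) \<in> carrier (Re D)" using x k m by (intro rdiag_Re X.crd) auto
      have "Y.crd z j (h0 (X.ac x (X.crd x k m) (bM x k))) = Y.crd z j (h0 (bM x k)) * rc (rdiag x (X.crd x k m)) z"
        using h0_Re[OF bM[OF x k] r] Y.crd_mal[OF r h0[OF bM[OF x k]] z j] by simp
      then show ?thesis using x k z j' by (cases "x = z") (auto simp: rc_rdiag F_def idx_def iso_le_refl)
    qed
    then have "(\<Sum>x\<in>uPm D. \<Sum>k=1..n x. Y.crd z j (h0 (X.ac x (X.crd x k m) (bM x k)))) =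
        (\<Sum>x\<in>uPm D. if x = z then \<Sum>k=1..n z. F (z, j) (z, k) * X.crd z k m else 0)"
      by (intro sum.cong refl) auto
    moreover have "Y.crd z j (h0 m) = (\<Sum>x\<in>uPm D. \<Sum>k=1..n x. Y.crd z j (h0 (X.ac x (X.crd x k m) (bM x k))))"
      using arg_cong[OF expand[of h0, OF h0_diff m], of "Y.crd z j"]
        crd_expand[of "\<lambda>x k. h0 (X.ac x (X.crd x k m) (bM x k))", OF h0[OF acM[OF m]] z j] by (rule trans)
    ultimately show "Y.crd z j (h0 m) = Y.crd z j (f0 F m)"
      using z by (simp add: f0_crd[OF F m z j'])
  qed
  have phF: "\<phi> \<delta> m = W1_map F \<delta> m" if g: "\<delta> \<in> W1" and m: "m \<in> mcar M" for \<delta> m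
  proof (rule Y.crd_ext[OF P.bm_closed[OF g m] W1_map_closed[OF F g m]])
    fix z j assume z: "z \<in> uPm D" and j: "j \<in> {1..dimvec D N z}"
    then have j': "j \<in> {1..n z}" by (simp add: dims)
    have gJ: "\<delta> \<in> dualJ D" using g by (simp add: W1_iff)
    show "Y.crd z j (\<phi> \<delta> m) = Y.crd z j (W1_map F \<delta> m)"
    proof (cases "z = Bot")
      case True
      \<comment> \<open>Elements of \<open>W\<^sub>1\<close> are fixed by \<open>ehat\<close> from
        the right, and the element \<open>(ehat D, 0)\<close> of \<open>R\<^sup>e\<close> has
        component zero at \<open>0\<close>.\<close>
      have r: "(ehat D, 0) \<in> carrier (Re D)" by (simp add: Re_iff ehat_SS SS_0 ehat_apply Pm_iff)
      have "\<phi> \<delta> m = mal N (ehat D, 0) (\<phi> \<delta> m)" using P.bm_r[OF r g m] g by (simp add: W1_iff)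
      then have "Y.crd z j (\<phi> \<delta> m) = Y.crd z j (\<phi> \<delta> m) * rc (ehat D, 0) z"
        using Y.crd_mal[OF r P.bm_closed[OF g m] z j] by simp
      then show ?thesis using True W1_map_Bot[OF F g m] j' by (simp add: rc_def)
    next
      case False
      then have zP: "z \<in> Pm D" using z by (simp add: Pm_iff)
      have tm: "Y.crd z j (\<phi> \<delta> (X.ac x (X.crd x k m) (bM x k))) =
          (if x = Bot then 0 else pr \<delta> z x (F (z, j) (x, k) * X.crd x k m))"
        if x: "x \<in> uPm D" and k: "k \<in> {1..n x}" for x k
      proof -
        let ?c = "X.crd x k m"
        have c: "?c \<in> RR D x x" by (rule X.crd(1)[OF x m k])
        have r: "rdiag x ?c \<in> carrier (Re D)" using x c by (rule rdiag_Re)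
        show ?thesis
        proof (cases "x = Bot")
          case True
          have "\<phi> \<delta> (X.ac x ?c (bM x k)) = \<phi> (dual_l D 0 \<delta>) (bM x k)"
            using P.bm_l[of 0 "munit Bot Bot ?c" \<delta> "bM x k"] r g bM[OF x k] True by (simp add: rdiag_def)
          moreover have "dual_l D 0 \<delta> = 0" using gJ by (auto simp: dual_l_def fun_eq_iff dualJ_0)
          ultimately show ?thesis using True z j bM[OF x k] by (simp add: P.bm_zero Y.crd_0)
        next
          case False
          then have xP: "x \<in> Pm D" using x by (simp add: Pm_iff)
          \<comment> \<open>The coordinate of \<open>m\<close> is moved into
            \<open>\<delta>\<close>, so that only the basis vector remains as argument of
            \<open>\<phi>\<close>.\<close>
          let ?g = "dual_l D (munit x x ?c) \<delta>"
          have cS: "munit x x ?c \<in> SS D" using x c by (simp add: munit_SS)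
          have gW: "?g \<in> W1" by (rule W_dual_l[OF diag_idem_ehat g cS])
          have ggJ: "?g \<in> dualJ D" using gW by (simp add: W1_iff)
          have g_SS: "?g p \<in> SS D" if "p \<in> BJ" for p by (rule dualJ_SS[OF ggJ BJ_JJ[OF that]])
          have gp: "(?g p, 0) \<in> carrier (Re D)" if "p \<in> BJ" for p
            using g_SS[OF that] peirceD_entry[OF diag_idem_ehat gW, of Bot p]
            by (simp add: Re_iff SS_0 ehat_apply Pm_iff)
          have phi_sum: "\<phi> (\<Sum>i\<in>I. h i) y = (\<Sum>i\<in>I. \<phi> (h i) y)"
            if "\<And>i. i \<in> I \<Longrightarrow> h i \<in> W1" "y \<in> mcar M" for I :: "('a, 'p) imat set" and h y
          proof -
            have "(\<Sum>i\<in>I. h i) \<in> W1 \<and> \<phi> (\<Sum>i\<in>I. h i) y = (\<Sum>i\<in>I. \<phi> (h i) y)" using that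
              by (induction I rule: infinite_finite_induct)
                (auto simp: P.bm_zero P.bm_add W_0 W_add diag_idems simp del: plus_fun_apply zero_fun_apply)
            then show ?thesis by simp
          qed
          have rW: "dual_r D (dual_el p) (?g p) \<in> W1" if "p \<in> BJ" for p
            by (rule peirceD_dual_r[OF diag_idem_ehat gW _ BJ_JJ[OF that]]) (use that in \<open>simp add: dual_el_dualJ\<close>)
          have "\<phi> \<delta> (X.ac x ?c (bM x k)) = \<phi> ?g (bM x k)"
            using P.bm_l[of "munit x x ?c" 0 \<delta> "bM x k"] r g bM[OF x k] False by (simp add: rdiag_def)
          also have "\<dots> = \<phi> (\<Sum>p\<in>BJ. dual_r D (dual_el p) (?g p)) (bM x k)"
            by (simp only: dual_repr[OF diag_idem_ehat gW])
          also have "\<dots> = (\<Sum>p\<in>BJ. \<phi> (dual_r D (dual_el p) (?g p)) (bM x k))"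
            by (rule phi_sum[OF rW bM[OF x k]])
          also have "\<dots> = (\<Sum>p\<in>BJ. mal N (?g p, 0) (\<phi> (dual_el p) (bM x k)))"
            by (intro sum.cong refl P.bm_r gp BJ_W1 bM x k)
          finally have "Y.crd z j (\<phi> \<delta> (X.ac x ?c (bM x k))) =
              Y.crd z j (\<Sum>p\<in>BJ. mal N (?g p, 0) (\<phi> (dual_el p) (bM x k)))" by (rule arg_cong)
          also have "\<dots> = (\<Sum>p\<in>BJ. Y.crd z j (mal N (?g p, 0) (\<phi> (dual_el p) (bM x k))))"
            by (rule Y.crd_sum[OF Y.R.\<alpha>_closed[OF gp P.bm_closed[OF BJ_W1 bM[OF x k]]] z j])
          also have "\<dots> = (\<Sum>p\<in>BJ. Y.crd z j (\<phi> (dual_el p) (bM x k)) * ?g p z z)"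
          proof (intro sum.cong refl)
            fix p assume p: "p \<in> BJ"
            show "Y.crd z j (mal N (?g p, 0) (\<phi> (dual_el p) (bM x k))) =
                Y.crd z j (\<phi> (dual_el p) (bM x k)) * ?g p z z"
              using Y.crd_mal[OF gp[OF p] P.bm_closed[OF BJ_W1[OF p] bM[OF x k]] z j] zP
              by (simp add: rc_def Pm_iff)
          qed
          \<comment> \<open>The entry at \<open>z\<close> of \<open>?g p\<close> is nonzero only if
            \<open>p\<close> lies in row \<open>z\<close>, and \<open>?g\<close> sees only column
            \<open>x\<close>; this leaves the basis of \<open>e\<^sub>z J e\<^sub>x\<close>.\<close>
          also have "\<dots> = (\<Sum>p\<in>Bs z x. Y.crd z j (\<phi> (dual_el p) (bM x k)) * ?g p z z)"
          proof (rule sum.mono_neutral_right)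
            show "Bs z x \<subseteq> BJ" by (rule Bs_BJ[OF zP])
            show "\<forall>p\<in>BJ - Bs z x. Y.crd z j (\<phi> (dual_el p) (bM x k)) * ?g p z z = 0"
            proof
              fix p assume p: "p \<in> BJ - Bs z x"
              obtain y x' where yx: "p \<in> Bs y x'" using B_Bs p by blast
              have y: "y \<in> uPm D" "x' \<in> uPm D" "y < x'" using BsD[OF yx] by auto
              have e: "?g p = munit y y (pr ?g y x' (p y x'))"
                using dual_munit[OF ggJ y Bs_munit(2)[OF yx]] Bs_munit(1)[OF yx] by metis
              have "?g p z z = 0"
              proof (cases "y = z")
                case True
                then have "x' \<noteq> x" using p yx by auto
                then have "pr ?g y x' (p y x') = 0"
                  using pr_dual_l[OF cS y Bs_munit(2)[OF yx], of \<delta>] gJ by (simp add: munit_apply pr_0)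
                then show ?thesis by (subst e) simp
              qed (subst e, simp add: munit_apply)
              then show "Y.crd z j (\<phi> (dual_el p) (bM x k)) * ?g p z z = 0" by simp
            qed
          qed (simp add: finite_B)
          also have "\<dots> = pr \<delta> z x (F (z, j) (x, k) * ?c)"
          proof (cases "z < x")
            case zx: True
            have t: "Y.crd z j (\<phi> (dual_el p) (bM x k)) \<in> RR D z z" "p z x * ?c \<in> RR D z x"
              if p: "p \<in> Bs z x" for p
            proof -
              have "p \<in> BJ" using Bs_BJ[OF zP] p by blast
              then show "Y.crd z j (\<phi> (dual_el p) (bM x k)) \<in> RR D z z"
                by (intro Y.crd z j P.bm_closed BJ_W1 bM x k)
              show "p z x * ?c \<in> RR D z x"
                by (rule RR_mult[OF z x x _ order_refl Bs_munit(2)[OF p] c]) (use zx in simp)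
            qed
            have "Y.crd z j (\<phi> (dual_el p) (bM x k)) * ?g p z z =
                pr \<delta> z x (Y.crd z j (\<phi> (dual_el p) (bM x k)) * (p z x * ?c))" if p: "p \<in> Bs z x" for p
            proof -
              have "?g p z z = pr ?g z x (p z x)" using Bs_munit(1)[OF p] by (metis pr_def)
              also have "\<dots> = pr \<delta> z x (p z x * ?c)"
                using pr_dual_l[OF cS z x zx Bs_munit(2)[OF p], of \<delta>] by (simp add: munit_apply)
              finally show ?thesis using pr_lin[OF gJ z x zx t(2)[OF p] t(1)[OF p]] by simp
            qed
            then have "(\<Sum>p\<in>Bs z x. Y.crd z j (\<phi> (dual_el p) (bM x k)) * ?g p z z) =
                (\<Sum>p\<in>Bs z x. pr \<delta> z x (Y.crd z j (\<phi> (dual_el p) (bM x k)) * (p z x * ?c)))"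
              by (intro sum.cong refl)
            also have "\<dots> = pr \<delta> z x (\<Sum>p\<in>Bs z x. Y.crd z j (\<phi> (dual_el p) (bM x k)) * (p z x * ?c))"
              by (rule pr_Sum[symmetric, OF gJ z x RR_mult[OF z z x order_refl _ t]]) auto
            also have "(\<Sum>p\<in>Bs z x. Y.crd z j (\<phi> (dual_el p) (bM x k)) * (p z x * ?c)) = F (z, j) (x, k) * ?c"
              using x k z j' zx False zP
              by (auto simp: F_def idx_def iso_le_def sum_distrib_right mult.assoc Pm_iff less_imp_le)
            finally show ?thesis .
          next
            case zx: False
            then have "Bs z x = {}" using BsD by blast
            then show ?thesis using zx by (simp add: pr_out[OF gJ])
          qed
          finally show ?thesis using False by simp
        qed
      qed
      have "Y.crd z j (\<phi> \<delta> m) = (\<Sum>x\<in>uPm D. \<Sum>k=1..n x. Y.crd z j (\<phi> \<delta> (X.ac x (X.crd x k m) (bM x k))))"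
        using arg_cong[OF expand[of "\<phi> \<delta>", OF P.bm_diff[OF g] m], of "Y.crd z j"]
          crd_expand[of "\<lambda>x k. \<phi> \<delta> (X.ac x (X.crd x k m) (bM x k))", OF P.bm_closed[OF g acM[OF m]] z j]
        by (rule trans)
      also have "\<dots> = (\<Sum>x\<in>uPm D. \<Sum>k=1..n x. if x = Bot then 0 else pr \<delta> z x (F (z, j) (x, k) * X.crd x k m))"
        by (intro sum.cong refl tm)
      also have "\<dots> = (\<Sum>x\<in>Pm D. \<Sum>k=1..n x. pr \<delta> z x (F (z, j) (x, k) * X.crd x k m))"
        by (rule sum.mono_neutral_cong_right) (auto simp: Pm_iff)
      finally show ?thesis by (simp add: W1_map_crd[OF F g m z j'])
    qed
  qed
  have "W0_compat F"
    unfolding W0_compat_def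
  proof (intro ballI)
    fix \<gamma> m assume g: "\<gamma> \<in> W0" and m: "m \<in> mcar M"
    have "d (in_W0 D \<gamma>) \<in> Tdeg D 1" using d_deg[OF in_W0_Tdeg[OF g]] by simp
    then have "Y.W0_act \<gamma> (h0 m) = h0 (X.W0_act \<gamma> m) + P.f1 (d (in_W0 D \<gamma>)) m"
      using h1_d[OF in_W0_Tdeg[OF g] m] h1_tmap[OF _ m] by (simp add: X.W0_act_def Y.W0_act_def)
    moreover have "(\<Sum>p\<in>BJ. mact N (\<phi> (dual_el p) m) (in_W0 D (dual_l D p \<gamma>))) =
        (\<Sum>p\<in>BJ. Y.W0_act (dual_l D p \<gamma>) (W1_map F (dual_el p) m))"
      by (intro sum.cong refl) (simp add: phF[OF BJ_W1 m] Y.W0_act_def)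
    ultimately show "Y.W0_act \<gamma> (f0 F m) + (\<Sum>p\<in>BJ. Y.W0_act (dual_l D p \<gamma>) (W1_map F (dual_el p) m)) = f0 F (X.W0_act \<gamma> m)"
      using f0F[OF m] f0F[OF X.W0_act_closed[OF g m]] by (simp add: P.f1_d_W0[OF g m])
  qed
  then have "intertwines F" by (rule W0_intertwines[OF F])
  then show ?thesis using F f0F fh by auto
qed


section \<open>Inverse matrices give inverse morphisms\<close>

lemma reversed: "De_two D B d N M bN bM v"
  by unfold_locales (use dims v_inj in auto)

lemma tri_dims: "tri (dimvec D N) = tri n"
  unfolding tri_def idx_dims ..

lemma mmul_diag:
  assumes G: "G \<in> tri n" and F: "F \<in> tri n" and z: "z \<in> uPm D"
  shows "mmul (idx n) G F (z, l) (z, k) = (\<Sum>j=1..n z. G (z, l) (z, j) * F (z, j) (z, k))"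
proof -
  have "(\<Sum>j=1..n y. G (z, l) (y, j) * F (y, j) (z, k)) = 0" if "y \<noteq> z" for y
  proof (rule sum.neutral, rule ballI)
    fix j
    have "\<not> iso_le z y \<or> \<not> iso_le y z" using that iso_le_antisym by blast
    then show "G (z, l) (y, j) * F (y, j) (z, k) = 0"
      using tri_zero[OF G, of "(z, l)" "(y, j)"] tri_zero[OF F, of "(y, j)" "(z, k)"] by auto
  qed
  then have "(\<Sum>y\<in>uPm D. \<Sum>j=1..n y. G (z, l) (y, j) * F (y, j) (z, k)) =
      (\<Sum>y\<in>uPm D. if y = z then \<Sum>j=1..n z. G (z, l) (z, j) * F (z, j) (z, k) else 0)"
    by (intro sum.cong refl) auto
  then show ?thesis using z by (simp add: mmul_idx)
qed

lemma mmul_less: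
  assumes G: "G \<in> tri n" and F: "F \<in> tri n" and z: "z \<in> uPm D" "x \<in> uPm D" "z < x"
  shows "mmul (idx n) G F (z, l) (x, k) = (\<Sum>j=1..n x. G (z, l) (x, j) * F (x, j) (x, k)) +
    (\<Sum>j=1..n z. G (z, l) (z, j) * F (z, j) (x, k)) +
    (\<Sum>y\<in>Pm D. \<Sum>j=1..n y. if z < y \<and> y < x then G (z, l) (y, j) * F (y, j) (x, k) else 0)"
proof -
  let ?T = "\<lambda>y. \<Sum>j=1..n y. G (z, l) (y, j) * F (y, j) (x, k)"
  have "?T y = 0" if "\<not> (z \<le> y \<and> y \<le> x)" for y
  proof (rule sum.neutral, rule ballI)
    fix j
    have "\<not> iso_le z y \<or> \<not> iso_le y x" using that by (auto simp: iso_le_def)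
    then show "G (z, l) (y, j) * F (y, j) (x, k) = 0"
      using tri_zero[OF G, of "(z, l)" "(y, j)"] tri_zero[OF F, of "(y, j)" "(x, k)"] by auto
  qed
  then have "mmul (idx n) G F (z, l) (x, k) = ?T x + ?T z + (\<Sum>y\<in>Pm D. if z < y \<and> y < x then ?T y else 0)"
    unfolding mmul_idx by (intro sum_between z) auto
  moreover have "(\<Sum>y\<in>Pm D. if z < y \<and> y < x then ?T y else 0) =
      (\<Sum>y\<in>Pm D. \<Sum>j=1..n y. if z < y \<and> y < x then G (z, l) (y, j) * F (y, j) (x, k) else 0)"
    by (intro sum.cong refl) auto
  ultimately show ?thesis by simp
qed

lemma tri_id_apply: "z \<in> uPm D \<Longrightarrow> l \<in> {1..n z} \<Longrightarrow> tri_id n (z, l) (x, k) = (if z = x \<and> l = k then eps D z else 0)"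
  by (simp add: mone_def idx_def)

lemma inverse_f0:
  assumes F: "F \<in> tri n" and G: "G \<in> tri n" and GF: "mmul (idx n) G F = tri_id n" and m: "m \<in> mcar M"
  shows "De_two.f0 D N M bN bM G (f0 F m) = m"
proof -
  interpret R: De_two D B d N M bN bM v by (rule reversed)
  have G': "G \<in> tri R.n" using G by (simp add: tri_dims)
  show ?thesis
  proof (rule X.crd_ext[OF R.f0_closed[OF G' f0_closed[OF F m]] m])
    fix z l assume z: "z \<in> uPm D" and l: "l \<in> {1..n z}"
    have "X.crd z l (R.f0 G (f0 F m)) = (\<Sum>j=1..n z. G (z, l) (z, j) * (\<Sum>k=1..n z. F (z, j) (z, k) * X.crd z k m))"
      unfolding R.f0_crd[OF G' f0_closed[OF F m] z l[folded dims[OF z]]]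
      by (intro sum.cong) (simp_all add: dims z f0_crd[OF F m z])
    also have "\<dots> = (\<Sum>k=1..n z. \<Sum>j=1..n z. G (z, l) (z, j) * F (z, j) (z, k) * X.crd z k m)"
      unfolding sum_distrib_left mult.assoc[symmetric] by (rule sum.swap)
    also have "\<dots> = (\<Sum>k=1..n z. if k = l then X.crd z l m else 0)"
    proof (intro sum.cong refl)
      fix k assume k: "k \<in> {1..n z}"
      have "(\<Sum>j=1..n z. G (z, l) (z, j) * F (z, j) (z, k)) = (if l = k then eps D z else 0)"
        using mmul_diag[OF G F z, of l k] GF tri_id_apply[OF z l] by simp
      then show "(\<Sum>j=1..n z. G (z, l) (z, j) * F (z, j) (z, k) * X.crd z k m) = (if k = l then X.crd z l m else 0)"
        using eps_l[OF X.crd(1)[OF z m l] z z order_refl] by (auto simp flip: sum_distrib_right)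
    qed
    also have "\<dots> = X.crd z l m" using l by simp
    finally show "X.crd z l (R.f0 G (f0 F m)) = X.crd z l m" .
  qed
qed

text \<open>For \<open>z < x\<close> the three terms are the parts of the entry of
  \<open>G F\<close> at \<open>(z, x)\<close> with middle index \<open>x\<close>, index
  \<open>z\<close>, and indices strictly between. This entry is zero as \<open>G F\<close> is the
  identity.\<close>

lemma inverse_W1:
  assumes F: "F \<in> tri n" and G: "G \<in> tri n" and GF: "mmul (idx n) G F = tri_id n"
    and g: "\<delta> \<in> W1" and m: "m \<in> mcar M"
  shows "De_two.W1_map D N M bN bM G \<delta> (f0 F m) + De_two.f0 D N M bN bM G (W1_map F \<delta> m) +
    (\<Sum>p\<in>BJ. De_two.W1_map D N M bN bM G (dual_l D p \<delta>) (W1_map F (dual_el p) m)) = 0"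
proof -
  interpret R: De_two D B d N M bN bM v by (rule reversed)
  have G': "G \<in> tri R.n" using G by (simp add: tri_dims)
  have gJ: "\<delta> \<in> dualJ D" using g by (simp add: W1_iff)
  have pW: "dual_l D p \<delta> \<in> W1" if "p \<in> BJ" for p
    using peirceD_dual_l[OF diag_idem_ehat g] BJ_JJ[OF that] by blast
  have phM: "W1_map F (dual_el p) m \<in> mcar N" if "p \<in> BJ" for p by (rule W1_map_closed[OF F BJ_W1[OF that] m])
  have q1: "R.W1_map G \<delta> (f0 F m) \<in> mcar M" by (rule R.W1_map_closed[OF G' g f0_closed[OF F m]])
  have q2: "R.f0 G (W1_map F \<delta> m) \<in> mcar M" by (rule R.f0_closed[OF G' W1_map_closed[OF F g m]])
  have q3: "R.W1_map G (dual_l D p \<delta>) (W1_map F (dual_el p) m) \<in> mcar M" if "p \<in> BJ" for p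
    by (rule R.W1_map_closed[OF G' pW[OF that] phM[OF that]])
  have q3'': "(\<Sum>p\<in>BJ. R.W1_map G (dual_l D p \<delta>) (W1_map F (dual_el p) m)) \<in> mcar M" by (rule mod_sum[OF X.M q3])
  show ?thesis
  proof (rule X.crd_ext[OF X.R.C_add[OF X.R.C_add[OF q1 q2] q3''] X.R.C_0])
    fix z l assume z: "z \<in> uPm D" and l: "l \<in> {1..n z}"
    have lN: "l \<in> {1..R.n z}" using l by (simp add: dims z)
    have sum: "X.crd z l (R.W1_map G \<delta> (f0 F m) + R.f0 G (W1_map F \<delta> m) +
          (\<Sum>p\<in>BJ. R.W1_map G (dual_l D p \<delta>) (W1_map F (dual_el p) m))) =
        X.crd z l (R.W1_map G \<delta> (f0 F m)) + X.crd z l (R.f0 G (W1_map F \<delta> m)) +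
          (\<Sum>p\<in>BJ. X.crd z l (R.W1_map G (dual_l D p \<delta>) (W1_map F (dual_el p) m)))"
      using X.crd_add[OF X.R.C_add[OF q1 q2] q3'' z l] X.crd_add[OF q1 q2 z l] X.crd_sum[OF q3 z l, of BJ] by simp
    show "X.crd z l (R.W1_map G \<delta> (f0 F m) + R.f0 G (W1_map F \<delta> m) +
          (\<Sum>p\<in>BJ. R.W1_map G (dual_l D p \<delta>) (W1_map F (dual_el p) m))) = X.crd z l 0"
    proof (cases "z = Bot")
      case True
      have "X.crd Bot l (R.f0 G (W1_map F \<delta> m)) = 0"
        using R.f0_crd[OF G' W1_map_closed[OF F g m] Bot_in_uPm] lN True
        by (simp add: dims W1_map_Bot[OF F g m])
      then show ?thesis
        unfolding sum X.crd_0[OF z l]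
        using True lN R.W1_map_Bot[OF G' g f0_closed[OF F m]] R.W1_map_Bot[OF G' pW phM]
        by simp
    next
      case False
      then have zP: "z \<in> Pm D" using z by (simp add: Pm_iff)
      have GR: "G (z, l) (x, j) \<in> RR D z x" if "x \<in> Pm D" "z < x" "j \<in> {1..n x}" for x j
        by (rule F_less[OF G zP that(1,2) l that(3)])
      have Fd: "F (x, j) (x, k) \<in> RR D x x" if "x \<in> Pm D" "j \<in> {1..n x}" "k \<in> {1..n x}" for x j k
        using F_diag[OF F _ that(2,3)] that(1) by (simp add: Pm_iff)
      let ?A = "\<lambda>x k. \<Sum>j=1..n x. G (z, l) (x, j) * F (x, j) (x, k)"
      let ?B = "\<lambda>x k. \<Sum>j=1..n z. G (z, l) (z, j) * F (z, j) (x, k)"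
      let ?C = "\<lambda>x k. \<Sum>y\<in>Pm D. \<Sum>j=1..n y. if z < y \<and> y < x then G (z, l) (y, j) * F (y, j) (x, k) else 0"
      have 1: "X.crd z l (R.W1_map G \<delta> (f0 F m)) = (\<Sum>x\<in>Pm D. \<Sum>k=1..n x. pr \<delta> z x (?A x k * X.crd x k m))"
      proof -
        have "X.crd z l (R.W1_map G \<delta> (f0 F m)) =
            (\<Sum>x\<in>Pm D. \<Sum>j=1..n x. pr \<delta> z x (G (z, l) (x, j) * (\<Sum>k=1..n x. F (x, j) (x, k) * X.crd x k m)))"
          unfolding R.W1_map_crd[OF G' g f0_closed[OF F m] z lN]
          by (intro sum.cong) (auto simp: dimsP f0_crd[OF F m] Pm_iff)
        also have "\<dots> = (\<Sum>x\<in>Pm D. \<Sum>k=1..n x. pr \<delta> z x (?A x k * X.crd x k m))"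
          by (rule pr_sum_diag[OF gJ z]) (use GR Fd cX[OF m] in auto)
        finally show ?thesis .
      qed
      have 2: "X.crd z l (R.f0 G (W1_map F \<delta> m)) = (\<Sum>x\<in>Pm D. \<Sum>k=1..n x. pr \<delta> z x (?B x k * X.crd x k m))"
      proof -
        have "X.crd z l (R.f0 G (W1_map F \<delta> m)) = (\<Sum>j\<in>{1..n z}. G (z, l) (z, j) *
            (\<Sum>x\<in>Pm D. \<Sum>k=1..n x. pr \<delta> z x (F (z, j) (x, k) * X.crd x k m)))"
          unfolding R.f0_crd[OF G' W1_map_closed[OF F g m] z lN]
          by (intro sum.cong) (simp_all add: dims z W1_map_crd[OF F g m z])
        also have "\<dots> = (\<Sum>x\<in>Pm D. \<Sum>k=1..n x. pr \<delta> z x (?B x k * X.crd x k m))"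
          by (rule pr_sum_left[OF gJ z]) (use F_diag[OF G z l] F_less[OF F zP] cX[OF m] in auto)
        finally show ?thesis .
      qed
      have 3: "(\<Sum>p\<in>BJ. X.crd z l (R.W1_map G (dual_l D p \<delta>) (W1_map F (dual_el p) m))) =
          (\<Sum>x\<in>Pm D. \<Sum>k=1..n x. pr \<delta> z x (?C x k * X.crd x k m))"
      proof -
        have "(\<Sum>p\<in>BJ. X.crd z l (R.W1_map G (dual_l D p \<delta>) (W1_map F (dual_el p) m))) =
            (\<Sum>p\<in>BJ. \<Sum>y\<in>Pm D. \<Sum>j=1..n y. pr (dual_l D p \<delta>) z y (G (z, l) (y, j) * Y.crd y j (W1_map F (dual_el p) m)))"
        proof (intro sum.cong refl)
          fix p assume p: "p \<in> BJ"
          show "X.crd z l (R.W1_map G (dual_l D p \<delta>) (W1_map F (dual_el p) m)) =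
              (\<Sum>y\<in>Pm D. \<Sum>j=1..n y. pr (dual_l D p \<delta>) z y (G (z, l) (y, j) * Y.crd y j (W1_map F (dual_el p) m)))"
            unfolding R.W1_map_crd[OF G' pW[OF p] phM[OF p] z lN] by (intro sum.cong) (simp_all add: dimsP)
        qed
        also have "\<dots> = (\<Sum>x\<in>Pm D. \<Sum>k=1..n x. pr \<delta> z x (?C x k * X.crd x k m))"
        proof (rule pr_sum_strict[OF gJ z, where n = "\<lambda>p y j. Y.crd y j (W1_map F (dual_el p) m)"])
          fix p y j assume "p \<in> BJ" "y \<in> Pm D" "j \<in> {1..n y}"
          then show "Y.crd y j (W1_map F (dual_el p) m) =
              (\<Sum>x\<in>Pm D. \<Sum>k=1..n x. pr (dual_el p) y x (F (y, j) (x, k) * X.crd x k m))"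
            by (intro W1_map_crd F BJ_W1 m) (simp_all add: Pm_iff)
        qed (use GR F_less[OF F] cX[OF m] in auto)
        finally show ?thesis .
      qed
      have "pr \<delta> z x (?A x k * X.crd x k m) + pr \<delta> z x (?B x k * X.crd x k m) + pr \<delta> z x (?C x k * X.crd x k m) = 0"
        if x: "x \<in> Pm D" and k: "k \<in> {1..n x}" for x k
      proof (cases "z < x")
        case True
        have xu: "x \<in> uPm D" "z \<le> x" using x True by (simp_all add: Pm_iff)
        note Rc = RR_mult[OF z xu(1) xu(1) xu(2) order_refl _ cX[OF m x k]]
        have A: "?A x k \<in> RR D z x"
          by (intro RR_sum RR_mult[OF z xu(1) xu(1) xu(2) order_refl] GR Fd x True k z xu)
        have B: "?B x k \<in> RR D z x"
          by (intro RR_sum RR_mult[OF z z xu(1) order_refl xu(2)] F_diag[OF G z l] F_less[OF F zP x True] k z xu)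
        have C0: "(if z < y \<and> y < x then G (z, l) (y, j) * F (y, j) (x, k) else 0) \<in> RR D z x"
          if y: "y \<in> Pm D" and j: "j \<in> {1..n y}" for y j
          using RR_mult[of z y x, OF z _ xu(1) _ _ GR[OF y _ j] F_less[OF F y x _ j k]] y xu z
          by (auto simp: RR_0 Pm_iff)
        have C: "?C x k \<in> RR D z x" by (intro RR_sum C0 z xu)
        have "?A x k + ?B x k + ?C x k = 0"
          using mmul_less[OF G F z xu(1) True, of l k] tri_id_apply[OF z l, of x k] less_imp_neq[OF True]
          unfolding GF by argo
        then have "pr \<delta> z x ((?A x k + ?B x k + ?C x k) * X.crd x k m) = 0" by (simp add: pr_0 gJ)
        then show ?thesis
          unfolding distrib_right
          using pr_add[OF gJ z xu(1) True RR_add[OF z xu(1) xu(2) Rc[OF A] Rc[OF B]] Rc[OF C]]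
            pr_add[OF gJ z xu(1) True Rc[OF A] Rc[OF B]] by simp
      qed (simp add: pr_out[OF gJ])
      then have "(\<Sum>x\<in>Pm D. \<Sum>k=1..n x. pr \<delta> z x (?A x k * X.crd x k m) + pr \<delta> z x (?B x k * X.crd x k m)
          + pr \<delta> z x (?C x k * X.crd x k m)) = 0"
        by (intro sum.neutral ballI)
      then show ?thesis unfolding sum 1 2 3 X.crd_0[OF z l] by (simp only: sum.distrib)
    qed
  qed
qed

lemma comp_id:
  assumes F: "F \<in> tri n" and G: "G \<in> tri n" and GF: "mmul (idx n) G F = tri_id n"
    and intertwines: "intertwines F" and intertwines': "De_two.intertwines D B N M bN bM v G"
  shows "De_mor_eq D M (De_comp D d (De_two.f0 D N M bN bM G, tmap N M (De_two.W1_map D N M bN bM G))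
    (f0 F, tmap M N (W1_map F))) De_id"
proof -
  interpret R: De_two D B d N M bN bM v by (rule reversed)
  have G': "G \<in> tri R.n" using G by (simp add: tri_dims)
  interpret P: De_pair D B d M N "W1_map F" by (rule pair[OF F])
  interpret Q: De_pair D B d N M "R.W1_map G" by (rule R.pair[OF G'])
  interpret C: De_pair2 D B d M N M "W1_map F" "R.W1_map G" ..
  have "snd (De_comp D d (R.f0 G, tmap N M (R.W1_map G)) (f0 F, tmap M N (W1_map F))) w m = 0"
    if w: "w \<in> Tdeg D 1" and m: "m \<in> mcar M" for w m
  proof (rule C.comp_is_id[OF _ _ _ _ dcond_F[OF F intertwines] R.dcond_F[OF G' intertwines'] _ w m])
    fix \<delta> m assume "\<delta> \<in> W1" "m \<in> mcar M"
    then show "R.W1_map G \<delta> (f0 F m) + R.f0 G (W1_map F \<delta> m) + (\<Sum>p\<in>BJ. R.W1_map G (dual_l D p \<delta>) (W1_map F (dual_el p) m)) = 0"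
      by (rule inverse_W1[OF F G GF])
  qed (use F G' in \<open>simp_all add: f0_closed f0_diff R.f0_closed R.f0_diff\<close>)
  then show ?thesis
    unfolding De_mor_eq_def using inverse_f0[OF F G GF] by (simp add: De_id_def De_comp_def)
qed

lemma mone_H: "mmul (idx n) (tri_id n) X.H = X.H"
proof (intro ext)
  fix a c
  have "mmul (idx n) (tri_id n) X.H a c = (\<Sum>l\<in>idx n. if l = a then eps D (fst a) * X.H a c else 0)"
    unfolding mmul_def by (intro sum.cong refl) (auto simp: mone_def)
  also have "\<dots> = X.H a c"
  proof (cases "fst a = Bot \<and> fst c \<in> Pm D \<and> a \<in> idx n \<and> c \<in> idx n")
    case True
    then have "X.H a c \<in> RR D Bot (fst c)" using X.H_in by (cases a; cases c) (auto simp: idx_def)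
    then have "eps D Bot * X.H a c = X.H a c" using True by (intro eps_l) (auto simp: Pm_iff less_eq_xp_def)
    then show ?thesis using True by simp
  next
    case False
    then have "X.H a c = 0" by (auto simp: X.H_def)
    then show ?thesis by simp
  qed
  finally show "mmul (idx n) (tri_id n) X.H a c = X.H a c" .
qed

lemma H_mone: "mmul (idx n) X.H (tri_id n) = X.H"
proof (intro ext)
  fix a c
  have "mmul (idx n) X.H (tri_id n) a c = (\<Sum>l\<in>idx n. if l = c then X.H a c * eps D (fst c) else 0)"
    unfolding mmul_def by (intro sum.cong refl) (auto simp: mone_def)
  also have "\<dots> = X.H a c"
  proof (cases "fst a = Bot \<and> fst c \<in> Pm D \<and> a \<in> idx n \<and> c \<in> idx n")
    case True
    then have "X.H a c \<in> RR D Bot (fst c)" using X.H_in by (cases a; cases c) (auto simp: idx_def)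
    then have "X.H a c * eps D (fst c) = X.H a c" using True by (intro eps_r) (auto simp: Pm_iff less_eq_xp_def)
    then show ?thesis using True by simp
  next
    case False
    then have "X.H a c = 0" by (auto simp: X.H_def)
    then show ?thesis by simp
  qed
  finally show "mmul (idx n) X.H (tri_id n) a c = X.H a c" .
qed

lemma isomorphic_F:
  assumes F: "F \<in> tri n" and G: "G \<in> tri n" and GF: "mmul (idx n) G F = tri_id n"
    and FG: "mmul (idx n) F G = tri_id n" and intertwines: "intertwines F"
  shows "De_isomorphic D d M N"
proof -
  interpret R: De_two D B d N M bN bM v by (rule reversed)
  have G': "G \<in> tri R.n" and F': "F \<in> tri R.n" using F G by (simp_all add: tri_dims)
  let ?m = "mmul (idx n)"
  have YH: "?m Y.H (tri_id n) = Y.H" using R.H_mone by (simp add: idx_dims)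
  \<comment> \<open>\<open>G\<close> intertwines in the opposite direction: insert
    \<open>F G\<close> to the right of \<open>Y.H\<close>, replace \<open>Y.H F\<close> by
    \<open>F X.H\<close>, and cancel \<open>G F\<close>.\<close>
  have "?m G Y.H = ?m G (?m Y.H (?m F G))" by (simp only: FG YH)
  also have "\<dots> = ?m (?m G (?m Y.H F)) G" by (simp add: mmul_assoc)
  also have "\<dots> = ?m (?m G (?m F X.H)) G" using intertwines by (simp add: intertwines_def)
  also have "\<dots> = ?m (?m (tri_id n) X.H) G" by (simp only: mmul_assoc[OF finite_idx] GF)
  also have "\<dots> = ?m X.H G" by (simp only: mone_H)
  finally have intertwines': "R.intertwines G" by (simp add: R.intertwines_def idx_dims)
  have e: "tri_id R.n = tri_id n" by (simp add: idx_dims)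
  have "De_mor_eq D M (De_comp D d (R.f0 G, tmap N M (R.W1_map G)) (f0 F, tmap M N (W1_map F))) De_id"
    by (rule comp_id[OF F G GF intertwines intertwines'])
  moreover have "De_mor_eq D N (De_comp D d (f0 F, tmap M N (W1_map F)) (R.f0 G, tmap N M (R.W1_map G))) De_id"
    using R.comp_id[OF G' F' _ intertwines' intertwines] FG by (simp add: idx_dims)
  ultimately show ?thesis
    using morphism_F[OF F intertwines] R.morphism_F[OF G' intertwines'] unfolding De_isomorphic_def by blast
qed

text \<open>Evaluating on basis vectors compares diagonal blocks, which are exactly what the first
  components of morphisms record. For the inverse morphism no relation between the other blocks is
  asked.\<close>

lemma f0_matrix_inverse:
  assumes F: "F \<in> tri n" and G: "G \<in> tri n"
    and inv: "\<And>m. m \<in> mcar M \<Longrightarrow> De_two.f0 D N M bN bM G (f0 F m) = m"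
    and z: "z \<in> uPm D" and l: "l \<in> {1..n z}" and k: "k \<in> {1..n z}"
  shows "(\<Sum>j=1..n z. G (z, l) (z, j) * F (z, j) (z, k)) = (if l = k then eps D z else 0)"
proof -
  interpret R: De_two D B d N M bN bM v by (rule reversed)
  have G': "G \<in> tri R.n" using G by (simp add: tri_dims)
  let ?m = "bM z k"
  have m: "?m \<in> mcar M" by (rule X.b_comp(1)[OF z k])
  have F1: "Y.crd z j (f0 F ?m) = F (z, j) (z, k)" if j: "j \<in> {1..n z}" for j
  proof -
    have "Y.crd z j (f0 F ?m) = (\<Sum>i=1..n z. if i = k then F (z, j) (z, k) else 0)"
      unfolding f0_crd[OF F m z j]
      using eps_r[OF F_diag[OF F z j k] z z order_refl]
      by (intro sum.cong refl) (auto simp: X.crd_b[OF z z _ k])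
    then show ?thesis using k by simp
  qed
  have "X.crd z l (R.f0 G (f0 F ?m)) = (\<Sum>j=1..n z. G (z, l) (z, j) * F (z, j) (z, k))"
    unfolding R.f0_crd[OF G' f0_closed[OF F m] z l[folded dims[OF z]]]
    by (intro sum.cong) (simp_all add: dims z F1)
  then show ?thesis using inv[OF m] X.crd_b[OF z z l k] by simp
qed

text \<open>The element described by \<open>rho\<close> exists because \<open>v x\<close> generates
  \<open>RR D Bot x\<close>, and it is unique because multiplication by \<open>v x\<close> is
  injective on \<open>RR D x x\<close>. The same holds for \<open>chi\<close>.\<close>

lemma rho:
  assumes x: "x \<in> Pm D" and a: "a \<in> RR D Bot Bot"
  shows "rho D v x a \<in> RR D x x" "v x * rho D v x a = a * v x"
proof -
  have xu: "x \<in> uPm D" "Bot \<le> x" using x by (simp_all add: Pm_iff less_eq_xp_def)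
  have "a * v x \<in> RR D Bot x"
    by (rule RR_mult[OF Bot_in_uPm Bot_in_uPm xu(1) order_refl xu(2) a]) (use X.v_gen[OF x] in blast)
  then obtain r where r: "r \<in> RR D x x" "a * v x = v x * r" using X.v_gen[OF x] by blast
  have "rho D v x a = r"
    unfolding rho_def
  proof (rule the_equality)
    fix s assume s: "s \<in> RR D x x \<and> a * v x = v x * s"
    have "s - r = 0"
      by (rule v_inj[OF x RR_diff[OF xu(1) xu(1) order_refl]]) (use s r in \<open>simp_all add: right_diff_distrib\<close>)
    then show "s = r" by simp
  qed (use r in simp)
  then show "rho D v x a \<in> RR D x x" "v x * rho D v x a = a * v x" using r by simp_all
qed

lemma chi:
  assumes y: "y \<in> Pm D" and x: "x \<in> Pm D" "y < x" and a: "a \<in> RR D y x"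
  shows "chi D v y x a \<in> RR D x x" "v x * chi D v y x a = v y * a"
proof -
  have xu: "x \<in> uPm D" "y \<in> uPm D" "Bot \<le> y" using x y by (simp_all add: Pm_iff less_eq_xp_def)
  have "v y * a \<in> RR D Bot x"
    by (rule RR_mult[OF Bot_in_uPm xu(2,1,3) less_imp_le[OF x(2)] _ a]) (use X.v_gen[OF y] in blast)
  then obtain r where r: "r \<in> RR D x x" "v y * a = v x * r" using X.v_gen[OF x(1)] by blast
  have "chi D v y x a = r"
    unfolding chi_def
  proof (rule the_equality)
    fix s assume s: "s \<in> RR D x x \<and> v y * a = v x * s"
    have "s - r = 0"
      by (rule v_inj[OF x(1) RR_diff[OF xu(1) xu(1) order_refl]]) (use s r in \<open>simp_all add: right_diff_distrib\<close>)
    then show "s = r" by simp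
  qed (use r in simp)
  then show "chi D v y x a \<in> RR D x x" "v x * chi D v y x a = v y * a" using r by simp_all
qed

text \<open>The matrix equation of the theorem at the entry \<open>(j, i)\<close> of the stripe at \<open>x\<close>, multiplied by
  \<open>v\<^sub>x\<close>; this removes \<open>\<rho>\<^sub>x\<close> and \<open>\<chi>\<^sub>y\<^sub>,\<^sub>x\<close>.\<close>

lemma stripe_equation:
  assumes F: "F \<in> tri n" and x: "x \<in> Pm D" and j: "j \<in> {1..n Bot}" and i: "i \<in> {1..n x}"
    and S: "\<And>l k. l \<in> {1..n Bot} \<Longrightarrow> k \<in> {1..n Bot} \<Longrightarrow> S l k \<in> RR D Bot Bot"
    and Tx: "\<And>l k. l \<in> {1..n x} \<Longrightarrow> k \<in> {1..n x} \<Longrightarrow> Tx l k = F (x, l) (x, k)"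
    and Ty: "\<And>y l k. y \<in> Pm D \<Longrightarrow> y < x \<Longrightarrow> l \<in> {1..n y} \<Longrightarrow> k \<in> {1..n x} \<Longrightarrow> Ty y l k = F (y, l) (x, k)"
  shows "stripe D B v M bM x j i =
      mat_mult (n Bot) (mat_map (rho D v x) S) (mat_mult (n x) (stripe D B v N bN x) Tx) j i
      + (\<Sum>y\<in>{y\<in>Pm D. y < x}. mat_mult (n Bot) (mat_map (rho D v x) S)
          (mat_map (chi D v y x) (mat_mult (n y) (stripe D B v N bN y) (Ty y))) j i)
    \<longleftrightarrow> X.H (Bot, j) (x, i) = (\<Sum>k=1..n Bot. S j k * mmul (idx n) Y.H F (Bot, k) (x, i))"
    (is "?L = ?R \<longleftrightarrow> ?E")
proof -
  let ?st = "stripe D B v N bN"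
  have xu: "x \<in> uPm D" using x by (simp add: Pm_iff)
  have st: "?st y k l \<in> RR D y y" if "y \<in> Pm D" "k \<in> {1..n Bot}" "l \<in> {1..n y}" for y k l
    using Y.stripe_spec(1)[OF that(1)] that by (simp add: dims dimsP)
  have HY: "Y.H (Bot, k) (y, l) = v y * ?st y k l" if "y \<in> Pm D" "k \<in> {1..n Bot}" "l \<in> {1..n y}" for y k l
    using that by (simp add: Y.H_def idx_dims) (simp add: idx_def Pm_iff)
  have M1: "mat_mult (n x) (?st x) Tx k i \<in> RR D x x" if k: "k \<in> {1..n Bot}" for k
    unfolding mat_mult_def
    by (intro RR_sum xu order_refl RR_mult[OF xu xu xu order_refl order_refl] st x k)
      (use F_diag[OF F xu _ i] Tx[OF _ i] in auto)
  have M2: "mat_mult (n y) (?st y) (Ty y) k i \<in> RR D y x" if y: "y \<in> Pm D" "y < x" and k: "k \<in> {1..n Bot}" for y k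
  proof -
    have yu: "y \<in> uPm D" "y \<le> x" using y by (simp_all add: Pm_iff)
    show ?thesis unfolding mat_mult_def
      by (intro RR_sum xu yu RR_mult[OF yu(1) yu(1) xu order_refl yu(2)] st y k)
        (use F_less[OF F y(1) x y(2) _ i] Ty[OF y _ i] in auto)
  qed
  have rS: "rho D v x (S j k) \<in> RR D x x" "v x * rho D v x (S j k) = S j k * v x" if "k \<in> {1..n Bot}" for k
    using rho[OF x S[OF j that]] by simp_all
  have cR: "chi D v y x (mat_mult (n y) (?st y) (Ty y) k i) \<in> RR D x x"
    "v x * chi D v y x (mat_mult (n y) (?st y) (Ty y) k i) = v y * mat_mult (n y) (?st y) (Ty y) k i"
    if "y \<in> Pm D" "y < x" "k \<in> {1..n Bot}" for y k
    using chi[OF that(1) x that(2) M2[OF that]] by simp_all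
  let ?R1 = "mat_mult (n Bot) (mat_map (rho D v x) S) (mat_mult (n x) (?st x) Tx) j i"
  let ?R2 = "\<lambda>y. mat_mult (n Bot) (mat_map (rho D v x) S)
          (mat_map (chi D v y x) (mat_mult (n y) (?st y) (Ty y))) j i"
  have R1: "?R1 \<in> RR D x x"
    unfolding mat_mult_def[of "n Bot"] mat_map_def
    by (intro RR_sum xu order_refl RR_mult[OF xu xu xu order_refl order_refl] rS M1)
  have R2: "?R2 y \<in> RR D x x" if "y \<in> {y\<in>Pm D. y < x}" for y
    unfolding mat_mult_def[of "n Bot"] mat_map_def
    by (intro RR_sum xu order_refl RR_mult[OF xu xu xu order_refl order_refl] rS cR) (use that in auto)
  have RR: "?R \<in> RR D x x" by (intro RR_add RR_sum xu order_refl R1 R2)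
  have LR: "?L \<in> RR D x x" by (rule X.stripe_spec(1)[OF x i j])
  have v1: "v x * ?R1 = (\<Sum>k=1..n Bot. S j k * (\<Sum>l=1..n x. Y.H (Bot, k) (x, l) * F (x, l) (x, i)))"
  proof -
    have "v x * ?R1 = (\<Sum>k=1..n Bot. v x * rho D v x (S j k) * mat_mult (n x) (?st x) Tx k i)"
      unfolding mat_mult_def[of "n Bot"] mat_map_def sum_distrib_left mult.assoc ..
    also have "\<dots> = (\<Sum>k=1..n Bot. S j k * (\<Sum>l=1..n x. Y.H (Bot, k) (x, l) * F (x, l) (x, i)))"
    proof (intro sum.cong refl)
      fix k assume k: "k \<in> {1..n Bot}"
      have "v x * mat_mult (n x) (?st x) Tx k i = (\<Sum>l=1..n x. Y.H (Bot, k) (x, l) * F (x, l) (x, i))"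
        unfolding mat_mult_def sum_distrib_left
        by (intro sum.cong refl) (simp add: HY[OF x k] Tx[OF _ i] mult.assoc del: atLeastAtMost_iff)
      then show "v x * rho D v x (S j k) * mat_mult (n x) (?st x) Tx k i =
          S j k * (\<Sum>l=1..n x. Y.H (Bot, k) (x, l) * F (x, l) (x, i))"
        by (simp add: rS(2)[OF k] mult.assoc)
    qed
    finally show ?thesis .
  qed
  have v2: "v x * ?R2 y = (\<Sum>k=1..n Bot. S j k * (\<Sum>l=1..n y. Y.H (Bot, k) (y, l) * F (y, l) (x, i)))"
    if y: "y \<in> Pm D" "y < x" for y
  proof -
    have "v x * ?R2 y = (\<Sum>k=1..n Bot. v x * rho D v x (S j k) * chi D v y x (mat_mult (n y) (?st y) (Ty y) k i))"
      unfolding mat_mult_def[of "n Bot"] mat_map_def sum_distrib_left mult.assoc ..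
    also have "\<dots> = (\<Sum>k=1..n Bot. S j k * (\<Sum>l=1..n y. Y.H (Bot, k) (y, l) * F (y, l) (x, i)))"
    proof (intro sum.cong refl)
      fix k assume k: "k \<in> {1..n Bot}"
      have "v y * mat_mult (n y) (?st y) (Ty y) k i = (\<Sum>l=1..n y. Y.H (Bot, k) (y, l) * F (y, l) (x, i))"
        unfolding mat_mult_def sum_distrib_left
        by (intro sum.cong refl) (simp add: HY[OF y(1) k] Ty[OF y _ i] mult.assoc del: atLeastAtMost_iff)
      then show "v x * rho D v x (S j k) * chi D v y x (mat_mult (n y) (?st y) (Ty y) k i) =
          S j k * (\<Sum>l=1..n y. Y.H (Bot, k) (y, l) * F (y, l) (x, i))"
        by (simp add: rS(2)[OF k] mult.assoc cR(2)[OF y k])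
    qed
    finally show ?thesis .
  qed
  have "v x * ?R = (\<Sum>k=1..n Bot. S j k * mmul (idx n) Y.H F (Bot, k) (x, i))"
  proof -
    have "(\<Sum>k=1..n Bot. S j k * mmul (idx n) Y.H F (Bot, k) (x, i)) =
        (\<Sum>k=1..n Bot. S j k * (\<Sum>l=1..n x. Y.H (Bot, k) (x, l) * F (x, l) (x, i))) +
        (\<Sum>k=1..n Bot. \<Sum>y\<in>Pm D. S j k * (\<Sum>l=1..n y. if Bot < y \<and> y < x then Y.H (Bot, k) (y, l) * F (y, l) (x, i) else 0))"
      unfolding mmul_H_F[OF F x] distrib_left sum.distrib by (simp add: sum_distrib_left)
    also have "(\<Sum>k=1..n Bot. \<Sum>y\<in>Pm D. S j k * (\<Sum>l=1..n y. if Bot < y \<and> y < x then Y.H (Bot, k) (y, l) * F (y, l) (x, i) else 0)) =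
        (\<Sum>y\<in>Pm D. \<Sum>k=1..n Bot. S j k * (\<Sum>l=1..n y. if Bot < y \<and> y < x then Y.H (Bot, k) (y, l) * F (y, l) (x, i) else 0))"
      by (rule sum.swap)
    also have "\<dots> = (\<Sum>y\<in>{y\<in>Pm D. y < x}. \<Sum>k=1..n Bot. S j k * (\<Sum>l=1..n y. Y.H (Bot, k) (y, l) * F (y, l) (x, i)))"
    proof (rule sum.mono_neutral_cong_right)
      show "\<forall>y\<in>Pm D - {y\<in>Pm D. y < x}. (\<Sum>k=1..n Bot. S j k *
          (\<Sum>l=1..n y. if Bot < y \<and> y < x then Y.H (Bot, k) (y, l) * F (y, l) (x, i) else 0)) = 0"
        by (intro ballI sum.neutral) (auto intro!: sum.neutral)
    qed (auto simp: Pm_iff Bot_less)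
    also have "\<dots> = (\<Sum>y\<in>{y\<in>Pm D. y < x}. v x * ?R2 y)"
      by (intro sum.cong refl) (simp only: mem_Collect_eq v2)
    finally show ?thesis by (simp only: distrib_left v1 sum_distrib_left)
  qed
  moreover have "X.H (Bot, j) (x, i) = v x * ?L" using x i j by (simp add: X.H_def idx_def Pm_iff)
  moreover have "?L = ?R \<longleftrightarrow> v x * ?L = v x * ?R"
  proof
    assume "v x * ?L = v x * ?R"
    then have "?L - ?R = 0"
      by (intro v_inj[OF x RR_diff[OF xu xu order_refl LR RR]]) (simp add: right_diff_distrib)
    then show "?L = ?R" by simp
  qed simp
  ultimately show ?thesis by simp
qed

end

section \<open>Extendable posets over fields\<close>

text \<open>Admissibility speaks of the points of \<open>Pm D\<close> only. The spaces starting at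
  \<open>0\<close> are \<open>eps D Bot * A * eps D y\<close>, and their closure properties follow
  from the idempotents; \<open>eps D Bot\<close> is the idempotent at \<open>Top\<close>. The
  idempotents are nonzero as units of fields.\<close>

lemma extendable_ext_poset:
  assumes ext: "extendable D" and fields: "\<forall>x\<in>uPm D. field (sub_ring (RR D x x) (eps D x))"
  shows "ext_poset D"
proof -
  have sc: "vector_space (scal D)" and fin: "finite (pts D)"
    and sc_mult: "scal D c (a * b) = scal D c a * b" "scal D c (a * b) = a * scal D c b"
    and idem: "x \<in> Pm D \<Longrightarrow> eps D x * eps D x = eps D x"
    and adm: "admissible (scal D) (Pm D) Top (RR D) (eps D)" for c a b x
    using ext unfolding extendable_def fd_algebra_def by blast+
  interpret vector_space "scal D" by (rule sc)
  have ms: "mult_system (scal D) (Pm D) (RR D) (eps D)" using adm by (simp add: admissible_def)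
  have sub: "subspace (RR D x y)" if "x \<in> Pm D" "y \<in> Pm D" "x \<le> y" for x y
    using ms that by (simp add: mult_system_def)
  have up: "y \<in> Pm D" if "x \<in> Pm D" "y \<in> uPm D" "x \<le> y" for x y
    using that by (auto simp: Pm_iff less_eq_xp_def)
  have idem: "eps D x * eps D x = eps D x" if "x \<in> uPm D" for x
    using idem[of x] idem[of Top] that by (auto simp: uPm_def Pm_def eps_def)
  have idem': "eps D x * (eps D x * a) = eps D x * a" if "x \<in> uPm D" for x a
    using idem[OF that] by (simp flip: mult.assoc)
  have RB: "RR D Bot y = {eps D Bot * t * eps D y | t. True}" for y
    by (simp add: RR_def ext_sys_def)
  have RB_I: "r \<in> RR D Bot y" if "r = eps D Bot * t * eps D y" for r t y
    using that unfolding RB by blast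
  note assoc = mult.assoc
  show ?thesis
  proof
    show "finite (pts D)" by (rule fin)
  next
    fix x y :: "'c xp" assume x: "x \<in> uPm D" "y \<in> uPm D" "x \<le> y"
    show "0 \<in> RR D x y"
    proof (cases "x = Bot")
      case True
      then show ?thesis using RB_I[of 0 0] by simp
    next
      case False
      then show ?thesis using subspace_0[OF sub] up x by (simp add: Pm_iff)
    qed
  next
    fix x y r s assume x: "x \<in> uPm D" "y \<in> uPm D" "x \<le> y" and rs: "r \<in> RR D x y" "s \<in> RR D x y"
    show "r - s \<in> RR D x y"
    proof (cases "x = Bot")
      case True
      then obtain t u where "r = eps D Bot * t * eps D y" "s = eps D Bot * u * eps D y"
        using rs unfolding True RB by blast
      then show ?thesis using RB_I[of "r - s" "t - u"] True by (simp add: algebra_simps)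
    next
      case False
      then show ?thesis using subspace_diff[OF sub] up x rs by (simp add: Pm_iff)
    qed
  next
    fix x y z r s assume x: "x \<in> uPm D" "y \<in> uPm D" "z \<in> uPm D" "x \<le> y" "y \<le> z"
      and rs: "r \<in> RR D x y" "s \<in> RR D y z"
    show "r * s \<in> RR D x z"
    proof (cases "x = Bot")
      case True
      obtain t u where "r = eps D Bot * t * eps D y" "s = eps D y * u * eps D z"
        using rs unfolding RR_def True by blast
      then show ?thesis using RB_I[of "r * s" "t * (eps D y * (eps D y * u))"] True by (simp add: assoc)
    next
      case False
      then have "x \<in> Pm D" using x by (simp add: Pm_iff)
      moreover from this have "y \<in> Pm D" using up x by blast
      moreover from this have "z \<in> Pm D" using up x by blast
      ultimately show ?thesis using ms x rs unfolding mult_system_def by blast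
    qed
  next
    fix x assume x: "x \<in> uPm D"
    show "eps D x \<in> RR D x x"
    proof (cases "x = Bot")
      case True
      then show ?thesis using RB_I[of "eps D Bot" 1 Bot] idem[OF x] by simp
    next
      case False
      then show ?thesis using ms x by (simp add: Pm_iff mult_system_def)
    qed
    show "eps D x \<noteq> 0"
    proof -
      interpret F: field "sub_ring (RR D x x) (eps D x)" using fields x by blast
      show ?thesis using F.one_not_zero by (simp add: sub_ring_def)
    qed
    show "scal D c (eps D x) \<in> RR D x x" for c
    proof (cases "x = Bot")
      case True
      have "scal D c (eps D x) = eps D x * scal D c 1 * eps D x"
        using sc_mult[of c "eps D x" 1] sc_mult(1)[of c "eps D x" "eps D x"] idem[OF x] by simp
      then show ?thesis using RB_I True by simp
    next
      case False
      then have "x \<in> Pm D" using x by (simp add: Pm_iff)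
      moreover from this have "eps D x \<in> RR D x x" using ms by (simp add: mult_system_def)
      ultimately show ?thesis using subspace_scale[OF sub] by simp
    qed
  next
    fix x y r assume r: "r \<in> RR D x y" and x: "x \<in> uPm D" "y \<in> uPm D"
    show "eps D x * r = r" "r * eps D y = r"
      using r idem' x idem by (auto simp: RR_def assoc)
  qed (simp_all add: sc_mult flip: sc_mult(2))
qed

section \<open>Injectivity of multiplication by \<open>v\<^sub>x\<close>; invariance of the
  dimension vector\<close>

context ext_poset_basis
begin

text \<open>The generator \<open>v\<close> and the basis vector \<open>w\<close> are multiples of
  each other, \<open>v = w c\<close> and \<open>w = v s\<close>, so freeness of \<open>w\<close>
  gives \<open>c s = 1\<close>. From \<open>v r = 0\<close> follows \<open>c r = 0\<close>, and
  commutativity of \<open>R\<^sub>x\<close> yields \<open>r = c s r = c r s = 0\<close>.\<close>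

lemma cyclic_generator_torsion_free:
  assumes field: "field (sub_ring (RR D x x) (eps D x))" and x: "x \<in> Pm D"
    and w: "right_basis (RR D x x) (*) (RR D Bot x) 1 w"
    and v: "v \<in> RR D Bot x" "RR D Bot x = {v * r | r. r \<in> RR D x x}"
    and r: "r \<in> RR D x x" "v * r = 0"
  shows "r = 0"
proof -
  have xu: "x \<in> uPm D" "Bot \<le> x" using x by (simp_all add: Pm_iff less_eq_xp_def)
  interpret F: field "sub_ring (RR D x x) (eps D x)" by (rule field)
  have comm: "a * c = c * a" if "a \<in> RR D x x" "c \<in> RR D x x" for a c
    using F.m_comm[of a c] that by (simp add: sub_ring_def)
  have one: "{1..1} = {1::nat}" by simp
  have w1: "w 1 \<in> RR D Bot x" using w by (simp add: right_basis_def del: One_nat_def)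
  have gen: "\<exists>c\<in>RR D x x. a = w 1 * c" if "a \<in> RR D Bot x" for a
  proof -
    have "\<forall>a\<in>RR D Bot x. \<exists>c\<in>{1..1::nat} \<rightarrow> RR D x x. a = (\<Sum>i=1..1. w i * c i)"
      using w unfolding right_basis_def by (elim conjE)
    from bspec[OF this that] obtain c where c: "c \<in> {1..1::nat} \<rightarrow> RR D x x" "a = (\<Sum>i=1..1. w i * c i)"
      by (elim bexE)
    have "c 1 \<in> RR D x x" by (rule Pi_mem[OF c(1)]) simp
    moreover have "a = w 1 * c 1" using c(2) unfolding one by simp
    ultimately show ?thesis by (rule bexI[rotated])
  qed
  have free: "c = 0" if "c \<in> RR D x x" "w 1 * c = 0" for c
  proof -
    have "\<forall>c\<in>{1..1::nat} \<rightarrow> RR D x x. (\<Sum>i=1..1. w i * c i) = 0 \<longrightarrow> (\<forall>i\<in>{1..1}. c i = 0)"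
      using w unfolding right_basis_def by (elim conjE)
    from bspec[OF this, of "\<lambda>_. c"] have "(\<Sum>i=1..1. w i * c) = 0 \<longrightarrow> (\<forall>i\<in>{1..1::nat}. c = 0)"
      using that(1) by blast
    then show ?thesis unfolding one using that(2) by simp
  qed
  obtain c where c: "c \<in> RR D x x" "v = w 1 * c" using gen[OF v(1)] by blast
  obtain s where s: "s \<in> RR D x x" "w 1 = v * s" using w1 v(2) by blast
  note mult = RR_mult[OF xu(1) xu(1) xu(1) order_refl order_refl]
  have "c * s - eps D x = 0"
  proof (rule free[OF RR_diff[OF xu(1) xu(1) order_refl mult[OF c(1) s(1)] eps_in[OF xu(1)]]])
    show "w 1 * (c * s - eps D x) = 0"
      using s(2) c(2) eps_r[OF w1 Bot_in_uPm xu] by (simp add: right_diff_distrib flip: mult.assoc)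
  qed
  moreover have "c * r = 0" by (rule free[OF mult[OF c(1) r(1)]]) (use c r in \<open>simp flip: mult.assoc\<close>)
  moreover have "(c * s) * r = (c * r) * s"
    using comm[OF s(1) r(1)] by (simp add: mult.assoc)
  ultimately show "r = 0" using eps_l[OF r(1) xu(1) xu(1) order_refl] by simp
qed

lemma right_basis_transport:
  assumes M: "right_module (T0alg D) M" and N: "right_module (T0alg D) N"
    and h: "\<And>m. m \<in> mcar M \<Longrightarrow> h m \<in> mcar N" and g: "\<And>n. n \<in> mcar N \<Longrightarrow> g n \<in> mcar M"
    and h_add: "\<And>m m'. m \<in> mcar M \<Longrightarrow> m' \<in> mcar M \<Longrightarrow> h (m + m') = h m + h m'"
    and h_Re: "\<And>r m. r \<in> carrier (Re D) \<Longrightarrow> m \<in> mcar M \<Longrightarrow> h (mal M r m) = mal N r (h m)"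
    and gh: "\<And>m. m \<in> mcar M \<Longrightarrow> g (h m) = m" and hg: "\<And>n. n \<in> mcar N \<Longrightarrow> h (g n) = n"
    and x: "x \<in> uPm D" and b: "right_basis (RR D x x) (act_at D M x) (comp_at D M x) k b"
  shows "right_basis (RR D x x) (act_at D N x) (comp_at D N x) k (\<lambda>i. h (b i))"
proof -
  interpret R: talg_rep "Re D" "WW D" "mcar M" "mal M" "mbe M" by (rule module_rep[OF M])
  have act: "act_at D M x m a = mal M (rdiag x a) m" "act_at D N x n a = mal N (rdiag x a) n" for m n a
    by (simp_all add: act_at_def mal_def diag_elt_rdiag)
  have comp: "comp_at D M x = mal M (rdiag x (eps D x)) ` mcar M"
    "comp_at D N x = mal N (rdiag x (eps D x)) ` mcar N"
    by (auto simp: comp_at_def mal_def diag_elt_rdiag)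
  have e: "rdiag x (eps D x) \<in> carrier (Re D)" by (simp add: rdiag_Re eps_in x)
  have h0: "h 0 = 0" using h_add[OF R.C_0 R.C_0] by simp
  have h_sum: "h (\<Sum>i\<in>I. f i) = (\<Sum>i\<in>I. h (f i))" if "\<And>i. i \<in> I \<Longrightarrow> f i \<in> mcar M" for I :: "nat set" and f
    using that by (induction I rule: infinite_finite_induct) (simp_all add: h0 h_add mod_sum[OF M])
  have bm: "b i \<in> mcar M" if "i \<in> {1..k}" for i
  proof -
    have "b i \<in> comp_at D M x" using b that unfolding right_basis_def by blast
    then show ?thesis using R.\<alpha>_closed[OF e] by (auto simp: comp)
  qed
  have term_in: "act_at D M x (b i) (c i) \<in> mcar M" if "c \<in> {1..k} \<rightarrow> RR D x x" "i \<in> {1..k}" for c i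
    unfolding act by (rule R.\<alpha>_closed[OF rdiag_Re[OF x] bm[OF that(2)]]) (use that in blast)
  have h_comb: "h (\<Sum>i=1..k. act_at D M x (b i) (c i)) = (\<Sum>i=1..k. act_at D N x (h (b i)) (c i))"
    if c: "c \<in> {1..k} \<rightarrow> RR D x x" for c
  proof -
    have "h (act_at D M x (b i) (c i)) = act_at D N x (h (b i)) (c i)" if i: "i \<in> {1..k}" for i
      unfolding act by (rule h_Re[OF rdiag_Re[OF x] bm[OF i]]) (use c i in blast)
    moreover have "h (\<Sum>i=1..k. act_at D M x (b i) (c i)) = (\<Sum>i=1..k. h (act_at D M x (b i) (c i)))"
      by (rule h_sum) (rule term_in[OF c])
    ultimately show ?thesis by simp
  qed
  show ?thesis
    unfolding right_basis_def
  proof (intro conjI ballI impI)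
    show "(\<lambda>i. h (b i)) \<in> {1..k} \<rightarrow> comp_at D N x"
    proof
      fix i assume i: "i \<in> {1..k}"
      then have "b i \<in> comp_at D M x" using b unfolding right_basis_def by blast
      then show "h (b i) \<in> comp_at D N x" using h_Re[OF e] h by (auto simp: comp)
    qed
  next
    fix n assume "n \<in> comp_at D N x"
    then obtain n' where n': "n' \<in> mcar N" "n = mal N (rdiag x (eps D x)) n'" by (auto simp: comp)
    have "mal M (rdiag x (eps D x)) (g n') \<in> comp_at D M x" using g[OF n'(1)] by (auto simp: comp)
    then obtain c where c: "c \<in> {1..k} \<rightarrow> RR D x x"
      "mal M (rdiag x (eps D x)) (g n') = (\<Sum>i=1..k. act_at D M x (b i) (c i))"
      using b unfolding right_basis_def by blast
    have "n = h (mal M (rdiag x (eps D x)) (g n'))"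
      using h_Re[OF e g[OF n'(1)]] hg[OF n'(1)] n'(2) by simp
    then show "\<exists>c\<in>{1..k} \<rightarrow> RR D x x. n = (\<Sum>i=1..k. act_at D N x (h (b i)) (c i))"
      using c h_comb[OF c(1)] by auto
  next
    fix c i assume c: "c \<in> {1..k} \<rightarrow> RR D x x" "(\<Sum>i=1..k. act_at D N x (h (b i)) (c i)) = 0"
      and i: "i \<in> {1..k}"
    have "(\<Sum>i=1..k. act_at D M x (b i) (c i)) \<in> mcar M" by (rule mod_sum[OF M term_in[OF c(1)]])
    then have "(\<Sum>i=1..k. act_at D M x (b i) (c i)) = g (h (\<Sum>i=1..k. act_at D M x (b i) (c i)))"
      by (simp add: gh)
    also have "\<dots> = g (h 0)" by (simp only: h_comb[OF c(1)] c(2) h0)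
    also have "\<dots> = 0" by (rule gh[OF R.C_0])
    finally show "c i = 0" using b c(1) i unfolding right_basis_def by blast
  qed
qed

lemma De_morphism_fst:
  assumes "De_morphism D d M N f" "m \<in> mcar M"
  shows "fst f m \<in> mcar N"
    and "m' \<in> mcar M \<Longrightarrow> fst f (m + m') = fst f m + fst f m'"
    and "r \<in> carrier (Re D) \<Longrightarrow> fst f (mal M r m) = mal N r (fst f m)"
proof -
  obtain h0 h1 where f: "f = (h0, h1)" by force
  show "fst f m \<in> mcar N" "m' \<in> mcar M \<Longrightarrow> fst f (m + m') = fst f m + fst f m'"
    "r \<in> carrier (Re D) \<Longrightarrow> fst f (mal M r m) = mal N r (fst f m)"
    using assms unfolding De_morphism_def f prod.case mal_def fst_conv by blast+
qed

text \<open>First components compose as functions, so those of an isomorphism and its inverse are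
  mutually inverse and linear over \<open>R\<^sup>e\<close>. They carry bases to bases; hence the
  same numbers occur as sizes of bases, and the definite descriptions in \<open>dimvec\<close>
  agree.\<close>

lemma isomorphic_dimvec:
  assumes M: "right_module (T0alg D) M" and N: "right_module (T0alg D) N"
    and iso: "De_isomorphic D d M N" and x: "x \<in> uPm D"
  shows "dimvec D M x = dimvec D N x"
proof -
  obtain f g where fg: "De_morphism D d M N f" "De_morphism D d N M g"
      "De_mor_eq D M (De_comp D d g f) De_id" "De_mor_eq D N (De_comp D d f g) De_id"
    using iso unfolding De_isomorphic_def by blast
  note f = De_morphism_fst[OF fg(1)] and g = De_morphism_fst[OF fg(2)]
  have inv: "m \<in> mcar M \<Longrightarrow> fst g (fst f m) = m" "n \<in> mcar N \<Longrightarrow> fst f (fst g n) = n" for m n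
    using fg(3,4) by (simp_all add: De_mor_eq_def De_comp_def De_id_def)
  have "(\<exists>b. right_basis (RR D x x) (act_at D M x) (comp_at D M x) k b) \<longleftrightarrow>
      (\<exists>b. right_basis (RR D x x) (act_at D N x) (comp_at D N x) k b)" for k
    using right_basis_transport[OF M N f(1) g(1) f(2) f(3) inv x, of k]
      right_basis_transport[OF N M g(1) f(1) g(2) g(3) inv(2,1) x, of k] by blast
  then show ?thesis by (simp add: dimvec_def)
qed

end

section \<open>The two directions of the equivalence for equal dimension vectors\<close>

context De_two
begin

abbreviation "stripes_equivalent T0 Tx Tyx \<equiv>
   nonsingular (n Bot) (RR D Bot Bot) (eps D Bot) T0 \<and>
   (\<forall>x\<in>Pm D. nonsingular (n x) (RR D x x) (eps D x) (Tx x)) \<and>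
   (\<forall>x\<in>Pm D. \<forall>y\<in>Pm D. y < x \<longrightarrow> Tyx y x \<in> mat_over (n y) (n x) (RR D y x)) \<and>
   (\<forall>x\<in>Pm D. \<forall>j\<in>{1..n Bot}. \<forall>i\<in>{1..n x}.
      stripe D B v M bM x j i =
        mat_mult (n Bot) (mat_map (rho D v x) T0)
          (mat_mult (n x) (stripe D B v N bN x) (Tx x)) j i
        + (\<Sum>y\<in>{y\<in>Pm D. y < x}.
            mat_mult (n Bot) (mat_map (rho D v x) T0)
              (mat_map (chi D v y x) (mat_mult (n y) (stripe D B v N bN y) (Tyx y x))) j i))"

lemma isomorphic_stripes:
  assumes "De_isomorphic D d M N"
  shows "\<exists>T0 Tx Tyx. stripes_equivalent T0 Tx Tyx"
proof -
  interpret R: De_two D B d N M bN bM v by (rule reversed)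
  obtain f g where fg: "De_morphism D d M N f" "De_morphism D d N M g"
      "De_mor_eq D M (De_comp D d g f) De_id" "De_mor_eq D N (De_comp D d f g) De_id"
    using assms unfolding De_isomorphic_def by blast
  obtain F where F: "F \<in> tri n" "intertwines F" "\<And>m. m \<in> mcar M \<Longrightarrow> fst f m = f0 F m"
    using morphism_matrix[OF fg(1)] by blast
  obtain G where G': "G \<in> tri R.n" "\<And>m. m \<in> mcar N \<Longrightarrow> fst g m = R.f0 G m"
    using R.morphism_matrix[OF fg(2)] by blast
  have G: "G \<in> tri n" and F': "F \<in> tri R.n" using G'(1) F(1) by (simp_all add: tri_dims)
  have inv: "R.f0 G (f0 F m) = m" if "m \<in> mcar M" for m
  proof -
    have "fst g (fst f m) = m" using fg(3) that by (simp add: De_mor_eq_def De_comp_def De_id_def)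
    then show ?thesis using F(3)[OF that] G'(2)[OF f0_closed[OF F(1) that]] by simp
  qed
  have inv': "f0 F (R.f0 G m) = m" if "m \<in> mcar N" for m
  proof -
    have "fst f (fst g m) = m" using fg(4) that by (simp add: De_mor_eq_def De_comp_def De_id_def)
    then show ?thesis using G'(2)[OF that] F(3)[OF R.f0_closed[OF G'(1) that]] by simp
  qed
  note GF = f0_matrix_inverse[OF F(1) G inv]
  have FG: "(\<Sum>j=1..n z. F (z, l) (z, j) * G (z, j) (z, k)) = (if l = k then eps D z else 0)"
    if "z \<in> uPm D" "l \<in> {1..n z}" "k \<in> {1..n z}" for z l k
    using R.f0_matrix_inverse[OF G'(1) F' inv' that(1)] that by (simp only: dims)
  define T0 where "T0 l k = G (Bot, l) (Bot, k)" for l k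
  define Tx where "Tx x l k = F (x, l) (x, k)" for x l k
  define Tyx where "Tyx y x l k = F (y, l) (x, k)" for y x l k
  have T0: "T0 l k \<in> RR D Bot Bot" if "l \<in> {1..n Bot}" "k \<in> {1..n Bot}" for l k
    unfolding T0_def by (rule F_diag[OF G Bot_in_uPm that])
  have "nonsingular (n Bot) (RR D Bot Bot) (eps D Bot) T0"
    unfolding nonsingular_def
    by (intro conjI bexI[of _ "\<lambda>l k. F (Bot, l) (Bot, k)"])
      (use T0 F_diag[OF F(1)] GF FG in \<open>auto simp: mat_over_def mat_mult_def T0_def simp del: atLeastAtMost_iff\<close>)
  moreover have "nonsingular (n x) (RR D x x) (eps D x) (Tx x)" if "x \<in> Pm D" for x
    unfolding nonsingular_def
    by (intro conjI bexI[of _ "\<lambda>l k. G (x, l) (x, k)"])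
      (use that F_diag[OF F(1)] F_diag[OF G] GF FG in
        \<open>auto simp: mat_over_def mat_mult_def Tx_def Pm_iff simp del: atLeastAtMost_iff\<close>)
  moreover have "Tyx y x \<in> mat_over (n y) (n x) (RR D y x)" if "x \<in> Pm D" "y \<in> Pm D" "y < x" for x y
    unfolding mat_over_def Tyx_def using F_less[OF F(1)] that by blast
  moreover have "stripe D B v M bM x j i =
      mat_mult (n Bot) (mat_map (rho D v x) T0) (mat_mult (n x) (stripe D B v N bN x) (Tx x)) j i
      + (\<Sum>y\<in>{y\<in>Pm D. y < x}. mat_mult (n Bot) (mat_map (rho D v x) T0)
          (mat_map (chi D v y x) (mat_mult (n y) (stripe D B v N bN y) (Tyx y x))) j i)"
    if x: "x \<in> Pm D" and j: "j \<in> {1..n Bot}" and i: "i \<in> {1..n x}" for x j i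
  proof (rule stripe_equation[OF F(1) x j i T0, THEN iffD2])
    have xu: "x \<in> uPm D" "Bot \<le> x" using x by (simp_all add: Pm_iff less_eq_xp_def)
    \<comment> \<open>The relation \<open>F X.H = Y.H F\<close> in the row of blocks at
      \<open>0\<close> is multiplied by \<open>T0\<close>, the inverse of the block of
      \<open>F\<close> at \<open>0\<close>.\<close>
    have "(\<Sum>k=1..n Bot. T0 j k * mmul (idx n) Y.H F (Bot, k) (x, i)) =
        (\<Sum>k=1..n Bot. \<Sum>l=1..n Bot. T0 j k * F (Bot, k) (Bot, l) * X.H (Bot, l) (x, i))"
      by (simp add: F(2)[unfolded intertwines_def, symmetric] mmul_F_H[OF F(1) x] sum_distrib_left mult.assoc)
    also have "\<dots> = (\<Sum>l=1..n Bot. (\<Sum>k=1..n Bot. T0 j k * F (Bot, k) (Bot, l)) * X.H (Bot, l) (x, i))"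
      unfolding sum_distrib_right by (rule sum.swap)
    also have "\<dots> = (\<Sum>l=1..n Bot. if l = j then X.H (Bot, j) (x, i) else 0)"
    proof (intro sum.cong refl)
      fix l assume l: "l \<in> {1..n Bot}"
      have "(\<Sum>k=1..n Bot. T0 j k * F (Bot, k) (Bot, l)) = (if j = l then eps D Bot else 0)"
        unfolding T0_def by (rule GF[OF _ Bot_in_uPm j l])
      then show "(\<Sum>k=1..n Bot. T0 j k * F (Bot, k) (Bot, l)) * X.H (Bot, l) (x, i) =
          (if l = j then X.H (Bot, j) (x, i) else 0)"
        using eps_l[OF X.H_in[OF x j i] Bot_in_uPm xu] by auto
    qed
    also have "\<dots> = X.H (Bot, j) (x, i)" using j by simp
    finally show "X.H (Bot, j) (x, i) = (\<Sum>k=1..n Bot. T0 j k * mmul (idx n) Y.H F (Bot, k) (x, i))" ..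
  qed (simp_all add: Tx_def Tyx_def)
  ultimately show ?thesis by blast
qed

lemma stripes_isomorphic:
  assumes "stripes_equivalent T0 Tx Tyx"
  shows "De_isomorphic D d M N"
proof -
  let ?over = "\<lambda>z X. X \<in> mat_over (n z) (n z) (RR D z z)"
  let ?id = "\<lambda>z X Y. \<forall>j\<in>{1..n z}. \<forall>i\<in>{1..n z}. mat_mult (n z) X Y j i = (if j = i then eps D z else 0)"
  \<comment> \<open>\<open>X\<close> is to become the diagonal block of \<open>F\<close> at
    \<open>z\<close> and \<open>Y\<close> its inverse. At \<open>0\<close> the given matrix
    \<open>T0\<close> plays the part of the inverse, at all other points \<open>Tx z\<close> is the
    block itself.\<close>
  have inverse: "\<exists>X Y. (z = Bot \<longrightarrow> Y = T0) \<and> (z \<noteq> Bot \<longrightarrow> X = Tx z) \<and> ?over z X \<and> ?over z Y \<and> ?id z X Y \<and> ?id z Y X"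
    if z: "z \<in> uPm D" for z
  proof (cases "z = Bot")
    case True
    have "nonsingular (n Bot) (RR D Bot Bot) (eps D Bot) T0" using assms by blast
    then show ?thesis unfolding nonsingular_def True by blast
  next
    case False
    then have "nonsingular (n z) (RR D z z) (eps D z) (Tx z)" using assms z by (simp add: Pm_iff)
    then show ?thesis using False unfolding nonsingular_def by blast
  qed
  define U where "U z = (SOME X. \<exists>Y. (z = Bot \<longrightarrow> Y = T0) \<and> (z \<noteq> Bot \<longrightarrow> X = Tx z) \<and>
      ?over z X \<and> ?over z Y \<and> ?id z X Y \<and> ?id z Y X)" for z
  define V where "V z = (SOME Y. (z = Bot \<longrightarrow> Y = T0) \<and> (z \<noteq> Bot \<longrightarrow> U z = Tx z) \<and>
      ?over z (U z) \<and> ?over z Y \<and> ?id z (U z) Y \<and> ?id z Y (U z))" for z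
  have UV: "(z = Bot \<longrightarrow> V z = T0) \<and> (z \<noteq> Bot \<longrightarrow> U z = Tx z) \<and>
      ?over z (U z) \<and> ?over z (V z) \<and> ?id z (U z) (V z) \<and> ?id z (V z) (U z)" if z: "z \<in> uPm D" for z
    using someI_ex[OF someI_ex[OF inverse[OF z], folded U_def], folded V_def] .
  have U_in: "U z l k \<in> RR D z z" and V_in: "V z l k \<in> RR D z z"
    and UV1: "(\<Sum>j=1..n z. U z l j * V z j k) = (if l = k then eps D z else 0)"
    and VU1: "(\<Sum>j=1..n z. V z l j * U z j k) = (if l = k then eps D z else 0)"
    if "z \<in> uPm D" "l \<in> {1..n z}" "k \<in> {1..n z}" for z l k
    using UV[OF that(1)] that(2,3) unfolding mat_over_def mat_mult_def by blast+
  have V_Bot: "V Bot = T0" using UV[OF Bot_in_uPm] by blast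
  have U_x: "U x = Tx x" if "x \<in> Pm D" for x using UV[of x] that by (simp add: Pm_iff)
  have Tyx: "Tyx y x l k \<in> RR D y x" if "x \<in> Pm D" "y \<in> Pm D" "y < x" "l \<in> {1..n y}" "k \<in> {1..n x}" for x y l k
  proof -
    have "Tyx y x \<in> mat_over (n y) (n x) (RR D y x)" using assms that(1-3) by blast
    then show ?thesis using that(4,5) by (simp add: mat_over_def del: atLeastAtMost_iff One_nat_def)
  qed
  define F where "F a c = (if a \<in> idx n \<and> c \<in> idx n \<and> iso_le (fst a) (fst c)
    then if fst a = fst c then U (fst a) (snd a) (snd c) else Tyx (fst a) (fst c) (snd a) (snd c) else 0)" for a c
  \<comment> \<open>The block diagonal matrix of the inverses, which inverts \<open>F\<close> on
    diagonal blocks as \<open>tri_inverse\<close> demands.\<close>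
  define E where "E a c = (if a \<in> idx n \<and> c \<in> idx n \<and> fst a = fst c
    then V (fst a) (snd a) (snd c) else 0)" for a c
  have idx: "(z, l) \<in> idx n \<longleftrightarrow> z \<in> uPm D \<and> l \<in> {1..n z}" for z l by (simp add: idx_def)
  have F: "F \<in> tri n"
  proof (rule tri_I)
    fix a c assume a: "a \<in> idx n" and c: "c \<in> idx n" and le: "iso_le (fst a) (fst c)"
    obtain z l x k where zx: "a = (z, l)" "c = (x, k)" by force
    show "F a c \<in> RR D (fst a) (fst c)"
    proof (cases "z = x")
      case True
      then show ?thesis using a c le U_in unfolding F_def zx by (simp add: idx iso_le_refl)
    next
      case False
      then have "z < x" "z \<in> Pm D" "x \<in> Pm D"
        using a c le unfolding zx by (auto simp: idx iso_le_def Pm_iff less_eq_xp_def less_le)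
      then show ?thesis using a c le Tyx False unfolding F_def zx by (simp add: idx)
    qed
  qed (auto simp: F_def)
  have E: "E \<in> tri n"
    by (rule tri_I) (auto simp: E_def idx iso_le_refl V_in RR_0 iso_le_le)
  have F_eq: "F (z, l) (z, k) = U z l k" if "z \<in> uPm D" "l \<in> {1..n z}" "k \<in> {1..n z}" for z l k
    using that by (simp add: F_def idx iso_le_refl)
  have E_eq: "E (z, l) (z, k) = V z l k" if "z \<in> uPm D" "l \<in> {1..n z}" "k \<in> {1..n z}" for z l k
    using that by (simp add: E_def idx)
  have EF: "mmul (idx n) E F a c = tri_id n a c" "mmul (idx n) F E a c = tri_id n a c"
    if ac: "a \<in> idx n" "c \<in> idx n" "fst a = fst c" for a c
  proof -
    obtain z l k where zx: "a = (z, l)" "c = (z, k)" using ac(3) by (cases a; cases c) auto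
    have z: "z \<in> uPm D" "l \<in> {1..n z}" "k \<in> {1..n z}" using ac(1,2) by (simp_all add: zx idx)
    have "mmul (idx n) E F a c = (\<Sum>j=1..n z. V z l j * U z j k)"
      unfolding zx mmul_diag[OF E F z(1)] by (intro sum.cong refl) (simp add: E_eq F_eq z del: atLeastAtMost_iff One_nat_def)
    then show "mmul (idx n) E F a c = tri_id n a c" by (simp add: VU1 z zx tri_id_apply del: atLeastAtMost_iff One_nat_def)
    have "mmul (idx n) F E a c = (\<Sum>j=1..n z. U z l j * V z j k)"
      unfolding zx mmul_diag[OF F E z(1)] by (intro sum.cong refl) (simp add: E_eq F_eq z del: atLeastAtMost_iff One_nat_def)
    then show "mmul (idx n) F E a c = tri_id n a c" by (simp add: UV1 z zx tri_id_apply del: atLeastAtMost_iff One_nat_def)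
  qed
  obtain G where G: "G \<in> tri n" "mmul (idx n) G F = tri_id n" "mmul (idx n) F G = tri_id n"
    using tri_inverse[OF F E EF] by blast
  have "intertwines F"
    unfolding intertwines_iff[OF F]
  proof (intro ballI)
    fix x l k assume x: "x \<in> Pm D" and l: "l \<in> {1..n Bot}" and k: "k \<in> {1..n x}"
    have xu: "x \<in> uPm D" "Bot \<le> x" using x by (simp_all add: Pm_iff less_eq_xp_def)
    let ?HF = "\<lambda>i. mmul (idx n) Y.H F (Bot, i) (x, k)"
    have eq: "X.H (Bot, j) (x, k) = (\<Sum>i=1..n Bot. T0 j i * ?HF i)" if j: "j \<in> {1..n Bot}" for j
    proof (rule stripe_equation[where Tx = "Tx x" and Ty = "\<lambda>y. Tyx y x", OF F x j k, THEN iffD1])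
      show "T0 l k \<in> RR D Bot Bot" if "l \<in> {1..n Bot}" "k \<in> {1..n Bot}" for l k
        using V_in[OF Bot_in_uPm that] by (simp add: V_Bot)
      show "Tx x l k = F (x, l) (x, k)" if "l \<in> {1..n x}" "k \<in> {1..n x}" for l k
        using F_eq[OF xu(1) that] by (simp add: U_x x)
      show "Tyx y x l k = F (y, l) (x, k)" if "y \<in> Pm D" "y < x" "l \<in> {1..n y}" "k \<in> {1..n x}" for y l k
        using that x by (auto simp: F_def idx Pm_iff iso_le_def)
      show "stripe D B v M bM x j k =
          mat_mult (n Bot) (mat_map (rho D v x) T0) (mat_mult (n x) (stripe D B v N bN x) (Tx x)) j k
          + (\<Sum>y\<in>{y\<in>Pm D. y < x}. mat_mult (n Bot) (mat_map (rho D v x) T0)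
            (mat_map (chi D v y x) (mat_mult (n y) (stripe D B v N bN y) (Tyx y x))) j k)"
        using assms x j k by blast
    qed
    have "mmul (idx n) F X.H (Bot, l) (x, k) = (\<Sum>j=1..n Bot. \<Sum>i=1..n Bot. U Bot l j * V Bot j i * ?HF i)"
      unfolding mmul_F_H[OF F x]
      by (intro sum.cong refl)
        (simp add: eq F_eq Bot_in_uPm l V_Bot sum_distrib_left mult.assoc del: atLeastAtMost_iff One_nat_def)
    also have "\<dots> = (\<Sum>i=1..n Bot. (\<Sum>j=1..n Bot. U Bot l j * V Bot j i) * ?HF i)"
      unfolding sum_distrib_right by (rule sum.swap)
    also have "\<dots> = (\<Sum>i=1..n Bot. if i = l then ?HF l else 0)"
    proof (intro sum.cong refl)
      fix i assume i: "i \<in> {1..n Bot}"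
      show "(\<Sum>j=1..n Bot. U Bot l j * V Bot j i) * ?HF i = (if i = l then ?HF l else 0)"
        unfolding UV1[OF Bot_in_uPm l i] using eps_l[OF mmul_HF_in[OF F x l k] Bot_in_uPm xu] by auto
    qed
    also have "\<dots> = ?HF l" using l by simp
    finally show "mmul (idx n) F X.H (Bot, l) (x, k) = ?HF l" .
  qed
  then show ?thesis using isomorphic_F[OF F G] by blast
qed

end

theorem theorem39:
  fixes D :: "('k::field, 'a::ring_1, 'p::order) eposet"
    and B :: "('a, 'p) imat set"
    and d :: "('a, 'p) t_el \<Rightarrow> ('a, 'p) t_el"
    and v :: "'p xp \<Rightarrow> 'a"
    and M :: "('a, 'p, 'm::ab_group_add) dmod"
    and N :: "('a, 'p, 'n::ab_group_add) dmod"
    and bM :: "'p xp \<Rightarrow> nat \<Rightarrow> 'm"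
    and bN :: "'p xp \<Rightarrow> nat \<Rightarrow> 'n"
  assumes "extendable D"
    and "\<forall>x\<in>uPm D. field (sub_ring (RR D x x) (eps D x))"
    and "\<forall>x\<in>Pm D. \<exists>b. right_basis (RR D x x) (*) (RR D Bot x) 1 b"
    and "basis_choice D B"
    and "is_differential D B d"
    and "\<forall>x\<in>Pm D. v x \<in> RR D Bot x \<and> RR D Bot x = {v x * r | r. r \<in> RR D x x}"
    and "mod_De D M" and "mod_De D N"
    and "local_basis D M bM" and "local_basis D N bN"
  shows "De_isomorphic D d M N \<longleftrightarrow>
    (\<forall>x\<in>uPm D. dimvec D M x = dimvec D N x) \<and>
    (\<exists>T0 Tx Tyx.
       nonsingular (dimvec D M Bot) (RR D Bot Bot) (eps D Bot) T0 \<and>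
       (\<forall>x\<in>Pm D. nonsingular (dimvec D M x) (RR D x x) (eps D x) (Tx x)) \<and>
       (\<forall>x\<in>Pm D. \<forall>y\<in>Pm D. y < x \<longrightarrow>
          Tyx y x \<in> mat_over (dimvec D M y) (dimvec D M x) (RR D y x)) \<and>
       (\<forall>x\<in>Pm D. \<forall>j\<in>{1..dimvec D M Bot}. \<forall>i\<in>{1..dimvec D M x}.
          stripe D B v M bM x j i =
            mat_mult (dimvec D M Bot) (mat_map (rho D v x) T0)
              (mat_mult (dimvec D M x) (stripe D B v N bN x) (Tx x)) j i
            + (\<Sum>y\<in>{y\<in>Pm D. y < x}.
                mat_mult (dimvec D M Bot) (mat_map (rho D v x) T0)
                  (mat_map (chi D v y x)
                    (mat_mult (dimvec D M y) (stripe D B v N bN y) (Tyx y x))) j i)))"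
proof -
  interpret ext_poset D by (rule extendable_ext_poset[OF assms(1,2)])
  interpret ditalgebra D B d by unfold_locales (rule assms(4), rule assms(5))
  have M: "right_module (T0alg D) M" and N: "right_module (T0alg D) N"
    using assms(7,8) by (simp_all add: mod_De_def fd_module_def)
  have v: "v x \<in> RR D Bot x" "RR D Bot x = {v x * r | r. r \<in> RR D x x}" if "x \<in> Pm D" for x
    using assms(6) that by blast+
  have torsion_free: "r = 0" if x: "x \<in> Pm D" and r: "r \<in> RR D x x" "v x * r = 0" for x r
  proof -
    obtain w where w: "right_basis (RR D x x) (*) (RR D Bot x) 1 w" using assms(3) x by blast
    have "field (sub_ring (RR D x x) (eps D x))" using assms(2) x by (simp add: Pm_iff)
    then show ?thesis by (rule cyclic_generator_torsion_free[OF _ x w v[OF x] r])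
  qed
  \<comment> \<open>The comparison of matrices in \<open>De_two\<close> presupposes equal dimension
    vectors. If they differ, the right hand side is false and so is the left, by
    \<open>isomorphic_dimvec\<close>.\<close>
  show ?thesis
  proof (cases "\<forall>x\<in>uPm D. dimvec D M x = dimvec D N x")
    case True
    interpret De_two D B d M N bM bN v
    proof unfold_locales
      show "v x \<in> RR D Bot x \<and> RR D Bot x = {v x * r | r. r \<in> RR D x x}" if "x \<in> Pm D" for x
        using assms(6) that by blast
      show "dimvec D N x = dimvec D M x" if "x \<in> uPm D" for x using True that by simp
    qed (fact M N assms(9,10) torsion_free)+
    show ?thesis
    proof (rule iffI)
      assume "De_isomorphic D d M N"
      then show "(\<forall>x\<in>uPm D. dimvec D M x = dimvec D N x) \<and> (\<exists>T0 Tx Tyx. stripes_equivalent T0 Tx Tyx)"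
        by (rule conjI[OF True isomorphic_stripes])
    next
      assume "(\<forall>x\<in>uPm D. dimvec D M x = dimvec D N x) \<and> (\<exists>T0 Tx Tyx. stripes_equivalent T0 Tx Tyx)"
      from conjunct2[OF this] show "De_isomorphic D d M N"
        by - (elim exE, rule stripes_isomorphic)
    qed
  next
    case False
    then show ?thesis using isomorphic_dimvec[OF M N] by blast
  qed
qed

end
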